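(* For every $n\ge1$ the triple $(\mathbb{Z}^n,\mathcal{S}_n,w_n)$ is rigid: $\mathcal{D}(\mathcal{S}_n,w_n)\cong\mathbb{Z}^n$, and for every directed $2$-complex $\mathcal{K}'$ such that the diagram groupoid $\mathcal{D}(\mathcal{K}')$ contains a copy of $\mathbb{Z}^n$ there exists a $w_n$-nonsingular morphism of $\mathcal{S}_n$ into $\mathcal{K}'$. In addition, let $\mathcal{K}$ be a directed $2$-complex. Then every copy of $\mathbb{Z}^n$ in $\mathcal{D}(\mathcal{K})$ is conjugate in $\mathcal{D}(\mathcal{K})$ to a subgroup of a naturally embedded copy of $\mathbb{Z}^m$ for some $m\ge n$.
   Context: Directed $2$-complexes. A directed $2$-complex $\mathcal{K}$ is a directed graph together with a set $\mathbf{F}$ of $2$-cells and maps $\lceil\cdot\rceil,\lfloor\cdot\rfloor\colon\mathbf{F}\to\mathbf{P}$ (top, bottom), ${}^{-1}\colon\mathbf{F}\to\mathbf{F}$ (inverse), where $\mathbf{P}$ is the set of all directed paths of the graph including empty paths (called $1$-paths; initial and terminal vertices are $\iota(p),\tau(p)$). It is required that for each $f$ the paths $\lceil f\rceil,\lfloor f\rfloor$ are non-empty with common initial vertex $\iota(f)$ and common terminal vertex $\tau(f)$, and that ${}^{-1}$ is an involution without fixed points with $\lceil f^{-1}\rceil=\lfloor f\rfloor$, $\lfloor f^{-1}\rfloor=\lceil f\rceil$. An orientation is a choice of a set $\mathbf{F}^+$ of positive $2$-cells with $\mathbf{F}=\mathbf{F}^+\sqcup(\mathbf{F}^+)^{-1}$.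 Diagram groups. An atomic $2$-path is a triple $\delta=(p,f,q)$ with $p,q$ $1$-paths, $f\in\mathbf{F}$, $\tau(p)=\iota(f)$, $\tau(f)=\iota(q)$; $\lceil\delta\rceil=p\lceil f\rceil q$, $\lfloor\delta\rfloor=p\lfloor f\rfloor q$, $\delta^{-1}=(p,f^{-1},q)$. A $2$-path is a finite sequence $\delta_1\circ\cdots\circ\delta_n$ of atomic $2$-paths with $\lfloor\delta_i\rfloor=\lceil\delta_{i+1}\rceil$; its top and bottom are $\lceil\delta_1\rceil$, $\lfloor\delta_n\rfloor$; each $1$-path $p$ is also a trivial $2$-path from $p$ to $p$. Homotopy of $2$-paths is the smallest equivalence relation invariant under concatenation such that $\delta\circ\delta^{-1}$ is equivalent to the trivial $2$-path and $(p,f_1,q\lceil f_2\rceil r)\circ(p\lfloor f_1\rfloor q,f_2,r)$ is equivalent to $(p\lceil f_1\rceil q,f_2,r)\circ(p,f_1,q\lfloor f_2\rfloor r)$. The diagram groupoid $\mathcal{D}(\mathcal{K})$ has the $1$-paths as objects and homotopy classes of $2$-paths as morphisms (product induced by concatenation). The diagram group $\mathcal{D}(\mathcal{K},p)$ is the local group of $\mathcal{D}(\mathcal{K})$ at $p$. A copy of a group in $\mathcal{D}(\mathcal{K})$ is a subgroup isomorphic to it of some local group $\mathcal{D}(\mathcal{K},p)$; conjugation of a subgroup of $\mathcal{D}(\mathcal{K},p)$ in $\mathcal{D}(\mathcal{K})$ is $A\mapsto\Gamma^{-1}A\Gamma$ for a morphism $\Gamma$ from $p$ to some $1$-path $q$,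 with result in $\mathcal{D}(\mathcal{K},q)$. Morphisms. A morphism $\phi\colon\mathcal{K}\to\mathcal{K}'$ maps vertices to vertices, edges to non-empty $1$-paths, $2$-cells to $2$-paths, and preserves $\iota,\tau$, top, bottom and inverses (with $\phi(e_1\cdots e_k)=\phi(e_1)\cdots\phi(e_k)$). It induces homomorphisms $\phi_p\colon\mathcal{D}(\mathcal{K},p)\to\mathcal{D}(\mathcal{K}',\phi(p))$, where $(p,f,q)$ is sent to $\phi(f)$ with every atomic factor multiplied by $\phi(p)$ on the left and $\phi(q)$ on the right. For a non-empty $1$-path $p$, the morphism is $p$-nonsingular if $\phi_p$ is injective; in this case the subgroup $\phi_p(\mathcal{D}(\mathcal{K},p))$ of $\mathcal{D}(\mathcal{K}')$ is called naturally embedded. Rigidity. A triple $(G,\mathcal{K},p)$ is rigid if $G=\mathcal{D}(\mathcal{K},p)$ and for every directed $2$-complex $\mathcal{K}'$ such that $\mathcal{D}(\mathcal{K}')$ contains a copy of $G$ there is a $p$-nonsingular morphism of $\mathcal{K}$ into $\mathcal{K}'$. The complex $\mathcal{S}_n$. It consists of a simple directed path $w_n=x_1\cdots x_n$ ($n+1$ distinct vertices, $n$ edges $x_1,\dots,x_n$) with $n$ positive $2$-cells attached, the $i$th one having top path $x_i$ and bottom path $x_i$ (plus inverse cells). A naturally embedded copy of $\mathbb{Z}^m$ in $\mathcal{D}(\mathcal{K})$ is the subgroup $\phi_{w_m}(\mathcal{D}(\mathcal{S}_m,w_m))$ for a $w_m$-nonsingular morphism $\phi\colon\mathcal{S}_m\to\mathcal{K}$.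 *)

theory Defs
  imports "HOL-Algebra.Product_Groups" "Graph_Theory.Arc_Walk"
begin

section \<open>Directed 2-complexes\<close>

text \<open>
  A 1-path is a pair of its initial vertex and its list of edges, so that there is one
  empty path at every vertex.
\<close>

type_synonym ('v, 'e) path1 = "'v \<times> 'e list"

record ('v, 'e, 'f) two_complex =
  under_graph :: "('v, 'e) pre_digraph"
  cells :: "'f set"
  cell_top :: "'f \<Rightarrow> ('v, 'e) path1"
  cell_bot :: "'f \<Rightarrow> ('v, 'e) path1"
  cell_inv :: "'f \<Rightarrow> 'f"

definition is_path1 :: "('v, 'e, 'f) two_complex \<Rightarrow> ('v, 'e) path1 \<Rightarrow> bool" where
  "is_path1 K p \<longleftrightarrow> (\<exists>v. pre_digraph.awalk (under_graph K) (fst p) (snd p) v)"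

definition init1 :: "('v, 'e) path1 \<Rightarrow> 'v" where
  "init1 p = fst p"

definition term1 :: "('v, 'e, 'f) two_complex \<Rightarrow> ('v, 'e) path1 \<Rightarrow> 'v" where
  "term1 K p = pre_digraph.awlast (under_graph K) (fst p) (snd p)"

definition nonempty1 :: "('v, 'e) path1 \<Rightarrow> bool" where
  "nonempty1 p \<longleftrightarrow> snd p \<noteq> []"

definition cat1 :: "('v, 'e) path1 \<Rightarrow> ('v, 'e) path1 \<Rightarrow> ('v, 'e) path1" (infixr \<open>\<cdot>\<close> 75) where
  "p \<cdot> q = (fst p, snd p @ snd q)"

locale directed_2_complex =
  fixes K :: "('v, 'e, 'f) two_complex"
  assumes wf_under_graph: "wf_digraph (under_graph K)"
    and top_path: "f \<in> cells K \<Longrightarrow> is_path1 K (cell_top K f) \<and> nonempty1 (cell_top K f)"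
    and bot_path: "f \<in> cells K \<Longrightarrow> is_path1 K (cell_bot K f) \<and> nonempty1 (cell_bot K f)"
    and init_eq: "f \<in> cells K \<Longrightarrow> init1 (cell_top K f) = init1 (cell_bot K f)"
    and term_eq: "f \<in> cells K \<Longrightarrow> term1 K (cell_top K f) = term1 K (cell_bot K f)"
    and inv_cell: "f \<in> cells K \<Longrightarrow> cell_inv K f \<in> cells K"
    and inv_inv: "f \<in> cells K \<Longrightarrow> cell_inv K (cell_inv K f) = f"
    and inv_no_fixpoint: "f \<in> cells K \<Longrightarrow> cell_inv K f \<noteq> f"
    and top_inv: "f \<in> cells K \<Longrightarrow> cell_top K (cell_inv K f) = cell_bot K f"
    and bot_inv: "f \<in> cells K \<Longrightarrow> cell_bot K (cell_inv K f) = cell_top K f"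

section \<open>2-paths and the diagram groupoid\<close>

type_synonym ('v, 'e, 'f) atom = "('v, 'e) path1 \<times> 'f \<times> ('v, 'e) path1"

definition is_atom :: "('v, 'e, 'f) two_complex \<Rightarrow> ('v, 'e, 'f) atom \<Rightarrow> bool" where
  "is_atom K = (\<lambda>(p, f, q). is_path1 K p \<and> f \<in> cells K \<and> is_path1 K q \<and>
     term1 K p = init1 (cell_top K f) \<and> term1 K (cell_top K f) = init1 q)"

definition atom_top :: "('v, 'e, 'f) two_complex \<Rightarrow> ('v, 'e, 'f) atom \<Rightarrow> ('v, 'e) path1" where
  "atom_top K = (\<lambda>(p, f, q). p \<cdot> cell_top K f \<cdot> q)"

definition atom_bot :: "('v, 'e, 'f) two_complex \<Rightarrow> ('v, 'e, 'f) atom \<Rightarrow> ('v, 'e) path1" where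
  "atom_bot K = (\<lambda>(p, f, q). p \<cdot> cell_bot K f \<cdot> q)"

definition atom_inv :: "('v, 'e, 'f) two_complex \<Rightarrow> ('v, 'e, 'f) atom \<Rightarrow> ('v, 'e, 'f) atom" where
  "atom_inv K = (\<lambda>(p, f, q). (p, cell_inv K f, q))"

text \<open>
  A 2-path is a pair of its top 1-path and its list of atomic factors; the trivial 2-path
  at a 1-path \<open>p\<close> is \<open>(p, [])\<close>.
\<close>

type_synonym ('v, 'e, 'f) path2 = "('v, 'e) path1 \<times> ('v, 'e, 'f) atom list"

fun is_path2 :: "('v, 'e, 'f) two_complex \<Rightarrow> ('v, 'e, 'f) path2 \<Rightarrow> bool" where
  "is_path2 K (p, []) \<longleftrightarrow> is_path1 K p"
| "is_path2 K (p, d # ds) \<longleftrightarrow> is_atom K d \<and> p = atom_top K d \<and> is_path2 K (atom_bot K d, ds)"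

definition top2 :: "('v, 'e, 'f) path2 \<Rightarrow> ('v, 'e) path1" where
  "top2 \<delta> = fst \<delta>"

definition bot2 :: "('v, 'e, 'f) two_complex \<Rightarrow> ('v, 'e, 'f) path2 \<Rightarrow> ('v, 'e) path1" where
  "bot2 K \<delta> = (if snd \<delta> = [] then fst \<delta> else atom_bot K (last (snd \<delta>)))"

definition cat2 :: "('v, 'e, 'f) path2 \<Rightarrow> ('v, 'e, 'f) path2 \<Rightarrow> ('v, 'e, 'f) path2" where
  "cat2 \<delta> \<epsilon> = (fst \<delta>, snd \<delta> @ snd \<epsilon>)"

definition inv2 :: "('v, 'e, 'f) two_complex \<Rightarrow> ('v, 'e, 'f) path2 \<Rightarrow> ('v, 'e, 'f) path2" where
  "inv2 K \<delta> = (bot2 K \<delta>, rev (map (atom_inv K) (snd \<delta>)))"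

inductive homotopic ::
  "('v, 'e, 'f) two_complex \<Rightarrow> ('v, 'e, 'f) path2 \<Rightarrow> ('v, 'e, 'f) path2 \<Rightarrow> bool"
  for K where
  refl: "is_path2 K \<delta> \<Longrightarrow> homotopic K \<delta> \<delta>"
| sym: "homotopic K \<delta> \<epsilon> \<Longrightarrow> homotopic K \<epsilon> \<delta>"
| trans: "homotopic K \<delta> \<epsilon> \<Longrightarrow> homotopic K \<epsilon> \<zeta> \<Longrightarrow> homotopic K \<delta> \<zeta>"
| cat: "homotopic K \<delta> \<delta>' \<Longrightarrow> homotopic K \<epsilon> \<epsilon>' \<Longrightarrow> bot2 K \<delta> = top2 \<epsilon> \<Longrightarrow> bot2 K \<delta>' = top2 \<epsilon>' \<Longrightarrow>
    homotopic K (cat2 \<delta> \<epsilon>) (cat2 \<delta>' \<epsilon>')"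
| cancel: "is_atom K d \<Longrightarrow> homotopic K (atom_top K d, [d, atom_inv K d]) (atom_top K d, [])"
| exchange: "is_path1 K p \<Longrightarrow> is_path1 K q \<Longrightarrow> is_path1 K r \<Longrightarrow> f \<in> cells K \<Longrightarrow> g \<in> cells K \<Longrightarrow>
    term1 K p = init1 (cell_top K f) \<Longrightarrow> term1 K (cell_top K f) = init1 q \<Longrightarrow>
    term1 K q = init1 (cell_top K g) \<Longrightarrow> term1 K (cell_top K g) = init1 r \<Longrightarrow>
    homotopic K
      (p \<cdot> cell_top K f \<cdot> q \<cdot> cell_top K g \<cdot> r,
        [(p, f, q \<cdot> cell_top K g \<cdot> r), (p \<cdot> cell_bot K f \<cdot> q, g, r)])
      (p \<cdot> cell_top K f \<cdot> q \<cdot> cell_top K g \<cdot> r,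
        [(p \<cdot> cell_top K f \<cdot> q, g, r), (p, f, q \<cdot> cell_bot K g \<cdot> r)])"

definition hclass :: "('v, 'e, 'f) two_complex \<Rightarrow> ('v, 'e, 'f) path2 \<Rightarrow> ('v, 'e, 'f) path2 set" where
  "hclass K \<delta> = {\<epsilon>. homotopic K \<delta> \<epsilon>}"

definition groupoid_hom ::
  "('v, 'e, 'f) two_complex \<Rightarrow> ('v, 'e) path1 \<Rightarrow> ('v, 'e) path1 \<Rightarrow> ('v, 'e, 'f) path2 set set" where
  "groupoid_hom K p q = {hclass K \<delta> |\<delta>. is_path2 K \<delta> \<and> top2 \<delta> = p \<and> bot2 K \<delta> = q}"

text \<open>
  The operations on homotopy classes do not depend on representatives, so the unions
  below are unions of copies of a single class.
\<close>

definition gcomp ::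
  "('v, 'e, 'f) two_complex \<Rightarrow> ('v, 'e, 'f) path2 set \<Rightarrow> ('v, 'e, 'f) path2 set \<Rightarrow>
   ('v, 'e, 'f) path2 set" where
  "gcomp K A B = (\<Union>\<delta>\<in>A. \<Union>\<epsilon>\<in>B. hclass K (cat2 \<delta> \<epsilon>))"

definition ginv ::
  "('v, 'e, 'f) two_complex \<Rightarrow> ('v, 'e, 'f) path2 set \<Rightarrow> ('v, 'e, 'f) path2 set" where
  "ginv K A = (\<Union>\<delta>\<in>A. hclass K (inv2 K \<delta>))"

definition diagram_group ::
  "('v, 'e, 'f) two_complex \<Rightarrow> ('v, 'e) path1 \<Rightarrow> ('v, 'e, 'f) path2 set monoid" where
  "diagram_group K p = \<lparr>carrier = groupoid_hom K p p, monoid.mult = gcomp K, one = hclass K (p, [])\<rparr>"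

definition is_copy ::
  "('v, 'e, 'f) two_complex \<Rightarrow> ('v, 'e) path1 \<Rightarrow> ('v, 'e, 'f) path2 set set \<Rightarrow> 'g monoid \<Rightarrow> bool" where
  "is_copy K p A G \<longleftrightarrow> is_path1 K p \<and> subgroup A (diagram_group K p) \<and>
     (diagram_group K p)\<lparr>carrier := A\<rparr> \<cong> G"

definition conjugate ::
  "('v, 'e, 'f) two_complex \<Rightarrow> ('v, 'e, 'f) path2 set \<Rightarrow> ('v, 'e, 'f) path2 set set \<Rightarrow>
   ('v, 'e, 'f) path2 set set" where
  "conjugate K \<Gamma> A = (\<lambda>a. gcomp K (gcomp K (ginv K \<Gamma>) a) \<Gamma>) ` A"

section \<open>Morphisms of directed 2-complexes\<close>

record ('v, 'e, 'f, 'w, 'd, 'g) complex_map =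
  vmap :: "'v \<Rightarrow> 'w"
  emap :: "'e \<Rightarrow> ('w, 'd) path1"
  fmap :: "'f \<Rightarrow> ('w, 'd, 'g) path2"

definition map1 :: "('v, 'e, 'f, 'w, 'd, 'g) complex_map \<Rightarrow> ('v, 'e) path1 \<Rightarrow> ('w, 'd) path1" where
  "map1 \<phi> p = (vmap \<phi> (fst p), concat (map (\<lambda>e. snd (emap \<phi> e)) (snd p)))"

definition is_morphism ::
  "('v, 'e, 'f) two_complex \<Rightarrow> ('w, 'd, 'g) two_complex \<Rightarrow>
   ('v, 'e, 'f, 'w, 'd, 'g) complex_map \<Rightarrow> bool" where
  "is_morphism K K' \<phi> \<longleftrightarrow>
     (\<forall>v\<in>verts (under_graph K). vmap \<phi> v \<in> verts (under_graph K')) \<and>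
     (\<forall>e\<in>arcs (under_graph K). is_path1 K' (emap \<phi> e) \<and> nonempty1 (emap \<phi> e) \<and>
        init1 (emap \<phi> e) = vmap \<phi> (tail (under_graph K) e) \<and>
        term1 K' (emap \<phi> e) = vmap \<phi> (head (under_graph K) e)) \<and>
     (\<forall>f\<in>cells K. is_path2 K' (fmap \<phi> f) \<and>
        top2 (fmap \<phi> f) = map1 \<phi> (cell_top K f) \<and>
        bot2 K' (fmap \<phi> f) = map1 \<phi> (cell_bot K f) \<and>
        fmap \<phi> (cell_inv K f) = inv2 K' (fmap \<phi> f))"

definition map_atom ::
  "('v, 'e, 'f, 'w, 'd, 'g) complex_map \<Rightarrow> ('v, 'e, 'f) atom \<Rightarrow> ('w, 'd, 'g) atom list" where
  "map_atom \<phi> = (\<lambda>(p, f, q).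
     map (\<lambda>(a, g, b). (map1 \<phi> p \<cdot> a, g, b \<cdot> map1 \<phi> q)) (snd (fmap \<phi> f)))"

definition map2 ::
  "('v, 'e, 'f, 'w, 'd, 'g) complex_map \<Rightarrow> ('v, 'e, 'f) path2 \<Rightarrow> ('w, 'd, 'g) path2" where
  "map2 \<phi> \<delta> = (map1 \<phi> (fst \<delta>), concat (map (map_atom \<phi>) (snd \<delta>)))"

definition induced ::
  "('w, 'd, 'g) two_complex \<Rightarrow> ('v, 'e, 'f, 'w, 'd, 'g) complex_map \<Rightarrow>
   ('v, 'e, 'f) path2 set \<Rightarrow> ('w, 'd, 'g) path2 set" where
  "induced K' \<phi> A = (\<Union>\<delta>\<in>A. hclass K' (map2 \<phi> \<delta>))"

definition nonsingular ::
  "('v, 'e, 'f) two_complex \<Rightarrow> ('w, 'd, 'g) two_complex \<Rightarrow> ('v, 'e) path1 \<Rightarrow>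
   ('v, 'e, 'f, 'w, 'd, 'g) complex_map \<Rightarrow> bool" where
  "nonsingular K K' p \<phi> \<longleftrightarrow> is_morphism K K' \<phi> \<and> is_path1 K p \<and> nonempty1 p \<and>
     inj_on (induced K' \<phi>) (carrier (diagram_group K p))"

section \<open>Rigidity\<close>

text \<open>
  The quantification over all directed 2-complexes ranges over those whose vertices, edges
  and cells are taken from the types named by the first argument. The equality of \<open>G\<close>
  with the diagram group is read as an isomorphism.
\<close>

definition rigid ::
  "('w, 'd, 'g) two_complex itself \<Rightarrow> 'h monoid \<Rightarrow> ('v, 'e, 'f) two_complex \<Rightarrow>
   ('v, 'e) path1 \<Rightarrow> bool" where
  "rigid T G K p \<longleftrightarrow> directed_2_complex K \<and> is_path1 K p \<and> diagram_group K p \<cong> G \<and>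
     (\<forall>K' :: ('w, 'd, 'g) two_complex.
        directed_2_complex K' \<and> (\<exists>q A. is_copy K' q A G) \<longrightarrow> (\<exists>\<phi>. nonsingular K K' p \<phi>))"

section \<open>Free abelian groups and the complexes carrying them\<close>

definition Z_pow :: "nat \<Rightarrow> (nat \<Rightarrow> int) monoid" where
  "Z_pow n = product_group {..<n} (\<lambda>_. integer_group)"

text \<open>
  Edges are numbered from 0, edge \<open>i\<close> leading from vertex \<open>i\<close> to vertex \<open>Suc i\<close>;
  the cells attached along edge \<open>i\<close> are \<open>(i, True)\<close> and its inverse \<open>(i, False)\<close>.
\<close>

definition S_complex :: "nat \<Rightarrow> (nat, nat, nat \<times> bool) two_complex" where
  "S_complex n = \<lparr>
     under_graph = \<lparr>verts = {..n}, arcs = {..<n}, tail = (\<lambda>i. i), head = Suc\<rparr>,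
     cells = {..<n} \<times> UNIV,
     cell_top = (\<lambda>(i, b). (i, [i])),
     cell_bot = (\<lambda>(i, b). (i, [i])),
     cell_inv = (\<lambda>(i, b). (i, \<not> b))\<rparr>"

definition w_path :: "nat \<Rightarrow> (nat, nat) path1" where
  "w_path n = (0, [0..<n])"

definition naturally_embedded_Z_pow ::
  "nat \<Rightarrow> ('v, 'e, 'f) two_complex \<Rightarrow> ('v, 'e) path1 \<Rightarrow> ('v, 'e, 'f) path2 set set \<Rightarrow> bool" where
  "naturally_embedded_Z_pow m K q N \<longleftrightarrow>
     (\<exists>\<phi>. nonsingular (S_complex m) K (w_path m) \<phi> \<and> q = map1 \<phi> (w_path m) \<and>
        N = induced K \<phi> ` carrier (diagram_group (S_complex m) (w_path m)))"

end

theory Submission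
  imports Defs
begin

text \<open>
  Homotopy classes of 2-paths are replaced by concrete data on which a group acts. A 1-path is
  written as a word in which a letter \<open>star\<close>, for a vertex, stands before, between and after
  its edges. Fix the top 1-path of a 2-path and give its letters the names \<open>Base i\<close>. When a
  2-cell \<open>f\<close> replaces a block \<open>t\<close> of named letters, its bottom letters get the names
  \<open>New f t i\<close>; when the inverse cell is applied to exactly these letters, the old names \<open>t\<close>
  come back. The list of names left by a 2-path, its state, is a complete invariant of homotopy
  (\<open>run_eq_imp_heq\<close>, \<open>homotopic_iff\<close>): a block that is present at the end can be created last,
  since everything that happened after its creation happened beside it. Composition becomes
  substitution of states, so the diagram groupoid is a groupoid of states.

  States behave like the vertices of a cubical complex of nonpositive curvature. Its oriented
  hyperplanes are the pairs \<open>(f, t)\<close>, here called walls; two states are separated by finitely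
  many of them, and are equal if by none. The local group \<open>Grp q\<close> acts freely. Moving a state
  so that \<open>g\<close> displaces it across as few walls as possible gives an axis of \<open>g\<close>: the states
  \<open>g\<^sup>i s\<close> never cross a wall twice (\<open>exists_axis\<close>). In particular the group is torsion free.

  Letters give more than walls. Suppose that \<open>g \<noteq> 1\<close> fixes a letter of its axis state other than
  the two end vertices. Then it fixes a vertex next to a letter that moves, and such
  boundary vertices are the same for all axis states. An element commuting with \<open>g\<close> permutes
  them and keeps their order from left to right, so it fixes them (\<open>boundary_fixed\<close>). Suppose
  that no such letter is fixed. Then some power of each element commuting with \<open>g\<close> is a power
  of \<open>g\<close> (\<open>simple_centralizer\<close>), because the translates of a wall of the axis all come back to
  the axis. This is \<open>centralizer_dichotomy\<close>.

  Given finitely many commuting elements, either all of them split at a common fixed vertex into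
  two families over shorter words, or they are powers of a single element, by the torsion-free
  argument of \<open>common_root\<close>. Induction (\<open>commuting_resolvable\<close>) conjugates them into a product of
  cyclic groups generated by elements \<open>B\<^sub>1, \<dots>, B\<^sub>m\<close> over consecutive subpaths of one 1-path;
  a trivial factor \<open>B\<^sub>j = 1\<close> is absorbed by a neighbour (\<open>merge_trivial_blocks\<close>). Sending the
  edge \<open>x\<^sub>j\<close> to the \<open>j\<close>th subpath and its cell to a 2-path representing \<open>B\<^sub>j\<close> is a
  nonsingular morphism of \<open>S_complex m\<close> whose image is this product (\<open>natural_embedding\<close>). A
  counting argument gives \<open>m \<ge> n\<close>, and the first \<open>n\<close> subpaths alone yield the morphism
  that rigidity asks for.
\<close>

section \<open>Named items\<close>

text \<open>
  \<open>Base i l\<close> is the letter \<open>l\<close> at position \<open>i\<close> of the initial word; \<open>New f t i\<close> is the \<open>i\<close>th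
  letter of the word that an application of \<open>f\<close> puts in the place of the letters \<open>t\<close>.
\<close>

datatype ('l, 'f) item = Base nat 'l | New 'f "('l, 'f) item list" nat

text \<open>
  Rewriting rules \<open>lhs f \<rightarrow> rhs f\<close>, each with an inverse rule \<open>rv f\<close>. The letter \<open>star\<close> stands for
  every vertex of a complex, the others for edges. Both sides of a rule begin and end with
  an edge and alternate between edges and vertices: applying a 2-cell leaves the two
  end vertices of its top path in place, so they are not part of the rule.
\<close>

locale rewriting_system =
  fixes C :: "'f set" and lhs rhs :: "'f \<Rightarrow> 'l list" and rv :: "'f \<Rightarrow> 'f" and star :: 'l
  assumes rv_in [simp]: "f \<in> C \<Longrightarrow> rv f \<in> C"
    and rv_rv [simp]: "f \<in> C \<Longrightarrow> rv (rv f) = f"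
    and rv_neq: "f \<in> C \<Longrightarrow> rv f \<noteq> f"
    and lhs_rv [simp]: "f \<in> C \<Longrightarrow> lhs (rv f) = rhs f"
    and lhs_ne [simp]: "f \<in> C \<Longrightarrow> lhs f \<noteq> []"
    and hd_lhs: "f \<in> C \<Longrightarrow> hd (lhs f) \<noteq> star"
    and last_lhs: "f \<in> C \<Longrightarrow> last (lhs f) \<noteq> star"
    and alt_lhs: "f \<in> C \<Longrightarrow> successively (\<lambda>a b. (a = star) \<noteq> (b = star)) (lhs f)"
begin

lemma rhs_rv [simp]: "f \<in> C \<Longrightarrow> rhs (rv f) = lhs f"
  using lhs_rv[of "rv f"] by simp

lemma rhs_ne [simp]: "f \<in> C \<Longrightarrow> rhs f \<noteq> []"
  using lhs_ne[of "rv f"] by simp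

lemma hd_rhs: "f \<in> C \<Longrightarrow> hd (rhs f) \<noteq> star"
  using hd_lhs[of "rv f"] by simp

lemma last_rhs: "f \<in> C \<Longrightarrow> last (rhs f) \<noteq> star"
  using last_lhs[of "rv f"] by simp

fun lab :: "('l, 'f) item \<Rightarrow> 'l" where
  "lab (Base i l) = l"
| "lab (New f t i) = rhs f ! i"

abbreviation labs :: "('l, 'f) item list \<Rightarrow> 'l list" where
  "labs s \<equiv> map lab s"

definition block :: "'f \<Rightarrow> ('l, 'f) item list \<Rightarrow> ('l, 'f) item list" where
  "block f t = map (New f t) [0..<length (rhs f)]"

text \<open>
  The last clause keeps names reduced: applying \<open>f\<close> to the block that \<open>rv f\<close> has just made from
  \<open>t'\<close> restores \<open>t'\<close> and must not create new names.
\<close>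

fun wf :: "'l list \<Rightarrow> ('l, 'f) item \<Rightarrow> bool" where
  "wf q (Base i l) \<longleftrightarrow> i < length q \<and> l = q ! i"
| "wf q (New f t i) \<longleftrightarrow> f \<in> C \<and> i < length (rhs f) \<and> (\<forall>x\<in>set t. wf q x) \<and>
     map lab t = lhs f \<and> (\<forall>t'. t \<noteq> block (rv f) t')"

abbreviation wfs :: "'l list \<Rightarrow> ('l, 'f) item list \<Rightarrow> bool" where
  "wfs q s \<equiv> \<forall>x\<in>set s. wf q x"

text \<open>
  Application of a rule to named letters. By \<open>block_inj\<close> there is at most one \<open>t'\<close> to choose.
\<close>

definition flip :: "'f \<Rightarrow> ('l, 'f) item list \<Rightarrow> ('l, 'f) item list" where
  "flip f t = (if \<exists>t'. t = block (rv f) t' then SOME t'. t = block (rv f) t' else block f t)"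

text \<open>
  A pair \<open>(f, t)\<close> is an oriented wall: it stands for every application of \<open>f\<close> to the letters
  named \<open>t\<close>, whatever the letters beside them are. Its opposite orientation is \<open>oinv (f, t)\<close>, and
  exactly one of the two is \<open>up\<close>, that is, creates new names.
\<close>

fun ocell :: "'l list \<Rightarrow> 'f \<times> ('l, 'f) item list \<Rightarrow> bool" where
  "ocell q (f, t) \<longleftrightarrow> f \<in> C \<and> wfs q t \<and> map lab t = lhs f"

fun up :: "'f \<times> ('l, 'f) item list \<Rightarrow> bool" where
  "up (f, t) \<longleftrightarrow> (\<forall>t'. t \<noteq> block (rv f) t')"

fun oinv :: "'f \<times> ('l, 'f) item list \<Rightarrow> 'f \<times> ('l, 'f) item list" where
  "oinv (f, t) = (rv f, flip f t)"

lemma length_block [simp]: "length (block f t) = length (rhs f)"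
  by (simp add: block_def)

lemma labs_block [simp]: "labs (block f t) = rhs f"
  by (simp add: block_def comp_def map_nth)

lemma set_block: "set (block f t) = New f t ` {..<length (rhs f)}"
  by (auto simp: block_def)

lemma block_ne [simp]: "f \<in> C \<Longrightarrow> block f t \<noteq> []"
  by (metis length_block length_0_conv rhs_ne)

lemma distinct_block [simp]: "distinct (block f t)"
  by (auto simp: block_def distinct_map inj_on_def)

lemma block_inj: "f \<in> C \<Longrightarrow> block f t = block g t' \<Longrightarrow> f = g \<and> t = t'"
proof -
  assume "f \<in> C" "block f t = block g t'"
  then have "New f t 0 \<in> set (block g t')"
    by (metis rhs_ne imageI length_greater_0_conv lessThan_iff set_block)
  then show ?thesis by (auto simp: set_block)
qed

lemma flip_block [simp]: "f \<in> C \<Longrightarrow> flip (rv f) (block f t) = t"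
proof -
  assume f: "f \<in> C"
  then have "(SOME t'. block f t = block f t') = t"
    by (intro some_equality) (auto dest: block_inj)
  then show ?thesis using f by (auto simp: flip_def)
qed

lemma flip_up: "up (f, t) \<Longrightarrow> flip f t = block f t"
  by (simp add: flip_def)

lemma not_upE:
  assumes "\<not> up (f, t)" "f \<in> C"
  obtains t' where "t = block (rv f) t'" "flip f t = t'"
proof -
  from assms(1) obtain t' where t': "t = block (rv f) t'" by auto
  with flip_block[of "rv f" t'] assms(2) that show ?thesis by auto
qed

lemma wfs_block: "ocell q (f, t) \<Longrightarrow> up (f, t) \<Longrightarrow> wfs q (block f t)"
  by (auto simp: set_block)

lemma block_wf_down:
  assumes "wfs q (block f t)" "f \<in> C"
  shows "ocell q (f, t)" "up (f, t)"
proof -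
  have "New f t 0 \<in> set (block f t)" using assms(2) by (auto simp: set_block)
  with assms(1) have "wf q (New f t 0)" by blast
  then show "ocell q (f, t)" "up (f, t)" by auto
qed

lemma not_up_ocellE:
  assumes "\<not> up (f, t)" "ocell q (f, t)"
  obtains t' where "t = block (rv f) t'" "flip f t = t'" "ocell q (rv f, t')" "up (rv f, t')"
proof -
  from assms have f: "f \<in> C" by simp
  from not_upE[OF assms(1) f] obtain t' where t': "t = block (rv f) t'" "flip f t = t'" .
  with assms(2) have "wfs q (block (rv f) t')" by simp
  from block_wf_down[OF this] f t' that show ?thesis by simp
qed

lemma wfs_flip: "ocell q (f, t) \<Longrightarrow> wfs q (flip f t)"
  by (cases "up (f, t)") (auto simp: flip_up wfs_block simp del: up.simps elim!: not_up_ocellE)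

lemma labs_flip: "ocell q (f, t) \<Longrightarrow> labs (flip f t) = rhs f"
proof (cases "up (f, t)")
  case False
  assume o: "ocell q (f, t)"
  from not_up_ocellE[OF False o] obtain t' where "flip f t = t'" "ocell q (rv f, t')" .
  then show ?thesis using o by simp
qed (simp add: flip_up)

lemma length_flip: "ocell q (f, t) \<Longrightarrow> length (flip f t) = length (rhs f)"
  by (metis labs_flip length_map)

lemma flip_flip [simp]: "ocell q (f, t) \<Longrightarrow> flip (rv f) (flip f t) = t"
proof (cases "up (f, t)")
  case False
  assume o: "ocell q (f, t)"
  from not_up_ocellE[OF False o] obtain t' where "t = block (rv f) t'" "flip f t = t'" "up (rv f, t')" .
  then show ?thesis using o by (simp add: flip_up)
qed (simp add: flip_up)

lemma ocell_oinv: "ocell q o' \<Longrightarrow> ocell q (oinv o')"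
proof (cases o')
  case (Pair f t)
  assume "ocell q o'"
  with Pair have o: "ocell q (f, t)" by simp
  from labs_flip[OF o] wfs_flip[OF o] o Pair show ?thesis by simp
qed

lemma oinv_oinv [simp]: "ocell q o' \<Longrightarrow> oinv (oinv o') = o'"
  by (cases o') auto

lemma oinv_neq: "ocell q o' \<Longrightarrow> oinv o' \<noteq> o'"
  using rv_neq by (cases o') auto

lemma up_oinv: "ocell q o' \<Longrightarrow> up (oinv o') \<longleftrightarrow> \<not> up o'"
proof (cases o')
  case (Pair f t)
  assume o: "ocell q o'"
  show ?thesis
  proof (cases "up (f, t)")
    case True
    then have "\<not> up (rv f, block f t)" using o Pair by auto
    with True Pair show ?thesis by (simp add: flip_up del: up.simps)
  next
    case False
    from not_up_ocellE[OF False] o Pair obtain t' where "flip f t = t'" "up (rv f, t')" by metis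
    then show ?thesis using False Pair by (simp del: up.simps)
  qed
qed

section \<open>Substitution of states\<close>

text \<open>
  Substitution: replace the letter \<open>Base i\<close> of the initial word by the \<open>i\<close>th item of \<open>T\<close> and repeat
  the applications recorded in the name. Some of them may now undo applications recorded in \<open>T\<close>;
  this is why the clause for \<open>New\<close> uses \<open>flip\<close> and not \<open>block\<close>.
\<close>

fun act :: "('l, 'f) item list \<Rightarrow> ('l, 'f) item \<Rightarrow> ('l, 'f) item" where
  "act T (Base i l) = T ! i"
| "act T (New f t i) = flip f (map (act T) t) ! i"

abbreviation comp_state (infixl "\<odot>" 70) where
  "a \<odot> b \<equiv> map (act a) b"

definition offset :: "nat \<Rightarrow> 'l list \<Rightarrow> ('l, 'f) item list" where
  "offset n q = map (\<lambda>i. Base (n + i) (q ! i)) [0..<length q]"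

abbreviation base :: "'l list \<Rightarrow> ('l, 'f) item list" where
  "base q \<equiv> offset 0 q"

lemma length_offset [simp]: "length (offset n q) = length q"
  by (simp add: offset_def)

lemma nth_offset [simp]: "i < length q \<Longrightarrow> offset n q ! i = Base (n + i) (q ! i)"
  by (simp add: offset_def)

lemma labs_offset [simp]: "labs (offset n q) = q"
  by (simp add: offset_def comp_def map_nth)

lemma distinct_offset [simp]: "distinct (offset n q)"
  by (auto simp: offset_def distinct_map inj_on_def)

lemma wfs_base [simp]: "wfs q (base q)"
  by (auto simp: offset_def)

lemma act_wf:
  assumes "wfs q T"
  shows "wf (labs T) x \<Longrightarrow> wf q (act T x) \<and> lab (act T x) = lab x"
proof (induction x)
  case (Base i l)
  with assms show ?case by auto
next
  case (New f t i)
  then have IH: "\<forall>x\<in>set t. wf q (act T x) \<and> lab (act T x) = lab x" by auto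
  then have "labs (map (act T) t) = labs t" by auto
  with New.prems IH have o: "ocell q (f, map (act T) t)" by auto
  with New.prems have "i < length (flip f (map (act T) t))" by (auto simp: length_flip)
  then show ?case using wfs_flip[OF o] labs_flip[OF o] New.prems
    by (metis act.simps(2) lab.simps(2) nth_map nth_mem)
qed

lemma act_wfs: "wfs q T \<Longrightarrow> wfs (labs T) s \<Longrightarrow> wfs q (T \<odot> s) \<and> labs (T \<odot> s) = labs s"
  using act_wf by auto

lemma act_ocell: "wfs q T \<Longrightarrow> ocell (labs T) (f, t) \<Longrightarrow> ocell q (f, T \<odot> t)"
  using act_wfs[of T q t] by (auto simp: act_wf)

lemma act_block:
  assumes T: "wfs q T" "labs T = q'" and o: "ocell q' (f, t)"
  shows "T \<odot> block f t = flip f (T \<odot> t)"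
proof -
  have "ocell q (f, T \<odot> t)" using act_ocell[OF T(1)] T(2) o by simp
  then have "length (flip f (T \<odot> t)) = length (rhs f)"
    by (rule length_flip)
  then show ?thesis by (auto simp: block_def comp_def intro!: nth_equalityI)
qed

text \<open>
  Substitution commutes with the application of rules. All later equivariance
  statements rest on this.
\<close>

lemma act_flip:
  assumes T: "wfs q T" "labs T = q'" and o: "ocell q' (f, t)"
  shows "T \<odot> flip f t = flip f (T \<odot> t)"
proof (cases "up (f, t)")
  case True
  then show ?thesis using act_block[OF T o] by (simp add: flip_up)
next
  case False
  from not_up_ocellE[OF False o] obtain t' where
    t': "t = block (rv f) t'" "flip f t = t'" "ocell q' (rv f, t')" .
  from act_block[OF T t'(3)] have "T \<odot> t = flip (rv f) (T \<odot> t')" using t' by simp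
  moreover have "ocell q (rv f, T \<odot> t')" using act_ocell T t'(3) by blast
  ultimately show ?thesis using t'(2) flip_flip[of q "rv f" "T \<odot> t'"] o by simp
qed

lemma act_comp:
  assumes T: "wfs q T" and T': "wfs (labs T) T'"
  shows "wf (labs T') x \<Longrightarrow> act (T \<odot> T') x = act T (act T' x)"
proof (induction x)
  case (New f t i)
  then have "(T \<odot> T') \<odot> t = T \<odot> (T' \<odot> t)" by auto
  moreover have o: "ocell (labs T) (f, T' \<odot> t)"
    using act_ocell[OF T', of f t] New.prems by auto
  ultimately have "act (T \<odot> T') (New f t i) = flip f (T \<odot> (T' \<odot> t)) ! i" by (simp del: map_map)
  also have "\<dots> = (T \<odot> flip f (T' \<odot> t)) ! i" using act_flip[OF T HOL.refl o] by simp
  also have "\<dots> = act T (flip f (T' \<odot> t) ! i)"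
    using New.prems length_flip[OF o] by simp
  finally show ?case by simp
qed simp

lemma comp_assoc:
  assumes "wfs q T" "wfs (labs T) T'" "wfs (labs T') T''"
  shows "(T \<odot> T') \<odot> T'' = T \<odot> (T' \<odot> T'')"
  using act_comp[OF assms(1,2)] assms(3) by auto

lemma act_base_id: "wf q x \<Longrightarrow> act (base q) x = x"
proof (induction x)
  case (New f t i)
  then have "base q \<odot> t = t" by (auto intro: map_idI)
  moreover have "flip f t = block f t" using New.prems by (simp add: flip_def)
  ultimately show ?case using New.prems by (simp add: block_def)
qed simp

lemma base_comp: "wfs q s \<Longrightarrow> base q \<odot> s = s"
  by (auto intro: map_idI act_base_id)

lemma comp_base [simp]: "T \<odot> base (labs T) = T"
  by (auto intro: nth_equalityI)

section \<open>Histories\<close>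

text \<open>
  The applications, with their operands, without which an item could not have come into being.
\<close>

fun hist :: "('l, 'f) item \<Rightarrow> ('f \<times> ('l, 'f) item list) set" where
  "hist (Base i l) = {}"
| "hist (New f t i) = insert (f, t) (\<Union>x\<in>set t. hist x)"

definition Hist :: "('l, 'f) item list \<Rightarrow> ('f \<times> ('l, 'f) item list) set" where
  "Hist s = (\<Union>x\<in>set s. hist x)"

lemma Hist_append [simp]: "Hist (s @ t) = Hist s \<union> Hist t"
  by (auto simp: Hist_def)

lemma Hist_base [simp]: "Hist (offset n q) = {}"
  by (auto simp: Hist_def offset_def)

lemma hist_New: "hist (New f t i) = insert (f, t) (Hist t)"
  by (simp add: Hist_def)

lemma Hist_block: "f \<in> C \<Longrightarrow> Hist (block f t) = insert (f, t) (Hist t)"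
proof -
  assume "f \<in> C"
  then have "0 \<in> {..<length (rhs f)}" by simp
  then show ?thesis by (auto simp: Hist_def set_block)
qed

lemma hist_trans: "(f, t) \<in> hist y \<Longrightarrow> Hist t \<subseteq> hist y"
  by (induction y) (auto simp: Hist_def)

lemma Hist_trans: "(f, t) \<in> Hist s \<Longrightarrow> Hist t \<subseteq> Hist s"
  using hist_trans by (fastforce simp: Hist_def)

lemma hist_ocell: "wf q y \<Longrightarrow> p \<in> hist y \<Longrightarrow> ocell q p \<and> up p"
  by (induction y) auto

lemma Hist_ocell: "wfs q s \<Longrightarrow> p \<in> Hist s \<Longrightarrow> ocell q p \<and> up p"
  by (auto simp: Hist_def dest: hist_ocell)

lemma finite_Hist: "finite (Hist s)"
proof -
  have "finite (hist x)" for x :: "('l, 'f) item" by (induction x) auto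
  then show ?thesis by (simp add: Hist_def)
qed

lemma New_hist: "New f t i \<in> set s \<Longrightarrow> (f, t) \<in> Hist s"
  by (force simp: Hist_def)

text \<open>
  An item is not one of its own operands: histories grow strictly.
\<close>

lemma block_notin: "x \<in> set t \<Longrightarrow> x \<notin> set (block f t)"
proof
  assume x: "x \<in> set t" "x \<in> set (block f t)"
  then obtain i where "x = New f t i" by (auto simp: set_block)
  moreover have "size x < size (New f t i)"
    using x(1) by (simp add: size_list_estimation less_Suc_eq_le size_list_estimation')
  ultimately show False by simp
qed

section \<open>Increasing sequences of moves\<close>

inductive upp :: "'l list \<Rightarrow> ('l list \<times> 'f \<times> 'l list) list \<Rightarrow> ('l, 'f) item list \<Rightarrow> bool" for q where
  base: "upp q [] (base q)"
| step: "upp q ms (l @ t @ r) \<Longrightarrow> ocell q (f, t) \<Longrightarrow> up (f, t) \<Longrightarrow>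
    upp q (ms @ [(labs l, f, labs r)]) (l @ block f t @ r)"

lemma upp_wfs: "upp q ms z \<Longrightarrow> wfs q z"
proof (induction rule: upp.induct)
  case (step ms l t r f)
  from wfs_block[OF step(2,3)] step(4) show ?case by auto
qed simp

text \<open>
  Letters that have been consumed never come back in an increasing sequence, so no wall is
  crossed twice and no name occurs twice.
\<close>

lemma upp_invariant:
  "upp q ms z \<Longrightarrow> distinct z \<and> (\<forall>p\<in>Hist z. set (snd p) \<inter> set z = {})"
proof (induction rule: upp.induct)
  case (step ms l t r f)
  let ?z = "l @ t @ r"
  have f: "f \<in> C" and t: "t \<noteq> []" using step.hyps(2) lhs_ne[of f] by (auto simp del: lhs_ne)
  \<comment> \<open>If \<open>(f, t)\<close> had been crossed before, its operands would be gone.\<close>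
  have new: "(f, t) \<notin> Hist ?z"
  proof
    assume "(f, t) \<in> Hist ?z"
    with step.IH have "set t \<inter> set ?z = {}" by force
    with t show False by (cases t) auto
  qed
  then have nb: "set (block f t) \<inter> set ?z = {}" by (auto simp: set_block dest!: New_hist)
  then have "distinct (l @ block f t @ r)" using step.IH by auto
  moreover have "set t' \<inter> set (l @ block f t @ r) = {}" if "(g, t') \<in> Hist (l @ block f t @ r)" for g t'
  proof (cases "(g, t') = (f, t)")
    case True
    then show ?thesis using step.IH block_notin by auto
  next
    case False
    with that have old: "(g, t') \<in> Hist ?z" by (auto simp: Hist_block f)
    then have "set t' \<inter> set ?z = {}" using step.IH by force
    moreover have "set t' \<inter> set (block f t) = {}"
    proof (rule ccontr)
      assume "set t' \<inter> set (block f t) \<noteq> {}"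
      then obtain i where "New f t i \<in> set t'" by (auto simp: set_block)
      then have "(f, t) \<in> Hist t'" by (rule New_hist)
      with Hist_trans[OF old] new show False by auto
    qed
    ultimately show ?thesis by auto
  qed
  ultimately show ?case by (metis prod.collapse)
qed simp

end

lemma contiguous_disjoint:
  assumes "l @ u @ r = l' @ u' @ r'" "set u \<inter> set u' = {}" "u \<noteq> []" "u' \<noteq> []"
  shows "(\<exists>m. l' = l @ u @ m \<and> r = m @ u' @ r') \<or> (\<exists>m. l = l' @ u' @ m \<and> r' = m @ u @ r)"
proof -
  let ?s = "l @ u @ r"
  have "length l + length u \<le> length l' \<or> length l' + length u' \<le> length l"
  proof (rule ccontr)
    assume *: "\<not> ?thesis"
    define i where "i = max (length l) (length l')"
    with * assms(3,4) have i: "length l \<le> i" "i < length l + length u" "length l' \<le> i"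
      "i < length l' + length u'" by (auto simp: max_def)
    then have "?s ! i \<in> set u" by (auto simp: nth_append)
    moreover have "?s ! i \<in> set u'" unfolding assms(1) using i by (auto simp: nth_append)
    ultimately show False using assms(2) by auto
  qed
  moreover have "\<exists>m. l' = l @ u @ m \<and> r = m @ u' @ r'" if "length l + length u \<le> length l'"
  proof -
    have "(l @ u) @ r = l' @ (u' @ r')" using assms(1) by simp
    then show ?thesis using that unfolding append_eq_append_conv2 by auto
  qed
  moreover have "\<exists>m. l = l' @ u' @ m \<and> r' = m @ u @ r" if "length l' + length u' \<le> length l"
  proof -
    have "(l' @ u') @ r' = l @ (u @ r)" using assms(1) by simp
    then show ?thesis using that unfolding append_eq_append_conv2 by auto
  qed
  ultimately show ?thesis by blast
qed

lemma distinct_append_eqD: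
  assumes "l @ u @ r = l' @ u @ r'" "distinct (l @ u @ r)" "u \<noteq> []"
  shows "l = l' \<and> r = r'"
proof -
  obtain x v where u: "u = x # v" using assms(3) by (cases u) auto
  have "x \<notin> set (v @ r)" "x \<notin> set l" using assms(2) u by auto
  then show ?thesis using assms(1) append_Cons_eq_iff[of x l "v @ r" l' "v @ r'"] by (simp add: u)
qed

context rewriting_system
begin

section \<open>Moves and their homotopy\<close>

fun valid :: "'l list \<Rightarrow> ('l list \<times> 'f \<times> 'l list) list \<Rightarrow> bool" where
  "valid q [] \<longleftrightarrow> True"
| "valid q ((u, f, v) # ms) \<longleftrightarrow> f \<in> C \<and> q = u @ lhs f @ v \<and> valid (u @ rhs f @ v) ms"

fun endw :: "'l list \<Rightarrow> ('l list \<times> 'f \<times> 'l list) list \<Rightarrow> 'l list" where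
  "endw q [] = q"
| "endw q ((u, f, v) # ms) = endw (u @ rhs f @ v) ms"

lemma valid_append [simp]: "valid q (ms @ ns) \<longleftrightarrow> valid q ms \<and> valid (endw q ms) ns"
  by (induction q ms rule: valid.induct) auto

lemma endw_append [simp]: "endw q (ms @ ns) = endw (endw q ms) ns"
  by (induction q ms rule: endw.induct) auto

text \<open>
  Homotopy of 2-paths in terms of words. Invariance under concatenation on the left is built into
  the last two rules, which may act behind any valid prefix.
\<close>

inductive heq :: "'l list \<Rightarrow> ('l list \<times> 'f \<times> 'l list) list \<Rightarrow> ('l list \<times> 'f \<times> 'l list) list \<Rightarrow> bool"
  for q where
  heq_refl: "valid q ms \<Longrightarrow> heq q ms ms"
| heq_sym: "heq q ms ms' \<Longrightarrow> heq q ms' ms"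
| heq_trans: "heq q ms ms' \<Longrightarrow> heq q ms' ms'' \<Longrightarrow> heq q ms ms''"
| heq_append: "heq q ms ms' \<Longrightarrow> valid (endw q ms) ns \<Longrightarrow> heq q (ms @ ns) (ms' @ ns)"
| heq_cancel: "valid q ms \<Longrightarrow> endw q ms = u @ lhs f @ v \<Longrightarrow> f \<in> C \<Longrightarrow>
    heq q (ms @ [(u, f, v), (u, rv f, v)]) ms"
| heq_exchange: "valid q ms \<Longrightarrow> endw q ms = u @ lhs f @ x @ lhs g @ v \<Longrightarrow> f \<in> C \<Longrightarrow> g \<in> C \<Longrightarrow>
    heq q (ms @ [(u, f, x @ lhs g @ v), (u @ rhs f @ x, g, v)])
          (ms @ [(u @ lhs f @ x, g, v), (u, f, x @ rhs g @ v)])"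

lemma heq_valid: "heq q ms ms' \<Longrightarrow> valid q ms \<and> valid q ms' \<and> endw q ms = endw q ms'"
  by (induction rule: heq.induct) auto

text \<open>
  The prefix \<open>u\<close> and the suffix \<open>v\<close> of the rewritten word only locate the block to which \<open>f\<close> is
  applied.
\<close>

fun move :: "('l list \<times> 'f \<times> 'l list) \<Rightarrow> ('l, 'f) item list \<Rightarrow> ('l, 'f) item list" where
  "move (u, f, v) s = take (length u) s @ flip f (take (length (lhs f)) (drop (length u) s)) @
     drop (length u + length (lhs f)) s"

abbreviation run :: "('l list \<times> 'f \<times> 'l list) list \<Rightarrow> ('l, 'f) item list \<Rightarrow> ('l, 'f) item list" where
  "run ms s \<equiv> fold move ms s"

lemma move_eq: "length l = length u \<Longrightarrow> length t = length (lhs f) \<Longrightarrow>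
    move (u, f, v) (l @ t @ r) = l @ flip f t @ r"
  by simp

lemma splitE:
  assumes "labs s = u @ w @ v" "wfs q s"
  obtains l t r where "s = l @ t @ r" "labs l = u" "labs t = w" "labs r = v" "wfs q l" "wfs q t" "wfs q r"
proof -
  from assms(1) obtain l s' where "s = l @ s'" "labs l = u" "labs s' = w @ v"
    by (metis map_eq_append_conv)
  moreover from this(3) obtain t r where "s' = t @ r" "labs t = w" "labs r = v"
    by (metis map_eq_append_conv)
  ultimately show ?thesis using that assms(2) by auto
qed

lemma move_wf:
  assumes "wfs q s" "labs s = u @ lhs f @ v" "f \<in> C"
  shows "wfs q (move (u, f, v) s) \<and> labs (move (u, f, v) s) = u @ rhs f @ v"
proof -
  from splitE[OF assms(2,1)] obtain l t r where
    s: "s = l @ t @ r" "labs l = u" "labs t = lhs f" "labs r = v" "wfs q l" "wfs q t" "wfs q r" .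
  then have o: "ocell q (f, t)" using assms(3) by simp
  have "move (u, f, v) s = l @ flip f t @ r"
    using s move_eq[of l u t f v r] by (metis length_map)
  with wfs_flip[OF o] labs_flip[OF o] s show ?thesis by auto
qed

lemma run_wf: "wfs q s \<Longrightarrow> valid (labs s) ms \<Longrightarrow> wfs q (run ms s) \<and> labs (run ms s) = endw (labs s) ms"
proof (induction ms arbitrary: s)
  case (Cons m ms)
  obtain u f v where m: "m = (u, f, v)" by (cases m)
  with Cons.prems have "f \<in> C" "labs s = u @ lhs f @ v" "valid (u @ rhs f @ v) ms" by auto
  with move_wf[OF Cons.prems(1), of u f v] Cons.IH[of "move m s"] m show ?case
    by (simp del: move.simps)
qed simp

lemma move_act:
  assumes "wfs q T" "wfs (labs T) s" "labs s = u @ lhs f @ v" "f \<in> C"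
  shows "T \<odot> move (u, f, v) s = move (u, f, v) (T \<odot> s)"
proof -
  from splitE[OF assms(3,2)] obtain l t r where
    s: "s = l @ t @ r" "labs l = u" "labs t = lhs f" "labs r = v" "wfs (labs T) t" by metis
  then have o: "ocell (labs T) (f, t)" using assms(4) by simp
  from s have len: "length l = length u" "length t = length (lhs f)" by (metis length_map)+
  then show ?thesis using move_eq[of l u t f v r] move_eq[of "T \<odot> l" u "T \<odot> t" f v "T \<odot> r"]
      act_flip[OF assms(1) HOL.refl o] s(1) by (simp del: move.simps)
qed

lemma run_act: "wfs q T \<Longrightarrow> wfs (labs T) s \<Longrightarrow> valid (labs s) ms \<Longrightarrow> T \<odot> run ms s = run ms (T \<odot> s)"
proof (induction ms arbitrary: s)
  case (Cons m ms)
  obtain u f v where m: "m = (u, f, v)" by (cases m)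
  with Cons.prems have *: "f \<in> C" "labs s = u @ lhs f @ v" "valid (u @ rhs f @ v) ms" by auto
  with move_wf[OF Cons.prems(2), of u f v] Cons.IH[of "move m s"] m Cons.prems(1)
    move_act[OF Cons.prems(1,2) *(2,1)]
  show ?case by (simp del: move.simps map_map)
qed simp

lemma run_eq_comp:
  assumes "wfs q T" "valid (labs T) ms"
  shows "run ms T = T \<odot> run ms (base (labs T))"
  using run_act[OF assms(1), of "base (labs T)" ms] assms(2) by simp

section \<open>States classify homotopy classes of moves\<close>

lemma upp_valid: "upp q ms z \<Longrightarrow> valid q ms \<and> endw q ms = labs z"
  by (induction rule: upp.induct) auto

lemma upp_run: "upp q ms z \<Longrightarrow> run ms (base q) = z"
proof (induction rule: upp.induct)
  case (step ms l t r f)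
  then have "length t = length (lhs f)" by (metis length_map ocell.simps)
  with step move_eq[of l "labs l" t f "labs r" r] show ?case by (simp add: flip_up del: move.simps up.simps)
qed simp

text \<open>
  A block that is still there at the end can be created last. Its creation is commuted past each
  later application, which happened entirely to its left or to its right because the letters of
  the block have survived.
\<close>

lemma commute_block:
  assumes "upp q ms z" "z = l @ block f t @ r" "f \<in> C"
  shows "\<exists>ms'. upp q ms' (l @ t @ r) \<and> heq q ms (ms' @ [(labs l, f, labs r)])"
  using assms
proof (induction arbitrary: l r rule: upp.induct)
  case base
  have "New f t 0 \<in> set (block f t)" using \<open>f \<in> C\<close> rhs_ne by (auto simp: set_block)
  with base(1) have "New f t 0 \<in> set (base q)" by simp
  then show ?case by (auto simp: offset_def)
next
  case (step ms l' t' r' f')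
  have f': "f' \<in> C" "labs t' = lhs f'" using step.hyps(2) by auto
  have wf: "upp q (ms @ [(labs l', f', labs r')]) (l' @ block f' t' @ r')"
    using step.hyps by (rule upp.step)
  have t: "labs t = lhs f" using block_wf_down(1)[of f t q] upp_wfs[OF wf] step.prems by auto
  show ?case
  proof (cases "(f', t') = (f, t)")
    \<comment> \<open>The last move created the block itself.\<close>
    case True
    from upp_invariant[OF wf] step.prems True have "l = l' \<and> r = r'"
      by (intro distinct_append_eqD[of l "block f t"]) auto
    then show ?thesis using step.hyps(1) True heq_refl upp_valid[OF wf] by (intro exI[of _ ms]) auto
  next
    case False
    then have "set (block f t) \<inter> set (block f' t') = {}" by (auto simp: set_block)
    from contiguous_disjoint[OF step.prems(1)[symmetric] this] step.prems f'
    consider m where "l' = l @ block f t @ m" "r = m @ block f' t' @ r'"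
      | m where "l = l' @ block f' t' @ m" "r' = m @ block f t @ r" by auto
    then show ?thesis
    proof cases
      case 1
      with step.IH[of l "m @ t' @ r'"] step.prems obtain ms1 where
        ms1: "upp q ms1 (l @ t @ m @ t' @ r')" "heq q ms (ms1 @ [(labs l, f, labs (m @ t' @ r'))])" by auto
      have "upp q (ms1 @ [(labs (l @ t @ m), f', labs r')]) ((l @ t @ m) @ block f' t' @ r')"
        using ms1(1) step.hyps by (intro upp.step) auto
      moreover have "heq q (ms @ [(labs l', f', labs r')])
          ((ms1 @ [(labs l, f, labs (m @ t' @ r'))]) @ [(labs l', f', labs r')])"
        using ms1(2) upp_valid[OF wf] by (intro heq_append) auto
      moreover have "heq q (ms1 @ [(labs l, f, labs m @ lhs f' @ labs r'), (labs l @ rhs f @ labs m, f', labs r')])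
         (ms1 @ [(labs l @ lhs f @ labs m, f', labs r'), (labs l, f, labs m @ rhs f' @ labs r')])"
        using upp_valid[OF ms1(1)] t f' step.prems by (intro heq_exchange) auto
      ultimately show ?thesis using 1 f' t
        by (intro exI[of _ "ms1 @ [(labs (l @ t @ m), f', labs r')]"]) (simp, blast intro: heq_trans)
    next
      case 2
      with step.IH[of "l' @ t' @ m" r] step.prems obtain ms1 where
        ms1: "upp q ms1 (l' @ t' @ m @ t @ r)" "heq q ms (ms1 @ [(labs (l' @ t' @ m), f, labs r)])" by auto
      have "upp q (ms1 @ [(labs l', f', labs (m @ t @ r))]) (l' @ block f' t' @ m @ t @ r)"
        using ms1(1) step.hyps by (intro upp.step) auto
      moreover have "heq q (ms @ [(labs l', f', labs r')])
          ((ms1 @ [(labs (l' @ t' @ m), f, labs r)]) @ [(labs l', f', labs r')])"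
        using ms1(2) upp_valid[OF wf] by (intro heq_append) auto
      moreover have "heq q (ms1 @ [(labs l', f', labs m @ lhs f @ labs r), (labs l' @ rhs f' @ labs m, f, labs r)])
         (ms1 @ [(labs l' @ lhs f' @ labs m, f, labs r), (labs l', f', labs m @ rhs f @ labs r)])"
        using upp_valid[OF ms1(1)] t f' step.prems by (intro heq_exchange) auto
      ultimately show ?thesis using 2 f' t
        by (intro exI[of _ "ms1 @ [(labs l', f', labs (m @ t @ r))]"]) (simp, blast intro: heq_trans heq_sym)
    qed
  qed
qed

text \<open>
  A move that removes a block cancels with the creation of that block, once the latter has been
  commuted to the end.
\<close>

lemma upp_step_any:
  assumes "upp q ms (l @ t @ r)" "ocell q (f, t)"
  shows "\<exists>ms'. upp q ms' (l @ flip f t @ r) \<and> heq q (ms @ [(labs l, f, labs r)]) ms'"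
proof (cases "up (f, t)")
  case True
  from upp.step[OF assms True] have u: "upp q (ms @ [(labs l, f, labs r)]) (l @ block f t @ r)" .
  with upp_valid[OF this] True show ?thesis
    by (intro exI[of _ "ms @ [(labs l, f, labs r)]"]) (auto simp: flip_up heq_refl simp del: up.simps)
next
  case False
  from not_up_ocellE[OF False assms(2)] obtain t' where
    t': "t = block (rv f) t'" "flip f t = t'" "ocell q (rv f, t')" .
  have f: "f \<in> C" using assms(2) by simp
  from commute_block[OF assms(1), of l "rv f" t' r] t' f obtain ms1 where
    ms1: "upp q ms1 (l @ t' @ r)" "heq q ms (ms1 @ [(labs l, rv f, labs r)])" by auto
  have "heq q (ms @ [(labs l, f, labs r)]) ((ms1 @ [(labs l, rv f, labs r)]) @ [(labs l, f, labs r)])"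
    using ms1(2) upp_valid[OF assms(1)] f t'(1) by (intro heq_append) auto
  moreover have "heq q (ms1 @ [(labs l, rv f, labs r), (labs l, rv (rv f), labs r)]) ms1"
    using upp_valid[OF ms1(1)] t'(3) f by (intro heq_cancel) auto
  ultimately have "heq q (ms @ [(labs l, f, labs r)]) ms1" using f by simp (blast intro: heq_trans)
  with ms1(1) t'(2) show ?thesis by auto
qed

lemma valid_upp: "valid q ms \<Longrightarrow> \<exists>ms'. upp q ms' (run ms (base q)) \<and> heq q ms ms'"
proof (induction ms rule: rev_induct)
  case Nil
  then show ?case using upp.base[of q] heq_refl[of q "[]"] by auto
next
  case (snoc m ms)
  obtain u f v where m: "m = (u, f, v)" by (cases m)
  with snoc.prems have v: "valid q ms" "endw q ms = u @ lhs f @ v" "f \<in> C" by auto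
  with snoc.IH obtain ms1 where ms1: "upp q ms1 (run ms (base q))" "heq q ms ms1" by auto
  let ?z = "run ms (base q)"
  have z: "labs ?z = u @ lhs f @ v" "wfs q ?z" using run_wf[of "base q" q ms] v by auto
  from splitE[OF z] obtain l t r where
    s: "?z = l @ t @ r" "labs l = u" "labs t = lhs f" "labs r = v" "wfs q t" by metis
  with v have o: "ocell q (f, t)" by simp
  from upp_step_any[OF ms1(1)[unfolded s(1)] o] obtain ms2 where
    ms2: "upp q ms2 (l @ flip f t @ r)" "heq q (ms1 @ [m]) ms2" using m s by auto
  have "move m ?z = l @ flip f t @ r" unfolding m s(1) using s by (intro move_eq) (metis length_map)+
  moreover have "heq q (ms @ [m]) (ms1 @ [m])" using ms1(2) v m by (intro heq_append) auto
  ultimately show ?case using ms2 by simp (blast intro: heq_trans)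
qed

text \<open>
  Peel off the last creation of the first sequence. Its block is still present at the end, so the
  second sequence can be rearranged to end with the same creation.
\<close>

lemma upp_heq: "upp q ms z \<Longrightarrow> upp q ms' z \<Longrightarrow> heq q ms ms'"
proof (induction arbitrary: ms' rule: upp.induct)
  case base
  from base show ?case
  proof (cases rule: upp.cases)
    case (step ms0 l t r f)
    have "New f t 0 \<in> set (block f t)" using step(4) rhs_ne by (auto simp: set_block)
    then have "New f t 0 \<in> set (base q)" unfolding step(2) by simp
    then show ?thesis by (auto simp: offset_def)
  qed (auto intro: heq_refl)
next
  case (step ms l t r f)
  from commute_block[OF step.prems, of l f t r] step.hyps(2) obtain ms1 where
    ms1: "upp q ms1 (l @ t @ r)" "heq q ms' (ms1 @ [(labs l, f, labs r)])" by auto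
  have "heq q (ms @ [(labs l, f, labs r)]) (ms1 @ [(labs l, f, labs r)])"
    using step.IH[OF ms1(1)] upp_valid[OF step.hyps(1)] step.hyps(2) by (intro heq_append) auto
  then show ?case using ms1(2) by (blast intro: heq_trans heq_sym)
qed

text \<open>
  The state reached is a complete invariant: both sequences are homotopic to increasing ones with
  the same final state.
\<close>

theorem run_eq_imp_heq:
  assumes "valid q ms" "valid q ms'" "run ms (base q) = run ms' (base q)"
  shows "heq q ms ms'"
proof -
  from valid_upp[OF assms(1)] valid_upp[OF assms(2)] assms(3) obtain ns ns' where
    "upp q ns (run ms (base q))" "heq q ms ns" "upp q ns' (run ms (base q))" "heq q ms' ns'" by auto
  with upp_heq show ?thesis by (blast intro: heq_trans heq_sym)
qed

end

section \<open>The groupoid of reachable states\<close>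

lemma pair_at_border:
  assumes "l @ t @ r = l' @ (if d then [w, e] else [e, w]) @ r'" "distinct (l @ t @ r)"
    "w \<notin> set t" "e \<in> set t"
  shows "if d then l = l' @ [w] \<and> hd t = e else r = w # r' \<and> last t = e"
proof -
  obtain t1 t2 where t: "t = t1 @ e # t2" using assms(4) by (meson split_list)
  let ?l = "if d then l' @ [w] else l'" and ?r = "if d then r' else w # r'"
  have "(l @ t1) @ [e] @ (t2 @ r) = ?l @ [e] @ ?r" using assms(1) t by (auto split: if_splits)
  with distinct_append_eqD[OF this] assms(2) t have *: "l @ t1 = ?l" "t2 @ r = ?r" by auto
  show ?thesis
  proof (cases d)
    case True
    then have "t1 = []" using * assms(3) t by (cases t1 rule: rev_cases) auto
    then show ?thesis using * True t by simp
  next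
    case False
    then have "t2 = []" using * assms(3) t by (cases t2) auto
    then show ?thesis using * False t by simp
  qed
qed

context rewriting_system
begin

definition reach :: "'l list \<Rightarrow> ('l, 'f) item list \<Rightarrow> bool" where
  "reach q z \<longleftrightarrow> (\<exists>ms. upp q ms z)"

lemma reach_base [simp]: "reach q (base q)"
  unfolding reach_def by (rule exI) (rule upp.base)

lemma reach_flip: "reach q (l @ t @ r) \<Longrightarrow> ocell q (f, t) \<Longrightarrow> reach q (l @ flip f t @ r)"
  unfolding reach_def using upp_step_any by blast

lemma reach_block: "reach q (l @ t @ r) \<Longrightarrow> ocell q (f, t) \<Longrightarrow> up (f, t) \<Longrightarrow> reach q (l @ block f t @ r)"
  unfolding reach_def using upp.step by blast

lemma reach_induct [consumes 1, case_names base step]: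
  assumes "reach q z" "P (base q)"
    "\<And>l t r f. reach q (l @ t @ r) \<Longrightarrow> ocell q (f, t) \<Longrightarrow> up (f, t) \<Longrightarrow> P (l @ t @ r) \<Longrightarrow> P (l @ block f t @ r)"
  shows "P z"
proof -
  from assms(1) obtain ms where "upp q ms z" by (auto simp: reach_def)
  then show ?thesis
  proof (induction rule: upp.induct)
    case (step ms l t r f)
    then show ?case using assms(3)[of l t r f] by (auto simp: reach_def simp del: up.simps)
  qed (rule assms(2))
qed

lemma reach_wfs: "reach q z \<Longrightarrow> wfs q z"
  using upp_wfs by (auto simp: reach_def)

lemma reach_distinct: "reach q z \<Longrightarrow> distinct z"
  using upp_invariant by (auto simp: reach_def)

lemma reach_consumed: "reach q z \<Longrightarrow> (f, t) \<in> Hist z \<Longrightarrow> x \<in> set t \<Longrightarrow> x \<notin> set z"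
  using upp_invariant by (fastforce simp: reach_def)

lemma reach_iff_run: "reach q z \<longleftrightarrow> (\<exists>ms. valid q ms \<and> run ms (base q) = z)"
  using valid_upp upp_run upp_valid by (metis reach_def)

lemma reach_comp: "reach q a \<Longrightarrow> reach (labs a) z \<Longrightarrow> reach q (a \<odot> z)"
proof -
  assume a: "reach q a"
  assume "reach (labs a) z"
  then show ?thesis
  proof (induction rule: reach_induct)
    case base
    then show ?case using a by simp
  next
    case (step l t r f)
    have "a \<odot> block f t = flip f (a \<odot> t)"
      using act_flip[OF reach_wfs[OF a] HOL.refl step.hyps(2)] step.hyps(3) by (simp add: flip_up del: up.simps)
    moreover have "ocell q (f, a \<odot> t)" using act_ocell[OF reach_wfs[OF a] step.hyps(2)] .
    ultimately show ?case using reach_flip[of q "a \<odot> l" "a \<odot> t" "a \<odot> r" f] step.IH by simp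
  qed
qed

text \<open>
  The inverse is built along the creation of \<open>a\<close>: the inverse of the state before the last creation
  is preceded by the step that removes the block just created.
\<close>

lemma reach_right_inverse:
  "reach q a \<Longrightarrow> \<exists>a'. reach (labs a) a' \<and> labs a' = q \<and> a \<odot> a' = base q"
proof (induction rule: reach_induct)
  case base
  then show ?case by (intro exI[of _ "base q"]) (simp add: base_comp)
next
  case (step l t r f)
  let ?y = "l @ t @ r" and ?a = "l @ block f t @ r"
  have f: "f \<in> C" and t: "labs t = lhs f" using step.hyps(2) by auto
  have a: "reach q ?a" using step.hyps by (rule reach_block)
  from step.IH obtain y' where y': "reach (labs ?y) y'" "labs y' = q" "?y \<odot> y' = base q" by blast
  define q2 where "q2 = labs ?a"
  then have q2: "labs (base q2) = labs l @ rhs f @ labs r" by simp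
  from splitE[OF q2 wfs_base] obtain l2 t2 r2 where
    s: "base q2 = l2 @ t2 @ r2" "labs l2 = labs l" "labs t2 = rhs f" "labs r2 = labs r" "wfs q2 t2" by metis
  from s f have o: "ocell q2 (rv f, t2)" by simp
  define d where "d = l2 @ flip (rv f) t2 @ r2"
  have d: "reach q2 d" unfolding d_def by (rule reach_flip[OF _ o]) (metis reach_base s(1))
  have ld: "labs d = labs ?y" using labs_flip[OF o] s f t by (simp add: d_def)
  have "?a \<odot> base q2 = ?a" unfolding q2_def by (rule comp_base)
  then have "?a \<odot> l2 @ ?a \<odot> t2 @ ?a \<odot> r2 = l @ block f t @ r" unfolding s(1) by simp
  moreover have "length l2 = length l" "length t2 = length (block f t)" using s(2,3) by (metis length_map labs_block)+
  ultimately have *: "?a \<odot> l2 = l" "?a \<odot> t2 = block f t" "?a \<odot> r2 = r"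
    by (auto simp del: map_append)
  have "?a \<odot> d = ?a \<odot> l2 @ ?a \<odot> flip (rv f) t2 @ ?a \<odot> r2" unfolding d_def by simp
  also have "\<dots> = ?y" using act_flip[OF reach_wfs[OF a] q2_def[symmetric] o] * f by simp
  finally have ad: "?a \<odot> d = ?y" .
  have "reach q2 (d \<odot> y')" using reach_comp[OF d] y'(1) ld by simp
  moreover have "labs (d \<odot> y') = q"
    using act_wfs[OF reach_wfs[OF d]] reach_wfs[OF y'(1)] ld y'(2) by metis
  moreover have "?a \<odot> (d \<odot> y') = base q"
    using comp_assoc[OF reach_wfs[OF a], of d y'] reach_wfs[OF d] reach_wfs[OF y'(1)] ad y'(3) q2_def ld by metis
  ultimately show ?case unfolding q2_def by blast
qed

lemma reach_inverse:
  assumes a: "reach q a"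
  obtains a' where "reach (labs a) a'" "labs a' = q" "a \<odot> a' = base q" "a' \<odot> a = base (labs a)"
proof -
  from reach_right_inverse[OF a] obtain a' where a': "reach (labs a) a'" "labs a' = q" "a \<odot> a' = base q" by blast
  from reach_right_inverse[OF a'(1)] obtain a'' where
    a'': "reach q a''" "labs a'' = labs a" "a' \<odot> a'' = base (labs a)" using a'(2) by metis
  have "a = a \<odot> (a' \<odot> a'')" using a'' by simp
  also have "\<dots> = (a \<odot> a') \<odot> a''"
    using comp_assoc[of a q a' a''] reach_wfs[OF a] reach_wfs[OF a'(1)] reach_wfs[OF a''(1)] a'(2) by simp
  also have "\<dots> = a''" using a' base_comp[OF reach_wfs[OF a''(1)]] by simp
  finally have "a' \<odot> a = base (labs a)" using a'' by simp
  with that a' show ?thesis by blast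
qed

lemma labs_comp: "reach q a \<Longrightarrow> reach (labs a) z \<Longrightarrow> labs (a \<odot> z) = labs z"
  using act_wfs reach_wfs by metis

lemma reach_assoc: "reach q a \<Longrightarrow> reach (labs a) b \<Longrightarrow> wfs (labs b) c \<Longrightarrow> (a \<odot> b) \<odot> c = a \<odot> (b \<odot> c)"
  using comp_assoc[of a q b c] reach_wfs by metis

lemma reach_divide:
  assumes "reach q a" "reach q z"
  obtains z' where "reach (labs a) z'" "z = a \<odot> z'" "labs z' = labs z"
proof -
  from reach_inverse[OF assms(1)] obtain a' where
    a': "reach (labs a) a'" "labs a' = q" "a \<odot> a' = base q" "a' \<odot> a = base (labs a)" .
  have "a \<odot> (a' \<odot> z) = z"
    using reach_assoc[OF assms(1) a'(1), of z] a' reach_wfs[OF assms(2)] base_comp by simp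
  moreover have "reach (labs a) (a' \<odot> z)" "labs (a' \<odot> z) = labs z"
    using reach_comp[OF a'(1)] labs_comp[OF a'(1)] assms(2) a'(2) by auto
  ultimately show ?thesis using that by metis
qed

lemma act_inject:
  assumes "reach q a" "wf (labs a) x" "wf (labs a) y" "act a x = act a y"
  shows "x = y"
proof -
  from reach_inverse[OF assms(1)] obtain a' where
    a': "reach (labs a) a'" "labs a' = q" "a' \<odot> a = base (labs a)" .
  have "act a' (act a z) = z" if "wf (labs a) z" for z
    using act_comp[OF reach_wfs[OF a'(1)], of a z] a' reach_wfs[OF assms(1)] that act_base_id by simp
  with assms show ?thesis by metis
qed

lemma comp_inject:
  assumes "reach q a" "wfs (labs a) x" "wfs (labs a) y" "a \<odot> x = a \<odot> y"
  shows "x = y"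
proof (rule map_inj_on[OF assms(4)])
  show "inj_on (act a) (set x \<union> set y)"
  proof (rule inj_onI)
    fix v v' assume "v \<in> set x \<union> set y" "v' \<in> set x \<union> set y" "act a v = act a v'"
    then show "v = v'" using act_inject[OF assms(1), of v v'] assms(2,3) by blast
  qed
qed

section \<open>Walls\<close>

fun oact :: "('l, 'f) item list \<Rightarrow> 'f \<times> ('l, 'f) item list \<Rightarrow> 'f \<times> ('l, 'f) item list" where
  "oact a (f, t) = (f, a \<odot> t)"

lemma fst_oact [simp]: "fst (oact a p) = fst p" and snd_oact [simp]: "snd (oact a p) = a \<odot> snd p"
  by (cases p; simp)+

lemma oact_ocell: "reach q a \<Longrightarrow> ocell (labs a) p \<Longrightarrow> ocell q (oact a p)"
  using act_ocell[OF reach_wfs] by (cases p) (metis oact.simps)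

lemma oact_oinv: "reach q a \<Longrightarrow> ocell (labs a) p \<Longrightarrow> oact a (oinv p) = oinv (oact a p)"
  using act_flip[OF reach_wfs] by (cases p) (metis oact.simps oinv.simps)

lemma oact_inject: "reach q a \<Longrightarrow> ocell (labs a) p \<Longrightarrow> ocell (labs a) p' \<Longrightarrow> oact a p = oact a p' \<longleftrightarrow> p = p'"
  using comp_inject[of q a] by (cases p; cases p') auto

lemma oact_comp: "reach q a \<Longrightarrow> reach (labs a) b \<Longrightarrow> ocell (labs b) p \<Longrightarrow> oact (a \<odot> b) p = oact a (oact b p)"
  using reach_assoc[of q a b] by (cases p) auto

lemma oact_base: "ocell q p \<Longrightarrow> oact (base q) p = p"
  using base_comp by (cases p) auto

text \<open>
  On which side of the wall \<open>p\<close> the state \<open>z\<close> lies. The initial state lies on the near side of the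
  walls that are \<open>up\<close>.
\<close>

definition beyond :: "('l, 'f) item list \<Rightarrow> 'f \<times> ('l, 'f) item list \<Rightarrow> bool" where
  "beyond z p \<longleftrightarrow> (if up p then p \<in> Hist z else oinv p \<notin> Hist z)"

lemma beyond_oinv: "ocell q p \<Longrightarrow> beyond z (oinv p) \<longleftrightarrow> \<not> beyond z p"
  using up_oinv[of q p] by (auto simp: beyond_def)

lemma beyond_base: "ocell q p \<Longrightarrow> beyond (base q) p \<longleftrightarrow> \<not> up p"
  by (simp add: beyond_def)

lemma beyond_up_step:
  assumes "reach q (l @ t @ r)" "ocell q (f, t)" "up (f, t)" "ocell q p"
  shows "beyond (l @ block f t @ r) p \<longleftrightarrow> p = (f, t) \<or> (beyond (l @ t @ r) p \<and> p \<noteq> oinv (f, t))"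
    and "\<not> beyond (l @ t @ r) (f, t)"
proof -
  have f: "f \<in> C" and t: "t \<noteq> []" using assms(2) lhs_ne[of f] by (auto simp del: lhs_ne)
  have H: "Hist (l @ block f t @ r) = insert (f, t) (Hist (l @ t @ r))" using f by (auto simp: Hist_block)
  have n: "(f, t) \<notin> Hist (l @ t @ r)" using reach_consumed[OF assms(1)] t by (cases t) fastforce+
  then show "\<not> beyond (l @ t @ r) (f, t)" using assms(3) by (simp add: beyond_def del: up.simps)
  have "oinv p = (f, t) \<longleftrightarrow> p = oinv (f, t)" using oinv_oinv[OF assms(2)] oinv_oinv[OF assms(4)] by metis
  moreover have "\<not> up (oinv (f, t))" using up_oinv[OF assms(2)] assms(3) by blast
  ultimately show "beyond (l @ block f t @ r) p \<longleftrightarrow> p = (f, t) \<or> (beyond (l @ t @ r) p \<and> p \<noteq> oinv (f, t))"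
    using assms(3) unfolding beyond_def H by (auto simp del: up.simps oinv.simps)
qed

text \<open>
  Applying a rule crosses exactly one wall.
\<close>

lemma beyond_step:
  assumes "reach q (l @ t @ r)" "ocell q (f, t)" "ocell q p"
  shows "beyond (l @ flip f t @ r) p \<longleftrightarrow> p = (f, t) \<or> (beyond (l @ t @ r) p \<and> p \<noteq> oinv (f, t))"
    and "\<not> beyond (l @ t @ r) (f, t)"
proof -
  have "(beyond (l @ flip f t @ r) p \<longleftrightarrow> p = (f, t) \<or> (beyond (l @ t @ r) p \<and> p \<noteq> oinv (f, t))) \<and>
    \<not> beyond (l @ t @ r) (f, t)"
  proof (cases "up (f, t)")
    case True
    then show ?thesis using beyond_up_step[OF assms(1,2) True assms(3)] by (simp add: flip_up del: up.simps)
  next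
    case False
    from not_up_ocellE[OF False assms(2)] obtain t' where
      t': "t = block (rv f) t'" "flip f t = t'" "ocell q (rv f, t')" "up (rv f, t')" .
    have r': "reach q (l @ t' @ r)" using reach_flip[OF assms(1,2)] t' by simp
    have inv: "(f, t) = oinv (rv f, t')" using oinv_oinv[OF assms(2)] t' by simp
    note st = beyond_up_step[OF r' t'(3,4), folded t'(1) inv]
    have "oinv (f, t) = (rv f, t')" using t' by simp
    moreover have "(f, t) \<noteq> (rv f, t')" using oinv_neq[OF t'(3)] inv by simp
    moreover have "beyond (l @ t' @ r) (f, t)"
      using beyond_oinv[OF t'(3)] st(2)[OF assms(2)] unfolding inv[symmetric] by blast
    ultimately show ?thesis
      using st(1)[OF assms(3)] st(1)[OF assms(2)] st(2)[OF assms(2)] unfolding t'(2) by metis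
  qed
  then show "beyond (l @ flip f t @ r) p \<longleftrightarrow> p = (f, t) \<or> (beyond (l @ t @ r) p \<and> p \<noteq> oinv (f, t))"
    "\<not> beyond (l @ t @ r) (f, t)" by auto
qed

text \<open>
  The walls crossed, in this direction, on the way from \<open>x\<close> to \<open>y\<close>.
\<close>

definition osep :: "'l list \<Rightarrow> ('l, 'f) item list \<Rightarrow> ('l, 'f) item list \<Rightarrow> ('f \<times> ('l, 'f) item list) set" where
  "osep q x y = {p. ocell q p \<and> \<not> beyond x p \<and> beyond y p}"

lemma osep_oinv: "ocell q p \<Longrightarrow> oinv p \<in> osep q x y \<longleftrightarrow> p \<in> osep q y x"
  using beyond_oinv ocell_oinv by (fastforce simp: osep_def)

lemma osep_base: "reach q z \<Longrightarrow> osep q (base q) z = Hist z"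
  using Hist_ocell[OF reach_wfs] beyond_base by (auto simp: osep_def beyond_def)

text \<open>
  Translating by \<open>a\<close> need not preserve sides as such, since the orientation that is \<open>up\<close> depends on the
  initial state. What is preserved is on which side \<open>z\<close> lies relative to the initial state.
\<close>

lemma beyond_act:
  assumes a: "reach q a" and z: "reach (labs a) z" and p: "ocell (labs a) p"
  shows "of_bool (beyond (a \<odot> z) (oact a p)) - of_bool (beyond a (oact a p)) =
     (of_bool (beyond z p) - of_bool (beyond (base (labs a)) p) :: int)"
  using z
proof (induction rule: reach_induct)
  case base
  then show ?case by simp
next
  case (step l t r f)
  let ?o = "(f, t)" and ?z = "l @ t @ r"
  have fl: "flip f t = block f t" using step.hyps(3) by (rule flip_up)
  note o = step.hyps(2)
  have oo: "ocell q (oact a p)" "ocell q (f, a \<odot> t)" using oact_ocell[OF a p] oact_ocell[OF a o] by simp_all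
  have e: "a \<odot> (l @ block f t @ r) = (a \<odot> l) @ flip f (a \<odot> t) @ (a \<odot> r)"
    using act_flip[OF reach_wfs[OF a] HOL.refl o] fl by simp
  have r1: "reach q ((a \<odot> l) @ (a \<odot> t) @ (a \<odot> r))" using reach_comp[OF a step.hyps(1)] by simp
  have i1: "oact a p = (f, a \<odot> t) \<longleftrightarrow> p = ?o" using oact_inject[OF a p o] by simp
  have i2: "oact a p = oinv (f, a \<odot> t) \<longleftrightarrow> p = oinv ?o"
    using oact_inject[OF a p ocell_oinv[OF o]] oact_oinv[OF a o] by simp
  have b1: "\<not> beyond (a \<odot> ?z) (f, a \<odot> t)" "beyond (a \<odot> ?z) (oinv (f, a \<odot> t))"
    using beyond_step(2)[OF r1 oo(2) oo(2)] beyond_oinv[OF oo(2)] by auto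
  have b2: "\<not> beyond ?z ?o" "beyond ?z (oinv ?o)"
    using beyond_step(2)[OF step.hyps(1) o o] beyond_oinv[OF o] by auto
  have s1: "beyond (a \<odot> (l @ block f t @ r)) (oact a p) \<longleftrightarrow>
    p = ?o \<or> (beyond (a \<odot> ?z) (oact a p) \<and> p \<noteq> oinv ?o)"
    using beyond_step(1)[OF r1 oo(2,1)] e i1 i2 by simp
  have s2: "beyond (l @ block f t @ r) p \<longleftrightarrow> p = ?o \<or> (beyond ?z p \<and> p \<noteq> oinv ?o)"
    using beyond_step(1)[OF step.hyps(1) o p] fl by simp
  consider "p = ?o" | "p = oinv ?o" "p \<noteq> ?o" | "p \<noteq> ?o" "p \<noteq> oinv ?o" by blast
  then show ?case
  proof cases
    case 1
    with step.IH b1 b2 i1 show ?thesis unfolding s1 s2 by simp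
  next
    case 2
    with step.IH b1 b2 i2 show ?thesis unfolding s1 s2 by simp
  next
    case 3
    with step.IH show ?thesis unfolding s1 s2 by simp
  qed
qed

lemma osep_act_iff:
  assumes a: "reach q a" and x: "reach (labs a) x" and y: "reach (labs a) y" and p: "ocell (labs a) p"
  shows "oact a p \<in> osep q (a \<odot> x) (a \<odot> y) \<longleftrightarrow> p \<in> osep (labs a) x y"
  using beyond_act[OF a x p] beyond_act[OF a y p] p oact_ocell[OF a p]
  by (auto simp: osep_def of_bool_def split: if_splits)

lemma osep_act:
  assumes a: "reach q a" and x: "reach (labs a) x" and y: "reach (labs a) y"
  shows "osep q (a \<odot> x) (a \<odot> y) = oact a ` osep (labs a) x y"
proof
  show "oact a ` osep (labs a) x y \<subseteq> osep q (a \<odot> x) (a \<odot> y)"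
  proof
    fix p assume "p \<in> oact a ` osep (labs a) x y"
    then obtain p' where p': "p = oact a p'" "p' \<in> osep (labs a) x y" by blast
    then have "ocell (labs a) p'" by (simp add: osep_def)
    with osep_act_iff[OF assms this] p' show "p \<in> osep q (a \<odot> x) (a \<odot> y)" by simp
  qed
  show "osep q (a \<odot> x) (a \<odot> y) \<subseteq> oact a ` osep (labs a) x y"
  proof
    fix p assume p: "p \<in> osep q (a \<odot> x) (a \<odot> y)"
    then have o: "ocell q p" by (simp add: osep_def)
    from reach_inverse[OF a] obtain a' where
      a': "reach (labs a) a'" "labs a' = q" "a \<odot> a' = base q" .
    have o': "ocell (labs a) (oact a' p)" using oact_ocell[OF a'(1)] a'(2) o by simp
    have e: "oact a (oact a' p) = p" using oact_comp[OF a a'(1), of p] a' o oact_base[OF o] by simp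
    with osep_act_iff[OF assms o'] p show "p \<in> oact a ` osep (labs a) x y" by (metis image_eqI)
  qed
qed

text \<open>
  Seen from \<open>a\<close>, separating walls are histories; facts about them can therefore be proved at the
  initial state and then translated.
\<close>

lemma osep_from:
  assumes "reach q a" "reach (labs a) z"
  shows "osep q a (a \<odot> z) = oact a ` Hist z"
  using osep_act[OF assms(1) reach_base assms(2)] osep_base[OF assms(2)] by simp

lemma finite_osep: "reach q a \<Longrightarrow> reach q z \<Longrightarrow> finite (osep q a z)"
  using osep_from finite_Hist by (metis reach_divide finite_imageI)

lemma osep_empty:
  assumes "reach q a" "reach q z" "osep q a z = {}"
  shows "z = a"
proof -
  from reach_divide[OF assms(1,2)] obtain z' where z': "reach (labs a) z'" "z = a \<odot> z'" .
  with osep_from[OF assms(1) z'(1)] assms(3) have "Hist z' = {}" by simp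
  from z'(1) obtain ms where "upp (labs a) ms z'" by (auto simp: reach_def)
  then have "z' = base (labs a)"
  proof (cases rule: upp.cases)
    case (step ms l t r f)
    then have "(f, t) \<in> Hist z'" by (auto simp: Hist_block)
    with \<open>Hist z' = {}\<close> show ?thesis by simp
  qed
  with z' show ?thesis by simp
qed

text \<open>
  The letters just behind a wall.
\<close>

abbreviation far :: "'f \<times> ('l, 'f) item list \<Rightarrow> ('l, 'f) item list" where
  "far p \<equiv> flip (fst p) (snd p)"

lemma far_oact: "reach q a \<Longrightarrow> ocell (labs a) p \<Longrightarrow> far (oact a p) = a \<odot> far p"
  using act_flip[OF reach_wfs HOL.refl] by (cases p) auto

text \<open>
  A wall in the history of \<open>z\<close> is crossed somewhere on the way to \<open>z\<close>; the state just before has a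
  smaller history.
\<close>

lemma hist_crossing:
  "reach q z \<Longrightarrow> (f, t) \<in> Hist z \<Longrightarrow> \<exists>l r. reach q (l @ t @ r) \<and> Hist (l @ t @ r) \<subseteq> Hist z - {(f, t)}"
proof (induction rule: reach_induct)
  case (step l u r g)
  have g: "g \<in> C" using step.hyps(2) by simp
  then have H: "Hist (l @ block g u @ r) = insert (g, u) (Hist (l @ u @ r))" by (auto simp: Hist_block)
  have u: "u \<noteq> []" using step.hyps(2) lhs_ne[of g] by (auto simp del: lhs_ne)
  have n: "(g, u) \<notin> Hist (l @ u @ r)" using reach_consumed[OF step.hyps(1)] u by (cases u) fastforce+
  show ?case
  proof (cases "(f, t) = (g, u)")
    case True
    then show ?thesis using step.hyps(1) n unfolding H by blast
  next
    case False
    then have "(f, t) \<in> Hist (l @ u @ r)" using step.prems unfolding H by blast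
    from step.IH[OF this] show ?thesis unfolding H by blast
  qed
qed simp

lemma base_item: "x \<in> set (base q) \<longleftrightarrow> (\<exists>i<length q. x = Base i (q ! i))"
  by (auto simp: offset_def)

lemma base_or_New:
  assumes "reach q z" "x \<in> set z" "x \<notin> set (base q)"
  obtains f t i where "x = New f t i" "(f, t) \<in> Hist z" "x \<in> set (block f t)"
proof (cases x)
  case (Base i l)
  then show ?thesis using reach_wfs[OF assms(1)] assms(2,3) base_item by force
next
  case (New f t i)
  with reach_wfs[OF assms(1)] assms(2) have "wf q (New f t i)" by blast
  then show ?thesis using that[OF New] New_hist assms(2) New by (auto simp: set_block)
qed

lemma Hist_up_ocell: "reach q z \<Longrightarrow> p \<in> Hist z \<Longrightarrow> ocell q p \<and> up p"
  using Hist_ocell[OF reach_wfs] .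

text \<open>
  A letter of \<open>z\<close> that \<open>a\<close> does not have was made by crossing one of the walls between them.
\<close>

lemma osep_far:
  assumes "reach q a" "reach q z" "x \<in> set z" "x \<notin> set a"
  obtains f t l r where "(f, t) \<in> osep q a z" "x \<in> set (flip f t)" "reach q (l @ t @ r)"
    "osep q a (l @ t @ r) \<subseteq> osep q a z - {(f, t)}"
proof -
  from reach_divide[OF assms(1,2)] obtain z' where z': "reach (labs a) z'" "z = a \<odot> z'" .
  with assms(3) obtain x' where x': "x' \<in> set z'" "x = act a x'" by auto
  have "a \<odot> base (labs a) = a" by (rule comp_base)
  then have "act a ` set (base (labs a)) = set a" by (metis set_map)
  then have "x' \<notin> set (base (labs a))" using assms(4) x'(2) by blast
  from base_or_New[OF z'(1) x'(1) this] obtain f t i where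
    n: "x' = New f t i" "(f, t) \<in> Hist z'" "x' \<in> set (block f t)" .
  have o: "ocell (labs a) (f, t)" "up (f, t)" using Hist_up_ocell[OF z'(1) n(2)] by auto
  from hist_crossing[OF z'(1) n(2)] obtain l r where
    lr: "reach (labs a) (l @ t @ r)" "Hist (l @ t @ r) \<subseteq> Hist z' - {(f, t)}" by blast
  have "x \<in> set (flip f (a \<odot> t))"
    using n(3) x'(2) act_flip[OF reach_wfs[OF assms(1)] HOL.refl o(1)] flip_up[OF o(2)]
    by (metis image_eqI set_map)
  moreover have "(f, a \<odot> t) \<in> osep q a z"
    using osep_from[OF assms(1) z'(1)] n(2) z'(2) by force
  moreover have "reach q ((a \<odot> l) @ (a \<odot> t) @ (a \<odot> r))" using reach_comp[OF assms(1) lr(1)] by simp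
  moreover have "osep q a ((a \<odot> l) @ (a \<odot> t) @ (a \<odot> r)) \<subseteq> osep q a z - {(f, a \<odot> t)}"
  proof -
    have e1: "osep q a ((a \<odot> l) @ (a \<odot> t) @ (a \<odot> r)) = oact a ` Hist (l @ t @ r)"
      using osep_from[OF assms(1) lr(1)] by simp
    have e2: "osep q a z = oact a ` Hist z'" using osep_from[OF assms(1) z'(1)] z'(2) by simp
    have ne: "oact a p \<noteq> (f, a \<odot> t)" if "p \<in> Hist (l @ t @ r)" for p
      using oact_inject[OF assms(1) _ o(1), of p] Hist_up_ocell[OF lr(1) that] lr(2) that
      unfolding oact.simps by blast
    show ?thesis unfolding e1 e2
    proof
      fix o' assume "o' \<in> oact a ` Hist (l @ t @ r)"
      then obtain p where p: "o' = oact a p" "p \<in> Hist (l @ t @ r)" by (rule imageE)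
      then have "p \<in> Hist z'" using lr(2) by (meson DiffD1 subsetD)
      with p ne[OF p(2)] show "o' \<in> oact a ` Hist z' - {(f, a \<odot> t)}" by simp
    qed
  qed
  ultimately show ?thesis using that by blast
qed

lemma osep_fromE:
  assumes "reach q a" "reach q z" "p \<in> osep q a z"
  obtains z' f t where "reach (labs a) z'" "z = a \<odot> z'" "(f, t) \<in> Hist z'" "p = oact a (f, t)"
    "ocell (labs a) (f, t)" "up (f, t)" "far p = a \<odot> block f t"
proof -
  from reach_divide[OF assms(1,2)] obtain z' where z': "reach (labs a) z'" "z = a \<odot> z'" .
  with osep_from[OF assms(1) z'(1)] assms(3) obtain f t where p: "(f, t) \<in> Hist z'" "p = oact a (f, t)" by auto
  have o: "ocell (labs a) (f, t)" "up (f, t)" using Hist_up_ocell[OF z'(1) p(1)] by auto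
  have "far p = a \<odot> block f t" using far_oact[OF assms(1) o(1)] p(2) flip_up[OF o(2)] by simp
  with that z' p o show ?thesis by blast
qed

lemma wfs_blockD: "ocell q (f, t) \<Longrightarrow> up (f, t) \<Longrightarrow> x \<in> set (block f t) \<Longrightarrow> wf q x"
  using wfs_block by blast

text \<open>
  Seen from \<open>a\<close>, the name of a letter determines the wall whose crossing made it.
\<close>

lemma far_unique:
  assumes "reach q a" "reach q z" "reach q z'" "p \<in> osep q a z" "p' \<in> osep q a z'"
    "x \<in> set (far p)" "x \<in> set (far p')"
  shows "p = p'"
proof -
  from osep_fromE[OF assms(1,2,4)] obtain f t where
    1: "p = oact a (f, t)" "ocell (labs a) (f, t)" "up (f, t)" "far p = a \<odot> block f t" by metis
  from osep_fromE[OF assms(1,3,5)] obtain f' t' where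
    2: "p' = oact a (f', t')" "ocell (labs a) (f', t')" "up (f', t')" "far p' = a \<odot> block f' t'" by metis
  from assms(6,7) 1(4) 2(4) obtain y y' where
    y: "y \<in> set (block f t)" "y' \<in> set (block f' t')" "act a y = act a y'" by auto
  with act_inject[OF assms(1) wfs_blockD[OF 1(2,3)] wfs_blockD[OF 2(2,3)]] have "y = y'" by blast
  with y have "(f, t) = (f', t')" by (auto simp: set_block)
  with 1 2 show ?thesis by simp
qed

lemma far_notin:
  assumes "reach q a" "reach q z" "p \<in> osep q a z" "x \<in> set (far p)"
  shows "x \<notin> set a"
proof
  assume x: "x \<in> set a"
  from osep_fromE[OF assms(1,2,3)] obtain f t where
    1: "p = oact a (f, t)" "ocell (labs a) (f, t)" "up (f, t)" "far p = a \<odot> block f t" by metis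
  from assms(4) 1(4) obtain y where y: "y \<in> set (block f t)" "x = act a y" by auto
  have "act a ` set (base (labs a)) = set a" using comp_base by (metis set_map)
  with x obtain y' where y': "y' \<in> set (base (labs a))" "x = act a y'" by blast
  have "y = y'" using act_inject[OF assms(1) wfs_blockD[OF 1(2,3) y(1)], of y'] y y' wfs_base[of "labs a"] by metis
  with y y' show False by (auto simp: set_block base_item)
qed

lemma far_mem:
  assumes "reach q a" "reach q z" "reach q y" "p \<in> osep q a z" "x \<in> set (far p)" "x \<in> set y"
  shows "p \<in> osep q a y"
proof -
  from far_notin[OF assms(1,2,4,5)] have "x \<notin> set a" .
  from osep_far[OF assms(1,3,6) this] obtain f t where
    "(f, t) \<in> osep q a y" "x \<in> set (flip f t)" by metis
  with far_unique[OF assms(1,2,3,4), of "(f, t)" x] assms(5) show ?thesis by simp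
qed

lemma minimal_hist: "hist x \<noteq> {} \<Longrightarrow> \<exists>(g, u)\<in>hist x. Hist u = {}"
proof (induction x)
  case (New f t i)
  show ?case
  proof (cases "Hist t = {}")
    case False
    then obtain y where "y \<in> set t" "hist y \<noteq> {}" by (auto simp: Hist_def)
    with New.IH[of y] show ?thesis by auto
  qed (auto simp: hist_New)
qed simp

text \<open>
  Letters of the initial word that are adjacent at some later time have always been adjacent.
\<close>

lemma contiguous_base:
  assumes "reach q z" "z = l @ u @ r" "u \<noteq> []" "Hist u = {}"
  shows "\<exists>l' r'. base q = l' @ u @ r'"
  using assms
proof (induction arbitrary: l r rule: reach_induct)
  case (step l' t r' f)
  have f: "f \<in> C" using step.hyps(2) by simp
  have "set u \<inter> set (block f t) = {}"
    using step.prems(3) by (auto simp: set_block dest!: New_hist)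
  from contiguous_disjoint[OF step.prems(1)[symmetric] this step.prems(2) block_ne[OF f]]
  consider m where "l' = l @ u @ m" | m where "r' = m @ u @ r" by blast
  then show ?case
  proof cases
    case 1
    with step.IH[of l "m @ t @ r'"] step.prems show ?thesis by simp
  next
    case 2
    with step.IH[of "l' @ t @ m" r] step.prems show ?thesis by simp
  qed
qed blast

text \<open>
  On the way across \<open>p\<close> one has to cross all walls in the history of the operands of \<open>p\<close>. A minimal
  one among them has all its operands in \<open>a\<close>, so it can be crossed at once.
\<close>

lemma osep_adjacent:
  assumes "reach q a" "reach q b" "p \<in> osep q a b"
  obtains f t l r where "(f, t) \<in> osep q a b" "a = l @ t @ r"
    "\<And>c. reach q c \<Longrightarrow> p \<in> osep q a c \<Longrightarrow> (f, t) \<in> osep q a c"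
proof -
  from osep_fromE[OF assms] obtain z' f t where
    1: "reach (labs a) z'" "b = a \<odot> z'" "(f, t) \<in> Hist z'" "p = oact a (f, t)" "ocell (labs a) (f, t)" by metis
  have "hist (New f t 0) \<noteq> {}" by simp
  from minimal_hist[OF this] obtain g u where gu: "(g, u) \<in> insert (f, t) (Hist t)" "Hist u = {}"
    unfolding hist_New by blast
  have sub: "(g, u) \<in> Hist c" if "(f, t) \<in> Hist c" for c using Hist_trans[OF that] gu(1) that by auto
  have o: "ocell (labs a) (g, u)" using Hist_up_ocell[OF 1(1) sub[OF 1(3)]] by blast
  then have "u \<noteq> []" using lhs_ne[of g] by (auto simp del: lhs_ne)
  from hist_crossing[OF 1(1) sub[OF 1(3)]] obtain l0 r0 where "reach (labs a) (l0 @ u @ r0)" by blast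
  from contiguous_base[OF this HOL.refl \<open>u \<noteq> []\<close> gu(2)] obtain l r where lr: "base (labs a) = l @ u @ r" by blast
  have "a = a \<odot> base (labs a)" by simp
  also have "\<dots> = (a \<odot> l) @ (a \<odot> u) @ (a \<odot> r)" unfolding lr by simp
  finally have "a = (a \<odot> l) @ (a \<odot> u) @ (a \<odot> r)" .
  moreover have *: "(g, a \<odot> u) \<in> osep q a c" if c: "reach q c" "p \<in> osep q a c" for c
  proof -
    from reach_divide[OF assms(1) c(1)] obtain c' where c': "reach (labs a) c'" "c = a \<odot> c'" .
    have "oact a (f, t) \<in> oact a ` Hist c'" using osep_from[OF assms(1) c'(1)] c(2) c'(2) 1(4) by simp
    then have "(f, t) \<in> Hist c'" using oact_inject[OF assms(1) 1(5)] Hist_up_ocell[OF c'(1)]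
      by (metis (no_types, lifting) imageE)
    from sub[OF this] show ?thesis using osep_from[OF assms(1) c'(1)] c'(2) by force
  qed
  ultimately show ?thesis using that[of g "a \<odot> u" "a \<odot> l" "a \<odot> r"] *[OF assms(2,3)] by blast
qed

text \<open>
  The letter \<open>y\<close> next to \<open>x\<close>, to the right if \<open>d\<close> holds and to the left otherwise. The flag allows
  one proof for the two sides.
\<close>

definition pr :: "bool \<Rightarrow> 'b \<Rightarrow> 'b \<Rightarrow> 'b list" where
  "pr d x y = (if d then [x, y] else [y, x])"

lemma set_pr [simp]: "set (pr d x y) = {x, y}"
  and pr_ne [simp]: "pr d x y \<noteq> []"
  and map_pr [simp]: "map g (pr d x y) = pr d (g x) (g y)"
  by (auto simp: pr_def)

lemma pr_border:
  assumes "l @ t @ r = l' @ pr d w e @ r'" "distinct (l @ t @ r)" "w \<notin> set t" "e \<in> set t"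
  shows "if d then l = l' @ [w] \<and> hd t = e else r = w # r' \<and> last t = e"
  using pair_at_border[OF assms(1)[unfolded pr_def] assms(2-4)] .

text \<open>
  If an initial letter has a new neighbour, then before the creation of the neighbour it was
  adjacent to one of the operands.
\<close>

lemma base_New_pair:
  assumes "reach q z" "z = l @ pr d (Base j b) (New f t i) @ r"
  shows "\<exists>l2 r2 e. e \<in> set t \<and> reach q (l2 @ pr d (Base j b) e @ r2) \<and>
    Hist (l2 @ pr d (Base j b) e @ r2) \<subseteq> Hist z - {(f, t)}"
  using assms
proof (induction arbitrary: l r rule: reach_induct)
  case base
  then have "New f t i \<in> set (base q)" by simp
  then show ?case by (auto simp: base_item)
next
  case (step l' u r' g)
  have g: "g \<in> C" using step.hyps(2) by simp
  have H: "Hist (l' @ block g u @ r') = insert (g, u) (Hist (l' @ u @ r'))" using g by (auto simp: Hist_block)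
  have u: "u \<noteq> []" using step.hyps(2) lhs_ne[of g] by (auto simp del: lhs_ne)
  have n: "(g, u) \<notin> Hist (l' @ u @ r')" using reach_consumed[OF step.hyps(1)] u by (cases u) fastforce+
  have z: "reach q (l' @ block g u @ r')" using reach_block step.hyps by blast
  show ?case
  proof (cases "(g, u) = (f, t)")
    case True
    have "New f t i \<in> set (l' @ block g u @ r')" unfolding step.prems by simp
    then have "New f t i \<in> set (block g u)" using n True by (auto dest!: New_hist)
    moreover have "Base j b \<notin> set (block g u)" by (auto simp: set_block)
    ultimately have "if d then l' = l @ [Base j b] else r' = Base j b # r"
      using pr_border[OF step.prems reach_distinct[OF z]] by (auto split: if_splits)
    then have "\<exists>l2 r2 e. e \<in> set u \<and> l' @ u @ r' = l2 @ pr d (Base j b) e @ r2"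
    proof (cases d)
      case True
      then show ?thesis using \<open>if d then _ else _\<close> u
        by (intro exI[of _ l] exI[of _ "tl u @ r'"] exI[of _ "hd u"]) (simp add: pr_def)
    next
      case False
      then show ?thesis using \<open>if d then _ else _\<close> u
        by (intro exI[of _ "l' @ butlast u"] exI[of _ r] exI[of _ "last u"]) (simp add: pr_def)
    qed
    moreover have "Hist (l' @ u @ r') \<subseteq> Hist (l' @ block g u @ r') - {(f, t)}" using H n True by auto
    ultimately show ?thesis using step.hyps(1) True by (metis prod.inject)
  next
    case False
    then have "set (pr d (Base j b) (New f t i)) \<inter> set (block g u) = {}" by (auto simp: set_block)
    from contiguous_disjoint[OF step.prems[symmetric] this pr_ne block_ne[OF g]]
    consider m where "l' = l @ pr d (Base j b) (New f t i) @ m" | m where "r' = m @ pr d (Base j b) (New f t i) @ r"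
      by blast
    then have "\<exists>l3 r3. l' @ u @ r' = l3 @ pr d (Base j b) (New f t i) @ r3" by cases (metis append_assoc)+
    with step.IH obtain l2 r2 e where *: "e \<in> set t" "reach q (l2 @ pr d (Base j b) e @ r2)"
      "Hist (l2 @ pr d (Base j b) e @ r2) \<subseteq> Hist (l' @ u @ r') - {(f, t)}" by blast
    then show ?thesis unfolding H by blast
  qed
qed

lemma base_edge_keeps_star:
  assumes "reach q z" "base q = l @ pr d w e @ r" "lab w \<noteq> star" "lab e = star" "w \<in> set z"
  shows "\<exists>l' r'. z = l' @ pr d w e @ r'"
  using assms
proof (induction rule: reach_induct)
  case (step l' u r' f)
  have f: "f \<in> C" and u: "labs u = lhs f" using step.hyps(2) by auto
  have u': "u \<noteq> []" using u lhs_ne[OF f] by auto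
  have z: "reach q (l' @ block f u @ r')" using reach_block step.hyps by blast
  have "w \<in> set (base q)" "e \<in> set (base q)" unfolding step.prems by auto
  then have n: "w \<notin> set (block f u)" "e \<notin> set (block f u)" by (auto simp: set_block base_item)
  then have w: "w \<in> set l' \<union> set r'" using step.prems(4) by auto
  then obtain l1 r1 where lr: "l' @ u @ r' = l1 @ pr d w e @ r1" using step.IH step.prems by auto
  have nu: "w \<notin> set u" using w reach_distinct[OF step.hyps(1)] by auto
  have "e \<notin> set u"
  proof
    assume "e \<in> set u"
    from pr_border[OF lr reach_distinct[OF step.hyps(1)] nu this] have "hd u = e \<or> last u = e" by (auto split: if_splits)
    then show False using hd_lhs[OF f] last_lhs[OF f] u u' step.prems(3) by (metis hd_map last_map)
  qed
  with nu have "set (pr d w e) \<inter> set u = {}" by simp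
  from contiguous_disjoint[OF lr[symmetric] this pr_ne u']
  show ?case by (metis append_assoc)
qed blast

text \<open>
  An edge keeps its end vertices for as long as it survives, since a rule consumes vertices
  only in the interior of a block.
\<close>

lemma edge_keeps_star:
  assumes "reach q a" "reach q z" "a = l @ pr d w e @ r" "lab w \<noteq> star" "lab e = star" "w \<in> set z"
  shows "\<exists>l' r'. z = l' @ pr d w e @ r'"
proof -
  from reach_divide[OF assms(1,2)] obtain z' where z': "reach (labs a) z'" "z = a \<odot> z'" .
  have "length (pr d w e) = 2" by (simp add: pr_def)
  then have lab: "labs (base (labs a)) = labs l @ pr d (lab w) (lab e) @ labs r" using assms(3) by simp
  from splitE[OF this wfs_base] obtain l0 u0 r0 where
    s: "base (labs a) = l0 @ u0 @ r0" "labs l0 = labs l" "labs u0 = pr d (lab w) (lab e)" "wfs (labs a) u0" by metis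
  have "a \<odot> base (labs a) = l @ pr d w e @ r" using assms(3) comp_base by metis
  then have "(a \<odot> l0) @ (a \<odot> u0) @ (a \<odot> r0) = l @ pr d w e @ r" unfolding s(1) by simp
  moreover have "length (a \<odot> l0) = length l" "length (a \<odot> u0) = length (pr d w e)"
    using s(2,3) by (metis length_map, metis length_map map_pr)
  ultimately have au: "a \<odot> u0 = pr d w e" by auto
  obtain w0 e0 where u0: "u0 = pr d w0 e0"
  proof (cases d)
    case True
    with s(3) that[of "hd u0" "u0 ! 1"] show ?thesis by (cases u0; cases "tl u0") (auto simp: pr_def)
  next
    case False
    with s(3) that[of "u0 ! 1" "hd u0"] show ?thesis by (cases u0; cases "tl u0") (auto simp: pr_def)
  qed
  have we: "act a w0 = w" "act a e0 = e" "lab w0 = lab w" "lab e0 = lab e"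
    using au s(3) unfolding u0 by (auto simp: pr_def split: if_splits)
  have wf: "wf (labs a) w0" using s(4) u0 by simp
  from assms(6) z'(2) obtain y where y: "y \<in> set z'" "w = act a y" by auto
  then have "y = w0" using act_inject[OF assms(1) _ wf] reach_wfs[OF z'(1)] we by metis
  with y have "w0 \<in> set z'" by simp
  from base_edge_keeps_star[OF z'(1) s(1)[unfolded u0] _ _ this] we assms(4,5) obtain l' r' where
    "z' = l' @ pr d w0 e0 @ r'" by auto
  then have "z = (a \<odot> l') @ pr d w e @ (a \<odot> r')" using z'(2) we by simp
  then show ?thesis by blast
qed

lemma base_order:
  assumes "reach q z" "A \<subseteq> set (base q)" "A \<subseteq> set z"
  shows "filter (\<lambda>x. x \<in> A) z = filter (\<lambda>x. x \<in> A) (base q)"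
  using assms
proof (induction rule: reach_induct)
  case (step l t r f)
  have f: "f \<in> C" using step.hyps(2) by simp
  have z: "reach q (l @ block f t @ r)" using reach_block step.hyps by blast
  have b: "A \<inter> set (block f t) = {}" using step.prems(1) by (auto simp: set_block base_item)
  have t: "A \<inter> set t = {}" using reach_consumed[OF z, of f t] step.prems(2) f by (auto simp: Hist_block)
  have "filter (\<lambda>x. x \<in> A) (block f t) = []" "filter (\<lambda>x. x \<in> A) t = []"
    using b t by (auto simp: filter_empty_conv)
  moreover have "A \<subseteq> set (l @ t @ r)" using step.prems(2) b by auto
  ultimately show ?case using step.IH step.prems(1) by simp
qed simp

text \<open>
  Letters present in both states stand there in the same order: surviving letters are never moved.
\<close>

lemma order_preserved:
  assumes "reach q a" "reach q z" "A \<subseteq> set a" "A \<subseteq> set z"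
  shows "filter (\<lambda>x. x \<in> A) z = filter (\<lambda>x. x \<in> A) a"
proof -
  from reach_divide[OF assms(1,2)] obtain z' where z': "reach (labs a) z'" "z = a \<odot> z'" .
  let ?b = "base (labs a)"
  define A' where "A' = {x \<in> set ?b. act a x \<in> A}"
  have "A' \<subseteq> set z'"
  proof
    fix x assume x: "x \<in> A'"
    then have "act a x \<in> set z" using assms(4) A'_def by auto
    then obtain y where y: "y \<in> set z'" "act a x = act a y" using z'(2) by auto
    moreover have "wf (labs a) x" using x wfs_base[of "labs a"] unfolding A'_def by blast
    ultimately have "x = y" using act_inject[OF assms(1), of x y] reach_wfs[OF z'(1)] by blast
    with y show "x \<in> set z'" by simp
  qed
  then have eq: "filter (\<lambda>x. x \<in> A') z' = filter (\<lambda>x. x \<in> A') ?b"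
    by (intro base_order[OF z'(1)]) (auto simp: A'_def)
  have "filter (\<lambda>x. x \<in> A) (a \<odot> s) = a \<odot> filter (\<lambda>x. x \<in> A') s" if "wfs (labs a) s" for s
  proof -
    have "act a x \<in> A \<longleftrightarrow> x \<in> A'" if x: "x \<in> set s" for x
    proof
      assume A: "act a x \<in> A"
      moreover have "act a ` set ?b = set a" using comp_base by (metis set_map)
      ultimately have "act a x \<in> act a ` set ?b" using assms(3) by blast
      then obtain y where y: "y \<in> set ?b" "act a x = act a y" by (rule imageE)
      with act_inject[OF assms(1), of x y] wfs_base \<open>wfs (labs a) s\<close> x have "x = y" by blast
      with A y show "x \<in> A'" by (simp add: A'_def)
    qed (simp add: A'_def)
    then show ?thesis by (auto simp: filter_map comp_def intro!: arg_cong[of _ _ "map (act a)"] filter_cong)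
  qed
  from this[OF reach_wfs[OF z'(1)]] this[OF wfs_base] eq z'(2) show ?thesis by (metis comp_base)
qed

text \<open>
  A rule begins and ends with an edge, so the two end vertices are never consumed.
\<close>

lemma reach_ends:
  assumes "reach q z" "q \<noteq> []" "hd q = star" "last q = star"
  shows "z \<noteq> [] \<and> hd z = Base 0 star \<and> last z = Base (length q - 1) star"
  using assms
proof (induction rule: reach_induct)
  case base
  moreover from base(1) have "base q \<noteq> []" by (metis length_offset length_0_conv)
  ultimately show ?case by (simp add: hd_conv_nth last_conv_nth)
next
  case (step l t r f)
  have f: "f \<in> C" and t: "labs t = lhs f" using step.hyps(2) by auto
  have t': "t \<noteq> []" using t lhs_ne[OF f] by auto
  have "lab (hd t) \<noteq> star" "lab (last t) \<noteq> star" using hd_lhs[OF f] last_lhs[OF f] t t' by (metis hd_map last_map)+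
  moreover have IH: "hd (l @ t @ r) = Base 0 star" "last (l @ t @ r) = Base (length q - 1) star"
    using step.IH step.prems by auto
  ultimately have "l \<noteq> []" "r \<noteq> []" using t' by auto
  with IH show ?case by simp
qed

end

section \<open>The local groups\<close>

lemma discrete_crossing:
  fixes a b :: int
  assumes "\<not> P a" "P b" "a \<le> b"
  shows "\<exists>j. a \<le> j \<and> j < b \<and> \<not> P j \<and> P (j + 1)"
proof -
  have "\<not> P (a + int n) \<or> (\<exists>j. a \<le> j \<and> j < a + int n \<and> \<not> P j \<and> P (j + 1))" for n
  proof (induction n)
    case (Suc n)
    show ?case
    proof (cases "P (a + int n)")
      case True
      with Suc.IH show ?thesis by force
    next
      case False
      then show ?thesis by (cases "P (a + int (Suc n))") (auto intro!: exI[of _ "a + int n"] simp: algebra_simps)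
    qed
  qed (simp add: assms)
  from this[of "nat (b - a)"] assms show ?thesis by auto
qed

lemma map_fixed: "map g t = t \<Longrightarrow> x \<in> set t \<Longrightarrow> g x = x"
  by (induction t) auto

lemma (in group) int_pow_commute:
  assumes x: "x \<in> carrier G" and c: "c \<in> carrier G" and xc: "c \<otimes> x = x \<otimes> c"
  shows "c \<otimes> x [^] (i :: int) = x [^] i \<otimes> c"
proof -
  have "subgroup {y \<in> carrier G. c \<otimes> y = y \<otimes> c} G"
  proof (rule subgroupI)
    fix a b assume "a \<in> {y \<in> carrier G. c \<otimes> y = y \<otimes> c}" "b \<in> {y \<in> carrier G. c \<otimes> y = y \<otimes> c}"
    then show "a \<otimes> b \<in> {y \<in> carrier G. c \<otimes> y = y \<otimes> c}" using c by simp (metis m_assoc)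
  next
    fix a assume a: "a \<in> {y \<in> carrier G. c \<otimes> y = y \<otimes> c}"
    then have "inv a \<otimes> (c \<otimes> a) \<otimes> inv a = inv a \<otimes> (a \<otimes> c) \<otimes> inv a" by simp
    moreover from a have a': "a \<in> carrier G" by simp
    then have "inv a \<otimes> (c \<otimes> a) \<otimes> inv a = inv a \<otimes> c" using c by (simp add: m_assoc)
    moreover have "inv a \<otimes> (a \<otimes> c) \<otimes> inv a = c \<otimes> inv a" using a' c by (simp add: m_assoc[symmetric])
    ultimately show "inv a \<in> {y \<in> carrier G. c \<otimes> y = y \<otimes> c}" using a by simp
  qed (use c in auto)
  from subgroup_int_pow_closed[OF this, of x i] x xc show ?thesis by simp
qed

context rewriting_system
begin

definition Grp :: "'l list \<Rightarrow> ('l, 'f) item list monoid" where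
  "Grp q = \<lparr>carrier = {z. reach q z \<and> labs z = q}, monoid.mult = (\<lambda>a b. a \<odot> b), one = base q\<rparr>"

lemma Grp_simps [simp]:
  "monoid.mult (Grp q) a b = a \<odot> b" "one (Grp q) = base q"
  by (auto simp: Grp_def)

lemma Grp_carrier: "z \<in> carrier (Grp q) \<longleftrightarrow> reach q z \<and> labs z = q"
  by (auto simp: Grp_def)

lemma Grp_reach: "g \<in> carrier (Grp q) \<Longrightarrow> reach q g"
  and Grp_labs: "g \<in> carrier (Grp q) \<Longrightarrow> labs g = q"
  by (auto simp: Grp_carrier)

lemma group_Grp: "group (Grp q)"
proof (rule groupI)
  fix a b c assume a: "a \<in> carrier (Grp q)" and b: "b \<in> carrier (Grp q)" and c: "c \<in> carrier (Grp q)"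
  show "a \<otimes>\<^bsub>Grp q\<^esub> b \<in> carrier (Grp q)"
    using a b reach_comp[of q a b] labs_comp[of q a b] by (auto simp: Grp_carrier simp del: map_map)
  show "a \<otimes>\<^bsub>Grp q\<^esub> b \<otimes>\<^bsub>Grp q\<^esub> c = a \<otimes>\<^bsub>Grp q\<^esub> (b \<otimes>\<^bsub>Grp q\<^esub> c)"
    using a b c reach_assoc[of q a b c] reach_wfs by (auto simp: Grp_carrier simp del: map_map)
  show "\<one>\<^bsub>Grp q\<^esub> \<otimes>\<^bsub>Grp q\<^esub> a = a" using a base_comp[OF reach_wfs, of q a] by (simp add: Grp_carrier)
  from a obtain a' where "reach q a'" "labs a' = q" "a' \<odot> a = base q"
    using reach_inverse[of q a] Grp_carrier by metis
  then show "\<exists>y\<in>carrier (Grp q). y \<otimes>\<^bsub>Grp q\<^esub> a = \<one>\<^bsub>Grp q\<^esub>" by (auto simp: Grp_carrier)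
qed (simp add: Grp_carrier)

definition pw :: "'l list \<Rightarrow> ('l, 'f) item list \<Rightarrow> int \<Rightarrow> ('l, 'f) item list" where
  "pw q g i = g [^]\<^bsub>Grp q\<^esub> i"

lemma pw_closed [simp]: "g \<in> carrier (Grp q) \<Longrightarrow> pw q g i \<in> carrier (Grp q)"
  by (simp add: pw_def group.int_pow_closed[OF group_Grp])

lemma pw_0 [simp]: "pw q g 0 = base q"
  by (simp add: pw_def)

lemma pw_1 [simp]: "g \<in> carrier (Grp q) \<Longrightarrow> pw q g 1 = g"
  by (simp add: pw_def group.int_pow_1[OF group_Grp])

lemma pw_add: "g \<in> carrier (Grp q) \<Longrightarrow> pw q g (i + j) = pw q g i \<odot> pw q g j"
  using group.int_pow_mult[OF group_Grp, of g q i j] by (simp add: pw_def)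

definition commutes :: "('l, 'f) item list \<Rightarrow> ('l, 'f) item list \<Rightarrow> bool" where
  "commutes a b \<longleftrightarrow> a \<odot> b = b \<odot> a"

lemma commutes_pw:
  assumes "g \<in> carrier (Grp q)" "c \<in> carrier (Grp q)" "commutes c g"
  shows "commutes c (pw q g i)"
  using group.int_pow_commute[OF group_Grp assms(1,2)] assms(3) by (simp add: commutes_def pw_def)

lemma commutes_sym: "commutes a b \<Longrightarrow> commutes b a"
  by (simp add: commutes_def)

lemma g_reach: "g \<in> carrier (Grp q) \<Longrightarrow> reach q s \<Longrightarrow> reach q (g \<odot> s)"
  using reach_comp Grp_carrier by metis

lemma g_labs: "g \<in> carrier (Grp q) \<Longrightarrow> reach q s \<Longrightarrow> labs (g \<odot> s) = labs s"
  using labs_comp Grp_carrier by metis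

lemma g_assoc: "g \<in> carrier (Grp q) \<Longrightarrow> h \<in> carrier (Grp q) \<Longrightarrow> reach q s \<Longrightarrow> (g \<odot> h) \<odot> s = g \<odot> (h \<odot> s)"
  using reach_assoc reach_wfs Grp_carrier by metis

lemma g_act: "g \<in> carrier (Grp q) \<Longrightarrow> h \<in> carrier (Grp q) \<Longrightarrow> wf q x \<Longrightarrow> act (g \<odot> h) x = act g (act h x)"
  using act_comp[of g q h x] reach_wfs Grp_carrier by metis

lemma g_wf: "g \<in> carrier (Grp q) \<Longrightarrow> wf q x \<Longrightarrow> wf q (act g x) \<and> lab (act g x) = lab x"
  using act_wf[of g q] reach_wfs Grp_carrier by metis

lemma g_inject: "g \<in> carrier (Grp q) \<Longrightarrow> wf q x \<Longrightarrow> wf q y \<Longrightarrow> act g x = act g y \<Longrightarrow> x = y"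
  using act_inject Grp_carrier by metis

lemma g_ocell: "g \<in> carrier (Grp q) \<Longrightarrow> ocell q p \<Longrightarrow> ocell q (oact g p)"
  using oact_ocell Grp_carrier by metis

lemma g_oinv: "g \<in> carrier (Grp q) \<Longrightarrow> ocell q p \<Longrightarrow> oact g (oinv p) = oinv (oact g p)"
  using oact_oinv Grp_carrier by metis

lemma g_oinject: "g \<in> carrier (Grp q) \<Longrightarrow> ocell q p \<Longrightarrow> ocell q p' \<Longrightarrow> oact g p = oact g p' \<longleftrightarrow> p = p'"
  using oact_inject Grp_carrier by metis

lemma g_oact: "g \<in> carrier (Grp q) \<Longrightarrow> h \<in> carrier (Grp q) \<Longrightarrow> ocell q p \<Longrightarrow> oact (g \<odot> h) p = oact g (oact h p)"
  using oact_comp Grp_carrier by metis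

lemma g_far: "g \<in> carrier (Grp q) \<Longrightarrow> ocell q p \<Longrightarrow> far (oact g p) = g \<odot> far p"
  using far_oact Grp_carrier by metis

lemma g_osep: "g \<in> carrier (Grp q) \<Longrightarrow> reach q x \<Longrightarrow> reach q y \<Longrightarrow>
    osep q (g \<odot> x) (g \<odot> y) = oact g ` osep q x y"
  using osep_act Grp_carrier by metis

lemma osep_ocell: "p \<in> osep q x y \<Longrightarrow> ocell q p"
  by (simp add: osep_def)

text \<open>
  A state is invertible in the groupoid, so it can be cancelled.
\<close>

lemma free_action:
  assumes g: "g \<in> carrier (Grp q)" and s: "reach q s" and e: "g \<odot> s = s"
  shows "g = base q"
proof -
  from reach_inverse[OF s] obtain s' where s': "reach (labs s) s'" "labs s' = q" "s \<odot> s' = base q" .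
  have "g = g \<odot> (s \<odot> s')" using s' Grp_labs[OF g] comp_base by metis
  also have "\<dots> = (g \<odot> s) \<odot> s'"
    using reach_assoc[of q g s s'] Grp_carrier g s reach_wfs[OF s'(1)] by auto
  finally show ?thesis using e s' by simp
qed

lemma pw_oact_add: "g \<in> carrier (Grp q) \<Longrightarrow> ocell q p \<Longrightarrow> oact (pw q g (i + j)) p = oact (pw q g i) (oact (pw q g j) p)"
  using g_oact[OF pw_closed pw_closed] by (simp add: pw_add)

lemma pw_state_add: "g \<in> carrier (Grp q) \<Longrightarrow> reach q s \<Longrightarrow> pw q g (i + j) \<odot> s = pw q g i \<odot> (pw q g j \<odot> s)"
  using g_assoc[OF pw_closed pw_closed] by (simp add: pw_add del: map_map)

lemma pw_cancel:
  assumes "g \<in> carrier (Grp q)" "ocell q p" "ocell q p'" "oact (pw q g i) p = oact (pw q g j) p'"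
  shows "p = oact (pw q g (j - i)) p'"
proof -
  have "oact (pw q g i) (oact (pw q g (j - i)) p') = oact (pw q g i) p"
    using pw_oact_add[OF assms(1,3), of i "j - i"] assms(4) by simp
  then show ?thesis using g_oinject[of "pw q g i" q] g_ocell assms by (metis pw_closed)
qed

section \<open>Axes of elements\<close>

definition sepg :: "'l list \<Rightarrow> ('l, 'f) item list \<Rightarrow> ('l, 'f) item list \<Rightarrow> ('f \<times> ('l, 'f) item list) set" where
  "sepg q g s = osep q s (g \<odot> s)"

lemma sepg_pw:
  assumes "g \<in> carrier (Grp q)" "reach q s"
  shows "osep q (pw q g i \<odot> s) (pw q g (i + 1) \<odot> s) = oact (pw q g i) ` sepg q g s"
  using g_osep[OF pw_closed[OF assms(1)] assms(2) g_reach[OF assms]] pw_state_add[OF assms, of i 1] assms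
  by (simp add: sepg_def del: map_map)

text \<open>
  By equivariance this says that the walls crossed from \<open>g\<^sup>i s\<close> to \<open>g\<^sup>i\<^sup>+\<^sup>1 s\<close>, for all integers
  \<open>i\<close>, are pairwise different even without orientation: the orbit of \<open>s\<close> is part of a geodesic line.
\<close>

definition axis :: "'l list \<Rightarrow> ('l, 'f) item list \<Rightarrow> ('l, 'f) item list \<Rightarrow> bool" where
  "axis q g s \<longleftrightarrow> reach q s \<and> (\<forall>i\<ge>1. \<forall>p\<in>sepg q g s.
     oact (pw q g i) p \<notin> sepg q g s \<and> oinv (oact (pw q g i) p) \<notin> sepg q g s)"

text \<open>
  The part of \<open>axis\<close> that two consecutive steps can violate by turning back across the same wall. It
  suffices for everything about fixed letters.
\<close>

definition straight :: "'l list \<Rightarrow> ('l, 'f) item list \<Rightarrow> ('l, 'f) item list \<Rightarrow> bool" where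
  "straight q g s \<longleftrightarrow> reach q s \<and> (\<forall>p\<in>sepg q g s. oinv (oact g p) \<notin> sepg q g s)"

lemma axis_straight: "g \<in> carrier (Grp q) \<Longrightarrow> axis q g s \<Longrightarrow> straight q g s"
  by (force simp: axis_def straight_def dest!: spec[of _ 1])

lemma beyond_flip_sepg:
  assumes g: "g \<in> carrier (Grp q)" and s: "reach q (l @ t @ r)" and o: "ocell q (f, t)" and p: "ocell q p"
  shows "beyond (g \<odot> (l @ flip f t @ r)) p \<longleftrightarrow>
      p = oact g (f, t) \<or> (beyond (g \<odot> (l @ t @ r)) p \<and> p \<noteq> oinv (oact g (f, t)))"
    and "\<not> beyond (g \<odot> (l @ t @ r)) (oact g (f, t))"
proof -
  have r: "reach q ((g \<odot> l) @ (g \<odot> t) @ (g \<odot> r))" using g_reach[OF g s] by simp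
  have o': "ocell q (f, g \<odot> t)" using g_ocell[OF g o] by simp
  have e: "g \<odot> flip f t = flip f (g \<odot> t)" using g_far[OF g o] by simp
  show "beyond (g \<odot> (l @ flip f t @ r)) p \<longleftrightarrow>
      p = oact g (f, t) \<or> (beyond (g \<odot> (l @ t @ r)) p \<and> p \<noteq> oinv (oact g (f, t)))"
    using beyond_step(1)[OF r o' p] e by simp
  show "\<not> beyond (g \<odot> (l @ t @ r)) (oact g (f, t))"
    using beyond_step(2)[OF r o' o'] by simp
qed

text \<open>
  Take \<open>s\<close> with the fewest walls between \<open>s\<close> and \<open>g s\<close>. Suppose the orbit meets a wall again
  after \<open>i\<close> steps, with \<open>i\<close> minimal over all states of this kind. It must then turn back across
  this wall, and also across a wall \<open>g\<^sup>i p\<^sub>1\<close> that bounds a step possible at \<open>g\<^sup>i s\<close> already. Move \<open>s\<close>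
  across \<open>p\<^sub>1\<close>. For \<open>i = 1\<close> the new state is displaced less than \<open>s\<close>. For \<open>i > 1\<close> it is displaced no
  more than \<open>s\<close>, but its orbit turns back one step earlier.
\<close>

lemma exists_axis:
  assumes g: "g \<in> carrier (Grp q)"
  shows "\<exists>s. axis q g s"
proof -
  define d where "d s = card (sepg q g s)" for s
  define D where "D = (LEAST n. \<exists>s. reach q s \<and> d s = n)"
  have "\<exists>n s. reach q s \<and> d s = n" using reach_base by blast
  then have "\<exists>s. reach q s \<and> d s = D" unfolding D_def by (rule LeastI_ex)
  then obtain s0 where s0: "reach q s0" "d s0 = D" by blast
  have Dle: "D \<le> d s" if "reach q s" for s unfolding D_def using that by (auto intro!: Least_le)
  have main: "\<forall>s. reach q s \<and> d s = D \<longrightarrow> (\<forall>p\<in>sepg q g s.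
     oact (pw q g (int i)) p \<notin> sepg q g s \<and> oinv (oact (pw q g (int i)) p) \<notin> sepg q g s)" if "i \<ge> 1" for i
    using that
  proof (induction i rule: less_induct)
    case (less i)
    have IH: "oact (pw q g j) p \<notin> sepg q g s" "oinv (oact (pw q g j) p) \<notin> sepg q g s"
      if "1 \<le> j" "j < int i" "reach q s" "d s = D" "p \<in> sepg q g s" for j s p
      using less.IH[of "nat j"] that by auto
    show ?case
    proof (rule ccontr)
      assume "\<not> ?thesis"
      then obtain s p where s: "reach q s" "d s = D" "p \<in> sepg q g s" and
        p: "oact (pw q g (int i)) p \<in> sepg q g s \<or> oinv (oact (pw q g (int i)) p) \<in> sepg q g s" by blast
      let ?I = "int i" and ?S = "sepg q g s" and ?st = "\<lambda>j. pw q g j \<odot> s"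
      have Soc: "ocell q p'" if "p' \<in> ?S" for p' using that osep_ocell unfolding sepg_def by blast
      have S_iff: "p' \<in> ?S \<longleftrightarrow> ocell q p' \<and> \<not> beyond s p' \<and> beyond (g \<odot> s) p'" for p'
        by (simp add: sepg_def osep_def)
      have st: "?st 0 = s" "?st 1 = g \<odot> s" using base_comp[OF reach_wfs[OF s(1)]] g by simp_all
      have rst: "reach q (?st j)" for j using g_reach[OF pw_closed[OF g] s(1)] .
      have sep_st: "osep q (?st j) (?st (j + 1)) = oact (pw q g j) ` ?S" for j by (rule sepg_pw[OF g s(1)])
      define o' where "o' = oact (pw q g ?I) p"
      have o'c: "ocell q o'" unfolding o'_def by (rule g_ocell[OF pw_closed[OF g] Soc[OF s(3)]])
      have o': "o' \<in> osep q (?st ?I) (?st (?I + 1))" unfolding sep_st o'_def using s(3) by blast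
      \<comment> \<open>If the orbit met \<open>o'\<close> again in the same direction, it would have crossed it backwards in
        between, after fewer than \<open>i\<close> steps.\<close>
      have "oinv o' \<in> ?S"
      proof (rule ccontr)
        assume "oinv o' \<notin> ?S"
        then have "o' \<in> ?S" using p o'_def by blast
        then have b: "beyond (?st 1) o'" "\<not> beyond (?st ?I) o'"
          using o' unfolding sepg_def osep_def st(2) by auto
        from discrete_crossing[of "\<lambda>j. \<not> beyond (?st j) o'" 1 ?I] b less.prems obtain j where
          j: "1 \<le> j" "j < ?I" "beyond (?st j) o'" "\<not> beyond (?st (j + 1)) o'" by auto
        then have "oinv o' \<in> oact (pw q g j) ` ?S"
          using o'c beyond_oinv[OF o'c] ocell_oinv[OF o'c] unfolding sep_st[symmetric] osep_def by auto
        then obtain p'' where p'': "p'' \<in> ?S" "oinv o' = oact (pw q g j) p''" by blast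
        then have "oinv (oact (pw q g j) p'') = o'" using o'c by (metis oinv_oinv)
        with IH(2)[OF j(1,2) s(1,2) p''(1)] \<open>o' \<in> ?S\<close> show False by simp
      qed
      then have bs: "beyond s o'" using beyond_oinv[OF o'c] unfolding S_iff by blast
      with o' have o's: "o' \<in> osep q (?st ?I) s" unfolding osep_def by blast
      \<comment> \<open>The orbit turns back across \<open>o'\<close>, so both \<open>s\<close> and \<open>g\<^sup>i\<^sup>+\<^sup>1 s\<close> lie beyond it as seen from \<open>g\<^sup>i s\<close>;
        hence they also lie beyond a wall adjacent to \<open>g\<^sup>i s\<close>.\<close>
      from osep_adjacent[OF rst rst o'] obtain f t l r where
        o1: "(f, t) \<in> osep q (?st ?I) (?st (?I + 1))" "?st ?I = l @ t @ r" and
        all: "\<And>c. reach q c \<Longrightarrow> o' \<in> osep q (?st ?I) c \<Longrightarrow> (f, t) \<in> osep q (?st ?I) c" by blast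
      from all[OF s(1) o's] have o1s: "(f, t) \<in> osep q (?st ?I) s" .
      let ?o1 = "(f, t)"
      have o1c: "ocell q ?o1" using o1(1) by (rule osep_ocell)
      from o1(1)[unfolded sep_st] obtain p1 where p1: "p1 \<in> ?S" "?o1 = oact (pw q g ?I) p1" by blast
      have p1c: "ocell q p1" using Soc[OF p1(1)] .
      have "oinv ?o1 \<in> ?S"
      proof -
        have "\<not> \<not> beyond (?st 0) ?o1" "\<not> beyond (?st ?I) ?o1" using o1s unfolding osep_def st by auto
        from discrete_crossing[of "\<lambda>j. \<not> beyond (?st j) ?o1" 0 ?I] this obtain j where
          j: "0 \<le> j" "j < ?I" "beyond (?st j) ?o1" "\<not> beyond (?st (j + 1)) ?o1" by auto
        then have "oinv ?o1 \<in> oact (pw q g j) ` ?S"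
          using o1c beyond_oinv[OF o1c] ocell_oinv[OF o1c] unfolding sep_st[symmetric] osep_def by auto
        then obtain p'' where p'': "p'' \<in> ?S" "oinv ?o1 = oact (pw q g j) p''" by blast
        then have "oact (pw q g j) p'' = oact (pw q g ?I) (oinv p1)"
          using p1 g_oinv[OF pw_closed[OF g] p1c] by metis
        from pw_cancel[OF g Soc[OF p''(1)] ocell_oinv[OF p1c] this]
        have "p'' = oinv (oact (pw q g (?I - j)) p1)" using g_oinv[OF pw_closed[OF g] p1c] by simp
        then have "\<not> (1 \<le> j)" using IH(2)[of "?I - j" s p1] j s p1(1) p''(1) by auto
        with j have "j = 0" by simp
        then have "oinv ?o1 = p''" using p'' oact_base[OF Soc[OF p''(1)]] by simp
        with p'' show ?thesis by simp
      qed
      then have b1: "beyond s ?o1" "\<not> beyond (g \<odot> s) ?o1"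
        using beyond_oinv[OF o1c] unfolding S_iff by blast+
      have inv: "oact (pw q g (- ?I)) ?o1 = p1" "pw q g (- ?I) \<odot> ?st ?I = s"
        using pw_oact_add[OF g p1c, of "- ?I" ?I] pw_state_add[OF g s(1), of "- ?I" ?I] p1 oact_base[OF p1c] st(1)
        by (simp_all del: map_map)
      \<comment> \<open>The translate of this adjacent wall by \<open>g\<^sup>-\<^sup>i\<close> is adjacent to \<open>s\<close>; let \<open>y\<close> be the state behind it.\<close>
      define l2 t2 r2 where "l2 = pw q g (- ?I) \<odot> l" and "t2 = pw q g (- ?I) \<odot> t" and "r2 = pw q g (- ?I) \<odot> r"
      have s2: "s = l2 @ t2 @ r2" using inv(2) unfolding o1(2) l2_def t2_def r2_def by simp
      have p1e: "p1 = (f, t2)" using inv(1) by (simp add: t2_def)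
      define y where "y = l2 @ flip f t2 @ r2"
      have s2r: "reach q (l2 @ t2 @ r2)" using s(1) s2 by simp
      have p1c': "ocell q (f, t2)" using p1c p1e by simp
      have y: "reach q y" unfolding y_def by (rule reach_flip[OF s2r p1c'])
      define o3 where "o3 = oact g p1"
      have o3c: "ocell q o3" unfolding o3_def by (rule g_ocell[OF g p1c])
      have bY: "beyond y p' \<longleftrightarrow> p' = p1 \<or> (beyond s p' \<and> p' \<noteq> oinv p1)" if "ocell q p'" for p'
        using beyond_step(1)[OF s2r p1c' that] unfolding p1e y_def s2 .
      have bgY: "beyond (g \<odot> y) p' \<longleftrightarrow> p' = o3 \<or> (beyond (g \<odot> s) p' \<and> p' \<noteq> oinv o3)" if "ocell q p'" for p'
        using beyond_flip_sepg(1)[OF g s2r p1c' that] unfolding p1e y_def s2 o3_def .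
      have bgs3: "\<not> beyond (g \<odot> s) o3"
        using beyond_flip_sepg(2)[OF g s2r p1c' p1c'] unfolding p1e s2 o3_def .
      have bp1: "\<not> beyond s p1" "beyond (g \<odot> s) p1" using p1(1) unfolding S_iff by auto
      have lab1: "?o1 \<noteq> oinv p1" "o3 \<noteq> oinv p1" using rv_neq[of f] o1c unfolding p1e o3_def by auto
      have Sy_iff: "p' \<in> sepg q g y \<longleftrightarrow> ocell q p' \<and> \<not> beyond y p' \<and> beyond (g \<odot> y) p'" for p'
        by (simp add: sepg_def osep_def)
      have finS: "finite ?S" unfolding sepg_def by (rule finite_osep[OF s(1) g_reach[OF g s(1)]])
      \<comment> \<open>From \<open>y\<close> to \<open>g y\<close> one need not cross \<open>p1\<close>; the only wall that may be new is its translate \<open>o3\<close>.\<close>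
      have key: "p' \<in> ?S - {p1}" if "p' \<in> sepg q g y" "p' \<noteq> o3" for p'
      proof -
        have c: "ocell q p'" and ny: "\<not> beyond y p'" and gy: "beyond (g \<odot> y) p'" using that(1) unfolding Sy_iff by auto
        from bY[OF c] ny have "p' \<noteq> p1" by blast
        from bgY[OF c] gy that(2) have gs: "beyond (g \<odot> s) p'" by blast
        have "p' \<noteq> oinv p1" using gs bp1(2) beyond_oinv[OF p1c] by blast
        with bY[OF c] ny have "\<not> beyond s p'" by blast
        with gs c \<open>p' \<noteq> p1\<close> show ?thesis by (simp add: S_iff del: map_map)
      qed
      show False
      proof (cases "i = 1")
        case True
        then have o31: "o3 = ?o1" using p1 g by (simp add: o3_def)
        \<comment> \<open>For \<open>i = 1\<close> the translate is the adjacent wall itself, which \<open>y\<close> still lies beyond.\<close>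
        have "sepg q g y \<subseteq> ?S - {p1}"
        proof
          fix p' assume p': "p' \<in> sepg q g y"
          have "p' \<noteq> o3" using p' bY[OF o1c] b1(1) lab1(1) unfolding Sy_iff o31 by blast
          with key[OF p'] show "p' \<in> ?S - {p1}" .
        qed
        then have "d y < d s" unfolding d_def using finS p1(1) by (intro psubset_card_mono) auto
        with Dle[OF y] s(2) show False by simp
      next
        case False
        with less.prems have i2: "1 < ?I" by simp
        have n3: "o3 \<notin> ?S" "oinv o3 \<notin> ?S"
          using IH[of 1 s p1] i2 s p1(1) g unfolding o3_def by auto
        then have bs3: "\<not> beyond s o3"
          using bgs3 beyond_oinv[OF o3c] ocell_oinv[OF o3c] unfolding S_iff by blast
        have "sepg q g y \<subseteq> insert o3 (?S - {p1})" using key by blast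
        then have "d y \<le> card (insert o3 (?S - {p1}))" unfolding d_def using finS by (intro card_mono) auto
        also have "\<dots> \<le> d s" unfolding d_def using finS p1(1) by (metis card_insert_le_m1 card_Diff_singleton card_gt_0_iff emptyE le_refl)
        finally have dy: "d y = D" using Dle[OF y] s(2) by simp
        have "o3 \<in> sepg q g y"
          using bY[OF o3c] bgY[OF o3c] bs3 n3(1) p1(1) o3c unfolding Sy_iff by metis
        \<comment> \<open>The orbit of \<open>y\<close> crosses \<open>o3\<close> in its first step and turns back across it after \<open>i - 1\<close> more.\<close>
        moreover have "oinv ?o1 \<in> sepg q g y"
          unfolding Sy_iff using bY[OF o1c] bgY[OF o1c] b1 lab1(1) bs3 ocell_oinv[OF o1c] beyond_oinv[OF o1c] by metis
        moreover have "?o1 = oact (pw q g (?I - 1)) o3"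
          using pw_oact_add[OF g p1c, of "?I - 1" 1] p1(2) g by (simp add: o3_def)
        ultimately show False using IH(2)[of "?I - 1" y o3] i2 y dy by auto
      qed
    qed
  qed
  have "axis q g s0"
    unfolding axis_def
  proof (intro conjI allI impI s0(1))
    fix i :: int assume "1 \<le> i"
    with main[of "nat i"] s0 show "\<forall>p\<in>sepg q g s0. oact (pw q g i) p \<notin> sepg q g s0 \<and>
      oinv (oact (pw q g i) p) \<notin> sepg q g s0" by auto
  qed
  then show ?thesis ..
qed

text \<open>
  If \<open>g\<^sup>k = 1\<close>, then an axis crosses no wall at all.
\<close>

theorem torsion_free:
  assumes g: "g \<in> carrier (Grp q)" and k: "k \<ge> 1" and e: "pw q g k = base q"
  shows "g = base q"
proof -
  from exists_axis[OF g] obtain s where s: "axis q g s" ..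
  then have r: "reach q s" by (simp add: axis_def)
  have "sepg q g s = {}"
  proof (rule ccontr)
    assume "sepg q g s \<noteq> {}"
    then obtain p where p: "p \<in> sepg q g s" by blast
    then have "ocell q p" using osep_ocell by (auto simp: sepg_def)
    then have "oact (pw q g k) p = p" using e oact_base by simp
    with s k p show False unfolding axis_def by metis
  qed
  then have "g \<odot> s = s" using osep_empty[OF r g_reach[OF g r]] by (simp add: sepg_def)
  with free_action[OF g r] show ?thesis .
qed

section \<open>Items fixed by an element\<close>

text \<open>
  Both \<open>p\<close> and its translate make the letter \<open>x\<close>. If they were different, neither \<open>s\<close> nor \<open>g s\<close> could
  be on the near side of both, by uniqueness of the wall that makes \<open>x\<close>. So the step from \<open>s\<close> to
  \<open>g s\<close> would cross \<open>p\<close> forwards and its translate backwards, which straightness forbids.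
\<close>

lemma wall_fixed:
  assumes g: "g \<in> carrier (Grp q)" and s: "straight q g s" and z: "reach q z" "x \<in> set z" "act g x = x"
    and p: "p \<in> osep q s z" "x \<in> set (far p)"
  shows "oact g p = p"
proof (rule ccontr)
  assume ne: "oact g p \<noteq> p"
  have rs: "reach q s" using s by (simp add: straight_def)
  have gs: "reach q (g \<odot> s)" and gz: "reach q (g \<odot> z)" using g_reach[OF g] rs z(1) by auto
  have pc: "ocell q p" using p(1) by (rule osep_ocell)
  let ?p = "oact g p"
  have pc': "ocell q ?p" by (rule g_ocell[OF g pc])
  have p': "?p \<in> osep q (g \<odot> s) (g \<odot> z)" using g_osep[OF g rs z(1)] p(1) by blast
  have "x \<in> act g ` set (far p)" using z(3) p(2) by (metis imageI)
  then have xf: "x \<in> set (far ?p)" using g_far[OF g pc] by simp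
  have "x \<in> act g ` set z" using z(2,3) by (metis imageI)
  then have xz: "x \<in> set (g \<odot> z)" by simp
  have a: "p \<in> osep q s (g \<odot> z)" by (rule far_mem[OF rs z(1) gz p xz])
  have b: "?p \<in> osep q (g \<odot> s) z" by (rule far_mem[OF gs gz z(1) p' xf z(2)])
  have "beyond s ?p"
  proof (rule ccontr)
    assume "\<not> beyond s ?p"
    then have "?p \<in> osep q s (g \<odot> z)" using p' unfolding osep_def by blast
    from far_unique[OF rs gz gz this a xf p(2)] ne show False by simp
  qed
  moreover have "\<not> beyond (g \<odot> s) ?p" using b unfolding osep_def by blast
  ultimately have 1: "oinv ?p \<in> sepg q g s"
    unfolding sepg_def osep_def using beyond_oinv[OF pc'] ocell_oinv[OF pc'] by blast
  have "beyond (g \<odot> s) p"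
  proof (rule ccontr)
    assume "\<not> beyond (g \<odot> s) p"
    then have "p \<in> osep q (g \<odot> s) (g \<odot> z)" using a unfolding osep_def by blast
    from far_unique[OF gs gz gz this p' p(2) xf] ne show False by simp
  qed
  then have "p \<in> sepg q g s" using p(1) unfolding sepg_def osep_def by blast
  with 1 s show False unfolding straight_def by blast
qed

lemma wall_fixed_items:
  assumes "g \<in> carrier (Grp q)" "ocell q p" "oact g p = p"
  shows "x \<in> set (snd p) \<Longrightarrow> act g x = x" "x \<in> set (far p) \<Longrightarrow> act g x = x"
proof -
  have "g \<odot> snd p = snd p" using assms(3) snd_oact by metis
  then show "x \<in> set (snd p) \<Longrightarrow> act g x = x" by (rule map_fixed)
  have "g \<odot> far p = far p" using g_far[OF assms(1,2)] assms(3) by simp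
  then show "x \<in> set (far p) \<Longrightarrow> act g x = x" by (rule map_fixed)
qed

lemma base_preimage:
  assumes "reach q s" "v \<in> set s" "wf (labs s) v'" "act s v' = v"
  shows "v' \<in> set (base (labs s))"
proof -
  have "act s ` set (base (labs s)) = set s" by (metis comp_base set_map)
  then obtain y where y: "y \<in> set (base (labs s))" "act s y = v" using assms(2) by (metis imageE)
  moreover have "wf (labs s) y" using y(1) wfs_base by blast
  ultimately show ?thesis using act_inject[OF assms(1), of y v'] assms(3,4) by simp
qed

lemma map_eq_pr:
  assumes "map g z = l @ pr d v e @ r"
  obtains l' v' e' r' where "z = l' @ pr d v' e' @ r'" "map g l' = l" "g v' = v" "g e' = e" "map g r' = r"
proof -
  from assms obtain l' z' where 1: "z = l' @ z'" "map g l' = l" "map g z' = pr d v e @ r" by (metis map_eq_append_conv)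
  from 1(3) obtain u r' where 2: "z' = u @ r'" "map g u = pr d v e" "map g r' = r" by (metis map_eq_append_conv)
  have "\<exists>v' e'. u = pr d v' e' \<and> g v' = v \<and> g e' = e"
    using 2(2) by (cases d) (auto simp: pr_def)
  then show ?thesis using that 1 2 by blast
qed

text \<open>
  The neighbour \<open>e\<close> of \<open>v\<close> is traced back to the state \<open>s\<close>. If \<open>e\<close> was made by a wall, then this wall is
  fixed by \<open>g\<close>, hence so are its operands, and one of them was the neighbour of \<open>v\<close> before.
\<close>

lemma fixed_neighbour:
  assumes g: "g \<in> carrier (Grp q)" and s: "straight q g s" and v: "v \<in> set s" "act g v = v"
    and z: "reach q z" "z = l @ pr d v e @ r" "act g e = e"
  shows "\<exists>l r e. s = l @ pr d v e @ r \<and> act g e = e"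
proof -
  have rs: "reach q s" using s by (simp add: straight_def)
  from reach_divide[OF rs z(1)] obtain z0 where z0: "reach (labs s) z0" "z = s \<odot> z0" by blast
  from z0(2) z(2) have "s \<odot> z0 = l @ pr d v e @ r" by simp
  from map_eq_pr[OF this] obtain l0 v0 e0 r0 where
    d0: "z0 = l0 @ pr d v0 e0 @ r0" "s \<odot> l0 = l" "act s v0 = v" "act s e0 = e" "s \<odot> r0 = r" .
  \<comment> \<open>Induction on the number of walls between \<open>s\<close> and the state in which \<open>v\<close> has a fixed neighbour.\<close>
  have "\<exists>l r e. s = l @ pr d v e @ r \<and> act g e = e"
    if "reach (labs s) z0" "z0 = l0 @ pr d v0 e0 @ r0" "act s v0 = v" "act g (act s e0) = act s e0" for z0 l0 v0 e0 r0
    using that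
  proof (induction "card (Hist z0)" arbitrary: z0 l0 v0 e0 r0 rule: less_induct)
    case less
    have wf: "wf (labs s) v0" "wf (labs s) e0" using reach_wfs[OF less.prems(1)] less.prems(2) by auto
    have "v0 \<in> set (base (labs s))" using base_preimage[OF rs v(1) wf(1) less.prems(3)] .
    then obtain j b where v0: "v0 = Base j b" by (auto simp: base_item)
    show ?case
    proof (cases e0)
      case (Base k b')
      have "Hist (pr d v0 e0) = {}" by (auto simp: pr_def Hist_def v0 Base)
      from contiguous_base[OF less.prems(1,2) pr_ne this] obtain l1 r1 where
        lr: "base (labs s) = l1 @ pr d v0 e0 @ r1" by blast
      have "s = s \<odot> base (labs s)" by simp
      also have "\<dots> = (s \<odot> l1) @ pr d v (act s e0) @ (s \<odot> r1)" unfolding lr using less.prems(3) by simp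
      finally show ?thesis using less.prems(4) by blast
    next
      case (New f t i)
      have t: "(f, t) \<in> Hist z0" using less.prems(2) New by (intro New_hist[of f t i]) simp
      have o: "ocell (labs s) (f, t)" "up (f, t)" using Hist_up_ocell[OF less.prems(1) t] by auto
      from base_New_pair[OF less.prems(1) less.prems(2)[unfolded v0 New]] obtain l2 r2 e2 where
        e2: "e2 \<in> set t" "reach (labs s) (l2 @ pr d v0 e2 @ r2)"
          "Hist (l2 @ pr d v0 e2 @ r2) \<subseteq> Hist z0 - {(f, t)}" unfolding v0 by blast
      let ?p = "oact s (f, t)"
      have p: "?p \<in> osep q s (s \<odot> z0)" using osep_from[OF rs less.prems(1)] t by blast
      have "e0 \<in> set (block f t)" using wf(2) New by (auto simp: set_block)
      then have "act s e0 \<in> set (far ?p)" using far_oact[OF rs o(1)] flip_up[OF o(2)] by simp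
      moreover have "act s e0 \<in> set (s \<odot> z0)" using less.prems(2) by simp
      ultimately have "oact g ?p = ?p"
        using wall_fixed[OF g s reach_comp[OF rs less.prems(1)] _ less.prems(4) p] by blast
      moreover have "act s e2 \<in> set (snd ?p)" using e2(1) by simp
      ultimately have "act g (act s e2) = act s e2"
        using wall_fixed_items(1)[OF g osep_ocell[OF p]] by blast
      moreover have "card (Hist (l2 @ pr d v0 e2 @ r2)) < card (Hist z0)"
        using e2(3) t finite_Hist by (intro psubset_card_mono) auto
      ultimately show ?thesis using less.hyps[OF _ e2(2) HOL.refl less.prems(3)] by blast
    qed
  qed
  from this[OF z0(1) d0(1,3)] d0(4) z(3) show ?thesis by simp
qed

section \<open>Words and boundary items\<close>

definition word :: "'l list \<Rightarrow> bool" where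
  "word q \<longleftrightarrow> q \<noteq> [] \<and> hd q = star \<and> last q = star \<and> successively (\<lambda>a b. (a = star) \<noteq> (b = star)) q"

text \<open>
  The end vertices are fixed by every element and are disregarded.
\<close>

definition proper :: "'l list \<Rightarrow> ('l, 'f) item \<Rightarrow> bool" where
  "proper q x \<longleftrightarrow> x \<noteq> Base 0 star \<and> x \<noteq> Base (length q - 1) star"

lemma proper_edge: "lab x \<noteq> star \<Longrightarrow> proper q x"
  by (auto simp: proper_def)

lemma alt_rhs: "f \<in> C \<Longrightarrow> successively (\<lambda>a b. (a = star) \<noteq> (b = star)) (rhs f)"
  using alt_lhs[of "rv f"] by simp

lemma near_edge:
  assumes "ocell q p"
  shows "snd p \<noteq> []" "lab (hd (snd p)) \<noteq> star"
proof -
  obtain f t where p: "p = (f, t)" by (cases p)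
  with assms have f: "f \<in> C" "labs t = lhs f" by auto
  then have "t \<noteq> []" using lhs_ne[OF f(1)] by (metis list.simps(8))
  moreover from this have "lab (hd t) = hd (labs t)" by (simp add: hd_map)
  ultimately show "snd p \<noteq> []" "lab (hd (snd p)) \<noteq> star" using p f hd_lhs[OF f(1)] by auto
qed

lemma word_replace:
  assumes "word (u @ lhs f @ v)" "f \<in> C"
  shows "word (u @ rhs f @ v)"
proof -
  have "u \<noteq> []" "v \<noteq> []" using assms hd_lhs[of f] last_lhs[of f] lhs_ne[of f] by (auto simp: word_def)
  then show ?thesis using assms hd_lhs[of f] last_lhs[of f] lhs_ne[of f] hd_rhs[of f] last_rhs[of f] rhs_ne[of f] alt_rhs[of f]
    by (auto simp: word_def successively_append_iff)
qed

lemma reach_word: "reach q z \<Longrightarrow> word q \<Longrightarrow> word (labs z)"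
proof (induction rule: reach_induct)
  case (step l t r f)
  then show ?case using word_replace[of "labs l" f "labs r"] by simp
qed simp

lemma word_ends:
  "word q \<Longrightarrow> reach q z \<Longrightarrow> z \<noteq> [] \<and> hd z = Base 0 star \<and> last z = Base (length q - 1) star"
  using reach_ends by (auto simp: word_def)

text \<open>
  The boundary vertices of \<open>g\<close>: those fixed while their neighbour on the side \<open>d\<close> is moved.
\<close>

definition bd :: "('l, 'f) item list \<Rightarrow> bool \<Rightarrow> ('l, 'f) item list \<Rightarrow> ('l, 'f) item set" where
  "bd g d s = {v. lab v = star \<and> act g v = v \<and> (\<exists>l r e. s = l @ pr d v e @ r \<and> act g e \<noteq> e)}"

lemma pr_unique:
  assumes "distinct s" "s = l @ pr d v e @ r" "s = l' @ pr d v e' @ r'"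
  shows "e = e'"
proof (cases d)
  case True
  then have "l @ [v] @ (e # r) = l' @ [v] @ (e' # r')" using assms(2,3) by (simp add: pr_def)
  from distinct_append_eqD[OF this] assms True show ?thesis by (simp add: pr_def)
next
  case False
  then have "(l @ [e]) @ [v] @ r = (l' @ [e']) @ [v] @ r'" using assms(2,3) by (simp add: pr_def)
  from distinct_append_eqD[OF this] assms False show ?thesis by (simp add: pr_def)
qed

lemma star_in_flip_neighbour:
  assumes "ocell q (f, t)" "v \<in> set (flip f t)" "lab v = star"
  shows "\<exists>l r e. flip f t = l @ pr d v e @ r"
proof -
  from assms(1) have f: "f \<in> C" by simp
  have L: "labs (flip f t) = rhs f" by (rule labs_flip[OF assms(1)])
  from assms(2) obtain l r where lr: "flip f t = l @ v # r" by (meson split_list)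
  have "l \<noteq> []"
    using L hd_rhs[OF f] assms(3) unfolding lr by (cases l) (auto, metis list.sel(1))
  moreover have "r \<noteq> []"
    using L last_rhs[OF f] assms(3) unfolding lr by (cases r) (auto, metis last_snoc)
  moreover have "l = butlast l @ [last l]" using calculation by simp
  ultimately show ?thesis
  proof (cases d)
    case True
    then have "flip f t = l @ pr d v (hd r) @ tl r" using lr \<open>r \<noteq> []\<close> by (simp add: pr_def)
    then show ?thesis by blast
  next
    case False
    then have "flip f t = butlast l @ pr d v (last l) @ r"
      using lr \<open>l \<noteq> []\<close> by (simp add: pr_def)
    then show ?thesis by blast
  qed
qed

lemma neighbour_exists:
  assumes "word q" "reach q s" "reach q u" "s = l @ pr d v e @ r" "v \<in> set u"
  shows "\<exists>l r e. u = l @ pr d v e @ r"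
proof -
  from assms(5) obtain l1 r1 where lr: "u = l1 @ v # r1" by (meson split_list)
  have ends: "hd u = hd s" "last u = last s" using word_ends[OF assms(1)] assms(2,3) by auto
  show ?thesis
  proof (cases d)
    case True
    have "r1 \<noteq> []"
    proof
      assume "r1 = []"
      then have "last s = v" using ends lr by simp
      moreover have "s = (l @ [v]) @ e # r" using assms(4) True by (simp add: pr_def)
      ultimately show False using reach_distinct[OF assms(2)]
        by (metis append_is_Nil_conv distinct_append disjoint_iff in_set_conv_decomp last_appendR last_in_set list.distinct(1))
    qed
    then have "u = l1 @ pr d v (hd r1) @ tl r1" using lr True by (simp add: pr_def)
    then show ?thesis by blast
  next
    case False
    have "l1 \<noteq> []"
    proof
      assume "l1 = []"
      then have "hd s = v" using ends lr by simp
      moreover have "s = (l @ [e]) @ v # r" using assms(4) False by (simp add: pr_def)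
      ultimately show False using reach_distinct[OF assms(2)]
        by (metis append_is_Nil_conv disjoint_iff distinct_append hd_append hd_in_set list.distinct(1) list.set_intros(1))
    qed
    then have "u = butlast l1 @ pr d v (last l1) @ r1" using lr False by (simp add: pr_def)
    then show ?thesis by blast
  qed
qed

text \<open>
  A boundary vertex of \<open>s\<close> occurs in \<open>u\<close> as well. Otherwise the wall between \<open>u\<close> and \<open>s\<close> that makes it
  would be fixed together with the letters behind it, so \<open>v\<close> would have a fixed neighbour on
  the side \<open>d\<close> in some state, hence in \<open>s\<close> by \<open>fixed_neighbour\<close>.
\<close>

lemma bd_transfer:
  assumes q: "word q" and g: "g \<in> carrier (Grp q)" and s: "straight q g s" and u: "straight q g u"
  shows "bd g d s \<subseteq> bd g d u"
proof
  fix v assume "v \<in> bd g d s"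
  then obtain l r e where v: "lab v = star" "act g v = v" "s = l @ pr d v e @ r" "act g e \<noteq> e"
    by (auto simp: bd_def)
  have rs: "reach q s" and ru: "reach q u" using s u by (auto simp: straight_def)
  have vs: "v \<in> set s" using v(3) by simp
  \<comment> \<open>In no state does \<open>v\<close> have a fixed neighbour on the side \<open>d\<close>.\<close>
  have no: "act g e' \<noteq> e'" if "reach q z" "z = l' @ pr d v e' @ r'" for z l' r' e'
  proof
    assume "act g e' = e'"
    from fixed_neighbour[OF g s vs v(2) that this] obtain l2 r2 e2 where
      "s = l2 @ pr d v e2 @ r2" "act g e2 = e2" by blast
    with pr_unique[OF reach_distinct[OF rs] v(3)] v(4) show False by blast
  qed
  have "v \<in> set u"
  proof (rule ccontr)
    assume "v \<notin> set u"
    from osep_far[OF ru rs vs this] obtain f t l1 r1 where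
      w: "(f, t) \<in> osep q u s" "v \<in> set (flip f t)" "reach q (l1 @ t @ r1)"
        "osep q u (l1 @ t @ r1) \<subseteq> osep q u s - {(f, t)}" .
    have o: "ocell q (f, t)" using w(1) by (rule osep_ocell)
    have fx: "oact g (f, t) = (f, t)" using wall_fixed[OF g u rs vs v(2) w(1)] w(2) by simp
    from star_in_flip_neighbour[OF o w(2) v(1), of d] obtain l3 r3 e3 where
      e3: "flip f t = l3 @ pr d v e3 @ r3" by blast
    have "act g e3 = e3" using wall_fixed_items(2)[OF g o fx, of e3] e3 by simp
    moreover have "reach q ((l1 @ l3) @ pr d v e3 @ (r3 @ r1))" using reach_flip[OF w(3) o] e3 by simp
    ultimately show False using no by blast
  qed
  from neighbour_exists[OF q rs ru v(3) this] obtain l' r' e' where "u = l' @ pr d v e' @ r'" by blast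
  with no[OF ru this] v show "v \<in> bd g d u" by (auto simp: bd_def)
qed

lemma sepg_translate:
  assumes g: "g \<in> carrier (Grp q)" and c: "c \<in> carrier (Grp q)" and cg: "commutes c g" and rs: "reach q s"
  shows "sepg q g (c \<odot> s) = oact c ` sepg q g s"
proof -
  have "g \<odot> (c \<odot> s) = c \<odot> (g \<odot> s)"
    using g_assoc[OF g c rs] g_assoc[OF c g rs] cg unfolding commutes_def by metis
  then show ?thesis using g_osep[OF c rs g_reach[OF g rs]] unfolding sepg_def by metis
qed

lemma straight_translate:
  assumes g: "g \<in> carrier (Grp q)" and c: "c \<in> carrier (Grp q)" and cg: "commutes c g" and s: "straight q g s"
  shows "straight q g (c \<odot> s)"
proof -
  have rs: "reach q s" using s by (simp add: straight_def)
  note S = sepg_translate[OF g c cg rs]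
  show ?thesis
    unfolding straight_def
  proof (intro conjI ballI notI)
    show "reach q (c \<odot> s)" by (rule g_reach[OF c rs])
    fix p assume "p \<in> sepg q g (c \<odot> s)" and p2: "oinv (oact g p) \<in> sepg q g (c \<odot> s)"
    then obtain p0 p1 where p0: "p0 \<in> sepg q g s" "p = oact c p0"
      and p1: "p1 \<in> sepg q g s" "oinv (oact g p) = oact c p1" unfolding S by blast
    have oc: "ocell q p0" "ocell q p1" using p0 p1 osep_ocell unfolding sepg_def by blast+
    have "oact g (oact c p0) = oact c (oact g p0)"
      using g_oact[OF g c oc(1)] g_oact[OF c g oc(1)] cg unfolding commutes_def by simp
    then have "oact c p1 = oact c (oinv (oact g p0))"
      using p1(2) p0(2) g_oinv[OF c g_ocell[OF g oc(1)]] by simp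
    then have "p1 = oinv (oact g p0)"
      using g_oinject[OF c oc(2) ocell_oinv[OF g_ocell[OF g oc(1)]]] by simp
    with p0 p1 s show False unfolding straight_def by blast
  qed
qed

text \<open>
  The boundary does not depend on the straight state, and \<open>c s\<close> is straight because \<open>c\<close> commutes with
  \<open>g\<close>. Hence \<open>c\<close> permutes the finite boundary of \<open>s\<close>; since it also preserves the order of letters,
  it fixes every boundary vertex.
\<close>

lemma boundary_fixed:
  assumes q: "word q" and g: "g \<in> carrier (Grp q)" and s: "straight q g s" and v: "v \<in> bd g d s"
    and c: "c \<in> carrier (Grp q)" and cg: "commutes c g"
  shows "act c v = v"
proof -
  have rs: "reach q s" using s by (simp add: straight_def)
  let ?B = "bd g d s" and ?u = "c \<odot> s"
  have ru: "reach q ?u" by (rule g_reach[OF c rs])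
  have su: "straight q g ?u" by (rule straight_translate[OF g c cg s])
  have eq: "bd g d ?u = ?B" using bd_transfer[OF q g s su] bd_transfer[OF q g su s] by blast
  have Bs: "?B \<subseteq> set s" by (auto simp: bd_def)
  have wfs: "wfs q s" by (rule reach_wfs[OF rs])
  have comm: "act g (act c x) = act c (act g x)" if "wf q x" for x
    using g_act[OF g c that] g_act[OF c g that] cg unfolding commutes_def by simp
  have "act c x \<in> ?B" if x: "x \<in> ?B" for x
  proof -
    from x obtain l r e where *: "lab x = star" "act g x = x" "s = l @ pr d x e @ r" "act g e \<noteq> e"
      by (auto simp: bd_def)
    then have w: "wf q x" "wf q e" using wfs by auto
    have "?u = (c \<odot> l) @ pr d (act c x) (act c e) @ (c \<odot> r)" using *(3) by simp
    moreover have "act g (act c e) \<noteq> act c e"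
      using comm[OF w(2)] g_inject[OF c _ w(2)] g_wf[OF g w(2)] *(4) by metis
    moreover have "act g (act c x) = act c x" using comm[OF w(1)] *(2) by simp
    ultimately have "act c x \<in> bd g d ?u" using g_wf[OF c w(1)] *(1) unfolding bd_def by blast
    then show ?thesis using eq by simp
  qed
  then have "act c ` ?B \<subseteq> ?B" by blast
  moreover have inj: "inj_on (act c) (set s)"
  proof (rule inj_onI)
    fix x y assume "x \<in> set s" "y \<in> set s" "act c x = act c y"
    then show "x = y" using g_inject[OF c, of x y] wfs by blast
  qed
  moreover have "finite ?B" using Bs finite_subset by blast
  ultimately have surj: "act c ` ?B = ?B" using Bs by (intro endo_inj_surj) (auto intro: inj_on_subset)
  have "bd g d ?u \<subseteq> set ?u" unfolding bd_def by (auto simp del: map_append set_map map_map)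
  then have "?B \<subseteq> set ?u" using eq by simp
  from order_preserved[OF rs ru Bs this] have 1: "filter (\<lambda>x. x \<in> ?B) ?u = filter (\<lambda>x. x \<in> ?B) s" .
  have "act c x \<in> ?B \<longleftrightarrow> x \<in> ?B" if "x \<in> set s" for x
    using inj_on_image_mem_iff[OF inj that Bs] surj by simp
  then have "filter (\<lambda>x. x \<in> ?B) ?u = c \<odot> filter (\<lambda>x. x \<in> ?B) s"
    by (auto simp: filter_map comp_def intro!: arg_cong[of _ _ "map (act c)"] filter_cong)
  with 1 have "c \<odot> filter (\<lambda>x. x \<in> ?B) s = filter (\<lambda>x. x \<in> ?B) s" by simp
  moreover have "v \<in> set (filter (\<lambda>x. x \<in> ?B) s)" using v Bs by auto
  ultimately show ?thesis by (rule map_fixed)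
qed

lemma axis_translate:
  assumes g: "g \<in> carrier (Grp q)" and c: "c \<in> carrier (Grp q)" and cg: "commutes c g" and s: "axis q g s"
  shows "axis q g (c \<odot> s)"
proof -
  have rs: "reach q s" using s by (simp add: axis_def)
  note S = sepg_translate[OF g c cg rs]
  have "oact (pw q g i) p \<notin> sepg q g (c \<odot> s) \<and> oinv (oact (pw q g i) p) \<notin> sepg q g (c \<odot> s)"
    if i: "i \<ge> 1" and p: "p \<in> sepg q g (c \<odot> s)" for i p
  proof -
    from p obtain p0 where p0: "p0 \<in> sepg q g s" "p = oact c p0" unfolding S by blast
    have oc: "ocell q p'" if "p' \<in> sepg q g s" for p' using that osep_ocell unfolding sepg_def by blast
    let ?h = "pw q g i"
    have h: "?h \<in> carrier (Grp q)" using g by simp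
    have "commutes c ?h" by (rule commutes_pw[OF g c cg])
    then have e: "oact ?h p = oact c (oact ?h p0)"
      using g_oact[OF h c oc[OF p0(1)]] g_oact[OF c h oc[OF p0(1)]] p0(2) unfolding commutes_def by simp
    have hp: "ocell q (oact ?h p0)" by (rule g_ocell[OF h oc[OF p0(1)]])
    have *: "p' \<in> sepg q g s" if p': "ocell q p'" "oact c p' \<in> sepg q g (c \<odot> s)" for p'
    proof -
      from p'(2) obtain p1 where "p1 \<in> sepg q g s" "oact c p' = oact c p1" unfolding S by blast
      with g_oinject[OF c p'(1) oc, of p1] show ?thesis by simp
    qed
    have "oact ?h p0 \<in> sepg q g s" if "oact ?h p \<in> sepg q g (c \<odot> s)"
      using *[OF hp] that unfolding e .
    moreover have "oinv (oact ?h p0) \<in> sepg q g s" if "oinv (oact ?h p) \<in> sepg q g (c \<odot> s)"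
      using *[OF ocell_oinv[OF hp]] that unfolding e g_oinv[OF c hp] .
    ultimately show ?thesis using s i p0(1) unfolding axis_def by blast
  qed
  then show ?thesis using g_reach[OF c rs] unfolding axis_def by blast
qed

text \<open>
  The wall that makes a fixed letter is fixed, and so are its operands, which lie closer to \<open>s\<close>. The
  first operand is an edge, so it is not an end vertex.
\<close>

lemma fixed_pullback:
  assumes g: "g \<in> carrier (Grp q)" and s: "straight q g s"
    and "reach q z" "x \<in> set z" "proper q x" "act g x = x"
  shows "\<exists>x'\<in>set s. proper q x' \<and> act g x' = x'"
  using assms(3-)
proof (induction "card (osep q s z)" arbitrary: z x rule: less_induct)
  case less
  have rs: "reach q s" using s by (simp add: straight_def)
  show ?case
  proof (cases "x \<in> set s")
    case False
    from osep_far[OF rs less.prems(1,2) False] obtain f t l r where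
      w: "(f, t) \<in> osep q s z" "x \<in> set (flip f t)" "reach q (l @ t @ r)"
        "osep q s (l @ t @ r) \<subseteq> osep q s z - {(f, t)}" .
    have o: "ocell q (f, t)" using w(1) by (rule osep_ocell)
    have t: "t \<noteq> []" "lab (hd t) \<noteq> star" using near_edge[OF o] by auto
    have "oact g (f, t) = (f, t)" using wall_fixed[OF g s less.prems(1,2,4) w(1)] w(2) by simp
    then have "act g (hd t) = hd t" using wall_fixed_items(1)[OF g o, of "hd t"] t(1) by simp
    moreover have "card (osep q s (l @ t @ r)) < card (osep q s z)"
      using w(1,4) finite_osep[OF rs less.prems(1)] by (intro psubset_card_mono) auto
    ultimately show ?thesis using less.hyps[OF _ w(3), of "hd t"] t proper_edge by auto
  qed (use less.prems in blast)
qed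

text \<open>
  Where a fixed letter meets a moved one, the fixed letter cannot be an edge, as the end vertices of
  an edge go where the edge goes.
\<close>

lemma fixed_next_to_nonfixed:
  assumes q: "word q" and u: "reach q u" and g: "g \<in> carrier (Grp q)"
    and "u = l @ pr d v e @ r" "act g v = v" "act g e \<noteq> e"
  shows "v \<in> bd g d u"
proof -
  have "lab v = star"
  proof (rule ccontr)
    assume v: "lab v \<noteq> star"
    have "lab e = star"
    proof -
      have "word (labs l @ pr d (lab v) (lab e) @ labs r)" using reach_word[OF u q] assms(4) by simp
      then show ?thesis using v unfolding word_def pr_def by (auto simp: successively_append_iff split: if_splits)
    qed
    moreover have gu: "g \<odot> u = (g \<odot> l) @ pr d v (act g e) @ (g \<odot> r)" using assms(4,5) by simp
    ultimately obtain l' r' where "g \<odot> u = l' @ pr d v e @ r'"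
      using edge_keeps_star[OF u g_reach[OF g u] assms(4) v] by (metis Un_iff insertI1 set_append set_pr)
    from pr_unique[OF reach_distinct[OF g_reach[OF g u]] gu this] assms(6) show False by simp
  qed
  then show ?thesis using assms(4-6) unfolding bd_def by blast
qed

lemma split_pr: "Suc k < length u \<Longrightarrow> u = take k u @ pr True (u ! k) (u ! Suc k) @ drop (Suc (Suc k)) u"
  by (simp add: pr_def Cons_nth_drop_Suc)

text \<open>
  Walk from a fixed letter to a moved one; the letter at which the change happens is a boundary
  vertex, and it is not an end of the word because \<open>x\<close> is not.
\<close>

lemma find_boundary:
  assumes q: "word q" and u: "reach q u" and g: "g \<in> carrier (Grp q)"
    and x: "x \<in> set u" "proper q x" "act g x = x" and y: "y \<in> set u" "act g y \<noteq> y"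
  shows "\<exists>d v. v \<in> bd g d u \<and> proper q v"
proof -
  from x(1) obtain i where i: "i < length u" "u ! i = x" by (metis in_set_conv_nth)
  from y(1) obtain j where j: "j < length u" "u ! j = y" by (metis in_set_conv_nth)
  note ends = word_ends[OF q u]
  have dist: "distinct u" by (rule reach_distinct[OF u])
  have u0: "u ! 0 = Base 0 star" "u ! (length u - 1) = Base (length q - 1) star"
    using ends by (metis hd_conv_nth, metis last_conv_nth)
  have inner: "proper q (u ! k)" if "0 < k" "k < length u - 1" for k
  proof -
    have "u ! k \<noteq> u ! 0" "u ! k \<noteq> u ! (length u - 1)" using that nth_eq_iff_index_eq[OF dist, of k 0]
      nth_eq_iff_index_eq[OF dist, of k "length u - 1"] ends by (auto simp flip: length_greater_0_conv)
    then show ?thesis unfolding proper_def using u0 by metis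
  qed
  have i': "0 < i" "i < length u - 1"
  proof -
    have "i \<noteq> 0" using x(2) i u0 by (metis proper_def)
    then show "0 < i" by simp
    have "i \<noteq> length u - 1" using x(2) i u0 by (metis proper_def)
    then show "i < length u - 1" using i by simp
  qed
  let ?F = "\<lambda>k. act g (u ! nat k) = u ! nat k"
  have "i \<noteq> j" using i j x y by auto
  then consider "i < j" | "j < i" by linarith
  then show ?thesis
  proof cases
    case 1
    from discrete_crossing[of "\<lambda>k. \<not> ?F k" "int i" "int j"] 1 i j x y obtain k' where
      k': "int i \<le> k'" "k' < int j" "?F k'" "\<not> ?F (k' + 1)" by auto
    define k where "k = nat k'"
    have e: "nat (k' + 1) = Suc k" using k'(1) unfolding k_def by linarith
    have k: "i \<le> k" "k < j" "act g (u ! k) = u ! k" "act g (u ! Suc k) \<noteq> u ! Suc k"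
      using k' e by (auto simp: k_def)
    then have "u ! k \<in> bd g True u" using fixed_next_to_nonfixed[OF q u g split_pr] j by simp
    moreover have "0 < k" "k < length u - 1" using k(1,2) i'(1) j(1) by linarith+
    ultimately show ?thesis using inner[of k] by blast
  next
    case 2
    from discrete_crossing[of ?F "int j" "int i"] 2 i j x y obtain k' where
      k': "int j \<le> k'" "k' < int i" "\<not> ?F k'" "?F (k' + 1)" by auto
    define k where "k = nat k'"
    have e: "nat (k' + 1) = Suc k" using k'(1) unfolding k_def by linarith
    have k: "j \<le> k" "k < i" "act g (u ! k) \<noteq> u ! k" "act g (u ! Suc k) = u ! Suc k"
      using k' e by (auto simp: k_def)
    have "u = take k u @ pr False (u ! Suc k) (u ! k) @ drop (Suc (Suc k)) u"
      using split_pr[of k u] k i by (simp add: pr_def)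
    from fixed_next_to_nonfixed[OF q u g this k(4,3)] inner[of "Suc k"] k i' show ?thesis by auto
  qed
qed

section \<open>Centralizers\<close>

lemma crossing_state:
  assumes "reach q a" "reach q z" "p \<in> osep q a z"
  shows "\<exists>l r. reach q (l @ snd p @ r)"
proof -
  from osep_fromE[OF assms] obtain z' f t where
    *: "reach (labs a) z'" "(f, t) \<in> Hist z'" "p = oact a (f, t)" by metis
  from hist_crossing[OF *(1,2)] obtain l r where "reach (labs a) (l @ t @ r)" by blast
  from reach_comp[OF assms(1) this] *(3) show ?thesis by auto
qed

text \<open>
  Otherwise the wall \<open>d p\<close> lies on the axis of \<open>g\<close> through \<open>d s\<close> but not on the one through \<open>s\<close>. The
  former crosses it for good, the latter never crosses it in the same direction, so far out on one
  side the wall \<open>d p\<close> separates \<open>g\<^sup>j s\<close> from \<open>g\<^sup>j d s\<close>. Translated back, infinitely many walls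
  separate \<open>s\<close> from \<open>d s\<close>.
\<close>

lemma translate_hits:
  assumes g: "g \<in> carrier (Grp q)" and s: "axis q g s" and p: "p \<in> sepg q g s"
    and d: "d \<in> carrier (Grp q)" "commutes d g"
  shows "\<exists>i. oact (pw q g i) (oact d p) \<in> sepg q g s"
proof (rule ccontr)
  assume none: "\<not> ?thesis"
  have rs: "reach q s" using s by (simp add: axis_def)
  let ?t = "d \<odot> s" and ?o = "oact d p"
  have t: "axis q g ?t" by (rule axis_translate[OF g d s])
  have rt: "reach q ?t" by (rule g_reach[OF d(1) rs])
  have ot: "?o \<in> sepg q g ?t" using p sepg_translate[OF g d rs] by blast
  have oc: "ocell q ?o" using ot osep_ocell unfolding sepg_def by blast
  have rS: "reach q (pw q g j \<odot> s)" and rT: "reach q (pw q g j \<odot> ?t)" for j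
    using g_reach[OF pw_closed[OF g]] rs rt by blast+
  have t0: "pw q g 0 \<odot> ?t = ?t" "pw q g 1 \<odot> ?t = g \<odot> ?t"
    using base_comp[OF reach_wfs[OF rt]] g by (simp_all del: map_map)
  have ob: "\<not> beyond (pw q g 0 \<odot> ?t) ?o" "beyond (pw q g 1 \<odot> ?t) ?o"
    using ot unfolding t0 sepg_def osep_def by auto
  \<comment> \<open>The axis through \<open>d s\<close> crosses \<open>d p\<close> in step 0 and never crosses it back.\<close>
  have no_return: "False" if "beyond (pw q g j \<odot> ?t) ?o" "\<not> beyond (pw q g (j + 1) \<odot> ?t) ?o" "j \<noteq> 0" for j
  proof -
    have "oinv ?o \<in> osep q (pw q g j \<odot> ?t) (pw q g (j + 1) \<odot> ?t)"
      using that beyond_oinv[OF oc] ocell_oinv[OF oc] unfolding osep_def by blast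
    then obtain p' where p': "p' \<in> sepg q g ?t" "oinv ?o = oact (pw q g j) p'"
      unfolding sepg_pw[OF g rt] by blast
    have oc': "ocell q p'" using p' osep_ocell unfolding sepg_def by blast
    show False
    proof (cases "j \<ge> 1")
      case True
      have "oinv (oact (pw q g j) p') = ?o" using p' oinv_oinv[OF oc] by metis
      with t True p'(1) ot show False unfolding axis_def by metis
    next
      case False
      have "oact (pw q g 0) (oinv ?o) = oact (pw q g j) p'" using p'(2) oact_base[OF ocell_oinv[OF oc]] by simp
      from pw_cancel[OF g oc' ocell_oinv[OF oc] this[symmetric]]
      have "p' = oinv (oact (pw q g (- j)) ?o)" using g_oinv[OF pw_closed[OF g] oc] by simp
      with t False that(3) p'(1) ot show False unfolding axis_def by (metis int_one_le_iff_zero_less linorder_less_linear neg_0_less_iff_less)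
    qed
  qed
  have after: "beyond (pw q g N \<odot> ?t) ?o" if "N \<ge> 1" for N
  proof (rule ccontr)
    assume "\<not> ?thesis"
    with discrete_crossing[of "\<lambda>j. \<not> beyond (pw q g j \<odot> ?t) ?o" 1 N] ob that no_return show False by force
  qed
  have before: "\<not> beyond (pw q g (- N) \<odot> ?t) ?o" if "N \<ge> 1" for N
  proof
    assume "beyond (pw q g (- N) \<odot> ?t) ?o"
    with discrete_crossing[of "\<lambda>j. \<not> beyond (pw q g j \<odot> ?t) ?o" "- N" 0] ob that no_return show False by force
  qed
  let ?P = "osep q ?t s \<union> osep q s ?t"
  have pull: "oact (pw q g (- j)) ?o \<in> osep q x y"
    if "?o \<in> osep q (pw q g j \<odot> x) (pw q g j \<odot> y)" "reach q x" "reach q y" for j x y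
  proof -
    have "?o \<in> oact (pw q g j) ` osep q x y" using that(1) unfolding g_osep[OF pw_closed[OF g] that(2,3)] .
    then obtain p' where p': "p' \<in> osep q x y" "?o = oact (pw q g j) p'" by blast
    have oc': "ocell q p'" using p'(1) by (rule osep_ocell)
    have "oact (pw q g j) p' = oact (pw q g 0) ?o" using p'(2) oact_base[OF oc] by simp
    from pw_cancel[OF g oc' oc this] p'(1) show ?thesis by simp
  qed
  \<comment> \<open>The other axis does not cross \<open>d p\<close> between \<open>-N\<close> and \<open>N\<close>, so it lies on the wrong side at one
    of the two ends.\<close>
  have "\<exists>e. abs e = int (Suc N) \<and> oact (pw q g e) ?o \<in> ?P" for N
  proof -
    let ?N = "int (Suc N)"
    have "\<not> (\<not> beyond (pw q g (- ?N) \<odot> s) ?o \<and> beyond (pw q g ?N \<odot> s) ?o)"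
    proof
      assume "\<not> beyond (pw q g (- ?N) \<odot> s) ?o \<and> beyond (pw q g ?N \<odot> s) ?o"
      with discrete_crossing[of "\<lambda>j. beyond (pw q g j \<odot> s) ?o" "- ?N" ?N] obtain j where
        "\<not> beyond (pw q g j \<odot> s) ?o" "beyond (pw q g (j + 1) \<odot> s) ?o" by auto
      then have "?o \<in> osep q (pw q g j \<odot> s) (pw q g j \<odot> (g \<odot> s))"
        using oc pw_state_add[OF g rs, of j 1] g unfolding osep_def by (simp del: map_map)
      from pull[OF this rs g_reach[OF g rs]] none show False unfolding sepg_def by blast
    qed
    then consider "beyond (pw q g (- ?N) \<odot> s) ?o" | "\<not> beyond (pw q g ?N \<odot> s) ?o" by blast
    then show ?thesis
    proof cases
      case 1
      then have "?o \<in> osep q (pw q g (- ?N) \<odot> ?t) (pw q g (- ?N) \<odot> s)"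
        using before[of ?N] oc unfolding osep_def by simp
      from pull[OF this rt rs] show ?thesis
        unfolding minus_minus by (intro exI[of _ ?N]) (simp del: of_nat_Suc)
    next
      case 2
      then have "?o \<in> osep q (pw q g ?N \<odot> s) (pw q g ?N \<odot> ?t)"
        using after[of ?N] oc unfolding osep_def by simp
      from pull[OF this rs rt] show ?thesis by (intro exI[of _ "- ?N"]) (simp del: of_nat_Suc)
    qed
  qed
  then obtain e where e: "\<And>N. abs (e N) = int (Suc N)" "\<And>N. oact (pw q g (e N)) ?o \<in> ?P" by metis
  have "finite ?P" using finite_osep[OF rt rs] finite_osep[OF rs rt] by blast
  then have "finite (range (\<lambda>N. oact (pw q g (e N)) ?o))" by (rule finite_subset[rotated]) (use e(2) in blast)
  then have "\<not> inj (\<lambda>N. oact (pw q g (e N)) ?o)" using finite_imageD infinite_UNIV_nat by blast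
  then obtain N M where NM: "N \<noteq> M" "oact (pw q g (e N)) ?o = oact (pw q g (e M)) ?o" by (auto simp: inj_on_def)
  have "e N \<noteq> e M" using e(1)[of N] e(1)[of M] NM(1) by auto
  moreover have fix1: "False" if "oact (pw q g i) ?o = ?o" "i \<ge> 1" for i
    using t ot that unfolding axis_def by metis
  ultimately show False
    using pw_cancel[OF g oc oc NM(2)] pw_cancel[OF g oc oc NM(2)[symmetric]] fix1[of "e M - e N"] fix1[of "e N - e M"]
    by (metis diff_ge_0_iff_ge diff_gt_0_iff_gt int_one_le_iff_zero_less linorder_less_linear)
qed

text \<open>
  The translates of \<open>p\<close> by the powers of \<open>c\<close> return, up to powers of \<open>g\<close>, to the finitely many walls
  between \<open>s\<close> and \<open>g s\<close>. Two of them agree, so some \<open>h = g\<^sup>m c\<^sup>n\<close> with \<open>n \<ge> 1\<close> fixes the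
  wall \<open>p\<close>. If \<open>h\<close> were nontrivial, it would have a boundary vertex, which \<open>g\<close> fixes by
  \<open>boundary_fixed\<close>; then \<open>g\<close> would fix a letter of \<open>s\<close>.
\<close>

lemma simple_centralizer:
  assumes q: "word q" and g: "g \<in> carrier (Grp q)" and s: "axis q g s" and p: "p \<in> sepg q g s"
    and simple: "\<not> (\<exists>x\<in>set s. proper q x \<and> act g x = x)"
    and c: "c \<in> carrier (Grp q)" "commutes c g"
  shows "\<exists>k j. k \<ge> (1::int) \<and> pw q c k = pw q g j"
proof -
  have rs: "reach q s" using s by (simp add: axis_def)
  have ss: "straight q g s" by (rule axis_straight[OF g s])
  have oc: "ocell q p" using p osep_ocell unfolding sepg_def by blast
  have cc: "pw q c i \<in> carrier (Grp q)" "commutes (pw q c i) g" for i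
    using c commutes_pw[OF c(1) g commutes_sym[OF c(2)]] commutes_sym by auto
  have "\<exists>i. oact (pw q g i) (oact (pw q c (int k)) p) \<in> sepg q g s" for k
    by (rule translate_hits[OF g s p cc])
  then obtain i where i: "\<And>k. oact (pw q g (i k)) (oact (pw q c (int k)) p) \<in> sepg q g s" by metis
  have "finite (sepg q g s)" unfolding sepg_def by (rule finite_osep[OF rs g_reach[OF g rs]])
  then have "finite (range (\<lambda>k. oact (pw q g (i k)) (oact (pw q c (int k)) p)))"
    by (rule finite_subset[rotated]) (use i in blast)
  then have "\<not> inj (\<lambda>k. oact (pw q g (i k)) (oact (pw q c (int k)) p))" using finite_imageD infinite_UNIV_nat by blast
  then obtain k k' where "k \<noteq> k'" "oact (pw q g (i k)) (oact (pw q c (int k)) p) = oact (pw q g (i k')) (oact (pw q c (int k')) p)"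
    by (auto simp: inj_on_def)
  then obtain k k' where k: "k < k'" "oact (pw q g (i k)) (oact (pw q c (int k)) p) = oact (pw q g (i k')) (oact (pw q c (int k')) p)"
    by (metis linorder_less_linear)
  \<comment> \<open>The index \<open>i k\<close> brings \<open>c\<^sup>k p\<close> back; comparing two equal results gives the element \<open>g\<^sup>m c\<^sup>n\<close>.\<close>
  define m n where "m = i k' - i k" and "n = int k' - int k"
  have n: "n \<ge> 1" using k(1) by (simp add: n_def)
  have gm: "pw q g m \<in> carrier (Grp q)" using g by simp
  have "oact (pw q c (int k)) p = oact (pw q g m) (oact (pw q c (int k')) p)"
    unfolding m_def by (rule pw_cancel[OF g g_ocell[OF cc(1) oc] g_ocell[OF cc(1) oc] k(2)])
  also have "oact (pw q c (int k')) p = oact (pw q c (int k)) (oact (pw q c n) p)"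
    using pw_oact_add[OF c(1) oc, of "int k" n] by (simp add: n_def)
  also have "oact (pw q g m) (oact (pw q c (int k)) (oact (pw q c n) p)) =
     oact (pw q c (int k)) (oact (pw q g m) (oact (pw q c n) p))"
    using g_oact[OF gm cc(1), of "oact (pw q c n) p"] g_oact[OF cc(1) gm, of "oact (pw q c n) p"]
      g_ocell[OF cc(1) oc] commutes_pw[OF g cc(1) cc(2)] unfolding commutes_def by metis
  finally have "p = oact (pw q g m) (oact (pw q c n) p)"
    using g_oinject[OF cc(1) oc] g_ocell[OF gm g_ocell[OF cc(1) oc]] by blast
  then have hp: "oact (pw q g m \<odot> pw q c n) p = p" using g_oact[OF gm cc(1) oc] by simp
  let ?h = "pw q g m \<odot> pw q c n"
  interpret G: group "Grp q" by (rule group_Grp)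
  have h: "?h \<in> carrier (Grp q)" using G.m_closed[OF gm cc(1)] by simp
  have gh: "commutes g ?h"
  proof -
    have 1: "g \<odot> pw q g m = pw q g m \<odot> g" using commutes_pw[OF g g, of m] by (simp add: commutes_def)
    have 2: "g \<odot> pw q c n = pw q c n \<odot> g" using cc(2)[of n] by (simp add: commutes_def)
    have "g \<odot> (pw q g m \<odot> pw q c n) = (pw q g m \<odot> g) \<odot> pw q c n"
      using G.m_assoc[OF g gm cc(1)] 1 by (simp del: map_map)
    also have "\<dots> = pw q g m \<odot> (pw q c n \<odot> g)"
      using G.m_assoc[OF gm g cc(1)] 2 by (simp del: map_map)
    also have "\<dots> = (pw q g m \<odot> pw q c n) \<odot> g"
      using G.m_assoc[OF gm cc(1) g] by (simp del: map_map)
    finally show ?thesis unfolding commutes_def .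
  qed
  have "?h = base q"
  proof (rule ccontr)
    assume ne: "?h \<noteq> base q"
    from exists_axis[OF h] obtain u where u: "axis q ?h u" ..
    then have ru: "reach q u" and su: "straight q ?h u" using axis_straight[OF h] by (auto simp: axis_def)
    \<comment> \<open>A fixed wall has fixed operands, the first of which is an edge. Pulling it back
      to an axis state of \<open>g\<^sup>m c\<^sup>n\<close> gives a fixed letter there, and some letter moves because the action
      is free.\<close>
    from crossing_state[OF rs g_reach[OF g rs]] p obtain l r where z: "reach q (l @ snd p @ r)"
      unfolding sepg_def by blast
    have t: "snd p \<noteq> []" "lab (hd (snd p)) \<noteq> star"
      using near_edge[OF oc] by auto
    have "act ?h (hd (snd p)) = hd (snd p)" using wall_fixed_items(1)[OF h oc hp] t(1) by simp
    from fixed_pullback[OF h su z _ proper_edge[OF t(2)] this] t(1) obtain x where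
      x: "x \<in> set u" "proper q x" "act ?h x = x" by auto
    obtain y where y: "y \<in> set u" "act ?h y \<noteq> y"
      using free_action[OF h ru] ne by (metis map_idI)
    from find_boundary[OF q ru h x y] obtain d v where v: "v \<in> bd ?h d u" "proper q v" by blast
    have "act g v = v" by (rule boundary_fixed[OF q h su v(1) g gh])
    moreover have "v \<in> set u" using v(1) by (auto simp: bd_def)
    ultimately show False using fixed_pullback[OF g ss ru _ v(2)] simple by blast
  qed
  then have "pw q g (- m) = pw q g (- m) \<odot> ?h" using pw_closed[OF g] Grp_labs comp_base by metis
  also have "\<dots> = (pw q g (- m) \<odot> pw q g m) \<odot> pw q c n"
    using G.m_assoc[OF pw_closed[OF g] gm cc(1)] by (simp del: map_map)
  also have "\<dots> = pw q c n" using pw_add[OF g, of "- m" m] base_comp[OF reach_wfs[OF Grp_reach[OF cc(1)]]] by simp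
  finally show ?thesis using n by metis
qed

theorem centralizer_dichotomy:
  assumes q: "word q" and g: "g \<in> carrier (Grp q)" and ax: "axis q g (base q)"
  shows "g = base q \<or>
    (\<exists>v\<in>set (base q). lab v = star \<and> proper q v \<and> (\<forall>c\<in>carrier (Grp q). commutes c g \<longrightarrow> act c v = v)) \<or>
    (\<forall>c\<in>carrier (Grp q). commutes c g \<longrightarrow> (\<exists>k j. k \<ge> (1::int) \<and> pw q c k = pw q g j))"
proof (cases "g = base q")
  case ne: False
  have rb: "reach q (base q)" by simp
  note st = axis_straight[OF g ax]
  show ?thesis
  proof (cases "\<exists>x\<in>set (base q). proper q x \<and> act g x = x")
    case True
    then obtain x where x: "x \<in> set (base q)" "proper q x" "act g x = x" by blast
    obtain y where y: "y \<in> set (base q)" "act g y \<noteq> y" using free_action[OF g rb] ne by (metis map_idI)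
    from find_boundary[OF q rb g x y] obtain d v where v: "v \<in> bd g d (base q)" "proper q v" by blast
    have "v \<in> set (base q)" "lab v = star" using v(1) by (auto simp: bd_def)
    with v boundary_fixed[OF q g st v(1)] show ?thesis by blast
  next
    case False
    have "sepg q g (base q) \<noteq> {}"
      using osep_empty[OF rb g_reach[OF g rb]] free_action[OF g rb] ne unfolding sepg_def by blast
    then obtain p where "p \<in> sepg q g (base q)" by blast
    from simple_centralizer[OF q g ax this False] show ?thesis by blast
  qed
qed simp

end

section \<open>Common roots of commuting elements\<close>

lemma map_eq_append3E:
  assumes "map g z = l @ u @ r"
  obtains l' u' r' where "z = l' @ u' @ r'" "map g l' = l" "map g u' = u" "map g r' = r"
proof -
  from assms obtain l' z' where "z = l' @ z'" "map g l' = l" "map g z' = u @ r" by (metis map_eq_append_conv)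
  moreover from this(3) obtain u' r' where "z' = u' @ r'" "map g u' = u" "map g r' = r" by (metis map_eq_append_conv)
  ultimately show ?thesis using that by blast
qed

context group
begin

text \<open>
  Divide both exponents by their greatest common divisor, which is harmless in the absence of torsion;
  Bezout coefficients of the quotients express the common root.
\<close>

lemma common_root_pair:
  assumes tf: "\<And>x k. x \<in> carrier G \<Longrightarrow> k \<ge> (1::int) \<Longrightarrow> x [^] k = \<one> \<Longrightarrow> x = \<one>"
    and b: "b \<in> carrier G" and c: "c \<in> carrier G" and bc: "b \<otimes> c = c \<otimes> b"
    and e: "c [^] k = b [^] (l::int)" and k: "k \<ge> (1::int)"
  shows "\<exists>u v i j. b = (b [^] (u::int) \<otimes> c [^] (v::int)) [^] (i::int) \<and> c = (b [^] u \<otimes> c [^] v) [^] (j::int)"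
proof -
  define d where "d = gcd k l"
  have d: "d \<ge> 1" using k unfolding d_def by (metis gcd_pos_int int_one_le_iff_zero_less not_one_le_zero)
  obtain k' l' where kl: "k = d * k'" "l = d * l'" unfolding d_def by (meson dvdE gcd_dvd1 gcd_dvd2)
  obtain u v where uv: "u * k + v * l = d" using bezout_int unfolding d_def by blast
  then have "d * (u * k' + v * l') = d * 1" using kl by (simp add: algebra_simps)
  then have uv': "u * k' + v * l' = 1" using d by (metis mult_cancel_left not_one_le_zero)
  have comm: "b [^] (i::int) \<otimes> c [^] (j::int) = c [^] j \<otimes> b [^] i" for i j
    using int_pow_commute[of b "c [^] j" i] int_pow_commute[OF c b bc, of j] b c by simp
  have "(c [^] k' \<otimes> b [^] (- l')) [^] d = c [^] (k' * d) \<otimes> b [^] (- l' * d)"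
    using int_pow_mult_distrib[of "c [^] k'" "b [^] (- l')" d] comm[of "- l'" k'] b c by (simp add: int_pow_pow)
  also have "\<dots> = c [^] k \<otimes> b [^] (- l)" using kl by (simp add: mult.commute)
  also have "\<dots> = \<one>" using e b by (simp add: int_pow_neg)
  finally have "c [^] k' \<otimes> b [^] (- l') = \<one>" using tf[OF _ d] b c by blast
  then have ck: "c [^] k' = b [^] l'" using b c by (simp add: int_pow_neg) (metis int_pow_closed inv_equality inv_inv inv_closed)
  let ?e = "b [^] u \<otimes> c [^] v"
  have pe: "?e [^] i = b [^] (u * i) \<otimes> c [^] (v * i)" for i
    using int_pow_mult_distrib[of "b [^] u" "c [^] v" i] comm[of u v] b c by (simp add: int_pow_pow)
  have "?e [^] k' = b [^] (u * k') \<otimes> b [^] (l' * v)"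
    unfolding pe using int_pow_pow[OF c, of k' v] int_pow_pow[OF b, of l' v] ck by (simp add: mult.commute)
  also have "\<dots> = b" using int_pow_mult[OF b, of "u * k'" "l' * v"] uv' b by (simp add: mult.commute)
  finally have 1: "b = ?e [^] k'" by simp
  have "?e [^] l' = c [^] (k' * u) \<otimes> c [^] (v * l')"
    unfolding pe using int_pow_pow[OF c, of k' u] int_pow_pow[OF b, of l' u] ck by (simp add: mult.commute)
  also have "\<dots> = c" using int_pow_mult[OF c, of "k' * u" "v * l'"] uv' c by (simp add: mult.commute)
  finally show ?thesis using 1 by metis
qed

lemma common_root:
  assumes tf: "\<And>x k. x \<in> carrier G \<Longrightarrow> k \<ge> (1::int) \<Longrightarrow> x [^] k = \<one> \<Longrightarrow> x = \<one>"
    and F: "finite F" "F \<subseteq> carrier G" and g: "g \<in> carrier G"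
    and comm: "\<And>x y. x \<in> insert g F \<Longrightarrow> y \<in> insert g F \<Longrightarrow> x \<otimes> y = y \<otimes> x"
    and root: "\<And>c. c \<in> F \<Longrightarrow> \<exists>k j. k \<ge> (1::int) \<and> c [^] k = g [^] (j::int)"
  shows "\<exists>B\<in>carrier G. \<forall>c\<in>F. \<exists>i::int. c = B [^] i"
proof -
  \<comment> \<open>The root found so far also has to commute with the elements still to come and to have \<open>g\<close> as
    a power.\<close>
  have "\<exists>B\<in>carrier G. (\<forall>c\<in>F. B \<otimes> c = c \<otimes> B) \<and> (\<exists>a::int. g = B [^] a) \<and> (\<forall>c\<in>E. \<exists>i::int. c = B [^] i)"
    if "E \<subseteq> F" for E
    using finite_subset[OF that F(1)] that
  proof (induction E rule: finite_induct)
    case empty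
    then show ?case using g comm by (intro bexI[of _ g]) (auto intro!: exI[of _ 1])
  next
    case (insert c E)
    then obtain B a where B: "B \<in> carrier G" "\<forall>c\<in>F. B \<otimes> c = c \<otimes> B" "g = B [^] (a::int)"
      "\<forall>c\<in>E. \<exists>i::int. c = B [^] i" by auto
    have c: "c \<in> F" "c \<in> carrier G" using insert.prems F by auto
    from root[OF c(1)] obtain k j where kj: "k \<ge> (1::int)" "c [^] k = g [^] (j::int)" by blast
    then have "c [^] k = B [^] (a * j)" using B by (simp add: int_pow_pow)
    then have "\<exists>u v i j. B = (B [^] (u::int) \<otimes> c [^] (v::int)) [^] (i::int) \<and> c = (B [^] u \<otimes> c [^] v) [^] (j::int)"
    proof (rule common_root_pair[OF _ B(1) c(2) _ _ kj(1), rotated 2])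
      show "B \<otimes> c = c \<otimes> B" using B(2) c(1) by blast
    qed (rule tf)
    then obtain u v i j' where
      e: "B = (B [^] (u::int) \<otimes> c [^] (v::int)) [^] (i::int)" "c = (B [^] u \<otimes> c [^] v) [^] (j'::int)" by blast
    let ?e = "B [^] u \<otimes> c [^] v"
    have ec: "?e \<in> carrier G" using B c by simp
    have "?e \<otimes> x = x \<otimes> ?e" if "x \<in> F" for x
    proof -
      have x: "x \<in> carrier G" using that F by auto
      have 1: "x \<otimes> B [^] u = B [^] u \<otimes> x" using int_pow_commute[OF B(1) x] B(2) that by metis
      have 2: "x \<otimes> c [^] v = c [^] v \<otimes> x" using int_pow_commute[OF c(2) x] comm c(1) that by blast
      show ?thesis using 1 2 x B(1) c(2) by (metis int_pow_closed m_assoc)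
    qed
    moreover have "g = ?e [^] (i * a)" using B(3) e(1) int_pow_pow[OF ec, of i a] by metis
    moreover have "\<exists>i'. x = ?e [^] (i'::int)" if "x \<in> insert c E" for x
    proof (cases "x = c")
      case True
      then show ?thesis using e(2) by blast
    next
      case False
      with that B(4) obtain i' where "x = B [^] (i'::int)" by blast
      then have "x = ?e [^] (i * i')" using e(1) int_pow_pow[OF ec, of i i'] by metis
      then show ?thesis by blast
    qed
    ultimately show ?case using ec by blast
  qed
  from this[OF subset_refl] show ?thesis by blast
qed

end

section \<open>Sums of states\<close>

context rewriting_system
begin

text \<open>
  Concatenation of words of 1-paths; the vertex at which they meet is kept once.
\<close>

definition join :: "'l list \<Rightarrow> 'l list \<Rightarrow> 'l list" (infixr "\<Join>" 65) where
  "p \<Join> q = butlast p @ q"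

primrec idx :: "('l, 'f) item \<Rightarrow> nat" where
  "idx (Base i l) = i"
| "idx (New f t i) = i"

fun sh :: "nat \<Rightarrow> ('l, 'f) item \<Rightarrow> ('l, 'f) item" where
  "sh n (Base i l) = Base (n + i) l"
| "sh n (New f t i) = New f (map (sh n) t) i"

text \<open>
  Two states side by side. The shift renames the base letters of the second one; its amount is the
  position of the last base letter of the first, which every reachable state over a word retains.
\<close>

definition ssum :: "('l, 'f) item list \<Rightarrow> ('l, 'f) item list \<Rightarrow> ('l, 'f) item list" (infixr "\<oplus>" 65) where
  "a \<oplus> b = butlast a @ map (sh (idx (last a))) b"

lemma lab_sh [simp]: "lab (sh n x) = lab x"
  by (cases x) auto

lemma labs_sh [simp]: "labs (map (sh n) s) = labs s"
  by simp

lemma sh_inj: "sh n x = sh n y \<Longrightarrow> x = y"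
proof (induction x arbitrary: y)
  case (Base i l)
  then show ?case by (cases y) auto
next
  case (New f t i)
  then obtain t' where y: "y = New f t' i" "map (sh n) t = map (sh n) t'" by (cases y) auto
  have "t = t'"
  proof (rule nth_equalityI)
    show "length t = length t'" using y(2) by (metis length_map)
    fix k assume "k < length t"
    with New.IH[of "t ! k" "t' ! k"] y(2) \<open>length t = length t'\<close> show "t ! k = t' ! k" by (metis nth_map nth_mem)
  qed
  with y show ?case by simp
qed

lemma map_sh_inj: "map (sh n) s = map (sh n) t \<longleftrightarrow> s = t"
  using sh_inj by (auto intro: map_injective simp: inj_def)

lemma sh_0 [simp]: "sh 0 x = x"
  by (induction x) (auto intro: map_idI)

lemma sh_sh [simp]: "sh n (sh m x) = sh (n + m) x"
  by (induction x) auto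

lemma sh_block [simp]: "map (sh n) (block f t) = block f (map (sh n) t)"
  by (simp add: block_def)

lemma up_sh: "up (f, map (sh n) t) \<longleftrightarrow> up (f, t)" if "f \<in> C"
proof
  assume "up (f, map (sh n) t)"
  then show "up (f, t)" by auto
next
  assume u: "up (f, t)"
  show "up (f, map (sh n) t)"
  proof (rule ccontr)
    assume "\<not> ?thesis"
    then obtain t' where t': "map (sh n) t = block (rv f) t'" by auto
    define t0 where "t0 = (case hd t of New g t0 i \<Rightarrow> t0 | _ \<Rightarrow> [])"
    have len: "length t = length (rhs (rv f))" using t' by (metis length_block length_map)
    have nth: "sh n (t ! k) = New (rv f) t' k" if "k < length t" for k
      using t' that len by (metis (no_types, lifting) block_def nth_map add_0 length_upt minus_nat.diff_0 nth_upt length_map)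
    have "t \<noteq> []" using len rhs_ne[of "rv f"] that by (auto simp del: rhs_ne rhs_rv)
    then obtain t1 where t1: "t ! 0 = New (rv f) t1 0" "map (sh n) t1 = t'"
      using nth[of 0] by (cases "t ! 0") auto
    have "t ! k = New (rv f) t1 k" if "k < length t" for k
      using nth[OF that] t1(2) map_sh_inj by (cases "t ! k") auto
    then have "t = block (rv f) t1" using len by (auto simp: block_def intro!: nth_equalityI)
    with u show False by (metis up.simps)
  qed
qed

lemma flip_sh: "f \<in> C \<Longrightarrow> flip f (map (sh n) t) = map (sh n) (flip f t)"
proof (cases "up (f, t)")
  case False
  assume f: "f \<in> C"
  from not_upE[OF False f] obtain t' where t': "t = block (rv f) t'" "flip f t = t'" .
  then show ?thesis using f flip_block[of "rv f" "map (sh n) t'"] by simp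
qed (simp add: flip_up up_sh del: up.simps)

lemma wf_join_left: "wf p x \<Longrightarrow> p \<noteq> [] \<Longrightarrow> q \<noteq> [] \<Longrightarrow> last p = hd q \<Longrightarrow> wf (p \<Join> q) x"
proof (induction x)
  case (Base i l)
  then have "p \<Join> q = p @ tl q" unfolding join_def by (metis append_butlast_last_id append.assoc append_Cons append_Nil list.collapse)
  then show ?case using Base by (auto simp: nth_append)
qed auto

lemma wf_join_right: "wf q x \<Longrightarrow> wf (p \<Join> q) (sh (length p - 1) x)"
proof (induction x)
  case (Base i l)
  then show ?case by (auto simp: join_def nth_append)
next
  case (New f t i)
  then have "up (f, t)" "f \<in> C" by auto
  then have "up (f, map (sh (length p - 1)) t)" by (simp add: up_sh del: up.simps)
  with New show ?case by (auto simp: comp_def)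
qed

lemma word_join:
  assumes "word p" "word q"
  shows "word (p \<Join> q)"
proof -
  from assms obtain p' where p: "p = p' @ [star]" unfolding word_def by (metis append_butlast_last_id)
  from assms obtain q' where q: "q = star # q'" unfolding word_def by (metis list.collapse)
  let ?P = "\<lambda>a b. (a = star) \<noteq> (b = star)"
  have "successively ?P p' \<and> (p' = [] \<or> ?P (last p') star)"
    using assms(1) unfolding word_def p successively_append_iff by auto
  moreover have "successively ?P (star # q')" using assms(2) unfolding word_def q by blast
  ultimately have "successively ?P (p' @ (star # q'))" unfolding successively_append_iff by auto
  moreover have "hd (p' @ star # q') = star" using assms(1) unfolding word_def p by (cases p') auto
  moreover have "last (p' @ star # q') = star" using assms(2) unfolding word_def q by auto
  ultimately show ?thesis unfolding p q join_def word_def by simp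
qed

lemma length_join: "word p \<Longrightarrow> length (p \<Join> q) = length p - 1 + length q"
  by (simp add: join_def)

lemma join_assoc: "word q \<Longrightarrow> (p \<Join> q) \<Join> r = p \<Join> (q \<Join> r)"
  by (auto simp: join_def word_def butlast_append)

lemma join_unit [simp]: "[star] \<Join> q = q"
  by (simp add: join_def)

lemma join_unit_right: "word p \<Longrightarrow> p \<Join> [star] = p"
  unfolding join_def word_def by (metis append_butlast_last_id)

lemma word_unit [simp]: "word [star]"
  by (simp add: word_def)

lemma reach_last: "word q \<Longrightarrow> reach q z \<Longrightarrow> z \<noteq> [] \<and> last z = Base (length q - 1) star \<and> idx (last z) = length q - 1"
  using word_ends by auto

lemma ssum_eq: "word q \<Longrightarrow> reach q z \<Longrightarrow> z \<oplus> w = butlast z @ map (sh (length q - 1)) w"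
  using reach_last by (simp add: ssum_def)

lemma labs_ssum: "labs (z \<oplus> w) = labs z \<Join> labs w"
  by (simp add: ssum_def join_def map_butlast)

lemma base_ssum:
  assumes "word p" "word q"
  shows "base p \<oplus> base q = base (p \<Join> q)"
proof -
  have p: "p \<noteq> []" using assms(1) by (simp add: word_def)
  show ?thesis unfolding ssum_eq[OF assms(1) reach_base]
    using p by (auto simp: join_def nth_append nth_butlast intro!: nth_equalityI)
qed

lemma reach_ssum:
  assumes "word p" "word q" "reach p z" "reach q w"
  shows "reach (p \<Join> q) (z \<oplus> w)"
  using assms(4)
proof (induction rule: reach_induct)
  case base
  show ?case using assms(3)
  proof (induction rule: reach_induct)
    case base
    then show ?case using base_ssum[OF assms(1,2)] by simp
  next
    case (step l t r f)
    let ?w = "map (sh (length p - 1)) (base q)"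
    have z: "reach p (l @ block f t @ r)" using reach_block step.hyps by blast
    have r: "r \<noteq> []"
    proof
      assume "r = []"
      then have "last (block f t) = Base (length p - 1) star"
        using reach_last[OF assms(1) z] step.hyps(2) by (simp add: last_append)
      moreover have "last (block f t) \<in> set (block f t)" using step.hyps(2) by simp
      ultimately show False by (auto simp: set_block)
    qed
    have "wfs (p \<Join> q) t" using step.hyps(2) assms(1,2) wf_join_left[of p _ q] by (auto simp: word_def)
    then have o: "ocell (p \<Join> q) (f, t)" using step.hyps(2) by auto
    have "(l @ t @ r) \<oplus> base q = l @ t @ (butlast r @ ?w)"
      using ssum_eq[OF assms(1) step.hyps(1)] r by (simp add: butlast_append)
    moreover have "(l @ block f t @ r) \<oplus> base q = l @ block f t @ (butlast r @ ?w)"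
      using ssum_eq[OF assms(1) z] r by (simp add: butlast_append)
    ultimately show ?case using reach_block[OF _ o step.hyps(3)] step.IH by metis
  qed
next
  case (step l t r f)
  let ?s = "map (sh (length p - 1))"
  have f: "f \<in> C" using step.hyps(2) by simp
  have "wfs (p \<Join> q) (?s t)" using step.hyps(2) wf_join_right by auto
  then have o: "ocell (p \<Join> q) (f, ?s t)" using step.hyps(2) by (simp add: comp_def)
  have u: "up (f, ?s t)" using step.hyps(3) up_sh[OF f] by blast
  have "z \<oplus> (l @ t @ r) = (butlast z @ ?s l) @ ?s t @ ?s r"
    "z \<oplus> (l @ block f t @ r) = (butlast z @ ?s l) @ block f (?s t) @ ?s r"
    using ssum_eq[OF assms(1,3)] by simp_all
  then show ?case using reach_block[OF _ o u] step.IH by metis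
qed

lemma ssum_nth:
  assumes p: "word p" and q: "word q" and z: "reach p z" and w: "reach q w"
  shows "i < length z \<Longrightarrow> (z \<oplus> w) ! i = z ! i"
    and "i < length w \<Longrightarrow> (z \<oplus> w) ! (length z - 1 + i) = sh (length p - 1) (w ! i)"
proof -
  have z0: "z \<noteq> []" "last z = Base (length p - 1) star" using reach_last[OF p z] by auto
  have w0: "w \<noteq> []" "hd w = Base 0 star" using word_ends[OF q w] by auto
  show 2: "(z \<oplus> w) ! (length z - 1 + i) = sh (length p - 1) (w ! i)" if "i < length w" for i
    using that by (simp add: ssum_eq[OF p z] nth_append)
  show "(z \<oplus> w) ! i = z ! i" if "i < length z"
  proof (cases "i = length z - 1")
    case True
    have "(z \<oplus> w) ! i = sh (length p - 1) (w ! 0)" using 2[of 0] w0(1) True by simp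
    also have "\<dots> = z ! i" using z0 w0 True by (simp add: hd_conv_nth last_conv_nth)
    finally show ?thesis .
  next
    case False
    then have "i < length z - 1" using that by simp
    then show ?thesis by (simp add: ssum_eq[OF p z] nth_append nth_butlast)
  qed
qed

lemma ssum_act:
  assumes p: "word p" and q: "word q" and z: "reach p z" and w: "reach q w"
  shows "wf (labs z) x \<Longrightarrow> act (z \<oplus> w) x = act z x"
    and "wf (labs w) x \<Longrightarrow> act (z \<oplus> w) (sh (length z - 1) x) = sh (length p - 1) (act w x)"
proof -
  show "wf (labs z) x \<Longrightarrow> act (z \<oplus> w) x = act z x"
  proof (induction x)
    case (Base i l)
    then show ?case using ssum_nth(1)[OF assms] by simp
  next
    case (New f t i)
    then have e: "(z \<oplus> w) \<odot> t = z \<odot> t" by auto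
    show ?case unfolding act.simps e ..
  qed
  show "wf (labs w) x \<Longrightarrow> act (z \<oplus> w) (sh (length z - 1) x) = sh (length p - 1) (act w x)"
  proof (induction x)
    case (Base i l)
    then show ?case using ssum_nth(2)[OF assms] by simp
  next
    case (New f t i)
    then have o: "ocell (labs w) (f, t)" by auto
    have e: "(z \<oplus> w) \<odot> map (sh (length z - 1)) t = map (sh (length p - 1)) (w \<odot> t)" using New by auto
    have "i < length (flip f (w \<odot> t))"
      using length_flip[OF act_ocell[OF reach_wfs[OF w] o]] New.prems by simp
    moreover have "f \<in> C" using o by simp
    ultimately show ?case unfolding act.simps sh.simps e by (simp add: flip_sh del: map_map)
  qed
qed

lemma ssum_comp:
  assumes p: "word p" and q: "word q" and z: "reach p z" and w: "reach q w"
    and z': "reach (labs z) z'" and w': "reach (labs w) w'"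
  shows "(z \<oplus> w) \<odot> (z' \<oplus> w') = (z \<odot> z') \<oplus> (w \<odot> w')"
proof -
  have wz: "word (labs z)" by (rule reach_word[OF z p])
  have a: "act (z \<oplus> w) x = act z x" if "x \<in> set z'" for x
    using ssum_act(1)[OF p q z w, of x] reach_wfs[OF z'] that by blast
  have b: "act (z \<oplus> w) (sh (length z - 1) x) = sh (length p - 1) (act w x)" if "x \<in> set w'" for x
    using ssum_act(2)[OF p q z w, of x] reach_wfs[OF w'] that by blast
  have "z' \<oplus> w' = butlast z' @ map (sh (length z - 1)) w'" using ssum_eq[OF wz z'] by simp
  moreover have "(z \<odot> z') \<oplus> (w \<odot> w') = butlast (z \<odot> z') @ map (sh (length p - 1)) (w \<odot> w')"
    by (rule ssum_eq[OF p reach_comp[OF z z']])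
  moreover have "(z \<oplus> w) \<odot> butlast z' = butlast (z \<odot> z')"
    using a by (auto simp: map_butlast[symmetric] dest: in_set_butlastD)
  moreover have "(z \<oplus> w) \<odot> map (sh (length z - 1)) w' = map (sh (length p - 1)) (w \<odot> w')"
    using b by auto
  ultimately show ?thesis by (simp del: map_map)
qed

lemma ssum_inject:
  assumes "word p" "word q" "reach p z" "reach p z'" "reach q w" "reach q w'"
    "length z = length z'" "z \<oplus> w = z' \<oplus> w'"
  shows "z = z' \<and> w = w'"
proof -
  have "butlast z @ map (sh (length p - 1)) w = butlast z' @ map (sh (length p - 1)) w'"
    using assms(8) ssum_eq[OF assms(1,3)] ssum_eq[OF assms(1,4)] by simp
  then have "butlast z = butlast z'" "w = w'" using assms(7) by (auto simp: map_sh_inj)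
  then show ?thesis using reach_last[OF assms(1,3)] reach_last[OF assms(1,4)] by (metis append_butlast_last_id)
qed

lemma ssum_assoc:
  assumes "word p" "word q" "reach p a" "reach q b"
  shows "(a \<oplus> b) \<oplus> c = a \<oplus> (b \<oplus> c)"
proof -
  have pq: "word (p \<Join> q)" using word_join assms by blast
  have b: "b \<noteq> []" using reach_last[OF assms(2,4)] by simp
  have q0: "q \<noteq> []" using assms(2) by (simp add: word_def)
  then have l: "length (p \<Join> q) - 1 = (length p - 1) + (length q - 1)"
    by (cases q) (auto simp: join_def)
  have "(a \<oplus> b) \<oplus> c = butlast (butlast a @ map (sh (length p - 1)) b) @ map (sh (length p - 1 + (length q - 1))) c"
    using ssum_eq[OF pq reach_ssum[OF assms], of c] l ssum_eq[OF assms(1,3), of b] by simp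
  also have "\<dots> = butlast a @ map (sh (length p - 1)) (butlast b @ map (sh (length q - 1)) c)"
    using b by (simp add: butlast_append map_butlast)
  also have "\<dots> = a \<oplus> (b \<oplus> c)" unfolding ssum_eq[OF assms(1,3)] ssum_eq[OF assms(2,4)] ..
  finally show ?thesis .
qed

lemma unit_ssum [simp]: "[Base 0 l] \<oplus> b = b"
  by (simp add: ssum_def map_idI)

lemma ssum_unit: "word p \<Longrightarrow> reach p a \<Longrightarrow> a \<oplus> [Base 0 star] = a"
  using ssum_eq[of p a] reach_last[of p a] append_butlast_last_id[of a] by simp

lemma base_unit: "base [star] = [Base 0 star]"
  by (simp add: offset_def)

text \<open>
  A vertex that survives separates the moves to its left from those to its right, as a rule acts on
  contiguous letters.
\<close>

lemma reach_split:
  assumes p: "word p" and q: "word q" and z: "reach (p \<Join> q) z" "Base (length p - 1) star \<in> set z"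
  shows "\<exists>a b. reach p a \<and> reach q b \<and> z = a \<oplus> b"
  using z
proof (induction rule: reach_induct)
  case base
  then show ?case using base_ssum[OF p q] by (metis reach_base)
next
  case (step l t r f)
  let ?v = "Base (length p - 1) star" and ?s = "map (sh (length p - 1))"
  have f: "f \<in> C" and lt: "labs t = lhs f" using step.hyps(2) by auto
  have t: "t \<noteq> []" using near_edge(1)[OF step.hyps(2)] by simp
  have z: "reach (p \<Join> q) (l @ block f t @ r)" using reach_block step.hyps by blast
  have "?v \<notin> set t" using reach_consumed[OF z, of f t ?v] step.prems f by (auto simp: Hist_block)
  \<comment> \<open>The vertex survives, so the rule acts on one side of it.\<close>
  then have disj: "set t \<inter> set [?v] = {}" by simp
  have "?v \<in> set (l @ t @ r)" using step.prems by (auto simp: set_block)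
  from step.IH[OF this] obtain a b where ab: "reach p a" "reach q b" "l @ t @ r = a \<oplus> b" by blast
  have a: "a \<noteq> []" "last a = ?v" using reach_last[OF p ab(1)] by auto
  have b: "b \<noteq> []" "hd b = Base 0 star" using word_ends[OF q ab(2)] by auto
  have sb: "?s b = ?v # ?s (tl b)" using b by (cases b) auto
  have "l @ t @ r = butlast a @ [?v] @ ?s (tl b)" using ab(3) ssum_eq[OF p ab(1)] sb by simp
  from contiguous_disjoint[OF this disj t] consider
    m where "butlast a = l @ t @ m" "r = m @ [?v] @ ?s (tl b)"
    | m where "l = butlast a @ [?v] @ m" "?s (tl b) = m @ t @ r" by auto
  then show ?case
  proof cases
    case 1
    have "a = butlast a @ [?v]" using a by (metis append_butlast_last_id)
    then have ae: "a = l @ t @ (m @ [?v])" unfolding 1(1) by simp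
    then have o: "ocell p (f, t)" using reach_wfs[OF ab(1)] f lt by auto
    have a': "reach p (l @ block f t @ (m @ [?v]))" using reach_block[OF _ o step.hyps(3)] ab(1) ae by simp
    have "(l @ block f t @ (m @ [?v])) \<oplus> b = l @ block f t @ r"
      unfolding ssum_eq[OF p a'] sb 1(2) by (simp add: butlast_append)
    then show ?thesis using a' ab(2) by metis
  next
    case 2
    from map_eq_append3E[OF 2(2)] obtain m' t' r' where
      "tl b = m' @ t' @ r'" "?s m' = m" "?s t' = t" "?s r' = r" .
    moreover have "b = Base 0 star # tl b" using b by (metis list.collapse)
    ultimately have be: "b = (Base 0 star # m') @ t' @ r'" "?s m' = m" "?s t' = t" "?s r' = r"
      by simp_all
    then have o: "ocell q (f, t')" using reach_wfs[OF ab(2)] f lt by (auto simp: comp_def)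
    have u: "up (f, t')" using step.hyps(3) be(3) up_sh[OF f, of "length p - 1" t'] by simp
    have b': "reach q ((Base 0 star # m') @ block f t' @ r')" using reach_block[OF _ o u, of "Base 0 star # m'" r'] ab(2) be(1) by simp
    have "a \<oplus> ((Base 0 star # m') @ block f t' @ r') = l @ block f t @ r"
      unfolding ssum_eq[OF p ab(1)] 2(1) using be by simp
    then show ?thesis using ab(1) b' by metis
  qed
qed

lemma pw_unique:
  assumes "g \<in> carrier (Grp q)" "h 0 = base q" "\<And>i. h i \<in> carrier (Grp q)" "\<And>i. h (i + 1) = h i \<odot> g"
  shows "h i = pw q g (i::int)"
proof (induction i rule: int_induct[where k = 0])
  case (step1 i)
  then show ?case using assms(4)[of i] pw_add[OF assms(1), of i 1] assms(1) by simp
next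
  case (step2 i)
  interpret group "Grp q" by (rule group_Grp)
  have "h (i - 1) \<odot> g = pw q g (i - 1) \<odot> g"
    using assms(4)[of "i - 1"] pw_add[OF assms(1), of "i - 1" 1] assms(1) step2 by simp
  then show ?case using assms(1)
    by (metis Grp_simps(1) assms(3) pw_closed right_cancel)
qed (simp add: assms)

lemma Grp_ssum:
  assumes "word p" "word q" "a \<in> carrier (Grp p)" "b \<in> carrier (Grp q)"
  shows "a \<oplus> b \<in> carrier (Grp (p \<Join> q))"
  using assms reach_ssum labs_ssum by (simp add: Grp_carrier)

lemma Grp_ssum_comp:
  assumes "word p" "word q" "a \<in> carrier (Grp p)" "b \<in> carrier (Grp q)" "reach p a'" "reach q b'"
  shows "(a \<oplus> b) \<odot> (a' \<oplus> b') = (a \<odot> a') \<oplus> (b \<odot> b')"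
  using ssum_comp[OF assms(1,2)] assms(3-) by (simp add: Grp_carrier)

lemma Grp_comp: "a \<in> carrier (Grp q) \<Longrightarrow> b \<in> carrier (Grp q) \<Longrightarrow> a \<odot> b \<in> carrier (Grp q)"
  using monoid.m_closed[OF group.is_monoid[OF group_Grp]] by (metis Grp_simps(1))

lemma pw_ssum:
  assumes "word p" "word q" "a \<in> carrier (Grp p)" "b \<in> carrier (Grp q)"
  shows "pw (p \<Join> q) (a \<oplus> b) i = pw p a i \<oplus> pw q b i"
proof (rule pw_unique[symmetric, OF Grp_ssum[OF assms]])
  show "pw p a 0 \<oplus> pw q b 0 = base (p \<Join> q)" using base_ssum[OF assms(1,2)] by simp
  show "pw p a i \<oplus> pw q b i \<in> carrier (Grp (p \<Join> q))" for i
    using Grp_ssum[OF assms(1,2)] assms(3,4) by simp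
  show "pw p a (i + 1) \<oplus> pw q b (i + 1) = (pw p a i \<oplus> pw q b i) \<odot> (a \<oplus> b)" for i
    using Grp_ssum_comp[OF assms(1,2) pw_closed[OF assms(3)] pw_closed[OF assms(4)], of a b]
      pw_add[OF assms(3), of i 1] pw_add[OF assms(4), of i 1] assms(3,4) Grp_reach by simp
qed

lemma sepg_base: "g \<in> carrier (Grp q) \<Longrightarrow> sepg q g (base q) = Hist g"
  using osep_base[OF Grp_reach] Grp_labs comp_base by (metis sepg_def)

fun osh :: "nat \<Rightarrow> 'f \<times> ('l, 'f) item list \<Rightarrow> 'f \<times> ('l, 'f) item list" where
  "osh n (f, t) = (f, map (sh n) t)"

lemma hist_sh: "hist (sh n x) = osh n ` hist x"
  by (induction x) auto

lemma Hist_sh: "Hist (map (sh n) s) = osh n ` Hist s"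
  by (auto simp: Hist_def hist_sh)

lemma osh_oinv: "ocell q p \<Longrightarrow> oinv (osh n p) = osh n (oinv p)"
  by (cases p) (auto simp: flip_sh)

lemma Hist_ssum:
  assumes "word p" "reach p a"
  shows "Hist (a \<oplus> b) = Hist a \<union> osh (length p - 1) ` Hist b"
proof -
  have "a = butlast a @ [Base (length p - 1) star]" using reach_last[OF assms] by (metis append_butlast_last_id)
  then have "Hist a = Hist (butlast a)" by (metis Hist_append Hist_def Un_empty_right empty_set hist.simps(1) image_empty list.simps(15) SUP_insert Sup_empty)
  then show ?thesis by (simp add: ssum_eq[OF assms] Hist_sh)
qed

text \<open>
  The walls of a sum are those of its summands, and the powers of \<open>a \<oplus> b\<close> act on either
  kind through one summand.
\<close>

lemma axis_ssum:
  assumes p: "word p" and q: "word q" and a: "a \<in> carrier (Grp p)" and b: "b \<in> carrier (Grp q)"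
    and ax: "axis (p \<Join> q) (a \<oplus> b) (base (p \<Join> q))"
  shows "axis p a (base p)" "axis q b (base q)"
proof -
  let ?g = "a \<oplus> b" and ?n = "length p - 1"
  have g: "?g \<in> carrier (Grp (p \<Join> q))" by (rule Grp_ssum[OF p q a b])
  have H: "Hist ?g = Hist a \<union> osh ?n ` Hist b" by (rule Hist_ssum[OF p Grp_reach[OF a]])
  have pw: "pw (p \<Join> q) ?g i = pw p a i \<oplus> pw q b i" for i by (rule pw_ssum[OF p q a b])
  have A: "oact (pw (p \<Join> q) ?g i) o' \<notin> Hist ?g" "oinv (oact (pw (p \<Join> q) ?g i) o') \<notin> Hist ?g"
    if "i \<ge> 1" "o' \<in> Hist ?g" for i o'
    using ax that unfolding axis_def sepg_base[OF g] by auto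
  have ra: "reach p (pw p a i)" "labs (pw p a i) = p" and rb: "reach q (pw q b i)" "labs (pw q b i) = q" for i
    using pw_closed a b Grp_carrier by blast+
  show "axis p a (base p)"
    unfolding axis_def sepg_base[OF a]
  proof (intro conjI allI impI ballI)
    fix i :: int and o' assume i: "1 \<le> i" and o: "o' \<in> Hist a"
    obtain f t where ft: "o' = (f, t)" by (cases o')
    have oc: "ocell p o'" using Hist_up_ocell[OF Grp_reach[OF a] o] by blast
    have "(pw p a i \<oplus> pw q b i) \<odot> t = pw p a i \<odot> t"
      using ssum_act(1)[OF p q ra(1) rb(1)] ra(2) oc ft by auto
    then have "oact (pw (p \<Join> q) ?g i) o' = oact (pw p a i) o'" using ft pw by simp
    with A[OF i, of o'] o show "oact (pw p a i) o' \<notin> Hist a" "oinv (oact (pw p a i) o') \<notin> Hist a"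
      unfolding H by auto
  qed simp
  show "axis q b (base q)"
    unfolding axis_def sepg_base[OF b]
  proof (intro conjI allI impI ballI)
    fix i :: int and o' assume i: "1 \<le> i" and o: "o' \<in> Hist b"
    obtain f t where ft: "o' = (f, t)" by (cases o')
    have oc: "ocell q o'" using Hist_up_ocell[OF Grp_reach[OF b] o] by blast
    have "length (pw p a i) = length p" using ra(2) by (metis length_map)
    then have "(pw p a i \<oplus> pw q b i) \<odot> map (sh ?n) t = map (sh ?n) (pw q b i \<odot> t)"
      using ssum_act(2)[OF p q ra(1)[of i] rb(1)[of i]] rb(2) oc ft by auto
    then have e: "oact (pw (p \<Join> q) ?g i) (osh ?n o') = osh ?n (oact (pw q b i) o')" using ft pw by simp
    have oc': "ocell q (oact (pw q b i) o')" by (rule g_ocell[OF pw_closed[OF b] oc])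
    from A[OF i, of "osh ?n o'"] o show "oact (pw q b i) o' \<notin> Hist b" "oinv (oact (pw q b i) o') \<notin> Hist b"
      unfolding H e osh_oinv[OF oc'] by auto
  qed simp
qed

section \<open>Products of cyclic groups\<close>

fun bword :: "('l list \<times> ('l, 'f) item list) list \<Rightarrow> 'l list" where
  "bword [] = [star]"
| "bword ((p, B) # bs) = p \<Join> bword bs"

text \<open>
  An element of the product of the cyclic groups that the blocks generate side by side. The empty
  product is the trivial state over a single vertex.
\<close>

fun Psi :: "('l list \<times> ('l, 'f) item list) list \<Rightarrow> int list \<Rightarrow> ('l, 'f) item list" where
  "Psi [] ks = [Base 0 star]"
| "Psi ((p, B) # bs) ks = pw p B (hd ks) \<oplus> Psi bs (tl ks)"

definition blocks :: "('l list \<times> ('l, 'f) item list) list \<Rightarrow> bool" where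
  "blocks bs \<longleftrightarrow> (\<forall>(p, B)\<in>set bs. word p \<and> length p > 1 \<and> B \<in> carrier (Grp p))"

lemma blocks_Cons [simp]:
  "blocks ((p, B) # bs) \<longleftrightarrow> word p \<and> length p > 1 \<and> B \<in> carrier (Grp p) \<and> blocks bs"
  by (auto simp: blocks_def)

lemma blocks_Nil [simp]: "blocks []"
  and blocks_append [simp]: "blocks (bs @ cs) \<longleftrightarrow> blocks bs \<and> blocks cs"
  by (auto simp: blocks_def)

lemma word_bword: "blocks bs \<Longrightarrow> word (bword bs)"
  by (induction bs rule: bword.induct) (auto intro: word_join)

lemma Psi_carrier: "blocks bs \<Longrightarrow> Psi bs ks \<in> carrier (Grp (bword bs))"
proof (induction bs ks rule: Psi.induct)
  case (1 ks)
  then show ?case using reach_base[of "[star]"] by (simp add: Grp_carrier base_unit)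
next
  case (2 p B bs ks)
  then show ?case using Grp_ssum[of p "bword bs"] word_bword by simp
qed

lemma Psi_reach: "blocks bs \<Longrightarrow> reach (bword bs) (Psi bs ks)"
  using Psi_carrier Grp_reach by blast

lemma bword_append: "blocks bs \<Longrightarrow> blocks cs \<Longrightarrow> bword (bs @ cs) = bword bs \<Join> bword cs"
  by (induction bs rule: bword.induct) (auto simp: join_assoc word_bword)

lemma Psi_append:
  "blocks bs \<Longrightarrow> blocks cs \<Longrightarrow> length ks = length bs \<Longrightarrow> Psi (bs @ cs) (ks @ ls) = Psi bs ks \<oplus> Psi cs ls"
proof (induction bs ks rule: Psi.induct)
  case (2 p B bs ks)
  then obtain k ks' where ks: "ks = k # ks'" by (cases ks) auto
  with 2 have "Psi (bs @ cs) (ks' @ ls) = Psi bs ks' \<oplus> Psi cs ls" by simp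
  moreover have "(pw p B k \<oplus> Psi bs ks') \<oplus> Psi cs ls = pw p B k \<oplus> (Psi bs ks' \<oplus> Psi cs ls)"
    using 2 by (intro ssum_assoc[of p "bword bs"]) (auto simp: word_bword Psi_reach intro: Grp_reach)
  ultimately show ?case using ks by simp
qed simp

lemma Psi_add:
  "blocks bs \<Longrightarrow> length ks = length bs \<Longrightarrow> length ls = length bs \<Longrightarrow>
    Psi bs (map (\<lambda>(k, l). k + l) (zip ks ls)) = Psi bs ks \<odot> Psi bs ls"
proof (induction bs ks arbitrary: ls rule: Psi.induct)
  case (1 ks)
  then show ?case by simp
next
  case (2 p B bs ks)
  then obtain k ks' l ls' where e: "ks = k # ks'" "ls = l # ls'" by (cases ks; cases ls) auto
  have *: "word p" "B \<in> carrier (Grp p)" "blocks bs" using "2.prems"(1) by auto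
  have "(pw p B k \<oplus> Psi bs ks') \<odot> (pw p B l \<oplus> Psi bs ls') = (pw p B k \<odot> pw p B l) \<oplus> (Psi bs ks' \<odot> Psi bs ls')"
    by (rule Grp_ssum_comp[OF *(1) word_bword[OF *(3)] pw_closed[OF *(2)] Psi_carrier[OF *(3)]
          Grp_reach[OF pw_closed[OF *(2)]] Psi_reach[OF *(3)]])
  then show ?case using 2 e pw_add[OF *(2), of k l] by simp
qed

lemma Psi_zero: "blocks bs \<Longrightarrow> Psi bs (replicate (length bs) 0) = base (bword bs)"
  by (induction bs rule: bword.induct) (auto simp: base_unit base_ssum word_bword)

lemma pw_inj:
  assumes B: "B \<in> carrier (Grp p)" "B \<noteq> base p" and e: "pw p B k = pw p B l"
  shows "k = l"
proof (rule ccontr)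
  assume ne: "k \<noteq> l"
  have "pw p B (k - l) = base p" if "pw p B k = pw p B l" for k l
  proof -
    have "pw p B (k - l) = pw p B k \<odot> pw p B (- l)" using pw_add[OF B(1), of k "- l"] by simp
    also have "\<dots> = base p" using that pw_add[OF B(1), of l "- l"] by simp
    finally show ?thesis .
  qed
  from this[OF e] this[OF e[symmetric]] show False
    using torsion_free[OF B(1), of "k - l"] torsion_free[OF B(1), of "l - k"] B(2) ne by linarith
qed

lemma Psi_inj:
  "blocks bs \<Longrightarrow> \<forall>(p, B)\<in>set bs. B \<noteq> base p \<Longrightarrow> length ks = length bs \<Longrightarrow> length ls = length bs \<Longrightarrow>
    Psi bs ks = Psi bs ls \<Longrightarrow> ks = ls"
proof (induction bs ks arbitrary: ls rule: Psi.induct)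
  case (2 p B bs ks)
  then obtain k ks' l ls' where e: "ks = k # ks'" "ls = l # ls'" by (cases ks; cases ls) auto
  have *: "word p" "B \<in> carrier (Grp p)" "blocks bs" "B \<noteq> base p" using "2.prems"(1,2) by auto
  have r: "reach p (pw p B i)" "labs (pw p B i) = p" for i using pw_closed[OF *(2)] Grp_carrier by blast+
  have "length (pw p B k) = length (pw p B l)" using r(2) by (metis length_map)
  then have "pw p B k = pw p B l \<and> Psi bs ks' = Psi bs ls'"
    using "2.prems"(5) e * r(1) by (intro ssum_inject[of p "bword bs"]) (auto simp: word_bword Psi_reach)
  with 2 e * pw_inj show ?case by auto
qed simp

section \<open>Resolution of commuting states\<close>

definition resolvable :: "'l list \<Rightarrow> ('l, 'f) item list set \<Rightarrow> bool" where
  "resolvable q cs \<longleftrightarrow> (\<exists>s bs. reach q s \<and> blocks bs \<and> labs s = bword bs \<and>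
     (\<forall>c\<in>cs. \<exists>ks. length ks = length bs \<and> c \<odot> s = s \<odot> Psi bs ks))"

lemma resolvable_cyclic:
  assumes q: "word q" "length q > 1" and B: "B \<in> carrier (Grp q)" and cs: "\<forall>c\<in>cs. \<exists>k. c = pw q B k"
  shows "resolvable q cs"
  unfolding resolvable_def
proof (rule exI[of _ "base q"], rule exI[of _ "[(q, B)]"], intro conjI ballI)
  show "reach q (base q)" "blocks [(q, B)]" using q B by auto
  show "labs (base q) = bword [(q, B)]" using join_unit_right[OF q(1)] by simp
  fix c assume "c \<in> cs"
  then obtain k where k: "c = pw q B k" using cs by blast
  have c: "reach q c" "labs c = q" using k pw_closed[OF B] Grp_carrier by blast+
  have "Psi [(q, B)] [k] = c" using k ssum_unit[OF q(1) c(1)] by simp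
  moreover have "c \<odot> base q = base q \<odot> c" using base_comp[OF reach_wfs[OF c(1)]] comp_base[of c] c(2) by simp
  ultimately show "\<exists>ks. length ks = length [(q, B)] \<and> c \<odot> base q = base q \<odot> Psi [(q, B)] ks"
    by (intro exI[of _ "[k]"]) simp
qed

lemma trivial_word:
  assumes "word q" "length q \<le> 1" "g \<in> carrier (Grp q)"
  shows "q = [star]" "g = base q"
proof -
  show q: "q = [star]" using assms(1,2) by (cases q) (auto simp: word_def)
  have g: "reach q g" "length g = 1" using assms(3) q by (auto simp: Grp_carrier dest: arg_cong[of _ _ length])
  then obtain x where "g = [x]" by (cases g) auto
  with word_ends[OF assms(1) g(1)] show "g = base q" by (simp add: q offset_def)
qed

lemma resolvable_trivial:
  assumes "word q" "cs \<subseteq> {base q}"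
  shows "resolvable q cs"
proof (cases "length q > 1")
  case True
  have "base q \<in> carrier (Grp q)" by (simp add: Grp_carrier)
  with resolvable_cyclic[OF assms(1) True] assms(2) show ?thesis by (metis pw_0 singletonD subsetD)
next
  case False
  have "base q \<in> carrier (Grp q)" by (simp add: Grp_carrier)
  then have q: "q = [star]" using trivial_word(1)[OF assms(1)] False by simp
  show ?thesis
    unfolding resolvable_def
    using assms(2) reach_base[of "[star]"] unfolding q
    by (intro exI[of _ "base [star]"] exI[of _ "[]"]) (auto simp: base_unit)
qed

lemma resolvable_insert_one:
  assumes "word q" "resolvable q (cs - {base q})"
  shows "resolvable q cs"
proof -
  from assms(2) obtain s bs where *: "reach q s" "blocks bs" "labs s = bword bs"
    "\<forall>c\<in>cs - {base q}. \<exists>ks. length ks = length bs \<and> c \<odot> s = s \<odot> Psi bs ks" unfolding resolvable_def by blast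
  have "base q \<odot> s = s \<odot> Psi bs (replicate (length bs) 0)"
    using Psi_zero[OF *(2)] base_comp[OF reach_wfs[OF *(1)]] comp_base[of s] *(3) by simp
  then have "\<exists>ks. length ks = length bs \<and> c \<odot> s = s \<odot> Psi bs ks" if "c \<in> cs" for c
    using *(4) that by (cases "c = base q") (auto simp del: map_eq_conv intro!: exI[of _ "replicate (length bs) 0"])
  with * show ?thesis unfolding resolvable_def by blast
qed

lemma resolvable_conj:
  assumes s: "reach q s" and res: "resolvable (labs s) cs'" and cs: "cs \<subseteq> carrier (Grp q)"
    and cs': "cs' \<subseteq> carrier (Grp (labs s))"
    and conj: "\<forall>c\<in>cs. \<exists>c'\<in>cs'. c \<odot> s = s \<odot> c'"
  shows "resolvable q cs"
proof -
  from res obtain s' bs where *: "reach (labs s) s'" "blocks bs" "labs s' = bword bs"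
    "\<forall>c\<in>cs'. \<exists>ks. length ks = length bs \<and> c \<odot> s' = s' \<odot> Psi bs ks" unfolding resolvable_def by blast
  have "\<exists>ks. length ks = length bs \<and> c \<odot> (s \<odot> s') = (s \<odot> s') \<odot> Psi bs ks" if c: "c \<in> cs" for c
  proof -
    from conj c obtain c' where c': "c' \<in> cs'" "c \<odot> s = s \<odot> c'" by blast
    with *(4) obtain ks where ks: "length ks = length bs" "c' \<odot> s' = s' \<odot> Psi bs ks" by blast
    have c'G: "reach (labs s) c'" "labs c' = labs s" using c'(1) cs' Grp_carrier by auto
    have cG: "reach q c" "labs c = q" using c cs Grp_carrier by auto
    have "c \<odot> (s \<odot> s') = (c \<odot> s) \<odot> s'" using reach_assoc[of q c s s'] cG s reach_wfs[OF *(1)] by metis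
    also have "\<dots> = s \<odot> (c' \<odot> s')" using reach_assoc[of q s c' s'] c'G s reach_wfs[OF *(1)] c'(2) by metis
    also have "\<dots> = (s \<odot> s') \<odot> Psi bs ks"
      using reach_assoc[of q s s' "Psi bs ks"] s *(1,3) ks(2) reach_wfs[OF Psi_reach[OF *(2)]] by metis
    finally show ?thesis using ks(1) by blast
  qed
  moreover have "reach q (s \<odot> s')" "labs (s \<odot> s') = bword bs"
    using reach_comp[OF s *(1)] labs_comp[OF s *(1)] *(3) by auto
  ultimately show ?thesis unfolding resolvable_def using *(2) by blast
qed

lemma resolvable_sum:
  assumes p: "word p" "word q" and res: "resolvable p (f1 ` cs)" "resolvable q (f2 ` cs)"
    and f: "\<And>c. c \<in> cs \<Longrightarrow> f1 c \<in> carrier (Grp p) \<and> f2 c \<in> carrier (Grp q) \<and> c = f1 c \<oplus> f2 c"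
  shows "resolvable (p \<Join> q) cs"
proof -
  from res(1) obtain s1 bs1 where 1: "reach p s1" "blocks bs1" "labs s1 = bword bs1"
    "\<forall>c\<in>f1 ` cs. \<exists>ks. length ks = length bs1 \<and> c \<odot> s1 = s1 \<odot> Psi bs1 ks" unfolding resolvable_def by blast
  from res(2) obtain s2 bs2 where 2: "reach q s2" "blocks bs2" "labs s2 = bword bs2"
    "\<forall>c\<in>f2 ` cs. \<exists>ks. length ks = length bs2 \<and> c \<odot> s2 = s2 \<odot> Psi bs2 ks" unfolding resolvable_def by blast
  have "\<exists>ks. length ks = length (bs1 @ bs2) \<and> c \<odot> (s1 \<oplus> s2) = (s1 \<oplus> s2) \<odot> Psi (bs1 @ bs2) ks" if c: "c \<in> cs" for c
  proof -
    from 1(4) c obtain k1 where k1: "length k1 = length bs1" "f1 c \<odot> s1 = s1 \<odot> Psi bs1 k1" by blast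
    from 2(4) c obtain k2 where k2: "length k2 = length bs2" "f2 c \<odot> s2 = s2 \<odot> Psi bs2 k2" by blast
    have "(f1 c \<oplus> f2 c) \<odot> (s1 \<oplus> s2) = (f1 c \<odot> s1) \<oplus> (f2 c \<odot> s2)"
      using f[OF c] 1(1) 2(1) by (intro Grp_ssum_comp[OF p]) auto
    also have "\<dots> = (s1 \<oplus> s2) \<odot> (Psi bs1 k1 \<oplus> Psi bs2 k2)"
      using ssum_comp[OF p 1(1) 2(1)] Psi_reach[OF 1(2)] Psi_reach[OF 2(2)] 1(3) 2(3) k1(2) k2(2) by metis
    also have "\<dots> = (s1 \<oplus> s2) \<odot> Psi (bs1 @ bs2) (k1 @ k2)"
      using Psi_append[OF 1(2) 2(2) k1(1)] by simp
    finally show ?thesis using f[OF c] k1(1) k2(1) by (metis length_append)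
  qed
  moreover have "labs (s1 \<oplus> s2) = bword (bs1 @ bs2)"
    using labs_ssum bword_append[OF 1(2) 2(2)] 1(3) 2(3) by simp
  ultimately show ?thesis
    unfolding resolvable_def using reach_ssum[OF p 1(1) 2(1)] 1(2) 2(2) blocks_append by blast
qed

lemma word_split:
  assumes "word q" "0 < i" "i < length q - 1" "q ! i = star"
  shows "word (take (Suc i) q)" "word (drop i q)" "take (Suc i) q \<Join> drop i q = q"
proof -
  let ?P = "\<lambda>a b. (a = star) \<noteq> (b = star)"
  have s: "successively ?P (take k q) \<and> successively ?P (drop k q)" for k
    using assms(1) append_take_drop_id[of k q] unfolding word_def by (metis successively_append_iff)
  have t: "take (Suc i) q = take i q @ [star]" using assms by (simp add: take_Suc_conv_app_nth)
  have d: "drop i q = star # drop (Suc i) q" using assms by (simp add: Cons_nth_drop_Suc[symmetric])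
  have "hd (take (Suc i) q) = star" using assms by (simp add: word_def hd_take)
  then show "word (take (Suc i) q)" using s[of "Suc i"] unfolding t word_def by auto
  show "word (drop i q)" using s[of i] assms unfolding word_def by (simp add: d[symmetric] last_drop hd_drop_conv_nth)
  show "take (Suc i) q \<Join> drop i q = q" unfolding join_def t by simp
qed

text \<open>
  The surviving vertex splits \<open>c\<close>; that it stands at position \<open>i\<close> again forces both summands to return
  to their own words.
\<close>

lemma split_at_fixed:
  assumes q: "word q" "0 < i" "i < length q - 1" "q ! i = star"
    and c: "c \<in> carrier (Grp q)" "c ! i = Base i star"
  shows "\<exists>a\<in>carrier (Grp (take (Suc i) q)). \<exists>b\<in>carrier (Grp (drop i q)). c = a \<oplus> b"
proof -
  note w = word_split[OF q]
  have rc: "reach q c" and lc: "labs c = q" using c(1) Grp_carrier by auto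
  have len: "length c = length q" using lc by (metis length_map)
  then have "Base i star \<in> set c" using c(2) q(3) by (metis nth_mem less_imp_diff_less less_trans diff_less length_pos_if_in_set Suc_lessD not_less_eq less_antisym diff_le_self order_less_le_trans)
  then have "Base (length (take (Suc i) q) - 1) star \<in> set c" using q(3) by simp
  with reach_split[OF w(1,2)] w(3) rc obtain a b where
    ab: "reach (take (Suc i) q) a" "reach (drop i q) b" "c = a \<oplus> b" by metis
  have a0: "a \<noteq> []" using reach_last[OF w(1) ab(1)] by simp
  have b0: "b \<noteq> []" "hd b = Base 0 star" using word_ends[OF w(2) ab(2)] by auto
  have "c ! (length a - 1 + 0) = sh (length (take (Suc i) q) - 1) (b ! 0)"
    using ssum_nth(2)[OF w(1,2) ab(1,2), of 0] b0(1) ab(3) by simp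
  then have "c ! (length a - 1) = Base i star" using b0 q(3) by (simp add: hd_conv_nth)
  moreover have "length a - 1 < length c" using a0 b0 unfolding ab(3) ssum_def by simp
  ultimately have ai: "length a - 1 = i"
    using c(2) nth_eq_iff_index_eq[OF reach_distinct[OF rc], of "length a - 1" i] q(3) len by simp
  have "butlast (labs a) @ labs b = q" using lc labs_ssum[of a b] ab(3) by (simp add: join_def)
  moreover have "length (butlast (labs a)) = i" using ai by simp
  ultimately have "butlast (labs a) = take i q" "labs b = drop i q" by (metis append_eq_conv_conj)+
  moreover have "last (labs a) = star" using reach_last[OF w(1) ab(1)] by (simp add: last_map)
  ultimately have "labs a = take (Suc i) q" "labs b = drop i q"
    using a0 q by (metis append_butlast_last_id list.map_disc_iff take_Suc_conv_app_nth less_imp_diff_less less_trans diff_less zero_less_one order_less_le_trans diff_le_self, simp)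
  then have "a \<in> carrier (Grp (take (Suc i) q))" "b \<in> carrier (Grp (drop i q))"
    using ab(1,2) by (simp_all add: Grp_carrier)
  then show ?thesis using ab(3) by blast
qed

text \<open>
  The induction on the word alternates with the induction on the number of elements. If \<open>g\<close>
  is trivial, it is dropped. If there is a common fixed vertex, all elements split there into families
  over shorter words, which are no larger and for which the summands of \<open>g\<close> are again on their
  axes. In the remaining case the elements generate a cyclic group.
\<close>

lemma resolvable_axis:
  assumes outer: "\<And>q cs. word q \<Longrightarrow> finite cs \<Longrightarrow> cs \<subseteq> carrier (Grp q) \<Longrightarrow> card cs < n \<Longrightarrow>
      (\<And>a b. a \<in> cs \<Longrightarrow> b \<in> cs \<Longrightarrow> commutes a b) \<Longrightarrow> resolvable q cs"
    and "word q" "finite cs" "cs \<subseteq> carrier (Grp q)" "card cs \<le> n" "g \<in> cs" "axis q g (base q)"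
    and "\<And>a b. a \<in> cs \<Longrightarrow> b \<in> cs \<Longrightarrow> commutes a b"
  shows "resolvable q cs"
  using assms(2-)
proof (induction "length q" arbitrary: q cs g rule: less_induct)
  case less
  note q = less.prems(1) and fin = less.prems(2) and cs = less.prems(3) and comm = less.prems(7)
  have g: "g \<in> carrier (Grp q)" using less.prems by blast
  from centralizer_dichotomy[OF q g less.prems(6)] consider
    "g = base q"
    | v where "g \<noteq> base q" "v \<in> set (base q)" "lab v = star" "proper q v" "\<forall>c\<in>carrier (Grp q). commutes c g \<longrightarrow> act c v = v"
    | "g \<noteq> base q" "\<forall>c\<in>carrier (Grp q). commutes c g \<longrightarrow> (\<exists>k j. k \<ge> (1::int) \<and> pw q c k = pw q g j)"
    by blast
  then show ?case
  proof cases
    case 1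
    have "card (cs - {base q}) < n"
      using less.prems(4,5) fin 1 by (metis card_Diff1_less order_less_le_trans)
    then have "resolvable q (cs - {base q})" using comm cs fin by (intro outer[OF q]) auto
    then show ?thesis by (rule resolvable_insert_one[OF q])
  next
    case 3
    interpret G: group "Grp q" by (rule group_Grp)
    have "\<exists>B\<in>carrier (Grp q). \<forall>c\<in>cs. \<exists>i::int. c = B [^]\<^bsub>Grp q\<^esub> i"
    proof (rule G.common_root[OF _ fin cs g])
      fix x and k :: int assume "x \<in> carrier (Grp q)" "1 \<le> k" "x [^]\<^bsub>Grp q\<^esub> k = \<one>\<^bsub>Grp q\<^esub>"
      then show "x = \<one>\<^bsub>Grp q\<^esub>" using torsion_free[of x q k] by (simp add: pw_def)
    next
      fix x y assume "x \<in> insert g cs" "y \<in> insert g cs"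
      then have "commutes x y" using comm less.prems(5) by blast
      then show "x \<otimes>\<^bsub>Grp q\<^esub> y = y \<otimes>\<^bsub>Grp q\<^esub> x" by (simp add: commutes_def)
    next
      fix c assume "c \<in> cs"
      with 3(2) cs comm less.prems(5) show "\<exists>k j. k \<ge> (1::int) \<and> c [^]\<^bsub>Grp q\<^esub> k = g [^]\<^bsub>Grp q\<^esub> (j::int)"
        unfolding pw_def by blast
    qed
    then obtain B where B: "B \<in> carrier (Grp q)" "\<forall>c\<in>cs. \<exists>i. c = pw q B i" unfolding pw_def by blast
    have "length q > 1" using trivial_word(2)[OF q _ g] 3(1) by (metis linorder_not_less)
    from resolvable_cyclic[OF q this B] show ?thesis .
  next
    case 2
    from 2(2,3) obtain i where i: "i < length q" "v = Base i (q ! i)" "q ! i = star" by (auto simp: base_item)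
    have i': "0 < i" "i < length q - 1" using 2(4) i by (auto simp: proper_def intro: Suc_lessI gr0I)
    let ?p = "take (Suc i) q" and ?r = "drop i q"
    note w = word_split[OF q i' i(3)]
    have "\<exists>a\<in>carrier (Grp ?p). \<exists>b\<in>carrier (Grp ?r). c = a \<oplus> b" if "c \<in> cs" for c
    proof -
      have c: "c \<in> carrier (Grp q)" "commutes c g" using that cs comm less.prems(5) by auto
      with 2(5) have "act c v = v" by blast
      then have "c ! i = Base i star" using i by simp
      from split_at_fixed[OF q i' i(3) c(1) this] show ?thesis .
    qed
    then obtain f1 f2 where f: "\<And>c. c \<in> cs \<Longrightarrow> f1 c \<in> carrier (Grp ?p) \<and> f2 c \<in> carrier (Grp ?r) \<and> c = f1 c \<oplus> f2 c"
      by metis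
    \<comment> \<open>The common vertex was found for \<open>g\<close>, but all of \<open>cs\<close> commutes with \<open>g\<close> and fixes it.\<close>
    have ax: "axis ?p (f1 g) (base ?p)" "axis ?r (f2 g) (base ?r)"
      using axis_ssum[OF w(1,2), of "f1 g" "f2 g"] f[OF less.prems(5)] less.prems(6) w(3) by auto
    have cm: "commutes (f1 a) (f1 b) \<and> commutes (f2 a) (f2 b)" if "a \<in> cs" "b \<in> cs" for a b
    proof -
      have fa: "f1 a \<in> carrier (Grp ?p)" "f2 a \<in> carrier (Grp ?r)" "a = f1 a \<oplus> f2 a"
        and fb: "f1 b \<in> carrier (Grp ?p)" "f2 b \<in> carrier (Grp ?r)" "b = f1 b \<oplus> f2 b" using f that by auto
      have "a \<odot> b = (f1 a \<odot> f1 b) \<oplus> (f2 a \<odot> f2 b)" "b \<odot> a = (f1 b \<odot> f1 a) \<oplus> (f2 b \<odot> f2 a)"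
        using Grp_ssum_comp[OF w(1,2) fa(1,2) Grp_reach[OF fb(1)] Grp_reach[OF fb(2)]]
          Grp_ssum_comp[OF w(1,2) fb(1,2) Grp_reach[OF fa(1)] Grp_reach[OF fa(2)]] fa(3) fb(3) by simp_all
      moreover have "a \<odot> b = b \<odot> a" using comm[OF that] by (simp add: commutes_def)
      ultimately have e: "(f1 a \<odot> f1 b) \<oplus> (f2 a \<odot> f2 b) = (f1 b \<odot> f1 a) \<oplus> (f2 b \<odot> f2 a)" by simp
      have m: "f1 a \<odot> f1 b \<in> carrier (Grp ?p)" "f1 b \<odot> f1 a \<in> carrier (Grp ?p)"
        "f2 a \<odot> f2 b \<in> carrier (Grp ?r)" "f2 b \<odot> f2 a \<in> carrier (Grp ?r)"
        by (intro Grp_comp fa fb)+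
      have "length (f1 a \<odot> f1 b) = length (f1 b \<odot> f1 a)" using m(1,2) Grp_labs by (metis length_map)
      from ssum_inject[OF w(1,2) Grp_reach[OF m(1)] Grp_reach[OF m(2)] Grp_reach[OF m(3)] Grp_reach[OF m(4)] this e]
      show ?thesis by (simp add: commutes_def)
    qed
    have c1: "card (f1 ` cs) \<le> n" "card (f2 ` cs) \<le> n" using card_image_le[OF fin] less.prems(4) le_trans by blast+
    have "resolvable ?p (f1 ` cs)"
      using i' f fin c1 cm ax less.prems(5) by (intro less.hyps[OF _ w(1), of _ "f1 g"]) auto
    moreover have "resolvable ?r (f2 ` cs)"
      using i' f fin c1 cm ax less.prems(5) by (intro less.hyps[OF _ w(2), of _ "f2 g"]) auto
    ultimately show ?thesis using resolvable_sum[OF w(1,2) _ _ f] w(3) by metis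
  qed
qed

text \<open>
  The exponent is an integer, so the conjugates are identified by their recursion.
\<close>

lemma pw_conj:
  assumes s: "reach q s" and c: "c \<in> carrier (Grp q)" and c': "c' \<in> carrier (Grp (labs s))"
    and e: "c \<odot> s = s \<odot> c'"
  shows "pw q c i \<odot> s = s \<odot> pw (labs s) c' i"
proof -
  have "\<exists>z. z \<in> carrier (Grp (labs s)) \<and> pw q c i \<odot> s = s \<odot> z" for i
  proof -
    have ci: "pw q c i \<in> carrier (Grp q)" using c by simp
    from reach_divide[OF s g_reach[OF ci s]] obtain z where
      "reach (labs s) z" "pw q c i \<odot> s = s \<odot> z" "labs z = labs (pw q c i \<odot> s)" .
    then show ?thesis using g_labs[OF ci s] by (auto simp: Grp_carrier simp del: map_map)
  qed
  then obtain z where z: "\<And>i. z i \<in> carrier (Grp (labs s))" "\<And>i. pw q c i \<odot> s = s \<odot> z i" by metis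
  have "z i = pw (labs s) c' i" for i
  proof (rule pw_unique[OF c'])
    have "s \<odot> z 0 = s \<odot> base (labs s)" using z(2)[of 0] base_comp[OF reach_wfs[OF s]] by simp
    then show "z 0 = base (labs s)" using comp_inject[OF s] reach_wfs[OF Grp_reach[OF z(1)]] wfs_base by metis
    fix i
    show "z i \<in> carrier (Grp (labs s))" by (rule z(1))
    have "s \<odot> z (i + 1) = pw q c i \<odot> (c \<odot> s)"
      using z(2)[of "i + 1"] pw_state_add[OF c s, of i 1] c by (simp del: map_map)
    also have "\<dots> = (pw q c i \<odot> s) \<odot> c'"
      using e reach_assoc[of q "pw q c i" s c'] pw_closed[OF c] s reach_wfs[OF Grp_reach[OF c']] Grp_carrier by metis
    also have "\<dots> = s \<odot> (z i \<odot> c')"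
      using z reach_assoc[OF s, of "z i" c'] reach_wfs[OF Grp_reach[OF c']] Grp_carrier by metis
    finally show "z (i + 1) = z i \<odot> c'"
      using comp_inject[OF s] reach_wfs[OF Grp_reach[OF z(1)]] reach_wfs[OF Grp_reach[OF Grp_comp[OF z(1) c']]] by metis
  qed
  with z(2) show ?thesis by simp
qed

text \<open>
  Conjugating by a state on the axis of one element \<open>g\<close> puts the initial state on the axis of \<open>g\<close>,
  as \<open>resolvable_axis\<close> requires.
\<close>

theorem commuting_resolvable:
  assumes "word q" "finite cs" "cs \<subseteq> carrier (Grp q)" "\<And>a b. a \<in> cs \<Longrightarrow> b \<in> cs \<Longrightarrow> commutes a b"
  shows "resolvable q cs"
  using assms
proof (induction "card cs" arbitrary: q cs rule: less_induct)
  case less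
  show ?case
  proof (cases "cs = {}")
    case True
    with resolvable_trivial[OF less.prems(1)] show ?thesis by simp
  next
    case False
    then obtain g where g: "g \<in> cs" by blast
    then have gG: "g \<in> carrier (Grp q)" using less.prems(3) by blast
    from exists_axis[OF gG] obtain s where s: "axis q g s" ..
    then have rs: "reach q s" by (simp add: axis_def)
    let ?q = "labs s"
    have "\<exists>c'. c' \<in> carrier (Grp ?q) \<and> c \<odot> s = s \<odot> c'" if "c \<in> cs" for c
    proof -
      have c: "c \<in> carrier (Grp q)" using that less.prems(3) by blast
      from reach_divide[OF rs g_reach[OF c rs]] obtain c' where
        "reach ?q c'" "c \<odot> s = s \<odot> c'" "labs c' = labs (c \<odot> s)" .
      then show ?thesis using g_labs[OF c rs] by (auto simp: Grp_carrier simp del: map_map)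
    qed
    then obtain h where h: "\<And>c. c \<in> cs \<Longrightarrow> h c \<in> carrier (Grp ?q) \<and> c \<odot> s = s \<odot> h c" by metis
    have hr: "reach ?q (h c)" "labs (h c) = ?q" if "c \<in> cs" for c using h[OF that] Grp_carrier by auto
    have prod: "(c \<odot> d) \<odot> s = s \<odot> (h c \<odot> h d)" if "c \<in> cs" "d \<in> cs" for c d
    proof -
      have cd: "c \<in> carrier (Grp q)" "d \<in> carrier (Grp q)" using that less.prems(3) by auto
      have "(c \<odot> d) \<odot> s = c \<odot> (s \<odot> h d)" using g_assoc[OF cd rs] h[OF that(2)] by metis
      also have "\<dots> = (c \<odot> s) \<odot> h d"
        using reach_assoc[of q c s "h d"] cd(1) rs reach_wfs[OF hr(1)[OF that(2)]] Grp_carrier by metis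
      also have "\<dots> = s \<odot> (h c \<odot> h d)"
        using reach_assoc[OF rs hr(1)[OF that(1)], of "h d"] reach_wfs[OF hr(1)[OF that(2)]] hr(2)[OF that(1)] h[OF that(1)] by metis
      finally show ?thesis .
    qed
    have cm: "commutes (h c) (h d)" if "c \<in> cs" "d \<in> cs" for c d
    proof -
      have "s \<odot> (h c \<odot> h d) = s \<odot> (h d \<odot> h c)"
        using prod[OF that] prod[OF that(2,1)] less.prems(4)[OF that] unfolding commutes_def by metis
      moreover have "h c \<odot> h d \<in> carrier (Grp ?q)" "h d \<odot> h c \<in> carrier (Grp ?q)"
        using h that by (blast intro: Grp_comp)+
      ultimately show ?thesis
        unfolding commutes_def using comp_inject[OF rs] reach_wfs[OF Grp_reach] by metis
    qed
    have ax: "axis ?q (h g) (base ?q)"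
    proof -
      have hg: "h g \<in> carrier (Grp ?q)" using h[OF g] by blast
      have S: "sepg q g s = oact s ` Hist (h g)"
        unfolding sepg_def using osep_from[OF rs hr(1)[OF g]] h[OF g] by simp
      have pws: "pw q g i \<odot> s = s \<odot> pw ?q (h g) i" for i
        using pw_conj[OF rs gG hg] h[OF g] by blast
      have e: "oact s (oact (pw ?q (h g) i) p) = oact (pw q g i) (oact s p)" if "ocell ?q p" for i p
      proof -
        have "oact (s \<odot> pw ?q (h g) i) p = oact s (oact (pw ?q (h g) i) p)"
          using oact_comp[OF rs, of "pw ?q (h g) i" p] pw_closed[OF hg] Grp_carrier that by metis
        moreover have "oact (pw q g i \<odot> s) p = oact (pw q g i) (oact s p)"
          using oact_comp[of q "pw q g i" s p] pw_closed[OF gG] Grp_carrier that rs by metis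
        ultimately show ?thesis using pws by simp
      qed
      have oc: "ocell ?q p" if "p \<in> Hist (h g)" for p using Hist_up_ocell[OF hr(1)[OF g] that] by blast
      have inj: "oact s p \<notin> sepg q g s \<Longrightarrow> p \<notin> Hist (h g)" for p unfolding S by blast
      show ?thesis
        unfolding axis_def sepg_base[OF hg]
      proof (intro conjI allI impI ballI)
        fix i :: int and p assume i: "1 \<le> i" and p: "p \<in> Hist (h g)"
        have "oact s p \<in> sepg q g s" using p S by blast
        then have A: "oact (pw q g i) (oact s p) \<notin> sepg q g s" "oinv (oact (pw q g i) (oact s p)) \<notin> sepg q g s"
          using s i unfolding axis_def by blast+
        then show "oact (pw ?q (h g) i) p \<notin> Hist (h g)" using inj e[OF oc[OF p]] by simp
        have "ocell ?q (oact (pw ?q (h g) i) p)" by (rule g_ocell[OF pw_closed[OF hg] oc[OF p]])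
        with A(2) show "oinv (oact (pw ?q (h g) i) p) \<notin> Hist (h g)"
          using inj e[OF oc[OF p]] oact_oinv[OF rs] by metis
      qed simp
    qed
    have card: "card (h ` cs) \<le> card cs" by (rule card_image_le[OF less.prems(2)])
    have "resolvable ?q (h ` cs)"
    proof (rule resolvable_axis[of "card cs"])
      fix q cs' assume "word q" "finite cs'" "cs' \<subseteq> carrier (Grp q)" "card cs' < card cs"
        "\<And>a b. a \<in> cs' \<Longrightarrow> b \<in> cs' \<Longrightarrow> commutes a b"
      then show "resolvable q cs'" using less.hyps by blast
    next
      show "word ?q" by (rule reach_word[OF rs less.prems(1)])
      show "finite (h ` cs)" using less.prems(2) by simp
      show "h ` cs \<subseteq> carrier (Grp ?q)" using h by blast
      show "card (h ` cs) \<le> card cs" by (rule card)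
      show "h g \<in> h ` cs" using g by blast
      show "axis ?q (h g) (base ?q)" by (rule ax)
      show "\<And>a b. a \<in> h ` cs \<Longrightarrow> b \<in> h ` cs \<Longrightarrow> commutes a b" using cm by blast
    qed
    then show ?thesis
      using h by (intro resolvable_conj[OF rs _ less.prems(3)]) blast+
  qed
qed

text \<open>
  A trivial block is joined to the next one, or to the preceding one at the end of the list. This
  is possible unless all blocks are trivial. A cell of a standard complex has to go to a 2-path of
  infinite order for the morphism to be nonsingular, which is why trivial blocks must go.
\<close>

lemma merge_trivial_blocks:
  assumes "blocks bs"
  shows "(\<forall>ks. length ks = length bs \<longrightarrow> Psi bs ks = base (bword bs)) \<or>
    (\<exists>bs'. blocks bs' \<and> bs' \<noteq> [] \<and> bword bs' = bword bs \<and> (\<forall>(p, B)\<in>set bs'. B \<noteq> base p) \<and>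
      (\<forall>ks. length ks = length bs \<longrightarrow> (\<exists>ks'. length ks' = length bs' \<and> Psi bs ks = Psi bs' ks')))"
  using assms
proof (induction bs)
  case Nil
  then show ?case by (simp add: base_unit)
next
  case (Cons b bs)
  obtain p B where b: "b = (p, B)" by (cases b)
  have *: "word p" "length p > 1" "B \<in> carrier (Grp p)" "blocks bs" using Cons.prems b by auto
  have wb: "word (bword bs)" by (rule word_bword[OF *(4)])
  have one: "pw p B k = base p" if "B = base p" for k
  proof (rule pw_unique[symmetric, OF *(3)])
    show "base p = base p \<odot> B" using that base_comp[OF wfs_base] by simp
  qed (use *(3) that in auto)
  from Cons.IH[OF *(4)] show ?case
  proof
    assume triv: "\<forall>ks. length ks = length bs \<longrightarrow> Psi bs ks = base (bword bs)"
    show ?thesis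
    proof (cases "B = base p")
      case True
      have "Psi (b # bs) ks = base (bword (b # bs))" if "length ks = length (b # bs)" for ks
      proof -
        have "Psi bs (tl ks) = base (bword bs)" using triv that by simp
        then show ?thesis using one[OF True] b base_ssum[OF *(1) wb] by simp
      qed
      then show ?thesis by blast
    next
      case False
      let ?B = "B \<oplus> base (bword bs)" and ?p = "p \<Join> bword bs"
      have bG: "base (bword bs) \<in> carrier (Grp (bword bs))" by (simp add: Grp_carrier)
      have wp: "word ?p" by (rule word_join[OF *(1) wb])
      have BG: "?B \<in> carrier (Grp ?p)" by (rule Grp_ssum[OF *(1) wb *(3) bG])
      have wb0: "length (bword bs) > 0" using wb by (simp add: word_def)
      have "length ?p > 1" using *(1,2) wb0 unfolding length_join[OF *(1)] by linarith
      then have "blocks [(?p, ?B)]" using wp BG by simp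
      moreover have "bword [(?p, ?B)] = bword (b # bs)" using join_unit_right[OF wp] b by simp
      moreover have "?B \<noteq> base ?p"
      proof
        assume "?B = base ?p"
        then have "B \<oplus> base (bword bs) = base p \<oplus> base (bword bs)" using base_ssum[OF *(1) wb] by simp
        moreover have "length B = length (base p)" using *(3) Grp_labs by (metis length_map length_offset)
        ultimately show False
          using ssum_inject[OF *(1) wb Grp_reach[OF *(3)] reach_base reach_base reach_base] False by metis
      qed
      moreover have "Psi (b # bs) ks = Psi [(?p, ?B)] [hd ks]" if "length ks = length (b # bs)" for ks
      proof -
        have "Psi bs (tl ks) = base (bword bs)" using triv that by simp
        moreover have "pw (bword bs) (base (bword bs)) (hd ks) = base (bword bs)"
          by (rule pw_unique[symmetric, OF bG]) (use bG base_comp[OF wfs_base] in auto)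
        ultimately have "Psi (b # bs) ks = pw ?p ?B (hd ks)" using b pw_ssum[OF *(1) wb *(3) bG] by simp
        also have "\<dots> = Psi [(?p, ?B)] [hd ks]"
          using ssum_unit[OF wp Grp_reach[OF pw_closed[OF BG]]] by simp
        finally show ?thesis .
      qed
      ultimately show ?thesis
        by (intro disjI2 exI[of _ "[(?p, ?B)]"]) (auto intro!: exI[of _ "[_]"])
    qed
  next
    assume "\<exists>bs'. blocks bs' \<and> bs' \<noteq> [] \<and> bword bs' = bword bs \<and> (\<forall>(p, B)\<in>set bs'. B \<noteq> base p) \<and>
      (\<forall>ks. length ks = length bs \<longrightarrow> (\<exists>ks'. length ks' = length bs' \<and> Psi bs ks = Psi bs' ks'))"
    then obtain bs' where bs': "blocks bs'" "bs' \<noteq> []" "bword bs' = bword bs" "\<forall>(p, B)\<in>set bs'. B \<noteq> base p"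
      "\<forall>ks. length ks = length bs \<longrightarrow> (\<exists>ks'. length ks' = length bs' \<and> Psi bs ks = Psi bs' ks')" by blast
    show ?thesis
    proof (cases "B = base p")
      case False
      have "\<exists>ks'. length ks' = length (b # bs') \<and> Psi (b # bs) ks = Psi (b # bs') ks'"
        if len: "length ks = length (b # bs)" for ks
      proof -
        have "length (tl ks) = length bs" using len by simp
        with bs'(5) obtain ks' where "length ks' = length bs'" "Psi bs (tl ks) = Psi bs' ks'" by blast
        then show ?thesis using b by (intro exI[of _ "hd ks # ks'"]) simp
      qed
      then show ?thesis using bs' * b False by (intro disjI2 exI[of _ "b # bs'"]) auto
    next
      case True
      obtain p1 B1 bs1 where e: "bs' = (p1, B1) # bs1" using bs'(2) by (cases bs') auto
      have 1: "word p1" "length p1 > 1" "B1 \<in> carrier (Grp p1)" "blocks bs1" "B1 \<noteq> base p1"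
        using bs'(1,4) e by auto
      let ?p = "p \<Join> p1" and ?B = "base p \<oplus> B1"
      have bG: "base p \<in> carrier (Grp p)" by (simp add: Grp_carrier)
      have wp: "word ?p" by (rule word_join[OF *(1) 1(1)])
      have BG: "?B \<in> carrier (Grp ?p)" by (rule Grp_ssum[OF *(1) 1(1) bG 1(3)])
      have "length ?p > 1" using *(1,2) 1(2) by (simp add: length_join)
      then have "blocks ((?p, ?B) # bs1)" using wp BG 1(4) by simp
      moreover have "bword ((?p, ?B) # bs1) = bword (b # bs)"
        using bs'(3) e b join_assoc[OF 1(1), of p "bword bs1"] by simp
      moreover have "?B \<noteq> base ?p"
      proof
        assume "?B = base ?p"
        then have "base p \<oplus> B1 = base p \<oplus> base p1" using base_ssum[OF *(1) 1(1)] by simp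
        then show False
          using ssum_inject[OF *(1) 1(1) reach_base reach_base Grp_reach[OF 1(3)] reach_base HOL.refl] 1(5) by metis
      qed
      moreover have "\<exists>ks'. length ks' = length ((?p, ?B) # bs1) \<and> Psi (b # bs) ks = Psi ((?p, ?B) # bs1) ks'"
        if len: "length ks = length (b # bs)" for ks
      proof -
        have "length (tl ks) = length bs" using len by simp
        with bs'(5) obtain ks' where k: "length ks' = length bs'" "Psi bs (tl ks) = Psi bs' ks'" by blast
        have "Psi (b # bs) ks = base p \<oplus> (pw p1 B1 (hd ks') \<oplus> Psi bs1 (tl ks'))"
          using b k(2) e one[OF True] by simp
        also have "\<dots> = (base p \<oplus> pw p1 B1 (hd ks')) \<oplus> Psi bs1 (tl ks')"
          using ssum_assoc[OF *(1) 1(1) reach_base Grp_reach[OF pw_closed[OF 1(3)]]] by simp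
        also have "base p \<oplus> pw p1 B1 (hd ks') = pw ?p ?B (hd ks')"
          using pw_ssum[OF *(1) 1(1) bG 1(3)] one[OF True] True by simp
        finally show ?thesis using k(1) e by (intro exI[of _ ks']) simp
      qed
      ultimately show ?thesis
        using 1(4) bs'(4) e by (intro disjI2 exI[of _ "(?p, ?B) # bs1"]) auto
    qed
  qed
qed

end

section \<open>Words of 1-paths\<close>

text \<open>
  The word of a 1-path without its two end vertices.
\<close>

fun inner :: "'e list \<Rightarrow> 'e option list" where
  "inner [] = []"
| "inner [e] = [Some e]"
| "inner (e # e' # es) = Some e # None # inner (e' # es)"

definition enc :: "'e list \<Rightarrow> 'e option list" where
  "enc es = None # concat (map (\<lambda>e. [Some e, None]) es)"

definition dec :: "'e option list \<Rightarrow> 'e list" where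
  "dec w = map the (filter (\<lambda>x. x \<noteq> None) w)"

lemma dec_append [simp]: "dec (u @ v) = dec u @ dec v"
  by (simp add: dec_def)

lemma dec_enc [simp]: "dec (enc es) = es"
  by (induction es) (auto simp: enc_def dec_def)

lemma dec_inner [simp]: "dec (inner es) = es"
  by (induction es rule: inner.induct) (auto simp: dec_def)

lemma enc_inject [simp]: "enc es = enc fs \<longleftrightarrow> es = fs"
  by (metis dec_enc)

lemma enc_append: "enc (p @ q) = enc p @ tl (enc q)"
  by (simp add: enc_def)

lemma enc_inner: "u \<noteq> [] \<Longrightarrow> enc (u @ q) = None # inner u @ enc q"
  by (induction u rule: inner.induct) (auto simp: enc_def)

lemma enc_append3: "u \<noteq> [] \<Longrightarrow> enc (p @ u @ q) = enc p @ inner u @ enc q"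
  using enc_append[of p "u @ q"] enc_inner[of u q] by simp

lemma enc_ne [simp]: "enc es \<noteq> []"
  by (simp add: enc_def)

lemma hd_enc [simp]: "hd (enc es) = None"
  by (simp add: enc_def)

lemma last_enc [simp]: "last (enc es) = None"
  by (induction es) (auto simp: enc_def)

lemma length_enc: "length (enc es) = Suc (2 * length es)"
  by (induction es) (auto simp: enc_def)

lemma butlast_enc: "butlast (enc p) @ enc q = enc (p @ q)"
proof -
  have "enc p = butlast (enc p) @ [None]" by (metis append_butlast_last_id enc_ne last_enc)
  moreover have "enc q = None # tl (enc q)" by (simp add: enc_def)
  ultimately show ?thesis unfolding enc_append by (metis append.assoc append_Cons append_Nil)
qed

abbreviation alternating :: "'e option list \<Rightarrow> bool" where
  "alternating \<equiv> successively (\<lambda>a b. (a = None) \<noteq> (b = None))"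

lemma alternating_inner: "alternating (inner es)"
proof (induction es rule: inner.induct)
  case (3 e e' es)
  then show ?case by (cases es) auto
qed auto

lemma inner_ends: "es \<noteq> [] \<Longrightarrow> inner es \<noteq> [] \<and> hd (inner es) \<noteq> None \<and> last (inner es) \<noteq> None"
  by (induction es rule: inner.induct) auto

lemma alternating_enc: "alternating (enc es)"
proof (induction es)
  case (Cons e es)
  have "enc (e # es) = None # Some e # enc es" by (simp add: enc_def)
  moreover obtain w where "enc es = None # w" by (simp add: enc_def)
  ultimately show ?case using Cons by simp
qed (simp add: enc_def)

lemma enc_dec:
  "w \<noteq> [] \<Longrightarrow> hd w = None \<Longrightarrow> last w = None \<Longrightarrow> alternating w \<Longrightarrow> enc (dec w) = w"
proof (induction w rule: length_induct)
  case (1 w)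
  then obtain w' where w: "w = None # w'" by (cases w) auto
  show ?case
  proof (cases w')
    case Nil
    then show ?thesis using w by (simp add: dec_def enc_def)
  next
    case (Cons x w'')
    then obtain e where x: "x = Some e" using "1.prems"(4) w by (cases x) auto
    have w'': "w'' \<noteq> []" using "1.prems"(3) w Cons x by auto
    then have "hd w'' = None" "last w'' = None" "alternating w''"
      using "1.prems" w Cons x by (cases w''; auto)+
    then have "enc (dec w'') = w''" using "1.IH" w'' w Cons by simp
    moreover have "dec w = e # dec w''" using w Cons x by (simp add: dec_def)
    moreover have "enc (e # dec w'') = None # Some e # enc (dec w'')" by (simp add: enc_def)
    ultimately show ?thesis using w Cons x by simp
  qed
qed

text \<open>
  Since a word of edges and vertices alternates, any occurrence of the top of a cell in it starts and
  ends at a vertex of the 1-path, so the occurrence is one in the 1-path itself.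
\<close>

lemma enc_parse:
  assumes "enc es = u @ inner t @ v" "t \<noteq> []"
  shows "u = enc (dec u)" "v = enc (dec v)" "es = dec u @ t @ dec v"
proof -
  have i: "inner t \<noteq> []" "hd (inner t) \<noteq> None" "last (inner t) \<noteq> None" using inner_ends[OF assms(2)] by auto
  have u: "u \<noteq> []" using assms(1) i hd_enc[of es] by (metis append_Nil hd_append2)
  have v: "v \<noteq> []" using assms(1) i last_enc[of es] by (metis append_Nil2 last_appendR)
  have a: "alternating (u @ inner t @ v)" using alternating_enc assms(1) by metis
  then have a': "alternating u" "alternating v" "(last u = None) \<noteq> (hd (inner t) = None)"
    "(last (inner t) = None) \<noteq> (hd v = None)"
    using u v i unfolding successively_append_iff by auto
  have "hd u = None" "last v = None"
    using assms(1) u v hd_enc[of es] last_enc[of es] by (metis hd_append2, metis append_is_Nil_conv last_appendR)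
  then show "u = enc (dec u)" "v = enc (dec v)" using enc_dec[of u] enc_dec[of v] u v a' i by auto
  have "dec (enc es) = dec (u @ inner t @ v)" using assms(1) by simp
  then show "es = dec u @ t @ dec v" by simp
qed

section \<open>Undoing and exchanging moves\<close>

context rewriting_system
begin

lemma move_undo:
  assumes "wfs q s" "labs s = u @ lhs f @ v" "f \<in> C"
  shows "move (u, rv f, v') (move (u, f, v) s) = s"
proof -
  from splitE[OF assms(2,1)] obtain l t r where
    s: "s = l @ t @ r" "labs l = u" "labs t = lhs f" "labs r = v" "wfs q l" "wfs q t" "wfs q r" .
  then have o: "ocell q (f, t)" using assms(3) by simp
  have len: "length l = length u" "length t = length (lhs f)" using s(2,3) by (metis length_map)+
  have "length (flip f t) = length (lhs (rv f))" using length_flip[OF o] assms(3) by simp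
  then show ?thesis
    using move_eq[OF len, of v r] move_eq[OF len(1), of "flip f t" "rv f" v' r] s(1) flip_flip[OF o] by (simp del: move.simps)
qed

fun rvm :: "'l list \<times> 'f \<times> 'l list \<Rightarrow> 'l list \<times> 'f \<times> 'l list" where
  "rvm (u, f, v) = (u, rv f, v)"

lemma run_undo:
  "wfs q s \<Longrightarrow> valid (labs s) ms \<Longrightarrow> run (rev (map rvm ms)) (run ms s) = s"
proof (induction ms arbitrary: s)
  case (Cons m ms)
  obtain u f v where m: "m = (u, f, v)" by (cases m)
  with Cons.prems have *: "f \<in> C" "labs s = u @ lhs f @ v" "valid (u @ rhs f @ v) ms" by auto
  note mv = move_wf[OF Cons.prems(1) *(2,1)]
  have "run (rev (map rvm ms)) (run ms (move m s)) = move m s"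
    using Cons.IH[of "move m s"] mv *(3) m by (simp del: move.simps)
  then show ?case using move_undo[OF Cons.prems(1) *(2,1), of v] m by (simp del: move.simps)
qed simp

lemma run_exchange:
  assumes "wfs q s" "labs s = u @ lhs f @ x @ lhs g @ v" "f \<in> C" "g \<in> C"
  shows "run [(u, f, x @ lhs g @ v), (u @ rhs f @ x, g, v)] s =
    run [(u @ lhs f @ x, g, v), (u, f, x @ rhs g @ v)] s"
proof -
  from splitE[OF assms(2,1)] obtain l t r0 where
    s: "s = l @ t @ r0" "labs l = u" "labs t = lhs f" "labs r0 = x @ lhs g @ v" "wfs q t" "wfs q r0" by metis
  from splitE[OF s(4,6)] obtain m t' r where
    s': "r0 = m @ t' @ r" "labs m = x" "labs t' = lhs g" "labs r = v" "wfs q t'" by metis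
  have o: "ocell q (f, t)" "ocell q (g, t')" using s s' assms by auto
  have len: "length l = length u" "length t = length (lhs f)" "length m = length x" "length t' = length (lhs g)"
    using s(2,3) s'(2,3) by (metis length_map)+
  have fl: "length (flip f t) = length (rhs f)" using length_flip[OF o(1)] .
  have "move (u, f, x @ lhs g @ v) s = (l @ flip f t @ m) @ t' @ r"
    using move_eq[OF len(1,2), of "x @ lhs g @ v" r0] s(1) s'(1) by simp
  moreover have "move (u @ rhs f @ x, g, v) ((l @ flip f t @ m) @ t' @ r) = (l @ flip f t @ m) @ flip g t' @ r"
    using len fl by (intro move_eq) auto
  moreover have "move (u @ lhs f @ x, g, v) ((l @ t @ m) @ t' @ r) = (l @ t @ m) @ flip g t' @ r"
    using len by (intro move_eq) auto
  moreover have "move (u, f, x @ rhs g @ v) (l @ t @ (m @ flip g t' @ r)) = l @ flip f t @ (m @ flip g t' @ r)"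
    using len by (intro move_eq) auto
  ultimately show ?thesis using s(1) s'(1) by (simp del: move.simps)
qed

end

lemma cat1_simps [simp]: "fst (p \<cdot> q) = fst p" "snd (p \<cdot> q) = snd p @ snd q"
  by (simp_all add: cat1_def)

section \<open>The rewriting system of a directed 2-complex\<close>

text \<open>
  All vertices become the same letter. Nothing is lost: a 1-path is determined by its edges and its
  initial vertex, which no 2-path changes.
\<close>

sublocale directed_2_complex \<subseteq> R: rewriting_system "cells K"
  "\<lambda>f. inner (snd (cell_top K f))" "\<lambda>f. inner (snd (cell_bot K f))" "cell_inv K" None
proof
  fix f assume f: "f \<in> cells K"
  then have ne: "snd (cell_top K f) \<noteq> []" using top_path by (simp add: nonempty1_def)
  show "cell_inv K f \<in> cells K" "cell_inv K (cell_inv K f) = f" "cell_inv K f \<noteq> f"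
    using f inv_cell inv_inv inv_no_fixpoint by auto
  show "inner (snd (cell_top K (cell_inv K f))) = inner (snd (cell_bot K f))" using top_inv[OF f] by simp
  show "inner (snd (cell_top K f)) \<noteq> []" "hd (inner (snd (cell_top K f))) \<noteq> None"
    "last (inner (snd (cell_top K f))) \<noteq> None" using inner_ends[OF ne] by auto
  show "alternating (inner (snd (cell_top K f)))" by (rule alternating_inner)
qed

context directed_2_complex
begin

lemma top_ne: "f \<in> cells K \<Longrightarrow> snd (cell_top K f) \<noteq> []"
  and bot_ne: "f \<in> cells K \<Longrightarrow> snd (cell_bot K f) \<noteq> []"
  using top_path bot_path by (auto simp: nonempty1_def)

lemma word_enc [simp]: "R.word (enc es)"
  unfolding R.word_def by (intro conjI enc_ne hd_enc last_enc alternating_enc)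

lemma word_iff: "R.word w \<Longrightarrow> enc (dec w) = w"
  using enc_dec by (auto simp: R.word_def)

section \<open>Subpaths of 1-paths\<close>

interpretation G: wf_digraph "under_graph K"
  by (rule wf_under_graph)

lemma awlast_eq: "G.awalk v es w \<Longrightarrow> G.awlast v es = w"
  by (rule G.awlast_of_awalk) (auto simp: NOMATCH_def)

lemma path_append:
  "is_path1 K (v, es @ fs) \<longleftrightarrow> is_path1 K (v, es) \<and> is_path1 K (term1 K (v, es), fs)"
proof
  assume "is_path1 K (v, es @ fs)"
  then obtain w where "G.awalk v (es @ fs) w" by (auto simp: is_path1_def)
  then have "G.awalk v es (G.awlast v es)" "G.awalk (G.awlast v es) fs w" by (auto simp: G.awalk_append_iff)
  then show "is_path1 K (v, es) \<and> is_path1 K (term1 K (v, es), fs)" by (auto simp: is_path1_def term1_def)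
next
  assume "is_path1 K (v, es) \<and> is_path1 K (term1 K (v, es), fs)"
  then obtain x w where 1: "G.awalk v es x" "G.awalk (G.awlast v es) fs w" by (auto simp: is_path1_def term1_def)
  then have "x = G.awlast v es" using awlast_eq by blast
  with 1 show "is_path1 K (v, es @ fs)" using G.awalk_appendI by (auto simp: is_path1_def)
qed

lemma term_append: "is_path1 K (v, es @ fs) \<Longrightarrow> term1 K (v, es @ fs) = term1 K (term1 K (v, es), fs)"
proof -
  assume "is_path1 K (v, es @ fs)"
  then obtain w where w: "G.awalk v (es @ fs) w" by (auto simp: is_path1_def)
  then have "G.awlast v (es @ fs) = w" by (rule awlast_eq)
  moreover from w have "G.awalk (G.awlast v es) fs w" by auto
  then have "G.awlast (G.awlast v es) fs = w" by (rule awlast_eq)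
  ultimately show ?thesis by (simp add: term1_def)
qed

lemma path_start: "is_path1 K (v, es) \<Longrightarrow> is_path1 K (w, es) \<Longrightarrow> es \<noteq> [] \<Longrightarrow> v = w"
  by (cases es) (auto simp: is_path1_def G.awalk_Cons_iff)

lemma term_Nil [simp]: "term1 K (v, []) = v"
  by (simp add: term1_def)

text \<open>
  An edge determines its end vertices, so wherever the edges of the top of a cell occur in a 1-path,
  the cell can be applied.
\<close>

lemma cell_in_path:
  assumes "is_path1 K (v, a @ snd (cell_top K f) @ b)" "f \<in> cells K"
  shows "is_path1 K (v, a)" "term1 K (v, a) = fst (cell_top K f)"
    "is_path1 K (term1 K (cell_top K f), b)" "is_path1 K (v, a @ snd (cell_bot K f) @ b)"
    "term1 K (v, a @ snd (cell_bot K f)) = term1 K (cell_top K f)"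
    "term1 K (v, a @ snd (cell_top K f)) = term1 K (cell_top K f)"
proof -
  let ?t = "cell_top K f" and ?b = "cell_bot K f"
  have *: "is_path1 K (v, a)" "is_path1 K (term1 K (v, a), snd ?t)"
    "is_path1 K (term1 K (term1 K (v, a), snd ?t), b)"
    using assms(1) path_append by blast+
  have t: "is_path1 K (fst ?t, snd ?t)" and b: "is_path1 K (fst ?b, snd ?b)"
    using top_path[OF assms(2)] bot_path[OF assms(2)] by auto
  show "is_path1 K (v, a)" by (rule *(1))
  show 1: "term1 K (v, a) = fst ?t" using path_start[OF *(2) t top_ne[OF assms(2)]] .
  have e: "fst ?t = fst ?b" using init_eq[OF assms(2)] by (simp add: init1_def)
  have tt: "term1 K (fst ?t, snd ?t) = term1 K ?t" "term1 K (fst ?b, snd ?b) = term1 K ?t"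
    using term_eq[OF assms(2)] by auto
  show 2: "is_path1 K (term1 K ?t, b)" using *(3) 1 tt by simp
  have pb: "is_path1 K (v, a @ snd ?b)" using *(1) b 1 e path_append by simp
  show tb: "term1 K (v, a @ snd ?b) = term1 K ?t" using term_append[OF pb] 1 e tt by simp
  have "is_path1 K (v, (a @ snd ?b) @ b)" by (subst path_append) (use pb 2 tb in simp)
  then show "is_path1 K (v, a @ snd ?b @ b)" by simp
  have pt: "is_path1 K (v, a @ snd ?t)" using *(1,2) path_append by simp
  show "term1 K (v, a @ snd ?t) = term1 K ?t" using term_append[OF pt] 1 tt by simp
qed

section \<open>2-paths as sequences of moves\<close>

fun E :: "('v, 'e, 'f) atom \<Rightarrow> 'e option list \<times> 'f \<times> 'e option list" where
  "E (p, f, q) = (enc (snd p), f, enc (snd q))"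

text \<open>
  Recovers an atomic 2-path from a move. The initial vertex \<open>v\<close> of the whole 1-path has to be
  supplied; the initial vertex of the part behind the cell is the terminal vertex of the cell.
\<close>

fun D :: "'v \<Rightarrow> 'e option list \<times> 'f \<times> 'e option list \<Rightarrow> ('v, 'e, 'f) atom" where
  "D v (u, f, w) = ((v, dec u), f, (term1 K (cell_top K f), dec w))"

definition st :: "('v, 'e, 'f) path2 \<Rightarrow> ('e option, 'f) item list" where
  "st \<delta> = R.run (map E (snd \<delta>)) (R.base (enc (snd (fst \<delta>))))"

lemma bot2_Nil [simp]: "bot2 K (p, []) = p"
  and bot2_Cons [simp]: "bot2 K (p, d # ds) = bot2 K (atom_bot K d, ds)"
  by (auto simp: bot2_def)

lemma path2_E:
  assumes "is_path2 K (P, ds)"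
  shows "is_path1 K P" "R.valid (enc (snd P)) (map E ds)"
    "R.endw (enc (snd P)) (map E ds) = enc (snd (bot2 K (P, ds)))"
    "fst (bot2 K (P, ds)) = fst P" "is_path1 K (bot2 K (P, ds))" "map (D (fst P)) (map E ds) = ds"
proof -
  have "is_path1 K P \<and> R.valid (enc (snd P)) (map E ds) \<and>
    R.endw (enc (snd P)) (map E ds) = enc (snd (bot2 K (P, ds))) \<and>
    fst (bot2 K (P, ds)) = fst P \<and> is_path1 K (bot2 K (P, ds)) \<and> map (D (fst P)) (map E ds) = ds"
    using assms
  proof (induction ds arbitrary: P)
    case (Cons d ds)
    obtain p f q where d: "d = (p, f, q)" by (cases d)
    have a: "is_path1 K p" "f \<in> cells K" "is_path1 K q" "term1 K p = init1 (cell_top K f)"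
      "term1 K (cell_top K f) = init1 q" "P = p \<cdot> cell_top K f \<cdot> q" "is_path2 K (atom_bot K d, ds)"
      using Cons.prems d by (auto simp: is_atom_def atom_top_def)
    note IH = Cons.IH[OF a(7)]
    have ab: "atom_bot K d = (fst P, snd p @ snd (cell_bot K f) @ snd q)"
      using a(6) d by (simp add: atom_bot_def cat1_def)
    have P: "P = (fst P, snd p @ snd (cell_top K f) @ snd q)" using a(6) by (simp add: cat1_def)
    have "is_path1 K P"
    proof -
      have t: "is_path1 K (fst (cell_top K f), snd (cell_top K f))" using top_path[OF a(2)] by simp
      have "is_path1 K (fst p, snd p @ snd (cell_top K f))"
        using a(1,4) t path_append by (simp add: init1_def)
      moreover from term_append[OF this] have "term1 K (fst p, snd p @ snd (cell_top K f)) = fst q"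
        using a(4,5) by (simp add: init1_def)
      ultimately have "is_path1 K (fst p, (snd p @ snd (cell_top K f)) @ snd q)"
        by (subst path_append) (use a(3) in simp)
      then show ?thesis using a(6) by (simp add: cat1_def)
    qed
    moreover have "enc (snd P) = enc (snd p) @ inner (snd (cell_top K f)) @ enc (snd q)"
      using enc_append3[OF top_ne[OF a(2)]] a(6) by simp
    moreover have "enc (snd (atom_bot K d)) = enc (snd p) @ inner (snd (cell_bot K f)) @ enc (snd q)"
      using enc_append3[OF bot_ne[OF a(2)]] ab by simp
    moreover have "D (fst P) (E d) = d" using d a(5,6) by (cases p; cases q) (simp add: init1_def cat1_def)
    ultimately show ?case using IH a(2) d ab by simp
  qed simp
  then show "is_path1 K P" "R.valid (enc (snd P)) (map E ds)"
    "R.endw (enc (snd P)) (map E ds) = enc (snd (bot2 K (P, ds)))"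
    "fst (bot2 K (P, ds)) = fst P" "is_path1 K (bot2 K (P, ds))" "map (D (fst P)) (map E ds) = ds" by auto
qed

lemma path2_D:
  assumes "is_path1 K (v, es)" "R.valid (enc es) ms"
  shows "is_path2 K ((v, es), map (D v) ms)" "map E (map (D v) ms) = ms"
proof -
  have "is_path2 K ((v, es), map (D v) ms) \<and> map E (map (D v) ms) = ms"
    using assms
  proof (induction ms arbitrary: es)
    case (Cons m ms)
    obtain u f w where m: "m = (u, f, w)" by (cases m)
    with Cons.prems have f: "f \<in> cells K" and e: "enc es = u @ inner (snd (cell_top K f)) @ w"
      and v: "R.valid (u @ inner (snd (cell_bot K f)) @ w) ms" by auto
    note p = enc_parse[OF e top_ne[OF f]]
    note c = cell_in_path[OF Cons.prems(1)[unfolded p(3)] f]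
    let ?es = "dec u @ snd (cell_bot K f) @ dec w"
    have "enc ?es = u @ inner (snd (cell_bot K f)) @ w" using enc_append3[OF bot_ne[OF f]] p by metis
    then have IH: "is_path2 K ((v, ?es), map (D v) ms)" "map E (map (D v) ms) = ms"
      using Cons.IH[OF c(4)] v by auto
    have "is_atom K (D v m)" using m c f by (simp add: is_atom_def init1_def)
    moreover have "atom_top K (D v m) = (v, es)" "atom_bot K (D v m) = (v, ?es)"
      using m p(3) by (simp_all add: atom_top_def atom_bot_def cat1_def)
    moreover have "E (D v m) = m" using m p(1,2) by simp
    ultimately show ?case using IH by simp
  qed simp
  then show "is_path2 K ((v, es), map (D v) ms)" "map E (map (D v) ms) = ms" by auto
qed

lemma st_reach: "is_path2 K \<delta> \<Longrightarrow> R.reach (enc (snd (fst \<delta>))) (st \<delta>)"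
  using path2_E(2)[of "fst \<delta>" "snd \<delta>"] by (auto simp: st_def R.reach_iff_run)

lemma st_labs: "is_path2 K \<delta> \<Longrightarrow> R.labs (st \<delta>) = enc (snd (bot2 K \<delta>))"
  using path2_E(2,3)[of "fst \<delta>" "snd \<delta>"] R.run_wf[OF R.wfs_base[of "enc (snd (fst \<delta>))"], of "map E (snd \<delta>)"]
  by (simp add: st_def)

lemma bot2_fst: "is_path2 K \<delta> \<Longrightarrow> fst (bot2 K \<delta>) = fst (fst \<delta>)"
  using path2_E(4)[of "fst \<delta>" "snd \<delta>"] by simp

lemma bot2_pair: "is_path2 K ((v, es), ds) \<Longrightarrow> bot2 K ((v, es), ds) = (v, snd (bot2 K ((v, es), ds)))"
  using bot2_fst[of "((v, es), ds)"] by (metis fst_conv prod.collapse)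

lemma path2_bot: "is_path2 K \<delta> \<Longrightarrow> is_path1 K (bot2 K \<delta>)"
  using path2_E(5)[of "fst \<delta>" "snd \<delta>"] by simp

lemma st_trivial [simp]: "st (P, []) = R.base (enc (snd P))"
  by (simp add: st_def)

lemma path2_cat:
  assumes "is_path2 K \<delta>" "is_path2 K \<epsilon>" "bot2 K \<delta> = fst \<epsilon>"
  shows "is_path2 K (cat2 \<delta> \<epsilon>)" "bot2 K (cat2 \<delta> \<epsilon>) = bot2 K \<epsilon>"
proof -
  have "is_path2 K (P, ds) \<Longrightarrow> bot2 K (P, ds) = fst \<epsilon> \<Longrightarrow> is_path2 K (P, ds @ snd \<epsilon>) \<and> bot2 K (P, ds @ snd \<epsilon>) = bot2 K \<epsilon>" for P ds
    using assms(2) by (induction ds arbitrary: P) auto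
  from this[of "fst \<delta>" "snd \<delta>"] assms show "is_path2 K (cat2 \<delta> \<epsilon>)" "bot2 K (cat2 \<delta> \<epsilon>) = bot2 K \<epsilon>"
    by (auto simp: cat2_def)
qed

lemma st_cat:
  assumes "is_path2 K \<delta>" "is_path2 K \<epsilon>" "bot2 K \<delta> = fst \<epsilon>"
  shows "st (cat2 \<delta> \<epsilon>) = R.comp_state (st \<delta>) (st \<epsilon>)"
proof -
  have "st (cat2 \<delta> \<epsilon>) = R.run (map E (snd \<epsilon>)) (st \<delta>)" by (simp add: st_def cat2_def)
  also have "\<dots> = R.comp_state (st \<delta>) (st \<epsilon>)"
    using R.run_eq_comp[OF R.reach_wfs[OF st_reach[OF assms(1)]], of "map E (snd \<epsilon>)"]
      path2_E(2)[of "fst \<epsilon>" "snd \<epsilon>"] assms(2,3) st_labs[OF assms(1)] by (simp add: st_def)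
  finally show ?thesis .
qed

lemma bot2_eqI:
  assumes "is_path2 K \<delta>" "is_path2 K \<epsilon>" "fst \<delta> = fst \<epsilon>" "st \<delta> = st \<epsilon>"
  shows "bot2 K \<delta> = bot2 K \<epsilon>"
  using st_labs[OF assms(1)] st_labs[OF assms(2)] bot2_fst[OF assms(1)] bot2_fst[OF assms(2)] assms(3,4)
  by (simp add: prod_eq_iff)

lemma exchange_paths:
  assumes "is_path1 K p" "is_path1 K q" "is_path1 K r" "f \<in> cells K" "g \<in> cells K"
    "term1 K p = init1 (cell_top K f)" "term1 K (cell_top K f) = init1 q"
    "term1 K q = init1 (cell_top K g)" "term1 K (cell_top K g) = init1 r"
  shows "is_path1 K (p \<cdot> cell_top K f \<cdot> q \<cdot> cell_top K g \<cdot> r)"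
proof -
  have t: "is_path1 K (fst (cell_top K f), snd (cell_top K f))" "is_path1 K (fst (cell_top K g), snd (cell_top K g))"
    using top_path assms(4,5) by auto
  have 1: "is_path1 K (fst (cell_top K g), snd (cell_top K g) @ snd r)"
    using t(2) assms(3,9) path_append by (simp add: init1_def)
  then have 2: "is_path1 K (fst q, snd q @ snd (cell_top K g) @ snd r)"
    using assms(2,8) path_append by (simp add: init1_def)
  then have 3: "is_path1 K (fst (cell_top K f), snd (cell_top K f) @ snd q @ snd (cell_top K g) @ snd r)"
    using t(1) assms(7) path_append by (simp add: init1_def)
  then have "is_path1 K (fst p, snd p @ snd (cell_top K f) @ snd q @ snd (cell_top K g) @ snd r)"
    using assms(1,6) path_append by (simp add: init1_def)
  then show ?thesis by (simp add: cat1_def)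
qed

text \<open>
  The state is invariant under each of the defining homotopies.
\<close>

lemma homotopic_sound:
  "homotopic K \<delta> \<epsilon> \<Longrightarrow> is_path2 K \<delta> \<and> is_path2 K \<epsilon> \<and> fst \<delta> = fst \<epsilon> \<and> st \<delta> = st \<epsilon>"
proof (induction rule: homotopic.induct)
  case (cat \<delta> \<delta>' \<epsilon> \<epsilon>')
  then show ?case using path2_cat[of \<delta> \<epsilon>] path2_cat[of \<delta>' \<epsilon>'] st_cat[of \<delta> \<epsilon>] st_cat[of \<delta>' \<epsilon>']
    by (simp add: top2_def cat2_def)
next
  case (cancel d)
  obtain p f q where d: "d = (p, f, q)" by (cases d)
  have f: "f \<in> cells K" using cancel d by (simp add: is_atom_def)
  have i: "is_atom K (atom_inv K d)" "atom_top K (atom_inv K d) = atom_bot K d"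
    "atom_bot K (atom_inv K d) = atom_top K d"
    using cancel d f inv_cell[OF f] top_inv[OF f] bot_inv[OF f] term_eq[OF f] init_eq[OF f]
    by (auto simp: is_atom_def atom_inv_def atom_top_def atom_bot_def)
  have p1: "is_path1 K (atom_top K d)"
  proof -
    have "is_path1 K (fst p, snd p @ snd (cell_top K f) @ snd q)"
    proof -
      have t: "is_path1 K (fst (cell_top K f), snd (cell_top K f))" using top_path[OF f] by simp
      have "is_path1 K (fst (cell_top K f), snd (cell_top K f) @ snd q)"
        using t cancel d path_append by (simp add: is_atom_def init1_def)
      then show ?thesis using cancel d path_append by (simp add: is_atom_def init1_def)
    qed
    then show ?thesis using d by (simp add: atom_top_def cat1_def)
  qed
  then have P: "is_path2 K (atom_top K d, [d, atom_inv K d])" using i cancel by simp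
  let ?s = "R.base (enc (snd (atom_top K d)))"
  have l: "R.labs ?s = enc (snd p) @ inner (snd (cell_top K f)) @ enc (snd q)"
    using enc_append3[OF top_ne[OF f]] d by (simp add: atom_top_def)
  have "R.run (map E [d, atom_inv K d]) ?s = ?s"
    using R.move_undo[OF R.wfs_base l f, of "enc (snd q)"] d by (simp add: atom_inv_def del: R.move.simps)
  with P p1 show ?case by (simp add: st_def)
next
  case (exchange p q r f g)
  note path = exchange_paths[OF exchange]
  let ?P = "p \<cdot> cell_top K f \<cdot> q \<cdot> cell_top K g \<cdot> r"
  have e: "snd ?P = snd p @ snd (cell_top K f) @ snd q @ snd (cell_top K g) @ snd r" by simp
  have P: "is_path1 K (fst p, snd p @ snd (cell_top K f) @ snd q @ snd (cell_top K g) @ snd r)"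
    using path by (simp add: cat1_def)
  have tl: "enc (snd q @ snd (cell_top K g) @ snd r) = enc (snd q) @ inner (snd (cell_top K g)) @ enc (snd r)"
    "enc (snd q @ snd (cell_bot K g) @ snd r) = enc (snd q) @ inner (snd (cell_bot K g)) @ enc (snd r)"
    "enc (snd p @ snd (cell_top K f) @ snd q) = enc (snd p) @ inner (snd (cell_top K f)) @ enc (snd q)"
    "enc (snd p @ snd (cell_bot K f) @ snd q) = enc (snd p) @ inner (snd (cell_bot K f)) @ enc (snd q)"
    using enc_append3 top_ne bot_ne exchange.hyps(4,5) by metis+
  let ?l = "[(p, f, q \<cdot> cell_top K g \<cdot> r), (p \<cdot> cell_bot K f \<cdot> q, g, r)]"
  let ?r = "[(p \<cdot> cell_top K f \<cdot> q, g, r), (p, f, q \<cdot> cell_bot K g \<cdot> r)]"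
  have ll: "R.labs (R.base (enc (snd ?P))) =
    enc (snd p) @ inner (snd (cell_top K f)) @ enc (snd q) @ inner (snd (cell_top K g)) @ enc (snd r)"
    using enc_append3[OF top_ne[OF exchange.hyps(4)], of "snd p" "snd q @ snd (cell_top K g) @ snd r"] tl(1) e by simp
  have "R.run (map E ?l) (R.base (enc (snd ?P))) = R.run (map E ?r) (R.base (enc (snd ?P)))"
    using R.run_exchange[OF R.wfs_base ll exchange.hyps(4,5)] tl by (simp del: R.move.simps)
  moreover have "is_path2 K (?P, ?l)" "is_path2 K (?P, ?r)"
  proof -
    have v: "R.valid (enc (snd ?P)) (map E ?l)" "R.valid (enc (snd ?P)) (map E ?r)"
      using ll exchange.hyps(4,5) tl by auto
    have "map (D (fst p)) (map E ?l) = ?l" "map (D (fst p)) (map E ?r) = ?r"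
      using exchange.hyps by (auto simp: init1_def cat1_def prod_eq_iff)
    with path2_D(1)[OF _ v(1), of "fst p"] path2_D(1)[OF _ v(2), of "fst p"] path
    show "is_path2 K (?P, ?l)" "is_path2 K (?P, ?r)" by (metis cat1_simps(1) prod.collapse)+
  qed
  ultimately show ?case unfolding st_def fst_conv snd_conv by blast
qed (auto simp: top2_def)

text \<open>
  Each homotopy of moves is one of atomic 2-paths. The converse of \<open>homotopic_sound\<close> follows, since
  equal states give homotopic moves.
\<close>

lemma heq_homotopic:
  "R.heq (enc es) ms ms' \<Longrightarrow> is_path1 K (v, es) \<Longrightarrow>
    homotopic K ((v, es), map (D v) ms) ((v, es), map (D v) ms')"
proof (induction rule: R.heq.induct)
  case (heq_refl ms)
  then show ?case using path2_D(1) homotopic.refl by blast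
next
  case (heq_sym ms ms')
  then show ?case using homotopic.sym by blast
next
  case (heq_trans ms ms' ms'')
  then show ?case using homotopic.trans by blast
next
  case (heq_append ms ms' ns)
  note h = heq_append.IH[OF heq_append.prems]
  note s = homotopic_sound[OF h]
  let ?\<delta> = "((v, es), map (D v) ms)" and ?\<delta>' = "((v, es), map (D v) ms')"
  have b: "bot2 K ?\<delta> = bot2 K ?\<delta>'" using bot2_eqI s by blast
  let ?Q = "bot2 K ?\<delta>"
  have vm: "R.valid (enc es) ms" using R.heq_valid[OF heq_append.hyps(1)] by blast
  have "enc (snd ?Q) = R.endw (enc es) ms"
    using path2_E(3)[of "(v, es)" "map (D v) ms"] s path2_D(2)[OF heq_append.prems vm] by simp
  moreover have Q: "?Q = (v, snd ?Q)" "is_path1 K ?Q" using bot2_pair path2_bot s by blast+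
  moreover from this have "is_path1 K (v, snd ?Q)" by metis
  ultimately have "is_path2 K (?Q, map (D v) ns)" using path2_D(1)[of v "snd ?Q" ns] heq_append.hyps(2) by simp
  then have "homotopic K (cat2 ?\<delta> (?Q, map (D v) ns)) (cat2 ?\<delta>' (?Q, map (D v) ns))"
    by (intro homotopic.cat[OF h homotopic.refl]) (simp_all only: top2_def fst_conv b)
  then show ?case by (simp add: cat2_def)
next
  case (heq_cancel ms u f w)
  let ?\<delta> = "((v, es), map (D v) ms)"
  have p: "is_path2 K ?\<delta>" "map E (map (D v) ms) = ms" using path2_D[OF heq_cancel.prems heq_cancel.hyps(1)] by auto
  let ?Q = "bot2 K ?\<delta>"
  have Q: "?Q = (v, snd ?Q)" "is_path1 K (v, snd ?Q)" "enc (snd ?Q) = u @ inner (snd (cell_top K f)) @ w"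
    using bot2_pair[OF p(1)] apply blast
    using bot2_pair[OF p(1)] path2_bot[OF p(1)] apply metis
    using path2_E(3)[OF p(1)] p(2) heq_cancel.hyps(2) by simp
  note e = enc_parse[OF Q(3) top_ne[OF heq_cancel.hyps(3)]]
  note c = cell_in_path[OF Q(2)[unfolded e(3)] heq_cancel.hyps(3)]
  let ?d = "D v (u, f, w)"
  have a: "is_atom K ?d" using c heq_cancel.hyps(3) by (simp add: is_atom_def init1_def)
  have t: "atom_top K ?d = ?Q" using Q(1) e(3) by (simp add: atom_top_def cat1_def prod_eq_iff)
  have i: "D v (u, cell_inv K f, w) = atom_inv K ?d"
    using top_inv[OF heq_cancel.hyps(3)] term_eq[OF heq_cancel.hyps(3)] by (simp add: atom_inv_def)
  have "homotopic K (cat2 ?\<delta> (?Q, [?d, atom_inv K ?d])) (cat2 ?\<delta> (?Q, []))"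
    using homotopic.cat[OF homotopic.refl[OF p(1)] homotopic.cancel[OF a]] t by (simp add: top2_def)
  then show ?case using i by (simp add: cat2_def)
next
  case (heq_exchange ms u f x g w)
  let ?\<delta> = "((v, es), map (D v) ms)"
  have p: "is_path2 K ?\<delta>" "map E (map (D v) ms) = ms" using path2_D[OF heq_exchange.prems heq_exchange.hyps(1)] by auto
  let ?Q = "bot2 K ?\<delta>" and ?t = "\<lambda>f. snd (cell_top K f)"
  have Q: "?Q = (v, snd ?Q)" "is_path1 K (v, snd ?Q)" "enc (snd ?Q) = u @ inner (?t f) @ (x @ inner (?t g) @ w)"
    using bot2_pair[OF p(1)] apply blast
    using bot2_pair[OF p(1)] path2_bot[OF p(1)] apply metis
    using path2_E(3)[OF p(1)] p(2) heq_exchange.hyps(2) by simp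
  note f = heq_exchange.hyps(3) and g = heq_exchange.hyps(4)
  note e = enc_parse[OF Q(3) top_ne[OF f]]
  note e2 = enc_parse[OF e(2)[symmetric] top_ne[OF g]]
  note c = cell_in_path[OF Q(2)[unfolded e(3)] f]
  have P3: "is_path1 K (term1 K (cell_top K f), dec x @ ?t g @ dec w)" using c(3) by simp
  note c2 = cell_in_path[OF P3 g]
  let ?p = "(v, dec u)" and ?q = "(term1 K (cell_top K f), dec x)" and ?r = "(term1 K (cell_top K g), dec w)"
  have h: "homotopic K
      (?p \<cdot> cell_top K f \<cdot> ?q \<cdot> cell_top K g \<cdot> ?r,
        [(?p, f, ?q \<cdot> cell_top K g \<cdot> ?r), (?p \<cdot> cell_bot K f \<cdot> ?q, g, ?r)])
      (?p \<cdot> cell_top K f \<cdot> ?q \<cdot> cell_top K g \<cdot> ?r,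
        [(?p \<cdot> cell_top K f \<cdot> ?q, g, ?r), (?p, f, ?q \<cdot> cell_bot K g \<cdot> ?r)])"
    using c c2 f g by (intro homotopic.exchange) (auto simp: init1_def)
  have t: "?p \<cdot> cell_top K f \<cdot> ?q \<cdot> cell_top K g \<cdot> ?r = ?Q"
    using Q(1) e(3) by (simp add: cat1_def prod_eq_iff)
  have "homotopic K (cat2 ?\<delta> (?Q, [(?p, f, ?q \<cdot> cell_top K g \<cdot> ?r), (?p \<cdot> cell_bot K f \<cdot> ?q, g, ?r)]))
     (cat2 ?\<delta> (?Q, [(?p \<cdot> cell_top K f \<cdot> ?q, g, ?r), (?p, f, ?q \<cdot> cell_bot K g \<cdot> ?r)]))"
    using homotopic.cat[OF homotopic.refl[OF p(1)] h[unfolded t]] by (simp add: top2_def)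
  then show ?case by (simp add: cat2_def cat1_def)
qed

text \<open>
  This theorem replaces homotopy classes by states in all that follows.
\<close>

theorem homotopic_iff:
  assumes "is_path2 K \<delta>" "is_path2 K \<epsilon>"
  shows "homotopic K \<delta> \<epsilon> \<longleftrightarrow> fst \<delta> = fst \<epsilon> \<and> st \<delta> = st \<epsilon>"
proof
  assume *: "fst \<delta> = fst \<epsilon> \<and> st \<delta> = st \<epsilon>"
  obtain v es ds where d: "\<delta> = ((v, es), ds)" by (metis prod.collapse)
  obtain ds' where e: "\<epsilon> = ((v, es), ds')" using * d by (metis fst_conv prod.collapse)
  have "R.heq (enc es) (map E ds) (map E ds')"
    using * path2_E(2)[OF assms(1)[unfolded d]] path2_E(2)[OF assms(2)[unfolded e]] unfolding d e st_def
    by (intro R.run_eq_imp_heq) auto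
  from heq_homotopic[OF this path2_E(1)[OF assms(1)[unfolded d]]]
  show "homotopic K \<delta> \<epsilon>"
    using path2_E(6)[OF assms(1)[unfolded d]] path2_E(6)[OF assms(2)[unfolded e]] d e by simp
qed (use homotopic_sound in blast)

end

section \<open>Moves in a context\<close>

context rewriting_system
begin

lemma valid_rev: "valid q ms \<Longrightarrow> valid (endw q ms) (rev (map rvm ms)) \<and> endw (endw q ms) (rev (map rvm ms)) = q"
  by (induction q ms rule: valid.induct) auto

fun ctx :: "'l list \<Rightarrow> 'l list \<Rightarrow> 'l list \<times> 'f \<times> 'l list \<Rightarrow> 'l list \<times> 'f \<times> 'l list" where
  "ctx a b (u, f, v) = (a @ u, f, v @ b)"

lemma valid_ctx: "valid q ms \<Longrightarrow> valid (a @ q @ b) (map (ctx a b) ms) \<and> endw (a @ q @ b) (map (ctx a b) ms) = a @ endw q ms @ b"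
  by (induction q ms rule: valid.induct) auto

lemma run_ctx:
  "valid (labs s) ms \<Longrightarrow> wfs q s \<Longrightarrow> length l = length a \<Longrightarrow> run (map (ctx a b) ms) (l @ s @ r) = l @ run ms s @ r"
proof (induction ms arbitrary: s)
  case (Cons m ms)
  obtain u f v where m: "m = (u, f, v)" by (cases m)
  with Cons.prems have *: "f \<in> C" "labs s = u @ lhs f @ v" "valid (u @ rhs f @ v) ms" by auto
  note mv = move_wf[OF Cons.prems(2) *(2,1)]
  from splitE[OF *(2) Cons.prems(2)] obtain l1 t r1 where
    s: "s = l1 @ t @ r1" "labs l1 = u" "labs t = lhs f" by metis
  have len: "length l1 = length u" "length t = length (lhs f)" using s by (metis length_map)+
  have "move (ctx a b m) (l @ s @ r) = l @ move m s @ r"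
    using move_eq[of "l @ l1" "a @ u" t f "v @ b" "r1 @ r"] move_eq[of l1 u t f v r1] len Cons.prems(3) s(1) m
    by (simp del: move.simps)
  moreover have "run (map (ctx a b) ms) (l @ move m s @ r) = l @ run ms (move m s) @ r"
    using Cons.IH[of "move m s"] mv *(3) m Cons.prems(3) by (simp del: move.simps)
  ultimately show ?case by (simp del: move.simps ctx.simps)
qed simp

lemma run_sh:
  "valid (labs s) ms \<Longrightarrow> wfs q s \<Longrightarrow> run ms (map (sh n) s) = map (sh n) (run ms s)"
proof (induction ms arbitrary: s)
  case (Cons m ms)
  obtain u f v where m: "m = (u, f, v)" by (cases m)
  with Cons.prems have *: "f \<in> C" "labs s = u @ lhs f @ v" "valid (u @ rhs f @ v) ms" by auto
  note mv = move_wf[OF Cons.prems(2) *(2,1)]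
  have "move m (map (sh n) s) = map (sh n) (move m s)"
    using m flip_sh[OF *(1)] by (simp add: take_map drop_map)
  moreover have "run ms (map (sh n) (move m s)) = map (sh n) (run ms (move m s))"
    using Cons.IH[of "move m s"] mv *(3) m by (simp del: move.simps)
  ultimately show ?case by (simp del: move.simps)
qed simp

lemma ssum_tl:
  assumes "word p" "word q" "reach p z" "reach q w"
  shows "z \<oplus> w = z @ tl (map (sh (length p - 1)) w)"
proof -
  have z: "z \<noteq> []" "last z = Base (length p - 1) star" using reach_last[OF assms(1,3)] by auto
  have w: "w \<noteq> []" "hd w = Base 0 star" using word_ends[OF assms(2,4)] by auto
  then have e: "map (sh (length p - 1)) w = Base (length p - 1) star # tl (map (sh (length p - 1)) w)"
    by (cases w) auto
  have "z \<oplus> w = butlast z @ Base (length p - 1) star # tl (map (sh (length p - 1)) w)"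
    unfolding ssum_eq[OF assms(1,3)] using e by metis
  also have "\<dots> = (butlast z @ [last z]) @ tl (map (sh (length p - 1)) w)" using z(2) by simp
  also have "butlast z @ [last z] = z" using z(1) by simp
  finally show ?thesis .
qed

text \<open>
  Moves in the middle of a word act on the middle summand of the initial state.
\<close>

lemma run_ctx_ssum:
  assumes p: "word p" and q: "word q" and r: "word r" and ms: "valid q ms"
  shows "run (map (ctx (butlast p) (tl r)) ms) (base (p \<Join> q \<Join> r)) = base p \<oplus> (run ms (base q) \<oplus> base r)"
proof -
  let ?z = "run ms (base q)" and ?n = "length p - 1" and ?T = "map (sh (length p - 1)) (tl (map (sh (length q - 1)) (base r)))"
  have z: "reach q ?z" using ms reach_iff_run by blast
  have e: "base p \<oplus> (y \<oplus> base r) = butlast (base p) @ map (sh ?n) y @ ?T" if "reach q y" for y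
    using ssum_tl[OF q r that reach_base] ssum_eq[OF p reach_base] by simp
  have "base (p \<Join> q \<Join> r) = base p \<oplus> (base q \<oplus> base r)"
    using base_ssum[OF p word_join[OF q r]] base_ssum[OF q r] by simp
  then have b: "base (p \<Join> q \<Join> r) = butlast (base p) @ map (sh ?n) (base q) @ ?T" using e[OF reach_base] by simp
  have wf: "wfs (p \<Join> q) (map (sh ?n) (base q))" using wf_join_right[of q _ p] wfs_base[of q] by auto
  have v: "valid (labs (map (sh ?n) (base q))) ms" unfolding labs_sh by (simp add: ms)
  have "run (map (ctx (butlast p) (tl r)) ms) (base (p \<Join> q \<Join> r)) = butlast (base p) @ run ms (map (sh ?n) (base q)) @ ?T"
    unfolding b by (rule run_ctx[OF v wf]) simp
  also have "run ms (map (sh ?n) (base q)) = map (sh ?n) ?z"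
    using run_sh[OF _ wfs_base, of q ms] ms by simp
  finally show ?thesis using e[OF z] by simp
qed

lemma Psi_unit:
  assumes "blocks bs" "i < length bs" "bs ! i = (p, B)"
  shows "base (bword (take i bs)) \<oplus> (pw p B k \<oplus> base (bword (drop (Suc i) bs))) =
    Psi bs (map (\<lambda>j. if j = i then k else 0) [0..<length bs])"
proof -
  let ?a = "take i bs" and ?b = "drop (Suc i) bs"
  have bs: "bs = ?a @ (p, B) # ?b" using assms(2,3) by (metis id_take_nth_drop)
  then have "blocks (?a @ (p, B) # ?b)" using assms(1) by simp
  then have ab: "blocks ?a" "blocks ((p, B) # ?b)" "blocks ?b" by simp_all
  have len: "length ?a = i" "length ?b = length bs - Suc i" using assms(2) by auto
  have ks: "map (\<lambda>j. if j = i then k else 0) [0..<length bs] =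
     replicate (length ?a) 0 @ k # replicate (length ?b) 0"
    using assms(2) by (intro nth_equalityI) (auto simp: nth_append nth_Cons')
  have "Psi (?a @ (p, B) # ?b) (replicate (length ?a) 0 @ k # replicate (length ?b) 0)
     = Psi ?a (replicate (length ?a) 0) \<oplus> Psi ((p, B) # ?b) (k # replicate (length ?b) 0)"
    by (rule Psi_append[OF ab(1,2)]) simp
  also have "\<dots> = base (bword ?a) \<oplus> (pw p B k \<oplus> base (bword ?b))"
    using Psi_zero[OF ab(1)] Psi_zero[OF ab(3)] by simp
  finally show ?thesis unfolding ks using bs by metis
qed

end

context directed_2_complex
begin

section \<open>Inverse 2-paths\<close>

lemma E_inv: "E (atom_inv K d) = R.rvm (E d)"
  by (cases d) (simp add: atom_inv_def)

lemma path2_atoms: "is_path2 K (P, ds) \<Longrightarrow> x \<in> set ds \<Longrightarrow> is_atom K x"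
proof (induction ds arbitrary: P)
  case (Cons d ds)
  then have "is_path2 K (atom_bot K d, ds)" "is_atom K d" by auto
  with Cons.IH[of "atom_bot K d"] Cons.prems(2) show ?case by auto
qed simp

text \<open>
  The states of a 2-path and of its inverse compose to the trivial state, as the reversed moves
  undo each other one by one.
\<close>

lemma inv2_path:
  assumes "is_path2 K \<delta>"
  shows "is_path2 K (inv2 K \<delta>)" "bot2 K (inv2 K \<delta>) = fst \<delta>" "fst (inv2 K \<delta>) = bot2 K \<delta>"
    "R.comp_state (st \<delta>) (st (inv2 K \<delta>)) = R.base (enc (snd (fst \<delta>)))" "inv2 K (inv2 K \<delta>) = \<delta>"
proof -
  obtain v es ds where d: "\<delta> = ((v, es), ds)" by (metis prod.collapse)
  note P = path2_E[OF assms[unfolded d]]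
  let ?ms = "map E ds" and ?Q = "bot2 K \<delta>"
  have Q: "?Q = (v, snd ?Q)" using bot2_pair assms d by blast
  have vr: "R.valid (enc (snd ?Q)) (rev (map R.rvm ?ms))" "R.endw (enc (snd ?Q)) (rev (map R.rvm ?ms)) = enc es"
    using R.valid_rev[OF P(2)] P(3) d by simp_all
  have cells: "fst (snd x) \<in> cells K" if "x \<in> set ds" for x
    using path2_atoms[OF assms[unfolded d] that] by (auto simp: is_atom_def split: prod.splits)
  have Einv: "map E (rev (map (atom_inv K) ds)) = rev (map R.rvm ?ms)" by (simp add: rev_map E_inv)
  have "D v (R.rvm (E x)) = atom_inv K (D v (E x))" if "x \<in> set ds" for x
    using cells[OF that] top_inv term_eq by (cases x) (simp add: atom_inv_def)
  then have "map (D v) (rev (map R.rvm ?ms)) = rev (map (atom_inv K) (map (D v) ?ms))"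
    by (simp add: rev_map)
  also have "\<dots> = rev (map (atom_inv K) ds)" using P(6) by simp
  finally have Dinv: "map (D v) (rev (map R.rvm ?ms)) = rev (map (atom_inv K) ds)" .
  have i: "inv2 K \<delta> = (?Q, rev (map (atom_inv K) ds))" using d by (simp add: inv2_def)
  have "is_path1 K (v, snd ?Q)" using path2_bot[OF assms] Q by metis
  from path2_D(1)[OF this vr(1)] Dinv i Q show ip: "is_path2 K (inv2 K \<delta>)" by metis
  show "fst (inv2 K \<delta>) = bot2 K \<delta>" using i by simp
  have "enc (snd (bot2 K (inv2 K \<delta>))) = enc es"
    using path2_E(3)[OF ip[unfolded i]] i vr(2) Einv by simp
  moreover have "fst (bot2 K (inv2 K \<delta>)) = v" using bot2_fst[OF ip] i Q by (metis fst_conv)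
  ultimately show bi: "bot2 K (inv2 K \<delta>) = fst \<delta>" using d by (metis enc_inject fst_conv prod.collapse)
  have "st (cat2 \<delta> (inv2 K \<delta>)) = R.comp_state (st \<delta>) (st (inv2 K \<delta>))"
    by (rule st_cat[OF assms ip]) (simp add: i)
  moreover have "st (cat2 \<delta> (inv2 K \<delta>)) = R.run (rev (map R.rvm ?ms)) (R.run ?ms (R.base (enc es)))"
    using d i Einv by (simp add: st_def cat2_def)
  moreover have "\<dots> = R.base (enc es)" using R.run_undo[OF R.wfs_base, of "enc es" ?ms] P(2) by simp
  ultimately show "R.comp_state (st \<delta>) (st (inv2 K \<delta>)) = R.base (enc (snd (fst \<delta>)))" using d by simp
  have "atom_inv K (atom_inv K x) = x" if "x \<in> set ds" for x
    using cells[OF that] inv_inv by (cases x) (simp add: atom_inv_def)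
  then have "map (atom_inv K) (map (atom_inv K) ds) = ds" by (simp add: map_idI)
  then have "snd (inv2 K (inv2 K \<delta>)) = ds" using i by (simp add: inv2_def rev_map[symmetric] del: map_map)
  moreover have "fst (inv2 K (inv2 K \<delta>)) = (v, es)" using bi d by (simp add: inv2_def)
  ultimately show "inv2 K (inv2 K \<delta>) = \<delta>" using d by (metis prod.collapse snd_conv)
qed

section \<open>The diagram groupoid as a groupoid of states\<close>

text \<open>
  The homotopy class with top \<open>P\<close> and state \<open>z\<close>.
\<close>

definition cls :: "('v, 'e) path1 \<Rightarrow> ('e option, 'f) item list \<Rightarrow> ('v, 'e, 'f) path2 set" where
  "cls P z = {\<delta>. is_path2 K \<delta> \<and> fst \<delta> = P \<and> st \<delta> = z}"

lemma hclass_cls: "is_path2 K \<delta> \<Longrightarrow> hclass K \<delta> = cls (fst \<delta>) (st \<delta>)"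
proof -
  assume d: "is_path2 K \<delta>"
  have "homotopic K \<delta> \<epsilon> \<longleftrightarrow> is_path2 K \<epsilon> \<and> fst \<epsilon> = fst \<delta> \<and> st \<epsilon> = st \<delta>"
    for \<epsilon> using homotopic_iff[OF d, of \<epsilon>] homotopic_sound[of \<delta> \<epsilon>] by metis
  then show ?thesis unfolding hclass_def cls_def by blast
qed

lemma cls_nonempty:
  assumes "is_path1 K P" "R.reach (enc (snd P)) z"
  obtains \<delta> where "\<delta> \<in> cls P z"
proof -
  from assms(2) obtain ms where ms: "R.valid (enc (snd P)) ms" "R.run ms (R.base (enc (snd P))) = z"
    using R.reach_iff_run by blast
  obtain v es where P: "P = (v, es)" by (cases P)
  from path2_D[of v es ms] assms(1) ms P have "((v, es), map (D v) ms) \<in> cls P z"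
    by (simp add: cls_def st_def)
  with that show ?thesis .
qed

lemma cls_inject:
  assumes "is_path1 K P" "R.reach (enc (snd P)) z"
  shows "cls P z = cls P z' \<longleftrightarrow> z = z'"
  using cls_nonempty[OF assms] by (auto simp: cls_def)

lemma cls_bot:
  assumes "\<delta> \<in> cls P z" "R.labs z = enc (snd Q)" "fst Q = fst P"
  shows "bot2 K \<delta> = Q"
proof -
  have d: "is_path2 K \<delta>" "fst \<delta> = P" "st \<delta> = z" using assms(1) by (auto simp: cls_def)
  have "enc (snd (bot2 K \<delta>)) = enc (snd Q)" using st_labs[OF d(1)] d(3) assms(2) by simp
  moreover have "fst (bot2 K \<delta>) = fst Q" using bot2_fst[OF d(1)] d(2) assms(3) by simp
  ultimately show ?thesis by (simp add: prod_eq_iff)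
qed

lemma cls_hom:
  assumes "is_path1 K P" "R.reach (enc (snd P)) z" "R.labs z = enc (snd Q)" "fst Q = fst P"
  shows "cls P z \<in> groupoid_hom K P Q"
proof -
  from cls_nonempty[OF assms(1,2)] obtain \<delta> where d: "\<delta> \<in> cls P z" .
  then have "is_path2 K \<delta>" "fst \<delta> = P" "st \<delta> = z" by (auto simp: cls_def)
  then show ?thesis using hclass_cls[of \<delta>] cls_bot[OF d assms(3,4)] unfolding groupoid_hom_def top2_def by blast
qed

lemma hom_cls:
  assumes "A \<in> groupoid_hom K P Q"
  obtains z where "R.reach (enc (snd P)) z" "R.labs z = enc (snd Q)" "A = cls P z"
proof -
  from assms obtain \<delta> where d: "A = hclass K \<delta>" "is_path2 K \<delta>" "fst \<delta> = P" "bot2 K \<delta> = Q"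
    by (auto simp: groupoid_hom_def top2_def)
  then show ?thesis using that[of "st \<delta>"] hclass_cls st_reach st_labs by metis
qed

lemma gcomp_cls:
  assumes P: "is_path1 K P" and a: "R.reach (enc (snd P)) a" "R.labs a = enc (snd Q)" "fst Q = fst P"
    and b: "R.reach (enc (snd Q)) b"
  shows "gcomp K (cls P a) (cls Q b) = cls P (R.comp_state a b)"
proof -
  have each: "hclass K (cat2 \<delta> \<epsilon>) = cls P (R.comp_state a b)" if "\<delta> \<in> cls P a" "\<epsilon> \<in> cls Q b" for \<delta> \<epsilon>
  proof -
    have d: "is_path2 K \<delta>" "fst \<delta> = P" "st \<delta> = a" and e: "is_path2 K \<epsilon>" "fst \<epsilon> = Q" "st \<epsilon> = b"
      using that by (auto simp: cls_def)
    have bd: "bot2 K \<delta> = fst \<epsilon>" using cls_bot[OF that(1) a(2,3)] e(2) by simp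
    show ?thesis
      using hclass_cls[OF path2_cat(1)[OF d(1) e(1) bd]] st_cat[OF d(1) e(1) bd] d e by (simp add: cat2_def)
  qed
  from cls_nonempty[OF P a(1)] obtain \<delta> where d: "\<delta> \<in> cls P a" .
  have "is_path1 K Q" using cls_bot[OF d a(2,3)] d path2_bot[of \<delta>] by (simp add: cls_def)
  from cls_nonempty[OF this b] obtain \<epsilon> where e: "\<epsilon> \<in> cls Q b" .
  show ?thesis unfolding gcomp_def using each d e by auto
qed

lemma ginv_cls:
  assumes P: "is_path1 K P" and a: "R.reach (enc (snd P)) a" "R.labs a = enc (snd Q)" "fst Q = fst P"
    and a': "R.reach (enc (snd Q)) a'" "R.comp_state a a' = R.base (enc (snd P))"
  shows "ginv K (cls P a) = cls Q a'"
proof -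
  have each: "hclass K (inv2 K \<delta>) = cls Q a'" if "\<delta> \<in> cls P a" for \<delta>
  proof -
    have d: "is_path2 K \<delta>" "fst \<delta> = P" "st \<delta> = a" using that by (auto simp: cls_def)
    note i = inv2_path[OF d(1)]
    have f: "fst (inv2 K \<delta>) = Q" using i(3) cls_bot[OF that a(2,3)] by simp
    have "R.reach (enc (snd Q)) (st (inv2 K \<delta>))" using st_reach[OF i(1)] f by simp
    moreover have "R.comp_state a (st (inv2 K \<delta>)) = R.comp_state a a'" using i(4) d a'(2) by simp
    ultimately have "st (inv2 K \<delta>) = a'"
      using R.comp_inject[OF a(1)] R.reach_wfs[OF a'(1)] R.reach_wfs a(2) by metis
    then show ?thesis using hclass_cls[OF i(1)] f by simp
  qed
  from cls_nonempty[OF P a(1)] obtain \<delta> where "\<delta> \<in> cls P a" .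
  then show ?thesis unfolding ginv_def using each by auto
qed

lemma diag_carrier:
  assumes "is_path1 K P"
  shows "carrier (diagram_group K P) = cls P ` carrier (R.Grp (enc (snd P)))"
proof -
  have "A \<in> groupoid_hom K P P \<longleftrightarrow> A \<in> cls P ` carrier (R.Grp (enc (snd P)))" for A
  proof
    assume "A \<in> groupoid_hom K P P"
    from hom_cls[OF this] obtain z where "R.reach (enc (snd P)) z" "R.labs z = enc (snd P)" "A = cls P z" .
    then show "A \<in> cls P ` carrier (R.Grp (enc (snd P)))" by (simp add: R.Grp_carrier)
  next
    assume "A \<in> cls P ` carrier (R.Grp (enc (snd P)))"
    then obtain z where "z \<in> carrier (R.Grp (enc (snd P)))" "A = cls P z" by blast
    then show "A \<in> groupoid_hom K P P" using cls_hom[OF assms, of z P] by (simp add: R.Grp_carrier)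
  qed
  then show ?thesis unfolding diagram_group_def by auto
qed

lemma diag_mult:
  assumes "is_path1 K P" "a \<in> carrier (R.Grp (enc (snd P)))" "b \<in> carrier (R.Grp (enc (snd P)))"
  shows "cls P a \<otimes>\<^bsub>diagram_group K P\<^esub> cls P b = cls P (R.comp_state a b)"
  using gcomp_cls[of P a P b] assms by (simp add: diagram_group_def R.Grp_carrier)

lemma cls_iso:
  assumes "is_path1 K P"
  shows "cls P \<in> iso (R.Grp (enc (snd P))) (diagram_group K P)"
proof (rule isoI)
  show "cls P \<in> hom (R.Grp (enc (snd P))) (diagram_group K P)"
    using diag_carrier[OF assms] diag_mult[OF assms] by (intro homI) auto
  show "bij_betw (cls P) (carrier (R.Grp (enc (snd P)))) (carrier (diagram_group K P))"
    unfolding bij_betw_def diag_carrier[OF assms]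
    using cls_inject[OF assms] by (auto simp: inj_on_def R.Grp_carrier)
qed

lemma diag_one: "is_path1 K P \<Longrightarrow> \<one>\<^bsub>diagram_group K P\<^esub> = cls P (R.base (enc (snd P)))"
  using hclass_cls[of "(P, [])"] by (simp add: diagram_group_def)

lemma group_diagram_group:
  assumes "is_path1 K P"
  shows "group (diagram_group K P)"
proof (rule groupI)
  let ?G = "R.Grp (enc (snd P))" and ?H = "diagram_group K P"
  interpret G: group ?G by (rule R.group_Grp)
  note c = diag_carrier[OF assms] and m = diag_mult[OF assms] and o = diag_one[OF assms]
  have cl: "R.comp_state a b \<in> carrier ?G" if "a \<in> carrier ?G" "b \<in> carrier ?G" for a b
    using G.m_closed[OF that] by simp
  have one: "R.base (enc (snd P)) \<in> carrier ?G" using G.one_closed by simp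
  show "\<one>\<^bsub>?H\<^esub> \<in> carrier ?H" unfolding c o using one by blast
  fix x y z assume "x \<in> carrier ?H" "y \<in> carrier ?H" "z \<in> carrier ?H"
  then obtain a b d where a: "a \<in> carrier ?G" "x = cls P a" and b: "b \<in> carrier ?G" "y = cls P b"
    and d: "d \<in> carrier ?G" "z = cls P d" unfolding c by blast
  show "x \<otimes>\<^bsub>?H\<^esub> y \<in> carrier ?H" using a b m cl unfolding c by blast
  show "x \<otimes>\<^bsub>?H\<^esub> y \<otimes>\<^bsub>?H\<^esub> z = x \<otimes>\<^bsub>?H\<^esub> (y \<otimes>\<^bsub>?H\<^esub> z)"
    unfolding a(2) b(2) d(2) m[OF a(1) b(1)] m[OF b(1) d(1)] m[OF cl[OF a(1) b(1)] d(1)] m[OF a(1) cl[OF b(1) d(1)]]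
    using G.m_assoc[OF a(1) b(1) d(1)] by (simp del: map_map)
  show "\<one>\<^bsub>?H\<^esub> \<otimes>\<^bsub>?H\<^esub> x = x" unfolding o a(2) m[OF one a(1)] using G.l_one[OF a(1)] by simp
  have "inv\<^bsub>?G\<^esub> a \<in> carrier ?G" using a(1) by simp
  then show "\<exists>y\<in>carrier ?H. y \<otimes>\<^bsub>?H\<^esub> x = \<one>\<^bsub>?H\<^esub>"
    unfolding c o a(2) using m[OF _ a(1)] G.l_inv[OF a(1)] by (intro bexI[of _ "cls P (inv\<^bsub>?G\<^esub> a)"]) auto
qed

end

section \<open>The complexes carrying free abelian groups\<close>

lemma S_cas: "i \<le> n \<Longrightarrow> pre_digraph.cas (under_graph (S_complex m)) i [i..<n] n"
proof (induction "n - i" arbitrary: i)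
  case 0
  then show ?case by (simp add: pre_digraph.cas.simps)
next
  case (Suc k)
  then have "[i..<n] = i # [Suc i..<n]" by (simp add: upt_conv_Cons)
  then show ?case using Suc.hyps(1)[of "Suc i"] Suc.hyps(2) by (simp add: pre_digraph.cas.simps S_complex_def)
qed

lemma S_awalk: "i \<le> n \<Longrightarrow> n \<le> m \<Longrightarrow> pre_digraph.awalk (under_graph (S_complex m)) i [i..<n] n"
  unfolding pre_digraph.awalk_def using S_cas[of i n m] by (auto simp: S_complex_def)

lemma S_wf: "wf_digraph (under_graph (S_complex m))"
  by unfold_locales (auto simp: S_complex_def)

lemma S_path: "i \<le> n \<Longrightarrow> n \<le> m \<Longrightarrow> is_path1 (S_complex m) (i, [i..<n])"
  using S_awalk by (auto simp: is_path1_def)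

lemma S_single: "i < m \<Longrightarrow> is_path1 (S_complex m) (i, [i])"
  using S_path[of i "Suc i" m] by simp

lemma S_term: "term1 (S_complex m) (i, [i]) = Suc i"
  by (simp add: term1_def pre_digraph.awalk_verts.simps S_complex_def)

lemma S_complex_is_complex: "directed_2_complex (S_complex m)"
proof (rule directed_2_complex.intro)
  show "wf_digraph (under_graph (S_complex m))" by (rule S_wf)
  fix f assume f: "f \<in> cells (S_complex m)"
  then obtain i b where i: "f = (i, b)" "i < m" by (auto simp: S_complex_def)
  have *: "cell_top (S_complex m) f = (i, [i])" "cell_bot (S_complex m) f = (i, [i])"
    "cell_inv (S_complex m) f = (i, \<not> b)" using i by (auto simp: S_complex_def)
  show "is_path1 (S_complex m) (cell_top (S_complex m) f) \<and> nonempty1 (cell_top (S_complex m) f)"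
    "is_path1 (S_complex m) (cell_bot (S_complex m) f) \<and> nonempty1 (cell_bot (S_complex m) f)"
    "init1 (cell_top (S_complex m) f) = init1 (cell_bot (S_complex m) f)"
    "term1 (S_complex m) (cell_top (S_complex m) f) = term1 (S_complex m) (cell_bot (S_complex m) f)"
    using * S_single[OF i(2)] by (auto simp: nonempty1_def)
  show "cell_inv (S_complex m) f \<in> cells (S_complex m)" "cell_inv (S_complex m) f \<noteq> f"
    "cell_inv (S_complex m) (cell_inv (S_complex m) f) = f"
    "cell_top (S_complex m) (cell_inv (S_complex m) f) = cell_bot (S_complex m) f"
    "cell_bot (S_complex m) (cell_inv (S_complex m) f) = cell_top (S_complex m) f"
    using i by (auto simp: S_complex_def)
qed

lemma w_path_is_path: "is_path1 (S_complex m) (w_path m)"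
  using S_path[of 0 m m] by (simp add: w_path_def)

text \<open>
  In the simple path there is a single place at which the cells along a given edge can be
  applied, and their application changes nothing.
\<close>

lemma S_atom:
  assumes "is_atom (S_complex m) d" "atom_top (S_complex m) d = w_path m"
  obtains i b where "i < m" "d = ((0, [0..<i]), (i, b), (Suc i, [Suc i..<m]))"
    "atom_bot (S_complex m) d = w_path m"
proof -
  obtain p i b q where d: "d = (p, (i, b), q)" by (metis prod.collapse)
  then have i: "i < m" and q: "fst q = Suc i"
    using assms(1) S_term by (auto simp: is_atom_def S_complex_def init1_def)
  have t: "cell_top (S_complex m) (i, b) = (i, [i])" "cell_bot (S_complex m) (i, b) = (i, [i])"
    by (auto simp: S_complex_def)
  have e: "fst p = 0" "snd p @ [i] @ snd q = [0..<m]"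
    using assms(2) d t by (auto simp: atom_top_def cat1_def w_path_def)
  have len: "length (snd p) < m" using arg_cong[OF e(2), of length] by simp
  have "[0..<m] ! length (snd p) = i" unfolding e(2)[symmetric] by simp
  then have li: "length (snd p) = i" using len by simp
  have "snd p = take i [0..<m]" "snd q = drop (Suc i) [0..<m]"
    unfolding e(2)[symmetric] using li by auto
  then have "p = (0, [0..<i])" "q = (Suc i, [Suc i..<m])" using e(1) q i by (auto simp: prod_eq_iff take_upt drop_upt)
  moreover have "atom_bot (S_complex m) d = w_path m"
    using assms(2) d t by (simp add: atom_top_def atom_bot_def)
  ultimately show ?thesis using that i d by blast
qed

text \<open>
  The exponent sum of the cells along edge \<open>i\<close>, which is invariant under homotopy.
\<close>

fun cnt :: "(nat, nat, nat \<times> bool) atom list \<Rightarrow> nat \<Rightarrow> int" where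
  "cnt [] i = 0"
| "cnt ((p, (j, b), q) # ds) i = (if j = i then (if b then 1 else - 1) else 0) + cnt ds i"

lemma cnt_append: "cnt (ds @ ds') i = cnt ds i + cnt ds' i"
  by (induction ds i rule: cnt.induct) auto

lemma cnt_homotopic: "homotopic (S_complex m) \<delta> \<epsilon> \<Longrightarrow> cnt (snd \<delta>) i = cnt (snd \<epsilon>) i"
proof (induction rule: homotopic.induct)
  case (cat \<delta> \<delta>' \<epsilon> \<epsilon>')
  then show ?case by (simp add: cat2_def cnt_append)
next
  case (cancel d)
  then show ?case by (cases d) (auto simp: atom_inv_def S_complex_def)
next
  case (exchange p q r f g)
  then show ?case by (cases f; cases g) auto
qed auto

section \<open>Morphisms of standard complexes\<close>

context directed_2_complex
begin

text \<open>
  A morphism multiplies the image of a cell on both sides by 1-paths; on states this is the sum with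
  trivial states. The vertex \<open>w\<close> is arbitrary, since the product of 1-paths ignores the initial vertex
  of the second factor.
\<close>

lemma ctx_path2:
  fixes w :: 'v
  assumes d: "is_path2 K ((v, es), ds)" "bot2 K ((v, es), ds) = (v, es)"
    and P: "is_path1 K (v0, a @ es @ b)"
  defines "ds' \<equiv> map (\<lambda>(x, g, y). ((v0, a) \<cdot> x, g, y \<cdot> (w, b))) ds"
  shows "is_path2 K ((v0, a @ es @ b), ds')" "bot2 K ((v0, a @ es @ b), ds') = (v0, a @ es @ b)"
    "st ((v0, a @ es @ b), ds') = R.ssum (R.base (enc a)) (R.ssum (st ((v, es), ds)) (R.base (enc b)))"
proof -
  note e = path2_E[OF d(1)]
  let ?ms = "map E ds" and ?P = "(v0, a @ es @ b)"
  let ?ms' = "map (R.ctx (butlast (enc a)) (tl (enc b))) ?ms"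
  have Ectx: "E ((v0, a) \<cdot> x, g, y \<cdot> (w, b)) = R.ctx (butlast (enc a)) (tl (enc b)) (E (x, g, y))" for x g y
    by (simp add: butlast_enc enc_append)
  then have E': "map E ds' = ?ms'" by (auto simp: ds'_def split: prod.splits)
  have word: "enc (a @ es @ b) = butlast (enc a) @ enc es @ tl (enc b)"
    using butlast_enc[of a "es @ b"] enc_append[of es b] by simp
  have v: "R.valid (enc (a @ es @ b)) ?ms'" "R.endw (enc (a @ es @ b)) ?ms' = enc (a @ es @ b)"
    using R.valid_ctx[of "enc es" ?ms "butlast (enc a)" "tl (enc b)"] e(2,3) d(2) word by simp_all
  have "D v0 (E ((v0, a) \<cdot> x, g, y \<cdot> (w, b))) = ((v0, a) \<cdot> x, g, y \<cdot> (w, b))" if "(x, g, y) \<in> set ds" for x g y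
  proof -
    have "D v (E (x, g, y)) = (x, g, y)" using e(6) that map_fixed[of "D v \<circ> E" ds "(x, g, y)"] by simp
    then show ?thesis by (cases y) (simp add: cat1_def)
  qed
  then have D': "map (D v0) (map E ds') = ds'" unfolding ds'_def by (auto simp: case_prod_beta')
  from path2_D(1)[OF P v(1)] show p: "is_path2 K (?P, ds')" using D' E' by simp
  have "enc (snd (bot2 K (?P, ds'))) = enc (a @ es @ b)" using path2_E(3)[OF p] v(2) E' by simp
  moreover have "fst (bot2 K (?P, ds')) = v0" using path2_E(4)[OF p] by simp
  ultimately show "bot2 K (?P, ds') = ?P" by (simp add: prod_eq_iff)
  have "enc (a @ es @ b) = R.join (enc a) (R.join (enc es) (enc b))"
    by (simp add: R.join_def butlast_enc)
  then have "R.run ?ms' (R.base (enc (a @ es @ b))) =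
      R.ssum (R.base (enc a)) (R.ssum (R.run ?ms (R.base (enc es))) (R.base (enc b)))"
    using R.run_ctx_ssum[OF word_enc word_enc word_enc, of es ?ms a b] e(2) by simp
  then show "st (?P, ds') = R.ssum (R.base (enc a)) (R.ssum (st ((v, es), ds)) (R.base (enc b)))"
    using E' by (simp add: st_def)
qed

definition pieces :: "('e option list \<times> ('e option, 'f) item list) list \<Rightarrow> 'e list" where
  "pieces bs = concat (map (\<lambda>(p, B). dec p) bs)"

lemma bword_pieces: "R.blocks bs \<Longrightarrow> R.bword bs = enc (pieces bs)"
proof (induction bs rule: R.bword.induct)
  case 1
  then show ?case by (simp add: pieces_def enc_def)
next
  case (2 p B bs)
  then have "enc (dec p) = p" using word_iff by simp
  then have "R.join p (enc (pieces bs)) = enc (dec p @ pieces bs)" using butlast_enc[of "dec p" "pieces bs"] by (simp add: R.join_def)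
  with 2 show ?case by (simp add: pieces_def)
qed

text \<open>
  \<open>\<phi>\<close> sends the edges of the standard path to the consecutive pieces of a 1-path and the cell along
  edge \<open>i\<close> to a 2-path representing the generator of the \<open>i\<close>th block.
\<close>

definition realizes ::
  "('e option list \<times> ('e option, 'f) item list) list \<Rightarrow> 'v \<Rightarrow>
   (nat, nat, nat \<times> bool, 'v, 'e, 'f) complex_map \<Rightarrow> bool" where
  "realizes bs v0 \<phi> \<longleftrightarrow> vmap \<phi> 0 = v0 \<and> (\<forall>i<length bs. \<forall>p B. bs ! i = (p, B) \<longrightarrow>
     snd (emap \<phi> i) = dec p \<and> (\<forall>b. is_path2 K (fmap \<phi> (i, b)) \<and> snd (fst (fmap \<phi> (i, b))) = dec p \<and>
       bot2 K (fmap \<phi> (i, b)) = fst (fmap \<phi> (i, b)) \<and> st (fmap \<phi> (i, b)) = R.pw p B (if b then 1 else - 1)))"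

lemma map_edges:
  assumes "realizes bs v0 \<phi>" "i \<le> j" "j \<le> length bs"
  shows "concat (map (\<lambda>e. snd (emap \<phi> e)) [i..<j]) = pieces (drop i (take j bs))"
proof -
  have "map (\<lambda>e. snd (emap \<phi> e)) [i..<j] = map (\<lambda>(p, B). dec p) (drop i (take j bs))"
    using assms by (intro nth_equalityI) (auto simp: realizes_def split: prod.splits)
  then show ?thesis by (simp add: pieces_def)
qed

lemma map1_w:
  assumes "realizes bs v0 \<phi>"
  shows "map1 \<phi> (w_path (length bs)) = (v0, pieces bs)"
  using map_edges[OF assms, of 0 "length bs"] assms by (simp add: map1_def w_path_def realizes_def)

text \<open>
  The image of a loop is determined by its exponent sums: each atomic factor contributes a generator
  or its inverse in its own block.
\<close>

lemma map2_state:
  assumes bs: "R.blocks bs" and r: "realizes bs v0 \<phi>" and P: "is_path1 K (v0, pieces bs)"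
    and "is_path2 (S_complex (length bs)) (w_path (length bs), ds)"
  shows "is_path2 K (map2 \<phi> (w_path (length bs), ds)) \<and>
    bot2 K (map2 \<phi> (w_path (length bs), ds)) = (v0, pieces bs) \<and>
    st (map2 \<phi> (w_path (length bs), ds)) = R.Psi bs (map (cnt ds) [0..<length bs])"
  using assms(4)
proof (induction ds)
  case Nil
  have e: "map (cnt []) [0..<length bs] = replicate (length bs) 0" by (intro nth_equalityI) auto
  show ?case unfolding e using map1_w[OF r] P R.Psi_zero[OF bs] bword_pieces[OF bs]
    by (simp add: map2_def)
next
  case (Cons d ds)
  let ?m = "length bs" and ?w = "w_path (length bs)" and ?P = "(v0, pieces bs)"
  have "is_atom (S_complex ?m) d" "atom_top (S_complex ?m) d = ?w" using Cons.prems by auto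
  from S_atom[OF this] obtain i b where
    d: "i < ?m" "d = ((0, [0..<i]), (i, b), (Suc i, [Suc i..<?m]))" "atom_bot (S_complex ?m) d = ?w" .
  then have IH: "is_path2 K (map2 \<phi> (?w, ds))" "bot2 K (map2 \<phi> (?w, ds)) = ?P"
    "st (map2 \<phi> (?w, ds)) = R.Psi bs (map (cnt ds) [0..<?m])" using Cons by auto
  obtain p B where pB: "bs ! i = (p, B)" by (cases "bs ! i")
  define k where "k = (if b then 1 else - 1 :: int)"
  have f: "is_path2 K (fmap \<phi> (i, b))" "snd (fst (fmap \<phi> (i, b))) = dec p"
    "bot2 K (fmap \<phi> (i, b)) = fst (fmap \<phi> (i, b))" "st (fmap \<phi> (i, b)) = R.pw p B k"
    using r d(1) pB by (auto simp: realizes_def k_def)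
  obtain v fs where fe: "fmap \<phi> (i, b) = ((v, dec p), fs)" using f(2) by (metis prod.collapse)
  let ?a = "pieces (take i bs)" and ?b = "pieces (drop (Suc i) bs)"
  have split: "bs = take i bs @ (p, B) # drop (Suc i) bs" using d(1) pB by (metis id_take_nth_drop)
  have pc: "pieces bs = ?a @ dec p @ ?b"
    by (subst split) (simp add: pieces_def)
  have m1: "map1 \<phi> (0, [0..<i]) = (v0, ?a)"
    using map_edges[OF r, of 0 i] d(1) r by (simp add: map1_def realizes_def)
  obtain w where m2: "map1 \<phi> (Suc i, [Suc i..<?m]) = (w, ?b)"
    using map_edges[OF r, of "Suc i" ?m] d(1) by (simp add: map1_def)
  have at: "map_atom \<phi> d = map (\<lambda>(x, g, y). ((v0, ?a) \<cdot> x, g, y \<cdot> (w, ?b))) fs"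
    using d(2) m1 m2 fe by (simp add: map_atom_def)
  have fp: "is_path2 K ((v, dec p), fs)" "bot2 K ((v, dec p), fs) = (v, dec p)" using f fe by auto
  note c = ctx_path2[OF fp P[unfolded pc], of w, folded at pc]
  have blk: "R.blocks (take i bs)" "R.blocks (drop (Suc i) bs)"
  proof -
    have "R.blocks (take i bs @ (p, B) # drop (Suc i) bs)" using bs split by simp
    then show "R.blocks (take i bs)" "R.blocks (drop (Suc i) bs)" by simp_all
  qed
  have "st (?P, map_atom \<phi> d) = R.Psi bs (map (\<lambda>j. if j = i then k else 0) [0..<?m])"
    using c(3) R.Psi_unit[OF bs d(1) pB, of k] bword_pieces[OF blk(1)] bword_pieces[OF blk(2)] f(4) fe by simp
  moreover have e: "map2 \<phi> (?w, d # ds) = cat2 (?P, map_atom \<phi> d) (map2 \<phi> (?w, ds))"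
    using map1_w[OF r] by (simp add: map2_def cat2_def)
  moreover have top: "bot2 K (?P, map_atom \<phi> d) = fst (map2 \<phi> (?w, ds))"
    using c(2) map1_w[OF r] by (simp add: map2_def)
  moreover have "map (cnt (d # ds)) [0..<?m] =
      map (\<lambda>(k, l). k + l) (zip (map (\<lambda>j. if j = i then k else 0) [0..<?m]) (map (cnt ds) [0..<?m]))"
    using d(2) by (intro nth_equalityI) (auto simp: k_def)
  ultimately show ?case
    using path2_cat[OF c(1) IH(1) top] st_cat[OF c(1) IH(1) top] IH(2,3) R.Psi_add[OF bs] by simp
qed

end

section \<open>Free abelian groups\<close>

text \<open>
  Rank by counting. The \<open>M\<^sup>n\<close> lattice points with coordinates in \<open>{0..<M}\<close> have different images,
  whose \<open>m\<close> coordinates range over at most \<open>(2C + 1) M\<close> values; for large \<open>M\<close> this forces \<open>n \<le> m\<close>.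
\<close>

lemma independent_vectors_le:
  fixes d :: "nat \<Rightarrow> nat \<Rightarrow> int"
  assumes inj: "\<And>x y. (\<forall>j<m. (\<Sum>i<n. x i * d i j) = (\<Sum>i<n. y i * d i j)) \<Longrightarrow> \<forall>i<n. x i = y i"
  shows "n \<le> m"
proof (rule ccontr)
  assume "\<not> n \<le> m"
  then have mn: "Suc m \<le> n" by simp
  \<comment> \<open>\<open>C\<close> bounds the sum of the absolute values of the coefficients in each coordinate, so the image
    of a point with coordinates in \<open>{0..<M}\<close> has coordinates between \<open>- C M\<close> and \<open>C M\<close>.\<close>
  define C where "C = nat (\<Sum>i<n. \<Sum>j<m. \<bar>d i j\<bar>)"
  define M where "M = (2 * C + 1) ^ m + 1"
  define X where "X = PiE {..<n} (\<lambda>_. {0..<int M})"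
  define Y where "Y = PiE {..<m} (\<lambda>_. {- int (C * M)..<int (C * M) + int M})"
  define \<kappa> where "\<kappa> x = (\<lambda>j\<in>{..<m}. \<Sum>i<n. x i * d i j)" for x
  have "inj_on \<kappa> X"
  proof (rule inj_onI)
    fix x y assume "x \<in> X" "y \<in> X" and e: "\<kappa> x = \<kappa> y"
    have "(\<Sum>i<n. x i * d i j) = (\<Sum>i<n. y i * d i j)" if "j < m" for j
      using fun_cong[OF e, of j] that by (simp add: \<kappa>_def)
    then have "\<forall>i<n. x i = y i" using inj by blast
    with \<open>x \<in> X\<close> \<open>y \<in> X\<close> show "x = y" unfolding X_def by (intro PiE_ext) auto
  qed
  moreover have "\<kappa> ` X \<subseteq> Y"
  proof
    fix z assume "z \<in> \<kappa> ` X"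
    then obtain x where x: "x \<in> X" "z = \<kappa> x" by blast
    have bound: "\<bar>\<Sum>i<n. x i * d i j\<bar> \<le> int (C * M)" if j: "j < m" for j
    proof -
      have "\<bar>\<Sum>i<n. x i * d i j\<bar> \<le> (\<Sum>i<n. \<bar>x i * d i j\<bar>)" by (rule sum_abs)
      also have "\<dots> \<le> (\<Sum>i<n. int M * (\<Sum>j<m. \<bar>d i j\<bar>))"
      proof (rule sum_mono)
        fix i assume i: "i \<in> {..<n}"
        then have "x i \<in> {0..<int M}" using x(1) unfolding X_def by (meson PiE_mem)
        then have "\<bar>x i\<bar> \<le> int M" by simp
        moreover have "\<bar>d i j\<bar> \<le> (\<Sum>j<m. \<bar>d i j\<bar>)" using j by (intro member_le_sum) auto
        ultimately show "\<bar>x i * d i j\<bar> \<le> int M * (\<Sum>j<m. \<bar>d i j\<bar>)"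
          by (auto simp: abs_mult intro!: mult_mono)
      qed
      also have "\<dots> = int M * (\<Sum>i<n. \<Sum>j<m. \<bar>d i j\<bar>)" by (simp add: sum_distrib_left)
      also have "\<dots> = int (C * M)" by (simp add: C_def sum_nonneg)
      finally show ?thesis .
    qed
    have "(\<Sum>i<n. x i * d i j) \<in> {- int (C * M)..<int (C * M) + int M}" if "j < m" for j
    proof -
      have "int M > 0" unfolding of_nat_0_less_iff M_def by simp
      with bound[OF that] show ?thesis unfolding atLeastLessThan_iff by linarith
    qed
    then show "z \<in> Y" using x(2) by (auto simp: Y_def \<kappa>_def)
  qed
  moreover have "finite Y" unfolding Y_def by (intro finite_PiE) auto
  ultimately have "card X \<le> card Y" by (metis card_inj_on_le)
  moreover have "card X = M ^ n" unfolding X_def by (simp add: card_PiE)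
  moreover have "card Y = (C * M + M + C * M) ^ m"
  proof -
    have "card {- int (C * M)..<int (C * M) + int M} = C * M + M + C * M"
      by (simp only: card_atLeastLessThan_int)
    then show ?thesis unfolding Y_def by (simp add: card_PiE)
  qed
  moreover have "C * M + M + C * M = (2 * C + 1) * M" by (simp add: algebra_simps)
  ultimately have "M ^ n \<le> (2 * C + 1) ^ m * M ^ m" by (simp only: power_mult_distrib)
  moreover have "M ^ Suc m \<le> M ^ n" using mn by (intro power_increasing) (auto simp: M_def)
  ultimately have "M * M ^ m \<le> (2 * C + 1) ^ m * M ^ m" unfolding power_Suc by (rule order_trans[rotated])
  then have "M \<le> (2 * C + 1) ^ m" by (simp add: M_def)
  then show False by (simp add: M_def)
qed

lemma Z_pow_simps:
  "x \<in> carrier (Z_pow n) \<longleftrightarrow> x \<in> PiE {..<n} (\<lambda>_. UNIV)"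
  "x \<otimes>\<^bsub>Z_pow n\<^esub> y = (\<lambda>i\<in>{..<n}. x i + y i)"
  "\<one>\<^bsub>Z_pow n\<^esub> = (\<lambda>i\<in>{..<n}. 0)"
  by (simp_all add: Z_pow_def product_group_def integer_group_def)

lemma group_Z_pow: "group (Z_pow n)"
  unfolding Z_pow_def by (rule product_group) (rule group_integer_group)

context rewriting_system
begin

lemma Psi_pw:
  assumes bs: "blocks bs" and len: "length ks = length bs"
  shows "pw (bword bs) (Psi bs ks) t = Psi bs (map (\<lambda>k. t * k) ks)"
proof (rule pw_unique[symmetric, OF Psi_carrier[OF bs]])
  have "map (\<lambda>k. 0 * k) ks = replicate (length bs) 0" using len by (intro nth_equalityI) auto
  then show "Psi bs (map (\<lambda>k. 0 * k) ks) = base (bword bs)" using Psi_zero[OF bs] by simp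
  fix i
  show "Psi bs (map (\<lambda>k. i * k) ks) \<in> carrier (Grp (bword bs))" by (rule Psi_carrier[OF bs])
  have "map (\<lambda>k. (i + 1) * k) ks = map (\<lambda>(k, l). k + l) (zip (map (\<lambda>k. i * k) ks) ks)"
    by (intro nth_equalityI) (auto simp: algebra_simps)
  then show "Psi bs (map (\<lambda>k. (i + 1) * k) ks) = Psi bs (map (\<lambda>k. i * k) ks) \<odot> Psi bs ks"
    using Psi_add[OF bs, of "map (\<lambda>k. i * k) ks" ks] len by simp
qed

lemma inverse_carrier:
  assumes "B \<in> carrier (Grp p)" "C' \<in> carrier (Grp p)" "B \<odot> C' = base p"
  shows "C' = pw p B (- 1)"
proof -
  interpret group "Grp p" by (rule group_Grp)
  have "B \<odot> pw p B (- 1) = base p" using pw_add[OF assms(1), of 1 "- 1"] assms(1) by simp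
  then have "B \<otimes>\<^bsub>Grp p\<^esub> C' = B \<otimes>\<^bsub>Grp p\<^esub> pw p B (- 1)" using assms(3) by simp
  then show ?thesis using Units_l_cancel[of B C' "pw p B (- 1)"] assms(1,2) pw_closed[OF assms(1)] Units_eq by blast
qed

end

context directed_2_complex
begin

interpretation G: wf_digraph "under_graph K"
  by (rule wf_under_graph)

lemma term_in_verts:
  assumes "is_path1 K (v, es)"
  shows "term1 K (v, es) \<in> verts (under_graph K)"
  using assms awlast_eq G.awalk_last_in_verts by (fastforce simp: is_path1_def term1_def)

text \<open>
  The vertices of the standard path go to the vertices at which the pieces meet; an inverse cell goes
  to the inverse of the chosen 2-path.
\<close>

lemma exists_realization:
  assumes bs: "R.blocks bs" and P: "is_path1 K (v0, pieces bs)"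
  shows "\<exists>\<phi>. realizes bs v0 \<phi> \<and> is_morphism (S_complex (length bs)) K \<phi>"
proof -
  define m where "m = length bs"
  define vx where "vx i = term1 K (v0, pieces (take i bs))" for i
  define es where "es i = dec (fst (bs ! i))" for i
  have split: "pieces bs = pieces (take i bs) @ es i @ pieces (drop (Suc i) bs)" if "i < m" for i
  proof -
    have "bs = take i bs @ bs ! i # drop (Suc i) bs" using that unfolding m_def by (metis id_take_nth_drop)
    then have "pieces bs = pieces (take i bs @ bs ! i # drop (Suc i) bs)" by simp
    then show ?thesis by (simp add: pieces_def es_def case_prod_beta')
  qed
  have Suc: "pieces (take (Suc i) bs) = pieces (take i bs) @ es i" if "i < m" for i
    using that by (simp add: pieces_def es_def take_Suc_conv_app_nth case_prod_beta' m_def)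
  have pre: "is_path1 K (v0, pieces (take i bs))" for i
  proof -
    have "pieces bs = pieces (take i bs) @ pieces (drop i bs)"
      unfolding pieces_def by (metis append_take_drop_id concat_append map_append)
    then show ?thesis using P path_append by metis
  qed
  have ep: "is_path1 K (vx i, es i)" if "i < m" for i
    using pre[of "Suc i"] Suc[OF that] path_append by (simp add: vx_def)
  have tm: "term1 K (vx i, es i) = vx (Suc i)" if "i < m" for i
    using term_append[of v0 "pieces (take i bs)" "es i"] pre[of "Suc i"] Suc[OF that] by (simp add: vx_def)
  have blk: "R.word (fst (bs ! i))" "length (fst (bs ! i)) > 1" "snd (bs ! i) \<in> carrier (R.Grp (fst (bs ! i)))"
    if "i < m" for i
    using bs that nth_mem[of i bs] unfolding R.blocks_def m_def by (auto simp: case_prod_beta')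
  have enc: "enc (es i) = fst (bs ! i)" if "i < m" for i unfolding es_def by (rule word_iff[OF blk(1)[OF that]])
  have ne: "es i \<noteq> []" if "i < m" for i using blk(2)[OF that] enc[OF that] length_enc[of "es i"] by auto
  have "\<exists>\<beta>. is_path2 K \<beta> \<and> fst \<beta> = (vx i, es i) \<and> bot2 K \<beta> = (vx i, es i) \<and> st \<beta> = snd (bs ! i)" if i: "i < m" for i
  proof -
    have r: "R.reach (enc (snd (vx i, es i))) (snd (bs ! i))" "R.labs (snd (bs ! i)) = enc (snd (vx i, es i))"
      using blk(3)[OF i] enc[OF i] by (auto simp: R.Grp_carrier)
    from cls_nonempty[OF ep[OF i] r(1)] obtain \<beta> where "\<beta> \<in> cls (vx i, es i) (snd (bs ! i))" .
    then show ?thesis using cls_bot[of \<beta> "(vx i, es i)" _ "(vx i, es i)"] r(2) unfolding cls_def by blast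
  qed
  then obtain \<beta> where \<beta>: "\<And>i. i < m \<Longrightarrow> is_path2 K (\<beta> i)" "\<And>i. i < m \<Longrightarrow> fst (\<beta> i) = (vx i, es i)"
    "\<And>i. i < m \<Longrightarrow> bot2 K (\<beta> i) = (vx i, es i)" "\<And>i. i < m \<Longrightarrow> st (\<beta> i) = snd (bs ! i)" by metis
  define \<phi> where "\<phi> = \<lparr>vmap = vx, emap = (\<lambda>i. (vx i, es i)),
    fmap = (\<lambda>(i, b). if b then \<beta> i else inv2 K (\<beta> i))\<rparr>"
  have fm: "is_path2 K (fmap \<phi> (i, b)) \<and> fst (fmap \<phi> (i, b)) = (vx i, es i) \<and> bot2 K (fmap \<phi> (i, b)) = (vx i, es i) \<and>
     st (fmap \<phi> (i, b)) = R.pw (fst (bs ! i)) (snd (bs ! i)) (if b then 1 else - 1)" if i: "i < m" for i b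
  proof (cases b)
    case True
    then show ?thesis using \<beta> i blk(3)[OF i] by (simp add: \<phi>_def)
  next
    case False
    note v = inv2_path[OF \<beta>(1)[OF i]]
    have r: "R.reach (enc (es i)) (st (inv2 K (\<beta> i)))" using st_reach[OF v(1)] v(3) \<beta>(3)[OF i] by simp
    have "R.labs (st (inv2 K (\<beta> i))) = enc (es i)" using st_labs[OF v(1)] v(2) \<beta>(2)[OF i] by simp
    then have "st (inv2 K (\<beta> i)) \<in> carrier (R.Grp (fst (bs ! i)))" using r enc[OF i] by (simp add: R.Grp_carrier)
    then have "st (inv2 K (\<beta> i)) = R.pw (fst (bs ! i)) (snd (bs ! i)) (- 1)"
      using R.inverse_carrier[OF blk(3)[OF i]] v(4) \<beta>[OF i] enc[OF i] by simp
    then show ?thesis using v(1-3) \<beta>[OF i] False by (simp add: \<phi>_def)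
  qed
  have "realizes bs v0 \<phi>"
    unfolding realizes_def
  proof (intro conjI allI impI)
    show "vmap \<phi> 0 = v0" by (simp add: \<phi>_def vx_def pieces_def)
    fix i p B b assume i: "i < length bs" "bs ! i = (p, B)"
    show "snd (emap \<phi> i) = dec p" using i by (simp add: \<phi>_def es_def)
    show "is_path2 K (fmap \<phi> (i, b))" "snd (fst (fmap \<phi> (i, b))) = dec p"
      "bot2 K (fmap \<phi> (i, b)) = fst (fmap \<phi> (i, b))" "st (fmap \<phi> (i, b)) = R.pw p B (if b then 1 else - 1)"
      using fm[of i b] i by (auto simp: m_def es_def)
  qed
  moreover have "is_morphism (S_complex (length bs)) K \<phi>"
    unfolding is_morphism_def
  proof (intro conjI ballI)
    fix v assume "v \<in> verts (under_graph (S_complex (length bs)))"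
    show "vmap \<phi> v \<in> verts (under_graph K)" using term_in_verts[OF pre] by (simp add: \<phi>_def vx_def)
  next
    fix e assume "e \<in> arcs (under_graph (S_complex (length bs)))"
    then have e: "e < m" by (simp add: S_complex_def m_def)
    show "is_path1 K (emap \<phi> e)" "nonempty1 (emap \<phi> e)"
      "init1 (emap \<phi> e) = vmap \<phi> (tail (under_graph (S_complex (length bs))) e)"
      "term1 K (emap \<phi> e) = vmap \<phi> (head (under_graph (S_complex (length bs))) e)"
      using ep[OF e] ne[OF e] tm[OF e] by (simp_all add: \<phi>_def nonempty1_def init1_def S_complex_def)
  next
    fix f assume "f \<in> cells (S_complex (length bs))"
    then obtain i b where f: "f = (i, b)" "i < m" by (auto simp: S_complex_def m_def)
    have t: "map1 \<phi> (cell_top (S_complex (length bs)) f) = (vx i, es i)"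
      "map1 \<phi> (cell_bot (S_complex (length bs)) f) = (vx i, es i)"
      using f by (auto simp: map1_def \<phi>_def S_complex_def)
    show "is_path2 K (fmap \<phi> f)" "top2 (fmap \<phi> f) = map1 \<phi> (cell_top (S_complex (length bs)) f)"
      "bot2 K (fmap \<phi> f) = map1 \<phi> (cell_bot (S_complex (length bs)) f)"
      using fm[OF f(2), of b] t f(1) by (simp_all add: top2_def)
    show "fmap \<phi> (cell_inv (S_complex (length bs)) f) = inv2 K (fmap \<phi> f)"
      using f inv2_path(5)[OF \<beta>(1)[OF f(2)]] by (simp add: \<phi>_def S_complex_def)
  qed
  ultimately show ?thesis by blast
qed

end

section \<open>The diagram group of the standard complex\<close>

lemma S_loops:
  assumes "is_path2 (S_complex m) (w_path m, ds)"
  shows "bot2 (S_complex m) (w_path m, ds) = w_path m"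
    "x \<in> set ds \<Longrightarrow> \<exists>i b. i < m \<and> x = ((0, [0..<i]), (i, b), (Suc i, [Suc i..<m]))"
proof -
  have "bot2 (S_complex m) (w_path m, ds) = w_path m \<and>
    (\<forall>x\<in>set ds. \<exists>i b. i < m \<and> x = ((0, [0..<i]), (i, b), (Suc i, [Suc i..<m])))"
    using assms
  proof (induction ds)
    case Nil
    then show ?case by (simp add: bot2_def)
  next
    case (Cons d ds)
    then have d: "is_atom (S_complex m) d" "atom_top (S_complex m) d = w_path m" by auto
    from S_atom[OF d] obtain i b where
      "i < m" "d = ((0, [0..<i]), (i, b), (Suc i, [Suc i..<m]))" "atom_bot (S_complex m) d = w_path m" .
    with Cons show ?case by (auto simp: bot2_def)
  qed
  then show "bot2 (S_complex m) (w_path m, ds) = w_path m"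
    "x \<in> set ds \<Longrightarrow> \<exists>i b. i < m \<and> x = ((0, [0..<i]), (i, b), (Suc i, [Suc i..<m]))" by auto
qed

definition S_cell :: "nat \<Rightarrow> bool \<Rightarrow> (nat, nat, nat \<times> bool) path2" where
  "S_cell i b = ((i, [i]), [((i, []), (i, b), (Suc i, []))])"

definition S_identity :: "(nat, nat, nat \<times> bool, nat, nat, nat \<times> bool) complex_map" where
  "S_identity = \<lparr>vmap = id, emap = (\<lambda>i. (i, [i])), fmap = (\<lambda>(i, b). S_cell i b)\<rparr>"

locale standard_complex =
  fixes m :: nat

sublocale standard_complex \<subseteq> directed_2_complex "S_complex m"
  by (rule S_complex_is_complex)

context standard_complex
begin

abbreviation "S \<equiv> S_complex m"

lemma S_cell_path:
  assumes "i < m"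
  shows "is_path2 S (S_cell i b)" "bot2 S (S_cell i b) = (i, [i])" "fst (S_cell i b) = (i, [i])"
    "inv2 S (S_cell i True) = S_cell i False"
proof -
  have c: "cell_top S (i, b) = (i, [i])" "cell_bot S (i, b) = (i, [i])" "(i, b) \<in> cells S" for b
    using assms by (auto simp: S_complex_def)
  have p: "is_path1 S (i, [])" "is_path1 S (Suc i, [])"
    using S_path[of i i m] S_path[of "Suc i" "Suc i" m] assms by auto
  show "is_path2 S (S_cell i b)" "bot2 S (S_cell i b) = (i, [i])" "fst (S_cell i b) = (i, [i])"
    using c p S_single[OF assms] S_term[of m i]
    by (auto simp: S_cell_def is_atom_def atom_top_def atom_bot_def init1_def cat1_def)
  show "inv2 S (S_cell i True) = S_cell i False"
    using c by (simp add: S_cell_def inv2_def bot2_def atom_bot_def atom_inv_def cat1_def S_complex_def)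
qed

text \<open>
  The computation of states for morphisms of \<open>S_complex m\<close>, applied to the identity morphism, computes
  the states of all loops in \<open>S_complex m\<close> itself.
\<close>

lemma standard_blocks:
  "\<exists>bs. R.blocks bs \<and> length bs = m \<and> (\<forall>(p, B)\<in>set bs. B \<noteq> R.base p) \<and> pieces bs = [0..<m] \<and>
    (\<forall>ds. is_path2 S (w_path m, ds) \<longrightarrow> st (w_path m, ds) = R.Psi bs (map (cnt ds) [0..<m]))"
proof -
  define B where "B i = st (S_cell i True)" for i
  define bs where "bs = map (\<lambda>i. (enc [i], B i)) [0..<m]"
  have B: "B i \<in> carrier (R.Grp (enc [i]))" if "i < m" for i
    using st_reach[OF S_cell_path(1)[OF that]] st_labs[OF S_cell_path(1)[OF that]] S_cell_path(2,3)[OF that]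
    by (simp add: R.Grp_carrier B_def)
  have Bne: "B i \<noteq> R.base (enc [i])" if "i < m" for i
  proof
    assume "B i = R.base (enc [i])"
    then have "homotopic S (S_cell i True) ((i, [i]), [])"
      using homotopic_iff[OF S_cell_path(1)[OF that], of "((i, [i]), [])"] S_single[OF that] S_cell_path(3)[OF that]
      by (simp add: B_def)
    from cnt_homotopic[OF this, of i] show False by (simp add: S_cell_def)
  qed
  have blk: "R.blocks bs" using B by (auto simp: R.blocks_def bs_def length_enc)
  have len: "length bs = m" by (simp add: bs_def)
  have pc: "pieces bs = [0..<m]" by (simp add: pieces_def bs_def comp_def concat_map_singleton)
  have Binv: "st (S_cell i False) = R.pw (enc [i]) (B i) (- 1)" if i: "i < m" for i
  proof (rule R.inverse_carrier[OF B[OF i]])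
    show "st (S_cell i False) \<in> carrier (R.Grp (enc [i]))"
      using st_reach[OF S_cell_path(1)[OF i]] st_labs[OF S_cell_path(1)[OF i]] S_cell_path(2,3)[OF i]
      by (simp add: R.Grp_carrier)
    show "R.comp_state (B i) (st (S_cell i False)) = R.base (enc [i])"
      using inv2_path(4)[OF S_cell_path(1)[OF i], of True] S_cell_path(3,4)[OF i] by (simp add: B_def)
  qed
  have real: "realizes bs 0 S_identity"
    unfolding realizes_def
  proof (intro conjI allI impI)
    show "vmap S_identity 0 = 0" by (simp add: S_identity_def)
    fix i p C b assume "i < length bs" "bs ! i = (p, C)"
    then have i: "i < m" "p = enc [i]" "C = B i" by (auto simp: bs_def)
    show "snd (emap S_identity i) = dec p" using i by (simp add: S_identity_def)
    show "is_path2 S (fmap S_identity (i, b))" "snd (fst (fmap S_identity (i, b))) = dec p"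
      "bot2 S (fmap S_identity (i, b)) = fst (fmap S_identity (i, b))"
      using S_cell_path[OF i(1)] i(2) by (simp_all add: S_identity_def)
    show "st (fmap S_identity (i, b)) = R.pw p C (if b then 1 else - 1)"
      using B[OF i(1)] Binv[OF i(1)] i by (cases b) (simp_all add: S_identity_def B_def)
  qed
  have "st (w_path m, ds) = R.Psi bs (map (cnt ds) [0..<m])" if ds: "is_path2 S (w_path m, ds)" for ds
  proof -
    have c: "concat (map (\<lambda>e. snd (emap S_identity e)) xs) = xs" for xs
      by (simp add: S_identity_def concat_map_singleton)
    have "map_atom S_identity x = [x]" if x: "x \<in> set ds" for x
    proof -
      from S_loops(2)[OF ds x] obtain i b where "x = ((0, [0..<i]), (i, b), (Suc i, [Suc i..<m]))" by blast
      then show ?thesis using c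
        by (simp add: map_atom_def map1_def cat1_def) (simp add: S_identity_def S_cell_def)
    qed
    then have "concat (map (map_atom S_identity) ds) = ds"
      by (induction ds) auto
    moreover have "map1 S_identity (w_path m) = w_path m"
      using c by (simp add: map1_def w_path_def) (simp add: S_identity_def)
    ultimately have "map2 S_identity (w_path m, ds) = (w_path m, ds)" by (simp add: map2_def)
    moreover have "is_path1 S (0, pieces bs)" using w_path_is_path[of m] pc by (simp add: w_path_def)
    ultimately show ?thesis using map2_state[OF blk real, of ds] len ds by simp
  qed
  with blk len pc Bne show ?thesis by (intro exI[of _ bs]) (auto simp: bs_def)
qed

lemma loop_homotopic_iff:
  assumes "is_path2 S (w_path m, ds)" "is_path2 S (w_path m, ds')"
  shows "homotopic S (w_path m, ds) (w_path m, ds') \<longleftrightarrow> (\<forall>i<m. cnt ds i = cnt ds' i)"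
proof
  assume "homotopic S (w_path m, ds) (w_path m, ds')"
  from cnt_homotopic[OF this] show "\<forall>i<m. cnt ds i = cnt ds' i" by simp
next
  from standard_blocks obtain bs where
    s: "\<And>ds. is_path2 S (w_path m, ds) \<Longrightarrow> st (w_path m, ds) = R.Psi bs (map (cnt ds) [0..<m])" by blast
  assume "\<forall>i<m. cnt ds i = cnt ds' i"
  then have e: "map (cnt ds) [0..<m] = map (cnt ds') [0..<m]" by simp
  have "st (w_path m, ds) = st (w_path m, ds')" unfolding s[OF assms(1)] s[OF assms(2)] e by (rule HOL.refl)
  then show "homotopic S (w_path m, ds) (w_path m, ds')" using homotopic_iff[OF assms] by simp
qed

lemma loop_with_counts:
  obtains ds where "is_path2 S (w_path m, ds)" "\<And>i. i < m \<Longrightarrow> cnt ds i = k i"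
proof -
  from standard_blocks obtain bs where bs: "R.blocks bs" "length bs = m" "\<forall>(p, B)\<in>set bs. B \<noteq> R.base p"
    "pieces bs = [0..<m]"
    and s: "\<And>ds. is_path2 S (w_path m, ds) \<Longrightarrow> st (w_path m, ds) = R.Psi bs (map (cnt ds) [0..<m])" by blast
  let ?z = "R.Psi bs (map k [0..<m])"
  have "R.reach (enc (snd (w_path m))) ?z"
    using R.Psi_reach[OF bs(1)] bword_pieces[OF bs(1)] bs(4) by (simp add: w_path_def)
  from cls_nonempty[OF w_path_is_path this] obtain \<delta> where "\<delta> \<in> cls (w_path m) ?z" .
  then obtain ds where d: "is_path2 S (w_path m, ds)" "st (w_path m, ds) = ?z"
    by (cases \<delta>) (auto simp: cls_def)
  have "map (cnt ds) [0..<m] = map k [0..<m]"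
    by (rule R.Psi_inj[OF bs(1,3)]) (use s[OF d(1)] d(2) bs(2) in auto)
  then show ?thesis using that[OF d(1)] by simp
qed

lemma loop_carrier: "carrier (diagram_group S (w_path m)) = {hclass S (w_path m, ds) | ds. is_path2 S (w_path m, ds)}"
proof -
  have "groupoid_hom S (w_path m) (w_path m) = {hclass S (w_path m, ds) | ds. is_path2 S (w_path m, ds)}"
  proof -
    have "A \<in> groupoid_hom S (w_path m) (w_path m) \<longleftrightarrow> (\<exists>ds. A = hclass S (w_path m, ds) \<and> is_path2 S (w_path m, ds))" for A
      unfolding groupoid_hom_def top2_def mem_Collect_eq using S_loops(1)[of m] by (metis fst_conv prod.collapse)
    then show ?thesis by blast
  qed
  then show ?thesis by (simp add: diagram_group_def)
qed

lemma hclass_eq_iff: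
  assumes "is_path2 S (w_path m, ds)" "is_path2 S (w_path m, ds')"
  shows "hclass S (w_path m, ds) = hclass S (w_path m, ds') \<longleftrightarrow> (\<forall>i<m. cnt ds i = cnt ds' i)"
  unfolding loop_homotopic_iff[OF assms, symmetric]
proof
  assume "hclass S (w_path m, ds) = hclass S (w_path m, ds')"
  moreover have "(w_path m, ds') \<in> hclass S (w_path m, ds')"
    using homotopic.refl[OF assms(2)] by (simp add: hclass_def)
  ultimately have "(w_path m, ds') \<in> hclass S (w_path m, ds)" by (simp only:)
  then show "homotopic S (w_path m, ds) (w_path m, ds')" by (simp add: hclass_def)
next
  assume "homotopic S (w_path m, ds) (w_path m, ds')"
  then have "homotopic S (w_path m, ds) \<delta> \<longleftrightarrow> homotopic S (w_path m, ds') \<delta>" for \<delta>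
    using homotopic.sym homotopic.trans by metis
  then show "hclass S (w_path m, ds) = hclass S (w_path m, ds')" by (simp add: hclass_def)
qed

text \<open>
  The isomorphism is given by the exponent sums, which are a complete invariant by
  \<open>loop_homotopic_iff\<close> and take arbitrary values by \<open>loop_with_counts\<close>.
\<close>

lemma standard_group: "diagram_group S (w_path m) \<cong> Z_pow m"
proof -
  define loop where "loop x = (SOME ds. is_path2 S (w_path m, ds) \<and> (\<forall>i<m. cnt ds i = x i))" for x
  have loop: "is_path2 S (w_path m, loop x)" "\<And>i. i < m \<Longrightarrow> cnt (loop x) i = x i" for x
  proof -
    have "\<exists>ds. is_path2 S (w_path m, ds) \<and> (\<forall>i<m. cnt ds i = x i)" using loop_with_counts[of x] by metis
    then have "is_path2 S (w_path m, loop x) \<and> (\<forall>i<m. cnt (loop x) i = x i)" unfolding loop_def by (rule someI_ex)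
    then show "is_path2 S (w_path m, loop x)" "\<And>i. i < m \<Longrightarrow> cnt (loop x) i = x i" by auto
  qed
  define F where "F x = hclass S (w_path m, loop x)" for x
  interpret D: group "diagram_group S (w_path m)" by (rule group_diagram_group[OF w_path_is_path])
  have "F \<in> iso (Z_pow m) (diagram_group S (w_path m))"
  proof (rule isoI)
    show "F \<in> hom (Z_pow m) (diagram_group S (w_path m))"
    proof (rule homI)
      fix x show "F x \<in> carrier (diagram_group S (w_path m))" using loop(1) by (auto simp: loop_carrier F_def)
    next
      fix x y
      let ?w = "w_path m" and ?d = "(w_path m, loop x)" and ?e = "(w_path m, loop y)"
      have b: "bot2 S ?d = fst ?e" using S_loops(1)[OF loop(1)] by simp
      have c: "is_path2 S (?w, loop x @ loop y)" using path2_cat(1)[OF loop(1) loop(1) b] by (simp add: cat2_def)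
      have a: "R.reach (enc (snd ?w)) (st ?d)" "R.labs (st ?d) = enc (snd ?w)" "R.reach (enc (snd ?w)) (st ?e)"
        using st_reach[OF loop(1)[of x]] st_reach[OF loop(1)[of y]] st_labs[OF loop(1)[of x]] b by simp_all
      have "F x \<otimes>\<^bsub>diagram_group S ?w\<^esub> F y = gcomp S (cls ?w (st ?d)) (cls ?w (st ?e))"
        using hclass_cls[OF loop(1)[of x]] hclass_cls[OF loop(1)[of y]] by (simp add: F_def diagram_group_def)
      also have "\<dots> = cls ?w (st (?w, loop x @ loop y))"
        using gcomp_cls[OF w_path_is_path a(1,2) HOL.refl a(3)] st_cat[OF loop(1) loop(1) b] by (simp add: cat2_def)
      also have "\<dots> = hclass S (?w, loop x @ loop y)" using hclass_cls[OF c] by simp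
      also have "\<dots> = F (x \<otimes>\<^bsub>Z_pow m\<^esub> y)"
        unfolding F_def hclass_eq_iff[OF c loop(1)] by (simp add: cnt_append loop(2) Z_pow_simps)
      finally show "F (x \<otimes>\<^bsub>Z_pow m\<^esub> y) = F x \<otimes>\<^bsub>diagram_group S ?w\<^esub> F y" by simp
    qed
    have "inj_on F (carrier (Z_pow m))"
    proof (rule inj_onI)
      fix x y assume xy: "x \<in> carrier (Z_pow m)" "y \<in> carrier (Z_pow m)" "F x = F y"
      then have "\<forall>i<m. x i = y i" unfolding F_def hclass_eq_iff[OF loop(1) loop(1)] by (simp add: loop(2))
      with xy show "x = y" unfolding Z_pow_simps by (intro PiE_ext) auto
    qed
    moreover have "F ` carrier (Z_pow m) = carrier (diagram_group S (w_path m))"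
    proof -
      have "hclass S (w_path m, ds) \<in> F ` carrier (Z_pow m)" if d: "is_path2 S (w_path m, ds)" for ds
      proof -
        have "hclass S (w_path m, ds) = F (\<lambda>i\<in>{..<m}. cnt ds i)"
          unfolding F_def hclass_eq_iff[OF d loop(1)] by (simp add: loop(2))
        then show ?thesis by (auto simp: Z_pow_simps)
      qed
      then show ?thesis using loop(1) by (auto simp: loop_carrier F_def)
    qed
    ultimately show "bij_betw F (carrier (Z_pow m)) (carrier (diagram_group S (w_path m)))"
      by (simp add: bij_betw_def)
  qed
  then have "Z_pow m \<cong> diagram_group S (w_path m)" by (auto simp: is_iso_def)
  then show ?thesis using group.iso_sym[OF group_Z_pow] by blast
qed

end

context directed_2_complex
begin

text \<open>
  On a loop with exponent sums \<open>ks\<close> the realization takes the value \<open>Psi bs ks\<close>. It is injective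
  because each \<open>B\<close> has infinite order and sums determine their summands.
\<close>

lemma natural_embedding:
  assumes bs: "R.blocks bs" "bs \<noteq> []" "\<forall>(p, B)\<in>set bs. B \<noteq> R.base p" and P: "is_path1 K (v0, pieces bs)"
  shows "\<exists>\<phi>. nonsingular (S_complex (length bs)) K (w_path (length bs)) \<phi> \<and>
    map1 \<phi> (w_path (length bs)) = (v0, pieces bs) \<and>
    induced K \<phi> ` carrier (diagram_group (S_complex (length bs)) (w_path (length bs))) =
      {cls (v0, pieces bs) (R.Psi bs ks) | ks. length ks = length bs}"
proof -
  let ?m = "length bs" and ?P = "(v0, pieces bs)"
  let ?S = "S_complex ?m" and ?w = "w_path ?m"
  interpret S: standard_complex ?m .
  from exists_realization[OF bs(1) P] obtain \<phi> where r: "realizes bs v0 \<phi>" "is_morphism ?S K \<phi>" by blast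
  have ind: "induced K \<phi> (hclass ?S (?w, ds)) = cls ?P (R.Psi bs (map (cnt ds) [0..<?m]))"
    if ds: "is_path2 ?S (?w, ds)" for ds
  proof -
    have each: "hclass K (map2 \<phi> \<delta>) = cls ?P (R.Psi bs (map (cnt ds) [0..<?m]))"
      if d: "\<delta> \<in> hclass ?S (?w, ds)" for \<delta>
    proof -
      from d have h: "homotopic ?S (?w, ds) \<delta>" by (simp add: hclass_def)
      then obtain ds' where d': "\<delta> = (?w, ds')" "is_path2 ?S (?w, ds')"
        using S.homotopic_sound[OF h] by (metis fst_conv prod.collapse)
      note m = map2_state[OF bs(1) r(1) P d'(2)]
      have e: "map (cnt ds) [0..<?m] = map (cnt ds') [0..<?m]"
        using cnt_homotopic[OF h] d'(1) by simp
      show ?thesis unfolding e using hclass_cls[of "map2 \<phi> \<delta>"] m d'(1) map1_w[OF r(1)] by (simp add: map2_def)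
    qed
    have "(?w, ds) \<in> hclass ?S (?w, ds)" using homotopic.refl[OF ds] by (simp add: hclass_def)
    with each show ?thesis unfolding induced_def by blast
  qed
  have reach: "R.reach (enc (snd ?P)) (R.Psi bs ks)" for ks
    using R.Psi_reach[OF bs(1)] bword_pieces[OF bs(1)] by simp
  have "inj_on (induced K \<phi>) (carrier (diagram_group ?S ?w))"
  proof (rule inj_onI)
    fix A B assume "A \<in> carrier (diagram_group ?S ?w)" "B \<in> carrier (diagram_group ?S ?w)"
      and e: "induced K \<phi> A = induced K \<phi> B"
    then obtain ds ds' where d: "A = hclass ?S (?w, ds)" "is_path2 ?S (?w, ds)"
      "B = hclass ?S (?w, ds')" "is_path2 ?S (?w, ds')" unfolding S.loop_carrier by blast
    from e have "R.Psi bs (map (cnt ds) [0..<?m]) = R.Psi bs (map (cnt ds') [0..<?m])"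
      unfolding d(1,3) ind[OF d(2)] ind[OF d(4)] using cls_inject[OF P reach] by blast
    from R.Psi_inj[OF bs(1,3) _ _ this] have "map (cnt ds) [0..<?m] = map (cnt ds') [0..<?m]" by simp
    then show "A = B" unfolding d(1,3) S.hclass_eq_iff[OF d(2,4)] by simp
  qed
  moreover have "induced K \<phi> ` carrier (diagram_group ?S ?w) = {cls ?P (R.Psi bs ks) | ks. length ks = ?m}"
  proof
    show "induced K \<phi> ` carrier (diagram_group ?S ?w) \<subseteq> {cls ?P (R.Psi bs ks) | ks. length ks = ?m}"
      unfolding S.loop_carrier using ind by auto
    show "{cls ?P (R.Psi bs ks) | ks. length ks = ?m} \<subseteq> induced K \<phi> ` carrier (diagram_group ?S ?w)"
    proof
      fix A assume "A \<in> {cls ?P (R.Psi bs ks) | ks. length ks = ?m}"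
      then obtain ks where ks: "A = cls ?P (R.Psi bs ks)" "length ks = ?m" by blast
      obtain ds where d: "is_path2 ?S (?w, ds)" "\<And>i. i < ?m \<Longrightarrow> cnt ds i = ks ! i"
        using S.loop_with_counts[of "\<lambda>i. ks ! i"] by blast
      then have "map (cnt ds) [0..<?m] = ks" using ks(2) by (intro nth_equalityI) auto
      then have "A = induced K \<phi> (hclass ?S (?w, ds))" using ind[OF d(1)] ks(1) by simp
      then show "A \<in> induced K \<phi> ` carrier (diagram_group ?S ?w)" using d(1) unfolding S.loop_carrier by blast
    qed
  qed
  moreover have "nonempty1 ?w" using bs(2) by (simp add: nonempty1_def w_path_def)
  ultimately show ?thesis
    using r(2) w_path_is_path map1_w[OF r(1)] unfolding nonsingular_def by blast
qed

end

section \<open>Free abelian groups of states\<close>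

context rewriting_system
begin

lemma comp_inject_left:
  assumes s: "reach q s" and a: "a \<in> carrier (Grp q)" and b: "b \<in> carrier (Grp q)" and e: "a \<odot> s = b \<odot> s"
  shows "a = b"
proof -
  from reach_inverse[OF s] obtain s' where s': "reach (labs s) s'" "labs s' = q" "s \<odot> s' = base q" .
  have c: "c = (c \<odot> s) \<odot> s'" if "c \<in> carrier (Grp q)" for c
  proof -
    have "c = c \<odot> (s \<odot> s')" using s' Grp_labs[OF that] comp_base by metis
    also have "\<dots> = (c \<odot> s) \<odot> s'"
      using reach_assoc[of q c s s'] that s reach_wfs[OF s'(1)] Grp_carrier by simp
    finally show ?thesis .
  qed
  show ?thesis using c[OF a] c[OF b] e by simp
qed

text \<open>
  Resolving the images of the unit vectors resolves the whole group: the exponents \<open>d i j\<close> of the unit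
  vectors extend linearly to all elements. Linear independence, and with it \<open>n \<le> m\<close>, comes from
  injectivity of \<open>z\<close>.
\<close>

lemma free_abelian_resolvable:
  assumes q: "word q" and n: "n \<ge> 1"
    and z: "z \<in> hom (Z_pow n) (Grp q)" "inj_on z (carrier (Z_pow n))"
  obtains s bs d where "reach q s" "blocks bs" "labs s = bword bs" "\<forall>(p, B)\<in>set bs. B \<noteq> base p"
    "n \<le> length bs"
    "\<forall>x\<in>carrier (Z_pow n). z x \<odot> s = s \<odot> Psi bs (map (\<lambda>j. \<Sum>i<n. x i * d i j) [0..<length bs])"
proof -
  interpret Q: group "Grp q" by (rule group_Grp)
  interpret Z: group "Z_pow n" by (rule group_Z_pow)
  interpret z: group_hom "Z_pow n" "Grp q" z
    using z(1) by unfold_locales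
  define u where "u k t = (\<lambda>j\<in>{..<n}. if j = k then t else 0 :: int)" for k t
  have uC: "u k t \<in> carrier (Z_pow n)" for k t by (simp add: u_def Z_pow_simps)
  have zC: "z x \<in> carrier (Grp q)" if "x \<in> carrier (Z_pow n)" for x using that by (rule z.hom_closed)
  have zm: "z (x \<otimes>\<^bsub>Z_pow n\<^esub> y) = z x \<odot> z y" if "x \<in> carrier (Z_pow n)" "y \<in> carrier (Z_pow n)" for x y
    using z.hom_mult[OF that] by simp
  have zpow: "z (u k t) = pw q (z (u k 1)) t" for k t
  proof (rule pw_unique)
    show "z (u k 1) \<in> carrier (Grp q)" "\<And>i. z (u k i) \<in> carrier (Grp q)" using zC uC by auto
    have "u k 0 = \<one>\<^bsub>Z_pow n\<^esub>" unfolding u_def Z_pow_simps by (rule restrict_ext) simp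
    then show "z (u k 0) = base q" using z.hom_one by simp
    fix i
    have "u k (i + 1) = u k i \<otimes>\<^bsub>Z_pow n\<^esub> u k 1" unfolding u_def Z_pow_simps by (rule restrict_ext) simp
    then show "z (u k (i + 1)) = z (u k i) \<odot> z (u k 1)" using zm uC by simp
  qed
  have "resolvable q ((\<lambda>k. z (u k 1)) ` {..<n})"
  proof (rule commuting_resolvable[OF q])
    show "(\<lambda>k. z (u k 1)) ` {..<n} \<subseteq> carrier (Grp q)" using zC uC by auto
    fix a b assume "a \<in> (\<lambda>k. z (u k 1)) ` {..<n}" "b \<in> (\<lambda>k. z (u k 1)) ` {..<n}"
    then obtain k l where kl: "a = z (u k 1)" "b = z (u l 1)" by auto
    have "u k 1 \<otimes>\<^bsub>Z_pow n\<^esub> u l 1 = u l 1 \<otimes>\<^bsub>Z_pow n\<^esub> u k 1" by (simp add: Z_pow_simps add.commute)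
    then show "commutes a b" unfolding commutes_def kl using zm uC by metis
  qed simp
  then obtain s bs0 where s: "reach q s" "blocks bs0" "labs s = bword bs0"
    and ks0: "\<forall>k<n. \<exists>ks. length ks = length bs0 \<and> z (u k 1) \<odot> s = s \<odot> Psi bs0 ks"
    unfolding resolvable_def by auto
  \<comment> \<open>If all blocks were trivial, the first unit vector would act trivially on \<open>s\<close>.\<close>
  have nontrivial: "\<not> (\<forall>ks. length ks = length bs0 \<longrightarrow> Psi bs0 ks = base (bword bs0))"
  proof
    assume triv: "\<forall>ks. length ks = length bs0 \<longrightarrow> Psi bs0 ks = base (bword bs0)"
    from ks0 n obtain ks where "length ks = length bs0" "z (u 0 1) \<odot> s = s \<odot> Psi bs0 ks" by force
    with triv s(3) have "z (u 0 1) \<odot> s = s \<odot> base (labs s)" by metis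
    then have "z (u 0 1) \<odot> s = s" using comp_base by metis
    then have "z (u 0 1) = z \<one>\<^bsub>Z_pow n\<^esub>" using free_action[OF zC[OF uC] s(1)] z.hom_one by simp
    then have "u 0 1 = \<one>\<^bsub>Z_pow n\<^esub>" using z(2) uC Z.one_closed by (meson inj_onD)
    then have "u 0 1 0 = (\<lambda>i\<in>{..<n}. 0 :: int) 0" by (simp add: Z_pow_simps)
    with n show False by (simp add: u_def)
  qed
  with merge_trivial_blocks[OF s(2)] obtain bs where bs: "blocks bs" "bword bs = bword bs0" "\<forall>(p, B)\<in>set bs. B \<noteq> base p"
    and mg: "\<And>ks. length ks = length bs0 \<Longrightarrow> \<exists>ks'. length ks' = length bs \<and> Psi bs0 ks = Psi bs ks'" by blast
  have "\<forall>k<n. \<exists>ks. length ks = length bs \<and> z (u k 1) \<odot> s = s \<odot> Psi bs ks"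
    using ks0 mg by metis
  then obtain ks where ks: "\<And>k. k < n \<Longrightarrow> length (ks k) = length bs"
    "\<And>k. k < n \<Longrightarrow> z (u k 1) \<odot> s = s \<odot> Psi bs (ks k)" by metis
  define d where "d k j = ks k ! j" for k j
  have ls: "labs s = bword bs" using s(3) bs(2) by simp
  have PC: "Psi bs l \<in> carrier (Grp (labs s))" for l unfolding ls by (rule Psi_carrier[OF bs(1)])
  have PR: "reach (labs s) (Psi bs l)" "labs (Psi bs l) = labs s" for l
    using PC[of l] by (auto dest: Grp_reach Grp_labs)
  have PW: "wfs (labs s) (Psi bs l)" for l by (rule reach_wfs[OF PR(1)])
  have zR: "reach q (z x)" "labs (z x) = q" if "x \<in> carrier (Z_pow n)" for x
    using zC[OF that] by (auto dest: Grp_reach Grp_labs)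
  have unit: "z (u k t) \<odot> s = s \<odot> Psi bs (map (\<lambda>j. t * d k j) [0..<length bs])" if k: "k < n" for k t
  proof -
    have "z (u k t) \<odot> s = s \<odot> pw (labs s) (Psi bs (ks k)) t"
      unfolding zpow[of k t] by (rule pw_conj[OF s(1) zC[OF uC] PC ks(2)[OF k]])
    also have "pw (labs s) (Psi bs (ks k)) t = Psi bs (map (\<lambda>k. t * k) (ks k))"
      unfolding ls by (rule Psi_pw[OF bs(1) ks(1)[OF k]])
    also have "map (\<lambda>k. t * k) (ks k) = map (\<lambda>j. t * d k j) [0..<length bs]"
      using ks(1)[OF k] by (intro nth_equalityI) (auto simp: d_def)
    finally show ?thesis .
  qed
  \<comment> \<open>The first \<open>l\<close> unit vectors suffice for vectors supported on \<open>{..<l}\<close>; one coordinate is split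
    off at a time.\<close>
  have partial: "z x \<odot> s = s \<odot> Psi bs (map (\<lambda>j. \<Sum>i<l. x i * d i j) [0..<length bs])"
    if "l \<le> n" "x \<in> carrier (Z_pow n)" "\<And>i. l \<le> i \<Longrightarrow> i < n \<Longrightarrow> x i = 0" for l x
    using that
  proof (induction l arbitrary: x)
    case 0
    have "x = \<one>\<^bsub>Z_pow n\<^esub>" using "0.prems"(2,3) unfolding Z_pow_simps by (intro PiE_ext) auto
    then have "z x = base q" using z.hom_one by simp
    moreover have "Psi bs (map (\<lambda>j. \<Sum>i<0. x i * d i j) [0..<length bs]) = base (labs s)"
      using Psi_zero[OF bs(1)] ls by (simp add: map_replicate_const)
    ultimately show ?case using base_comp[OF reach_wfs[OF s(1)]] comp_base by metis
  next
    case (Suc l)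
    define y where "y = (\<lambda>i\<in>{..<n}. if i = l then 0 else x i)"
    have y: "y \<in> carrier (Z_pow n)" by (simp add: y_def Z_pow_simps)
    have l: "l < n" using Suc.prems(1) by simp
    have x: "x = y \<otimes>\<^bsub>Z_pow n\<^esub> u l (x l)"
    proof (rule PiE_ext)
      show "x \<in> PiE {..<n} (\<lambda>_. UNIV)" using Suc.prems(2) by (simp add: Z_pow_simps)
      show "y \<otimes>\<^bsub>Z_pow n\<^esub> u l (x l) \<in> PiE {..<n} (\<lambda>_. UNIV)" by (simp add: Z_pow_simps)
      show "x i = (y \<otimes>\<^bsub>Z_pow n\<^esub> u l (x l)) i" if "i \<in> {..<n}" for i
        using that by (simp add: Z_pow_simps y_def u_def)
    qed
    have y0: "y i = 0" if "l \<le> i" "i < n" for i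
      using Suc.prems(3)[of i] that by (cases "i = l") (auto simp: y_def)
    let ?a = "map (\<lambda>j. \<Sum>i<l. y i * d i j) [0..<length bs]"
    let ?b = "map (\<lambda>j. x l * d l j) [0..<length bs]"
    have IH: "z y \<odot> s = s \<odot> Psi bs ?a" using Suc.IH[OF _ y] y0 l by simp
    have "z x = z y \<odot> z (u l (x l))" by (subst x) (rule zm[OF y uC])
    then have "z x \<odot> s = (z y \<odot> z (u l (x l))) \<odot> s" by (simp only:)
    also have "\<dots> = z y \<odot> (z (u l (x l)) \<odot> s)"
      by (rule reach_assoc[OF zR(1)[OF y]]) (simp_all only: zR[OF y] zR[OF uC], rule reach_wfs[OF s(1)])
    also have "\<dots> = z y \<odot> (s \<odot> Psi bs ?b)" by (simp only: unit[OF l])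
    also have "\<dots> = (z y \<odot> s) \<odot> Psi bs ?b"
      by (rule reach_assoc[OF zR(1)[OF y], symmetric]) (simp_all only: zR[OF y] s(1), rule PW)
    also have "\<dots> = (s \<odot> Psi bs ?a) \<odot> Psi bs ?b" by (simp only: IH)
    also have "\<dots> = s \<odot> (Psi bs ?a \<odot> Psi bs ?b)"
      by (rule reach_assoc[OF s(1) PR(1)]) (simp only: PR(2), rule PW)
    also have "Psi bs ?a \<odot> Psi bs ?b = Psi bs (map (\<lambda>(k, l). k + l) (zip ?a ?b))"
      using Psi_add[OF bs(1), of ?a ?b] by simp
    also have "map (\<lambda>(k, l). k + l) (zip ?a ?b) = map (\<lambda>j. \<Sum>i<Suc l. x i * d i j) [0..<length bs]"
    proof (rule nth_equalityI)
      fix j assume "j < length (map (\<lambda>(k, l). k + l) (zip ?a ?b))"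
      moreover have "(\<Sum>i<l. y i * d i j) = (\<Sum>i<l. x i * d i j)"
        using l by (intro sum.cong) (auto simp: y_def)
      ultimately show "map (\<lambda>(k, l). k + l) (zip ?a ?b) ! j = map (\<lambda>j. \<Sum>i<Suc l. x i * d i j) [0..<length bs] ! j"
        by simp
    qed simp
    finally show ?case .
  qed
  have full: "z x \<odot> s = s \<odot> Psi bs (map (\<lambda>j. \<Sum>i<n. x i * d i j) [0..<length bs])"
    if "x \<in> carrier (Z_pow n)" for x
    using partial[OF order_refl that] by simp
  have "n \<le> length bs"
  proof (rule independent_vectors_le[where d = d])
    fix x y :: "nat \<Rightarrow> int"
    assume e: "\<forall>j<length bs. (\<Sum>i<n. x i * d i j) = (\<Sum>i<n. y i * d i j)"
    let ?x = "restrict x {..<n}" and ?y = "restrict y {..<n}"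
    have c: "?x \<in> carrier (Z_pow n)" "?y \<in> carrier (Z_pow n)" by (auto simp: Z_pow_simps)
    have "map (\<lambda>j. \<Sum>i<n. ?x i * d i j) [0..<length bs] = map (\<lambda>j. \<Sum>i<n. ?y i * d i j) [0..<length bs]"
      using e by simp
    then have "z ?x \<odot> s = z ?y \<odot> s" using full[OF c(1)] full[OF c(2)] by metis
    then have "z ?x = z ?y" using comp_inject_left[OF s(1) zC[OF c(1)] zC[OF c(2)]] by simp
    then have "?x = ?y" using z(2) c by (meson inj_onD)
    then show "\<forall>i<n. x i = y i" by (metis lessThan_iff restrict_apply')
  qed
  with that[OF s(1) bs(1) ls bs(3)] full show ?thesis by blast
qed

end

section \<open>Copies of free abelian groups\<close>

context directed_2_complex
begin

lemma cls_path: "is_path1 K P \<Longrightarrow> R.reach (enc (snd P)) z \<Longrightarrow> R.labs z = enc (snd Q) \<Longrightarrow> fst Q = fst P \<Longrightarrow> is_path1 K Q"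
  using cls_bot path2_bot cls_nonempty unfolding cls_def by (metis (mono_tags, lifting) mem_Collect_eq)

text \<open>
  Used twice: for the conjugate of the given copy, and with the unit matrix for the naturally
  embedded group that contains it.
\<close>

lemma subgroup_Psi_image:
  assumes bs: "R.blocks bs" and Q: "is_path1 K (v, pieces bs)"
  shows "subgroup ((\<lambda>x. cls (v, pieces bs) (R.Psi bs (map (\<lambda>j. \<Sum>i<n. x i * d i j) [0..<length bs]))) ` carrier (Z_pow n))
    (diagram_group K (v, pieces bs))" (is "subgroup (?f ` _) ?D")
proof -
  let ?\<kappa> = "\<lambda>x. map (\<lambda>j. \<Sum>i<n. x i * d i j) [0..<length bs]"
  have PC: "R.Psi bs ks \<in> carrier (R.Grp (enc (snd (v, pieces bs))))" for ks
    using R.Psi_carrier[OF bs] bword_pieces[OF bs] by simp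
  have "?f \<in> hom (Z_pow n) ?D"
  proof (rule homI)
    fix x show "?f x \<in> carrier ?D" unfolding diag_carrier[OF Q] using PC by blast
    fix y
    have "?\<kappa> (x \<otimes>\<^bsub>Z_pow n\<^esub> y) = map (\<lambda>(k, l). k + l) (zip (?\<kappa> x) (?\<kappa> y))"
      by (intro nth_equalityI) (auto simp: Z_pow_simps distrib_right sum.distrib)
    then have "R.Psi bs (?\<kappa> (x \<otimes>\<^bsub>Z_pow n\<^esub> y)) = R.comp_state (R.Psi bs (?\<kappa> x)) (R.Psi bs (?\<kappa> y))"
      using R.Psi_add[OF bs, of "?\<kappa> x" "?\<kappa> y"] by simp
    then show "?f (x \<otimes>\<^bsub>Z_pow n\<^esub> y) = ?f x \<otimes>\<^bsub>?D\<^esub> ?f y" using diag_mult[OF Q PC PC] by (simp only:)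
  qed
  then interpret f: group_hom "Z_pow n" ?D ?f
    using group_Z_pow group_diagram_group[OF Q] by (simp add: group_hom_def group_hom_axioms_def)
  show ?thesis by (rule f.img_is_subgroup)
qed

text \<open>
  The state \<open>s\<close> that resolves the copy is, as a homotopy class, the conjugating morphism.
\<close>

lemma copy_of_Z_pow:
  assumes copy: "is_copy K P A (Z_pow n)" and n: "n \<ge> 1"
  obtains \<Gamma> bs v d where "\<Gamma> \<in> groupoid_hom K P (v, pieces bs)" "is_path1 K (v, pieces bs)"
    "R.blocks bs" "\<forall>(p, B)\<in>set bs. B \<noteq> R.base p" "n \<le> length bs"
    "conjugate K \<Gamma> A =
      (\<lambda>x. cls (v, pieces bs) (R.Psi bs (map (\<lambda>j. \<Sum>i<n. x i * d i j) [0..<length bs]))) ` carrier (Z_pow n)"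
proof -
  let ?w = "enc (snd P)" and ?D = "diagram_group K P"
  have P: "is_path1 K P" and A: "subgroup A ?D" and iso: "?D\<lparr>carrier := A\<rparr> \<cong> Z_pow n"
    using copy by (auto simp: is_copy_def)
  interpret D: group ?D by (rule group_diagram_group[OF P])
  interpret W: group "R.Grp ?w" by (rule R.group_Grp)
  from group.iso_sym[OF subgroup.subgroup_is_group[OF A D.group_axioms] iso] obtain h
    where h: "h \<in> iso (Z_pow n) (?D\<lparr>carrier := A\<rparr>)" by (auto simp: is_iso_def)
  then have hA: "h ` carrier (Z_pow n) = A" and hinj: "inj_on h (carrier (Z_pow n))"
    by (auto simp: iso_def bij_betw_def)
  have AD: "A \<subseteq> carrier ?D" by (rule subgroup.subset[OF A])
  have hhom: "h \<in> hom (Z_pow n) ?D" using h AD by (auto simp: iso_def hom_def)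
  \<comment> \<open>The isomorphism, read in the group of states.\<close>
  define \<psi> where "\<psi> = inv_into (carrier (R.Grp ?w)) (cls P)"
  have \<psi>: "\<psi> \<in> iso ?D (R.Grp ?w)" unfolding \<psi>_def by (rule W.iso_set_sym[OF cls_iso[OF P]])
  define z where "z = \<psi> \<circ> h"
  have zhom: "z \<in> hom (Z_pow n) (R.Grp ?w)"
    unfolding z_def by (rule hom_compose[OF hhom]) (use \<psi> in \<open>simp add: iso_def\<close>)
  have "inj_on \<psi> (h ` carrier (Z_pow n))"
    using \<psi> AD unfolding hA iso_def bij_betw_def by (blast intro: inj_on_subset)
  then have zinj: "inj_on z (carrier (Z_pow n))" unfolding z_def by (rule comp_inj_on[OF hinj])
  have zh: "cls P (z x) = h x" if "x \<in> carrier (Z_pow n)" for x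
  proof -
    have "h x \<in> cls P ` carrier (R.Grp ?w)" using hA AD that unfolding diag_carrier[OF P] by blast
    then show ?thesis by (simp add: z_def \<psi>_def f_inv_into_f)
  qed
  from R.free_abelian_resolvable[OF word_enc n zhom zinj] obtain s bs d where
    s: "R.reach ?w s" "R.blocks bs" "R.labs s = R.bword bs" "\<forall>(p, B)\<in>set bs. B \<noteq> R.base p" "n \<le> length bs"
    and c: "\<forall>x\<in>carrier (Z_pow n). R.comp_state (z x) s = R.comp_state s (R.Psi bs (map (\<lambda>j. \<Sum>i<n. x i * d i j) [0..<length bs]))" .
  let ?Q = "(fst P, pieces bs)"
  have lab: "R.labs s = enc (snd ?Q)" using s(3) bword_pieces[OF s(2)] by simp
  have Q: "is_path1 K ?Q" by (rule cls_path[OF P s(1) lab]) simp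
  have G: "cls P s \<in> groupoid_hom K P ?Q" by (rule cls_hom[OF P s(1) lab]) simp
  from R.reach_inverse[OF s(1)] obtain s' where
    s': "R.reach (R.labs s) s'" "R.labs s' = ?w" "R.comp_state s s' = R.base ?w" "R.comp_state s' s = R.base (R.labs s)" .
  have s'Q: "R.reach (enc (snd ?Q)) s'" using s'(1) lab by simp
  have inv: "ginv K (cls P s) = cls ?Q s'"
    by (rule ginv_cls[OF P s(1) lab _ s'Q s'(3)]) simp
  let ?\<kappa> = "\<lambda>x. map (\<lambda>j. \<Sum>i<n. x i * d i j) [0..<length bs]"
  have conj: "gcomp K (gcomp K (ginv K (cls P s)) (h x)) (cls P s) = cls ?Q (R.Psi bs (?\<kappa> x))"
    if x: "x \<in> carrier (Z_pow n)" for x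
  proof -
    have zx: "R.reach ?w (z x)" "R.labs (z x) = ?w"
      using hom_in_carrier[OF zhom x] by (simp_all add: R.Grp_carrier)
    have f: "fst P = fst ?Q" by simp
    have r: "R.reach (enc (snd ?Q)) (R.comp_state s' (z x))" "R.labs (R.comp_state s' (z x)) = ?w"
      using R.reach_comp[OF s'Q] R.labs_comp[OF s'Q] zx s'(2) by (simp_all del: map_map)
    have P': "R.reach (enc (snd ?Q)) (R.Psi bs (?\<kappa> x))" using R.Psi_reach[OF s(2)] bword_pieces[OF s(2)] by simp
    have "gcomp K (gcomp K (ginv K (cls P s)) (h x)) (cls P s) =
        gcomp K (cls ?Q (R.comp_state s' (z x))) (cls P s)"
      unfolding inv zh[OF x, symmetric] using gcomp_cls[OF Q s'Q s'(2) f zx(1)] by (simp only:)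
    also have "\<dots> = cls ?Q (R.comp_state (R.comp_state s' (z x)) s)" by (rule gcomp_cls[OF Q r f s(1)])
    also have "R.comp_state (R.comp_state s' (z x)) s = R.comp_state s' (R.comp_state (z x) s)"
      by (rule R.reach_assoc[OF s'Q]) (use zx s'(2) R.reach_wfs[OF s(1)] in auto)
    also have "\<dots> = R.comp_state s' (R.comp_state s (R.Psi bs (?\<kappa> x)))" by (simp only: bspec[OF c x])
    also have "\<dots> = R.comp_state (R.comp_state s' s) (R.Psi bs (?\<kappa> x))"
      by (rule R.reach_assoc[OF s'Q, symmetric]) (use s'(2) s(1) lab R.reach_wfs[OF P'] in auto)
    also have "\<dots> = R.Psi bs (?\<kappa> x)" unfolding s'(4) lab by (rule R.base_comp[OF R.reach_wfs[OF P']])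
    finally show ?thesis .
  qed
  have "conjugate K (cls P s) A = (\<lambda>x. cls ?Q (R.Psi bs (?\<kappa> x))) ` carrier (Z_pow n)"
    unfolding conjugate_def hA[symmetric] image_image by (rule image_cong[OF HOL.refl conj])
  from that[OF G Q s(2,4,5) this] show ?thesis .
qed

end

text \<open>
  The first \<open>n\<close> of the blocks suffice, since any sublist of consecutive blocks embeds naturally.
\<close>

lemma copy_rigid:
  assumes K: "directed_2_complex K" and copy: "is_copy K p A (Z_pow n)" and n: "n \<ge> 1"
  shows "\<exists>\<phi>. nonsingular (S_complex n) K (w_path n) \<phi>"
proof -
  interpret directed_2_complex K by (rule K)
  from copy_of_Z_pow[OF copy n] obtain \<Gamma> bs v d where "\<Gamma> \<in> groupoid_hom K p (v, pieces bs)" and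
    bs: "is_path1 K (v, pieces bs)" "R.blocks bs" "\<forall>(p, B)\<in>set bs. B \<noteq> R.base p" "n \<le> length bs"
    and "conjugate K \<Gamma> A =
      (\<lambda>x. cls (v, pieces bs) (R.Psi bs (map (\<lambda>j. \<Sum>i<n. x i * d i j) [0..<length bs]))) ` carrier (Z_pow n)" .
  let ?bs = "take n bs"
  have pc: "pieces bs = pieces ?bs @ pieces (drop n bs)"
    unfolding pieces_def by (metis append_take_drop_id concat_append map_append)
  have P: "is_path1 K (v, pieces ?bs)" using bs(1) unfolding pc path_append by (rule conjunct1)
  have blk: "R.blocks ?bs" using bs(2) R.blocks_append[of ?bs "drop n bs"] unfolding append_take_drop_id by simp
  have ne: "\<forall>(p, B)\<in>set ?bs. B \<noteq> R.base p" using bs(3) set_take_subset[of n bs] by blast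
  have len: "length ?bs = n" using bs(4) by simp
  then have "?bs \<noteq> []" using n by auto
  from natural_embedding[OF blk this ne P] show ?thesis unfolding len by (elim exE conjE) (rule exI)
qed

lemma copy_conjugate:
  assumes K: "directed_2_complex K" and copy: "is_copy K p A (Z_pow n)" and n: "n \<ge> 1"
  shows "\<exists>m\<ge>n. \<exists>q N \<Gamma>. naturally_embedded_Z_pow m K q N \<and> \<Gamma> \<in> groupoid_hom K p q \<and>
    subgroup (conjugate K \<Gamma> A) ((diagram_group K q)\<lparr>carrier := N\<rparr>)"
proof -
  interpret directed_2_complex K by (rule K)
  from copy_of_Z_pow[OF copy n] obtain \<Gamma> bs v d where
    G: "\<Gamma> \<in> groupoid_hom K p (v, pieces bs)" and
    bs: "is_path1 K (v, pieces bs)" "R.blocks bs" "\<forall>(p, B)\<in>set bs. B \<noteq> R.base p" "n \<le> length bs"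
    and cj: "conjugate K \<Gamma> A =
      (\<lambda>x. cls (v, pieces bs) (R.Psi bs (map (\<lambda>j. \<Sum>i<n. x i * d i j) [0..<length bs]))) ` carrier (Z_pow n)" .
  let ?m = "length bs" and ?Q = "(v, pieces bs)"
  let ?N = "{cls ?Q (R.Psi bs ks) | ks. length ks = ?m}"
  have "bs \<noteq> []" using n bs(4) by auto
  from natural_embedding[OF bs(2) this bs(3,1)] have nat: "naturally_embedded_Z_pow ?m K ?Q ?N"
    unfolding naturally_embedded_Z_pow_def by (elim exE conjE) (intro exI conjI, assumption, simp_all only:)
  have N: "?N = (\<lambda>x. cls ?Q (R.Psi bs (map (\<lambda>j. \<Sum>i<?m. x i * (if i = j then 1 else 0)) [0..<?m]))) ` carrier (Z_pow ?m)"
  proof -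
    have sm: "map (\<lambda>j. \<Sum>i<?m. x i * (if i = j then 1 else 0)) [0..<?m] = map x [0..<?m]" for x :: "nat \<Rightarrow> int"
      by (intro nth_equalityI) (auto simp: if_distrib sum.delta' cong: if_cong)
    have "cls ?Q (R.Psi bs ks) \<in> (\<lambda>x. cls ?Q (R.Psi bs (map x [0..<?m]))) ` carrier (Z_pow ?m)"
      if "length ks = ?m" for ks
    proof
      show "(\<lambda>i\<in>{..<?m}. ks ! i) \<in> carrier (Z_pow ?m)" by (simp add: Z_pow_simps)
      have "map (\<lambda>i\<in>{..<?m}. ks ! i) [0..<?m] = ks" using that by (intro nth_equalityI) auto
      then show "cls ?Q (R.Psi bs ks) = cls ?Q (R.Psi bs (map (\<lambda>i\<in>{..<?m}. ks ! i) [0..<?m]))" by simp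
    qed
    then show ?thesis unfolding sm by auto
  qed
  have "subgroup ?N (diagram_group K ?Q)" unfolding N by (rule subgroup_Psi_image[OF bs(2,1)])
  moreover have "subgroup (conjugate K \<Gamma> A) (diagram_group K ?Q)" unfolding cj by (rule subgroup_Psi_image[OF bs(2,1)])
  moreover have "conjugate K \<Gamma> A \<subseteq> ?N" unfolding cj by force
  ultimately have "subgroup (conjugate K \<Gamma> A) ((diagram_group K ?Q)\<lparr>carrier := ?N\<rparr>)"
    using group.subgroup_incl[OF group_diagram_group[OF bs(1)]] by blast
  with nat G bs(4) show ?thesis by blast
qed

theorem theorem10p4:
  fixes n :: nat
  assumes "n \<ge> 1"
  shows "rigid TYPE(('v, 'e, 'f) two_complex) (Z_pow n) (S_complex n) (w_path n) \<and>
    (\<forall>(K :: ('v, 'e, 'f) two_complex) p A.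
       directed_2_complex K \<and> is_copy K p A (Z_pow n) \<longrightarrow>
       (\<exists>m\<ge>n. \<exists>q N \<Gamma>. naturally_embedded_Z_pow m K q N \<and> \<Gamma> \<in> groupoid_hom K p q \<and>
          subgroup (conjugate K \<Gamma> A) ((diagram_group K q)\<lparr>carrier := N\<rparr>)))"
proof -
  interpret S: standard_complex n .
  show ?thesis
    using S.directed_2_complex_axioms w_path_is_path S.standard_group copy_rigid copy_conjugate assms
    unfolding rigid_def by blast
qed

end
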